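(* Let $k\ge2$ and let $\tilde\omega_S$ be the image of $\sum_{i=1}^g\log(p(a_i))\wedge\log(p(b_i))$ in $\bigwedge^2\mathfrak{g}_{k+1}/\bigwedge^2\mathfrak{g}_{k+1}^{(1)}$. Then $D_*\tilde\omega_S=\xi_S$. Further, the crossed homomorphism \[d\tilde\omega_S\in Z^1\bigl(\mathrm{Mod};D_*^{-1}(\mathrm{Hom}(H,\mathfrak{g}_{k+1}^{(1)}\cap \Lambda_{k+1}))\bigr),\qquad d\tilde\omega_S([\phi])=[\phi]\cdot\tilde\omega_S-\tilde\omega_S,\] extends $\hat v\circ\tau_k$ (i.e. restricts to it on $\mathcal{I}(k)$), and its range $D_*^{-1}(\mathrm{Hom}(H,\mathfrak{g}_{k+1}^{(1)}\cap \Lambda_{k+1}))$ is a finite-rank free abelian group.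
   Context: Let $\Sigma$ be the compact oriented surface of genus $g\ge1$ with one boundary component, basepoint $*\in\partial\Sigma$, $\pi=\pi_1(\Sigma,* )$ (free of rank $2g$), $H=H_1(\pi)$. $\mathrm{Mod}$ is the group of diffeomorphisms of $\Sigma$ fixing $\partial\Sigma$ pointwise modulo homotopy rel $\partial\Sigma$; $\mathrm{Mod}\hookrightarrow\mathrm{Aut}\,\pi$. Lower central series: $\pi_{(0)}=\pi$, $\pi_{(k+1)}=[\pi,\pi_{(k)}]$; $\Gamma_k=\pi/\pi_{(k-1)}$; $p\colon\pi\to\Gamma_{k+1}$ is the projection; $\mathcal{L}_{k+1}=\pi_{(k-1)}/\pi_{(k)}$, a central subgroup of $\Gamma_{k+1}$. $\mathcal{I}(k)$ is the kernel of the action of $\mathrm{Mod}$ on $\Gamma_k$. $S=\{a_1,\dots,a_g,b_1,\dots,b_g\}$ is a free generating set of $\pi$ with $\prod_i[a_i,b_i]$ the class of the boundary loop of $\Sigma$. Tensor products with $H$ are over $\mathbb{Z}$. $G_k$ is the Mal'cev completion of $\Gamma_k$ (the unique simply connected nilpotent Lie group containing $\Gamma_k$ as a lattice), $\mathfrak{g}_k$ its Lie algebra, $\mathfrak{g}_k^{(1)}=[\mathfrak{g}_k,\mathfrak{g}_k]$, $\log=\exp^{-1}\colon G_k\to\mathfrak{g}_k$. $\mathrm{Aut}\,\pi$, hence $\mathrm{Mod}$, acts on $\mathfrak{g}_k$. $\Lambda_{k+1}$ is the $\mathbb{Z}$-span of $\log(\Gamma_{k+1})$, an invariant lattice in $\mathfrak{g}_{k+1}$.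 $\xi_S\colon H\to\mathfrak{g}_{k+1}$ is the homomorphism with $\xi_S([s])=\log(p(s))$ for $s\in S$. Since $\Gamma_2=H$, $\log$ induces $H\otimes\mathbb{R}\cong\mathfrak{g}_2$; $q\colon\mathfrak{g}_{k+1}\to\mathfrak{g}_2\cong H\otimes\mathbb{R}$ is the projection, with kernel $\mathfrak{g}_{k+1}^{(1)}$. Poincaré–Lefschetz duality identifies $H$ with $H^*$ by $x\mapsto(y\mapsto x\cdot y)$, normalized by $[a_i]\cdot[b_i]=1$, and hence $H\otimes M\cong\mathrm{Hom}(H,M)$ for $M=\mathcal{L}_{k+1},\mathfrak{g}_{k+1},\mathfrak{g}_{k+1}^{(1)}$. The $\mathrm{Mod}$-equivariant injection $D_*\colon\bigwedge^2\mathfrak{g}_{k+1}/\bigwedge^2\mathfrak{g}_{k+1}^{(1)}\to\mathrm{Hom}(H,\mathfrak{g}_{k+1})$ is induced by $X\wedge Y\mapsto q(X)\otimes Y-q(Y)\otimes X\in (H\otimes\mathbb{R})\otimes_{\mathbb{R}}\mathfrak{g}_{k+1}=H\otimes\mathfrak{g}_{k+1}$ followed by this duality. The subspace $(\mathfrak{g}_{k+1}\wedge\mathfrak{g}_{k+1}^{(1)})/\bigwedge^2\mathfrak{g}_{k+1}^{(1)}$ is identified with $H\otimes\mathfrak{g}_{k+1}^{(1)}$ via $X\wedge Y\mapsto q(X)\otimes Y$ ($Y\in\mathfrak{g}_{k+1}^{(1)}$), and $D_*$ restricts to the duality isomorphism $H\otimes\mathfrak{g}_{k+1}^{(1)}\cong\mathrm{Hom}(H,\mathfrak{g}_{k+1}^{(1)})$.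 The surface Johnson homomorphism $\tau_k\colon\mathcal{I}(k)\to H\otimes\mathcal{L}_{k+1}$ is the duality isomorphism applied to $\delta_k\colon\mathcal{I}(k)\to\mathrm{Hom}(H,\mathcal{L}_{k+1})$, $\delta_k(\alpha)([u])=(\alpha(u)u^{-1})\cdot\pi_{(k)}$. The map $\hat v\colon H\otimes\mathcal{L}_{k+1}\to H\otimes\mathfrak{g}_{k+1}^{(1)}$ is $\mathrm{id}_H$ tensored with the injection $\log|_{\mathcal{L}_{k+1}}\colon\mathcal{L}_{k+1}\hookrightarrow\mathfrak{g}_{k+1}^{(1)}$. $Z^1$ denotes crossed homomorphisms, $f(gh)=g\cdot f(h)+f(g)$. *)

theory Defs
  imports "HOL-Analysis.Analysis" "HOL-Homology.Homology"
begin

section \<open>Smooth manifolds with boundary\<close>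

text \<open>\<open>C_on n f U\<close> is the usual notion of a \<open>C\<^sup>n\<close> map when \<open>U\<close> is open.\<close>

primrec C_on :: "nat \<Rightarrow> ('a::euclidean_space \<Rightarrow> 'b::euclidean_space) \<Rightarrow> 'a set \<Rightarrow> bool" where
  "C_on 0 f U \<longleftrightarrow> continuous_on U f"
| "C_on (Suc n) f U \<longleftrightarrow> (\<forall>x\<in>U. f differentiable (at x)) \<and>
     (\<forall>v. C_on n (\<lambda>x. frechet_derivative f (at x) v) U)"

definition smooth_on :: "'a::euclidean_space set \<Rightarrow> ('a \<Rightarrow> 'b::euclidean_space) \<Rightarrow> bool" where
  "smooth_on S f \<longleftrightarrow> (\<forall>x\<in>S. \<exists>U F. open U \<and> x \<in> U \<and> (\<forall>n. C_on n F U) \<and> (\<forall>y\<in>S \<inter> U. F y = f y))"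

type_synonym ('a, 'e) chart = "'a set \<times> ('a \<Rightarrow> 'e)"

text \<open>Charts take values in a model set \<open>M\<close>: a half-space for manifolds with boundary, \<open>UNIV\<close> for
  manifolds without boundary. Functions on the manifold \<open>X\<close> are only meaningful on \<open>X\<close>. The ambient
  types below are Hausdorff; second countability is automatic for the compact surfaces and the
  connected Lie groups considered here.\<close>

definition smooth_atlas ::
  "'e::euclidean_space set \<Rightarrow> 'a::topological_space set \<Rightarrow> ('a, 'e) chart set \<Rightarrow> bool" where
  "smooth_atlas M X A \<longleftrightarrow>
     (\<forall>(U, \<phi>)\<in>A. openin (top_of_set X) U \<and> openin (top_of_set M) (\<phi> ` U) \<and>
        (\<exists>\<psi>. homeomorphism U (\<phi> ` U) \<phi> \<psi>)) \<and>
     (\<Union>(U, \<phi>)\<in>A. U) = X \<and>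
     (\<forall>(U, \<phi>)\<in>A. \<forall>(V, \<psi>)\<in>A. smooth_on (\<phi> ` (U \<inter> V)) (\<psi> \<circ> inv_into U \<phi>))"

definition smooth_map ::
  "'a::topological_space set \<Rightarrow> ('a, 'e::euclidean_space) chart set \<Rightarrow>
   'b::topological_space set \<Rightarrow> ('b, 'f::euclidean_space) chart set \<Rightarrow> ('a \<Rightarrow> 'b) \<Rightarrow> bool" where
  "smooth_map X A Y B f \<longleftrightarrow> f ` X \<subseteq> Y \<and> continuous_on X f \<and>
     (\<forall>(U, \<phi>)\<in>A. \<forall>(V, \<psi>)\<in>B. smooth_on (\<phi> ` (U \<inter> f -` V)) (\<psi> \<circ> f \<circ> inv_into U \<phi>))"

definition diffeo ::
  "'a::topological_space set \<Rightarrow> ('a, 'e::euclidean_space) chart set \<Rightarrow> ('a \<Rightarrow> 'a) \<Rightarrow> bool" where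
  "diffeo X A f \<longleftrightarrow> bij_betw f X X \<and> smooth_map X A X A f \<and> smooth_map X A X A (inv_into X f)"

definition prod_atlas ::
  "('a, 'e) chart set \<Rightarrow> ('b, 'f) chart set \<Rightarrow> ('a \<times> 'b, 'e \<times> 'f) chart set" where
  "prod_atlas A B = (\<lambda>((U, \<phi>), (V, \<psi>)). (U \<times> V, map_prod \<phi> \<psi>)) ` (A \<times> B)"


section \<open>Compact oriented surfaces with one boundary component\<close>

definition half_plane :: "(real ^ 2) set" where
  "half_plane = {x. 0 \<le> x $ 2}"

definition oriented_atlas :: "('a, real ^ 2) chart set \<Rightarrow> bool" where
  "oriented_atlas A \<longleftrightarrow> (\<forall>(U, \<phi>)\<in>A. \<forall>(V, \<psi>)\<in>A. \<forall>x\<in>\<phi> ` (U \<inter> V).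
     \<exists>D. ((\<psi> \<circ> inv_into U \<phi>) has_derivative D) (at x within \<phi> ` (U \<inter> V)) \<and> det (matrix D) > 0)"

definition mfd_boundary :: "('a, real ^ 2) chart set \<Rightarrow> 'a set" where
  "mfd_boundary A = {x. \<exists>(U, \<phi>)\<in>A. x \<in> U \<and> \<phi> x $ 2 = 0}"

text \<open>A surface with one boundary component has genus \<open>g\<close> iff its first homology is free of
  rank \<open>2g\<close>.\<close>

definition surface_one_boundary ::
  "nat \<Rightarrow> 'a::t2_space set \<Rightarrow> ('a, real ^ 2) chart set \<Rightarrow> bool" where
  "surface_one_boundary g X A \<longleftrightarrow>
     compact X \<and> connected X \<and> smooth_atlas half_plane X A \<and> oriented_atlas A \<and>
     mfd_boundary A \<noteq> {} \<and> connected (mfd_boundary A) \<and>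
     homology_group 1 (top_of_set X) \<cong> free_Abelian_group {..<2 * g}"

definition loop_class :: "'a::topological_space set \<Rightarrow> (real \<Rightarrow> 'a) \<Rightarrow> (real \<Rightarrow> 'a) set" where
  "loop_class X p = {q. homotopic_paths X p q}"

definition pi1 :: "'a::topological_space set \<Rightarrow> 'a \<Rightarrow> (real \<Rightarrow> 'a) set monoid" where
  "pi1 X x0 =
     \<lparr>carrier = {loop_class X p | p. path p \<and> path_image p \<subseteq> X \<and> pathstart p = x0 \<and> pathfinish p = x0},
      mult = (\<lambda>c d. \<Union>p\<in>c. \<Union>q\<in>d. loop_class X (p +++ q)),
      one = loop_class X (\<lambda>_. x0)\<rparr>"

definition boundary_diffeos ::
  "'a::topological_space set \<Rightarrow> ('a, real ^ 2) chart set \<Rightarrow> ('a \<Rightarrow> 'a) set" where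
  "boundary_diffeos X A = {f. diffeo X A f \<and> (\<forall>x\<in>mfd_boundary A. f x = x)}"

definition mapping_class ::
  "'a::topological_space set \<Rightarrow> ('a, real ^ 2) chart set \<Rightarrow> ('a \<Rightarrow> 'a) \<Rightarrow> ('a \<Rightarrow> 'a) set" where
  "mapping_class X A f = {f' \<in> boundary_diffeos X A.
     homotopic_with_canon (\<lambda>h. \<forall>x\<in>mfd_boundary A. h x = x) X X f f'}"

definition mapping_class_group ::
  "'a::topological_space set \<Rightarrow> ('a, real ^ 2) chart set \<Rightarrow> ('a \<Rightarrow> 'a) set monoid" where
  "mapping_class_group X A =
     \<lparr>carrier = mapping_class X A ` boundary_diffeos X A,
      mult = (\<lambda>c d. \<Union>f\<in>c. \<Union>f'\<in>d. mapping_class X A (f \<circ> f')),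
      one = mapping_class X A id\<rparr>"

definition mcg_act_pi1 ::
  "'a::topological_space set \<Rightarrow> ('a \<Rightarrow> 'a) set \<Rightarrow> (real \<Rightarrow> 'a) set \<Rightarrow> (real \<Rightarrow> 'a) set" where
  "mcg_act_pi1 X c u = (\<Union>f\<in>c. \<Union>p\<in>u. loop_class X (f \<circ> p))"


section \<open>Group theory\<close>

definition commutator :: "('a, 'm) monoid_scheme \<Rightarrow> 'a \<Rightarrow> 'a \<Rightarrow> 'a" where
  "commutator G x y = x \<otimes>\<^bsub>G\<^esub> y \<otimes>\<^bsub>G\<^esub> inv\<^bsub>G\<^esub> x \<otimes>\<^bsub>G\<^esub> inv\<^bsub>G\<^esub> y"

primrec lower_central :: "('a, 'm) monoid_scheme \<Rightarrow> nat \<Rightarrow> 'a set" where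
  "lower_central G 0 = carrier G"
| "lower_central G (Suc k) =
     generate G {commutator G x y | x y. x \<in> carrier G \<and> y \<in> lower_central G k}"

text \<open>The quotient written \<open>\<Gamma>\<^sub>k\<close> for \<open>k \<ge> 1\<close>; its elements are the cosets \<open>nil_proj G k x\<close>.\<close>

definition nil_quot :: "('a, 'm) monoid_scheme \<Rightarrow> nat \<Rightarrow> 'a set monoid" where
  "nil_quot G k = G Mod lower_central G (k - 1)"

definition nil_proj :: "('a, 'm) monoid_scheme \<Rightarrow> nat \<Rightarrow> 'a \<Rightarrow> 'a set" where
  "nil_proj G k x = lower_central G (k - 1) #>\<^bsub>G\<^esub> x"

text \<open>\<open>\<L>\<^sub>k\<close> for \<open>k \<ge> 2\<close>: the last term of the lower central series of \<open>\<Gamma>\<^sub>k\<close>, in multiplicative notation.\<close>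

definition nil_layer :: "('a, 'm) monoid_scheme \<Rightarrow> nat \<Rightarrow> 'a set monoid" where
  "nil_layer G k = (nil_quot G k)\<lparr>carrier := nil_proj G k ` lower_central G (k - 2)\<rparr>"

text \<open>Letters of a word are pairs (generator, is it not inverted).\<close>

definition word_value :: "('a, 'm) monoid_scheme \<Rightarrow> ('a \<times> bool) list \<Rightarrow> 'a" where
  "word_value G w = foldr (\<lambda>(s, e) x. (if e then s else inv\<^bsub>G\<^esub> s) \<otimes>\<^bsub>G\<^esub> x) w \<one>\<^bsub>G\<^esub>"

definition reduced_word :: "('a \<times> bool) list \<Rightarrow> bool" where
  "reduced_word w \<longleftrightarrow> (\<forall>i. Suc i < length w \<longrightarrow>
     \<not> (fst (w ! i) = fst (w ! Suc i) \<and> snd (w ! i) \<noteq> snd (w ! Suc i)))"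

definition free_generating_set :: "('a, 'm) monoid_scheme \<Rightarrow> 'a set \<Rightarrow> bool" where
  "free_generating_set G S \<longleftrightarrow> S \<subseteq> carrier G \<and> generate G S = carrier G \<and>
     (\<forall>w. w \<noteq> [] \<and> fst ` set w \<subseteq> S \<and> reduced_word w \<longrightarrow> word_value G w \<noteq> \<one>\<^bsub>G\<^esub>)"

text \<open>\<open>\<Prod>\<^sub>i [a\<^sub>i, b\<^sub>i]\<close> is represented by an injective parametrisation of the boundary circle. No direction
  is imposed on it: the direction only affects the sign of the intersection form,
  and that is normalised separately.\<close>

definition standard_generators ::
  "nat \<Rightarrow> 'a::t2_space set \<Rightarrow> ('a, real ^ 2) chart set \<Rightarrow> 'a \<Rightarrow>
   (nat \<Rightarrow> (real \<Rightarrow> 'a) set) \<Rightarrow> (nat \<Rightarrow> (real \<Rightarrow> 'a) set) \<Rightarrow> bool" where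
  "standard_generators g X A x0 a b \<longleftrightarrow>
     free_generating_set (pi1 X x0) (a ` {1..g} \<union> b ` {1..g}) \<and>
     card (a ` {1..g} \<union> b ` {1..g}) = 2 * g \<and>
     (\<exists>\<gamma>. simple_path \<gamma> \<and> path_image \<gamma> = mfd_boundary A \<and> pathstart \<gamma> = x0 \<and> pathfinish \<gamma> = x0 \<and>
        foldr (\<lambda>i u. commutator (pi1 X x0) (a i) (b i) \<otimes>\<^bsub>pi1 X x0\<^esub> u) [1..<Suc g] \<one>\<^bsub>pi1 X x0\<^esub>
          = loop_class X \<gamma>)"

text \<open>\<open>\<cdot>\<close> on \<open>H = \<Gamma>\<^sub>2\<close>. As the product of commutators \<open>[a\<^sub>i, b\<^sub>i]\<close> bounds the surface, the classes
  \<open>[a\<^sub>i]\<close>, \<open>[b\<^sub>i]\<close> form a symplectic basis, so the normalisation \<open>[a\<^sub>i] \<cdot> [b\<^sub>i] = 1\<close> leaves exactly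
  this form.\<close>

definition intersection_form ::
  "nat \<Rightarrow> ('h, 'm) monoid_scheme \<Rightarrow> (nat \<Rightarrow> 'h) \<Rightarrow> (nat \<Rightarrow> 'h) \<Rightarrow> ('h \<Rightarrow> 'h \<Rightarrow> int) \<Rightarrow> bool" where
  "intersection_form g H \<alpha> \<beta> I \<longleftrightarrow>
     (\<forall>x\<in>carrier H. \<forall>y\<in>carrier H. \<forall>z\<in>carrier H.
        I (x \<otimes>\<^bsub>H\<^esub> y) z = I x z + I y z \<and> I z (x \<otimes>\<^bsub>H\<^esub> y) = I z x + I z y) \<and>
     (\<forall>x\<in>carrier H. I x x = 0) \<and>
     (\<forall>i\<in>{1..g}. \<forall>j\<in>{1..g}. I (\<alpha> i) (\<alpha> j) = 0 \<and> I (\<beta> i) (\<beta> j) = 0 \<and>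
        I (\<alpha> i) (\<beta> j) = (if i = j then 1 else 0))"


section \<open>Abelian groups: Hom, tensor product, exterior square, crossed homomorphisms\<close>

text \<open>The homomorphism \<open>A \<rightarrow> B\<close> sending \<open>s i\<close> to \<open>t i\<close> for \<open>i \<in> J\<close>. In all uses the \<open>s i\<close> generate \<open>A\<close>,
  so that it is determined on \<open>carrier A\<close>.\<close>

definition hom_by ::
  "('a, 'm) monoid_scheme \<Rightarrow> ('b, 'n) monoid_scheme \<Rightarrow> 'i set \<Rightarrow> ('i \<Rightarrow> 'a) \<Rightarrow> ('i \<Rightarrow> 'b) \<Rightarrow> 'a \<Rightarrow> 'b" where
  "hom_by A B J s t = (SOME h. h \<in> hom A B \<and> (\<forall>i\<in>J. h (s i) = t i))"

definition add_group :: "'v::ab_group_add set \<Rightarrow> 'v monoid" where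
  "add_group V = \<lparr>carrier = V, mult = (+), one = 0\<rparr>"

definition Hom_group :: "('a, 'm) monoid_scheme \<Rightarrow> ('b, 'n) monoid_scheme \<Rightarrow> ('a \<Rightarrow> 'b) monoid" where
  "Hom_group A B =
     \<lparr>carrier = hom A B \<inter> extensional (carrier A),
      mult = (\<lambda>f f'. \<lambda>x\<in>carrier A. f x \<otimes>\<^bsub>B\<^esub> f' x),
      one = (\<lambda>x\<in>carrier A. \<one>\<^bsub>B\<^esub>)\<rparr>"

definition tensor_rels ::
  "('a, 'm) monoid_scheme \<Rightarrow> ('b, 'n) monoid_scheme \<Rightarrow> ('a \<times> 'b \<Rightarrow>\<^sub>0 int) set" where
  "tensor_rels A B =
     {frag_of (x \<otimes>\<^bsub>A\<^esub> x', y) - frag_of (x, y) - frag_of (x', y) | x x' y.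
        x \<in> carrier A \<and> x' \<in> carrier A \<and> y \<in> carrier B} \<union>
     {frag_of (x, y \<otimes>\<^bsub>B\<^esub> y') - frag_of (x, y) - frag_of (x, y') | x y y'.
        x \<in> carrier A \<and> y \<in> carrier B \<and> y' \<in> carrier B}"

definition tensor_subgroup ::
  "('a, 'm) monoid_scheme \<Rightarrow> ('b, 'n) monoid_scheme \<Rightarrow> ('a \<times> 'b \<Rightarrow>\<^sub>0 int) set" where
  "tensor_subgroup A B = generate (free_Abelian_group (carrier A \<times> carrier B)) (tensor_rels A B)"

definition tensor ::
  "('a, 'm) monoid_scheme \<Rightarrow> ('b, 'n) monoid_scheme \<Rightarrow> ('a \<times> 'b \<Rightarrow>\<^sub>0 int) set monoid" where
  "tensor A B = free_Abelian_group (carrier A \<times> carrier B) Mod tensor_subgroup A B"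

definition tens ::
  "('a, 'm) monoid_scheme \<Rightarrow> ('b, 'n) monoid_scheme \<Rightarrow> 'a \<Rightarrow> 'b \<Rightarrow> ('a \<times> 'b \<Rightarrow>\<^sub>0 int) set" where
  "tens A B x y =
     tensor_subgroup A B #>\<^bsub>free_Abelian_group (carrier A \<times> carrier B)\<^esub> frag_of (x, y)"

text \<open>\<open>id\<^sub>A \<otimes> f : A \<otimes> B \<rightarrow> A \<otimes> B'\<close>.\<close>

definition tensor_map ::
  "('a, 'm) monoid_scheme \<Rightarrow> ('b, 'n) monoid_scheme \<Rightarrow> ('c, 'k) monoid_scheme \<Rightarrow> ('b \<Rightarrow> 'c) \<Rightarrow>
   ('a \<times> 'b \<Rightarrow>\<^sub>0 int) set \<Rightarrow> ('a \<times> 'c \<Rightarrow>\<^sub>0 int) set" where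
  "tensor_map A B B' f = hom_by (tensor A B) (tensor A B') (carrier A \<times> carrier B)
     (\<lambda>(x, y). tens A B x y) (\<lambda>(x, y). tens A B' x (f y))"

text \<open>\<open>H \<otimes> M \<rightarrow> Hom(H, M)\<close>, \<open>x \<otimes> m \<mapsto> (y \<mapsto> (x \<cdot> y) m)\<close>, with \<open>M\<close> written multiplicatively.\<close>

definition duality ::
  "('h, 'm) monoid_scheme \<Rightarrow> ('h \<Rightarrow> 'h \<Rightarrow> int) \<Rightarrow> ('b, 'n) monoid_scheme \<Rightarrow>
   ('h \<times> 'b \<Rightarrow>\<^sub>0 int) set \<Rightarrow> 'h \<Rightarrow> 'b" where
  "duality H I M = hom_by (tensor H M) (Hom_group H M) (carrier H \<times> carrier M)
     (\<lambda>(x, m). tens H M x m) (\<lambda>(x, m). \<lambda>y\<in>carrier H. m [^]\<^bsub>M\<^esub> I x y)"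

text \<open>The real exterior square of \<open>'v\<close>, as an abelian group.\<close>

definition ext_rels :: "('v::real_vector \<times> 'v \<Rightarrow>\<^sub>0 int) set" where
  "ext_rels =
     {frag_of (x + x', y) - frag_of (x, y) - frag_of (x', y) | x x' y. True} \<union>
     {frag_of (x, y + y') - frag_of (x, y) - frag_of (x, y') | x y y'. True} \<union>
     {frag_of (r *\<^sub>R x, y) - frag_of (x, r *\<^sub>R y) | r x y. True} \<union>
     {frag_of (x, x) | x. True}"

definition ext_square :: "('v::real_vector \<times> 'v \<Rightarrow>\<^sub>0 int) set monoid" where
  "ext_square = free_Abelian_group UNIV Mod generate (free_Abelian_group UNIV) ext_rels"

definition wedge :: "'v::real_vector \<Rightarrow> 'v \<Rightarrow> ('v \<times> 'v \<Rightarrow>\<^sub>0 int) set" where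
  "wedge x y = generate (free_Abelian_group UNIV) ext_rels #>\<^bsub>free_Abelian_group UNIV\<^esub> frag_of (x, y)"

definition ext_square_of :: "'v::real_vector set \<Rightarrow> ('v \<times> 'v \<Rightarrow>\<^sub>0 int) set set" where
  "ext_square_of W = generate ext_square {wedge x y | x y. x \<in> W \<and> y \<in> W}"

text \<open>\<open>\<And>\<^sup>2 V / \<And>\<^sup>2 W\<close>, where \<open>V\<close> is the whole type.\<close>

definition ext_quot :: "'v::real_vector set \<Rightarrow> ('v \<times> 'v \<Rightarrow>\<^sub>0 int) set set monoid" where
  "ext_quot W = ext_square Mod ext_square_of W"

definition qwedge :: "'v::real_vector set \<Rightarrow> 'v \<Rightarrow> 'v \<Rightarrow> ('v \<times> 'v \<Rightarrow>\<^sub>0 int) set set" where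
  "qwedge W x y = ext_square_of W #>\<^bsub>ext_square\<^esub> wedge x y"

definition ext_quot_map ::
  "'v::real_vector set \<Rightarrow> ('v \<Rightarrow> 'v) \<Rightarrow> ('v \<times> 'v \<Rightarrow>\<^sub>0 int) set set \<Rightarrow> ('v \<times> 'v \<Rightarrow>\<^sub>0 int) set set" where
  "ext_quot_map W f = hom_by (ext_quot W) (ext_quot W) UNIV
     (\<lambda>(x, y). qwedge W x y) (\<lambda>(x, y). qwedge W (f x) (f y))"

text \<open>\<open>(V \<and> W) / \<And>\<^sup>2 W\<close>.\<close>

definition mixed_wedge :: "'v::real_vector set \<Rightarrow> ('v \<times> 'v \<Rightarrow>\<^sub>0 int) set set monoid" where
  "mixed_wedge W = (ext_quot W)\<lparr>carrier := generate (ext_quot W) {qwedge W x y | x y. y \<in> W}\<rparr>"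

definition is_module ::
  "('g, 'm) monoid_scheme \<Rightarrow> ('g \<Rightarrow> 'b \<Rightarrow> 'b) \<Rightarrow> ('b, 'n) monoid_scheme \<Rightarrow> bool" where
  "is_module G \<rho> M \<longleftrightarrow> comm_group M \<and> (\<forall>c\<in>carrier G. \<rho> c \<in> hom M M) \<and>
     (\<forall>m\<in>carrier M. \<rho> \<one>\<^bsub>G\<^esub> m = m) \<and>
     (\<forall>c\<in>carrier G. \<forall>d\<in>carrier G. \<forall>m\<in>carrier M. \<rho> (c \<otimes>\<^bsub>G\<^esub> d) m = \<rho> c (\<rho> d m))"

definition crossed_homs ::
  "('g, 'm) monoid_scheme \<Rightarrow> ('g \<Rightarrow> 'b \<Rightarrow> 'b) \<Rightarrow> ('b, 'n) monoid_scheme \<Rightarrow> ('g \<Rightarrow> 'b) set" where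
  "crossed_homs G \<rho> M = {f. (\<forall>c\<in>carrier G. f c \<in> carrier M) \<and>
     (\<forall>c\<in>carrier G. \<forall>d\<in>carrier G. f (c \<otimes>\<^bsub>G\<^esub> d) = \<rho> c (f d) \<otimes>\<^bsub>M\<^esub> f c)}"

definition free_abelian_finite_rank :: "('b, 'n) monoid_scheme \<Rightarrow> bool" where
  "free_abelian_finite_rank M \<longleftrightarrow> (\<exists>n::nat. M \<cong> free_Abelian_group {..<n})"


section \<open>Lie groups and Mal'cev completions\<close>

definition lie_group :: "'b::t2_space monoid \<Rightarrow> ('b, 'e::euclidean_space) chart set \<Rightarrow> bool" where
  "lie_group G B \<longleftrightarrow> Group.group G \<and> smooth_atlas UNIV (carrier G) B \<and>
     smooth_map (carrier G \<times> carrier G) (prod_atlas B B) (carrier G) B (\<lambda>(x, y). x \<otimes>\<^bsub>G\<^esub> y) \<and>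
     smooth_map (carrier G) B (carrier G) B (\<lambda>x. inv\<^bsub>G\<^esub> x)"

definition nilpotent_group :: "('b, 'm) monoid_scheme \<Rightarrow> bool" where
  "nilpotent_group G \<longleftrightarrow> Group.group G \<and> (\<exists>n. lower_central G n = {\<one>\<^bsub>G\<^esub>})"

text \<open>Discrete subgroup \<open>K\<close> with compact quotient \<open>G / K\<close> (\<open>G\<close> being locally compact, \<open>G / K\<close> is compact
  iff \<open>G = C K\<close> for some compact \<open>C\<close>).\<close>

definition lattice_in :: "'b::t2_space monoid \<Rightarrow> 'b set \<Rightarrow> bool" where
  "lattice_in G K \<longleftrightarrow> subgroup K G \<and> discrete K \<and>
     (\<exists>C. compact C \<and> C \<subseteq> carrier G \<and> C <#>\<^bsub>G\<^esub> K = carrier G)"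

definition malcev_completion ::
  "('c, 'm) monoid_scheme \<Rightarrow> 'b::t2_space monoid \<Rightarrow> ('b, 'e::euclidean_space) chart set \<Rightarrow> ('c \<Rightarrow> 'b) \<Rightarrow> bool"
  where
  "malcev_completion \<Gamma> G B \<iota> \<longleftrightarrow> lie_group G B \<and> simply_connected (carrier G) \<and> nilpotent_group G \<and>
     \<iota> \<in> hom \<Gamma> G \<and> inj_on \<iota> (carrier \<Gamma>) \<and> lattice_in G (\<iota> ` carrier \<Gamma>)"

text \<open>A chart \<open>(U, \<phi>)\<close> at the identity identifies the tangent space there, i.e. the Lie algebra, with the
  model space \<open>'e\<close>. In this chart, centred at the identity, multiplication is
  \<open>x + y + b(x, y) + \<dots>\<close> with \<open>b\<close> bilinear, and the Lie bracket is \<open>b(x, y) - b(y, x)\<close>.\<close>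

definition chart_mult ::
  "('b, 'm) monoid_scheme \<Rightarrow> ('b, 'e::euclidean_space) chart \<Rightarrow> 'e \<Rightarrow> 'e \<Rightarrow> 'e" where
  "chart_mult G = (\<lambda>(U, \<phi>) x y.
     \<phi> (inv_into U \<phi> (\<phi> \<one>\<^bsub>G\<^esub> + x) \<otimes>\<^bsub>G\<^esub> inv_into U \<phi> (\<phi> \<one>\<^bsub>G\<^esub> + y)) - \<phi> \<one>\<^bsub>G\<^esub>)"

definition chart_mult_quadratic ::
  "('b, 'm) monoid_scheme \<Rightarrow> ('b, 'e::euclidean_space) chart \<Rightarrow> 'e \<Rightarrow> 'e \<Rightarrow> 'e" where
  "chart_mult_quadratic G c x y =
     vector_derivative (\<lambda>s. vector_derivative (\<lambda>t. chart_mult G c (s *\<^sub>R x) (t *\<^sub>R y)) (at 0)) (at (0::real))"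

definition lie_bracket ::
  "('b, 'm) monoid_scheme \<Rightarrow> ('b, 'e::euclidean_space) chart \<Rightarrow> 'e \<Rightarrow> 'e \<Rightarrow> 'e" where
  "lie_bracket G c x y = chart_mult_quadratic G c x y - chart_mult_quadratic G c y x"

definition derived_algebra :: "('e::real_vector \<Rightarrow> 'e \<Rightarrow> 'e) \<Rightarrow> 'e set" where
  "derived_algebra br = span {br x y | x y. True}"

definition lie_automorphism :: "('e::real_vector \<Rightarrow> 'e \<Rightarrow> 'e) \<Rightarrow> ('e \<Rightarrow> 'e) \<Rightarrow> bool" where
  "lie_automorphism br f \<longleftrightarrow> linear f \<and> bij f \<and> (\<forall>x y. f (br x y) = br (f x) (f y))"

definition exponential_map ::
  "'b::t2_space monoid \<Rightarrow> ('b, 'e::euclidean_space) chart set \<Rightarrow> ('b, 'e) chart \<Rightarrow> ('e \<Rightarrow> 'b) \<Rightarrow> bool" where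
  "exponential_map G B c ex \<longleftrightarrow> smooth_map UNIV {(UNIV, id)} (carrier G) B ex \<and>
     (\<forall>X s t. ex ((s + t) *\<^sub>R X) = ex (s *\<^sub>R X) \<otimes>\<^bsub>G\<^esub> ex (t *\<^sub>R X)) \<and>
     (\<forall>X. ((\<lambda>t. snd c (ex (t *\<^sub>R X))) has_vector_derivative X) (at (0::real)))"

definition logarithm_map :: "'b monoid \<Rightarrow> ('e \<Rightarrow> 'b) \<Rightarrow> ('b \<Rightarrow> 'e) \<Rightarrow> bool" where
  "logarithm_map G ex lg \<longleftrightarrow> (\<forall>X. lg (ex X) = X) \<and> (\<forall>x\<in>carrier G. ex (lg x) = x)"


section \<open>The Johnson homomorphism and the map \<open>D\<^sub>*\<close>\<close>

text \<open>In this section \<open>P\<close> is the group \<open>\<pi>\<close>, \<open>H\<close> is \<open>nil_quot P 2\<close>, and \<open>lp\<close> is \<open>log \<circ> p\<close> on \<open>P\<close>.\<close>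

definition real_homology :: "('h, 'm) monoid_scheme \<Rightarrow> ('h \<times> real \<Rightarrow>\<^sub>0 int) set monoid" where
  "real_homology H = tensor H (add_group UNIV)"

text \<open>For \<open>u \<in> H \<otimes> \<real>\<close> and \<open>Y \<in> V\<close>, with \<open>V\<close> a real subspace, the element \<open>u \<otimes> Y\<close> of
  \<open>(H \<otimes> \<real>) \<otimes>\<^sub>\<real> V = H \<otimes> V\<close>.\<close>

definition real_tens ::
  "('h, 'm) monoid_scheme \<Rightarrow> 'v::real_vector set \<Rightarrow> ('h \<times> real \<Rightarrow>\<^sub>0 int) set \<Rightarrow> 'v \<Rightarrow>
   ('h \<times> 'v \<Rightarrow>\<^sub>0 int) set" where
  "real_tens H V u Y = tensor_map H (add_group UNIV) (add_group V) (\<lambda>r::real. r *\<^sub>R Y) u"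

text \<open>The projection \<open>q : \<gg>\<^sub>k\<^sub>+\<^sub>1 \<rightarrow> \<gg>\<^sub>2 \<cong> H \<otimes> \<real>\<close>: the real-linear map induced by \<open>\<Gamma>\<^sub>k\<^sub>+\<^sub>1 \<rightarrow> \<Gamma>\<^sub>2 = H\<close>, with
  kernel the derived algebra \<open>W\<close>.\<close>

definition abelian_projection ::
  "('a, 'm) monoid_scheme \<Rightarrow> ('a \<Rightarrow> 'e::real_vector) \<Rightarrow> 'e set \<Rightarrow>
   ('e \<Rightarrow> ('a set \<times> real \<Rightarrow>\<^sub>0 int) set) \<Rightarrow> bool" where
  "abelian_projection P lp W q \<longleftrightarrow>
     q \<in> hom (add_group UNIV) (real_homology (nil_quot P 2)) \<and>
     (\<forall>r X. q (r *\<^sub>R X) = real_tens (nil_quot P 2) UNIV (q X) r) \<and>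
     (\<forall>x\<in>carrier P. q (lp x) = tens (nil_quot P 2) (add_group UNIV) (nil_proj P 2 x) 1) \<and>
     {X. q X = \<one>\<^bsub>real_homology (nil_quot P 2)\<^esub>} = W"

definition johnson_kernel ::
  "('g, 'k) monoid_scheme \<Rightarrow> ('g \<Rightarrow> 'a \<Rightarrow> 'a) \<Rightarrow> ('a, 'm) monoid_scheme \<Rightarrow> nat \<Rightarrow> 'g set" where
  "johnson_kernel Md act P k = {c \<in> carrier Md. \<forall>C\<in>carrier (nil_quot P k). act c ` C = C}"

definition johnson_delta :: "('a, 'm) monoid_scheme \<Rightarrow> nat \<Rightarrow> ('a \<Rightarrow> 'a) \<Rightarrow> 'a set \<Rightarrow> 'a set" where
  "johnson_delta P k \<alpha> = (\<lambda>h\<in>carrier (nil_quot P 2).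
     let u = (SOME u. u \<in> h) in nil_proj P (k + 1) (\<alpha> u \<otimes>\<^bsub>P\<^esub> inv\<^bsub>P\<^esub> u))"

definition johnson_tau ::
  "('a, 'm) monoid_scheme \<Rightarrow> ('a set \<Rightarrow> 'a set \<Rightarrow> int) \<Rightarrow> nat \<Rightarrow> ('a \<Rightarrow> 'a) \<Rightarrow> ('a set \<times> 'a set \<Rightarrow>\<^sub>0 int) set"
  where
  "johnson_tau P I k \<alpha> =
     inv_into (carrier (tensor (nil_quot P 2) (nil_layer P (k + 1))))
       (duality (nil_quot P 2) I (nil_layer P (k + 1))) (johnson_delta P k \<alpha>)"

definition D_star ::
  "('h, 'm) monoid_scheme \<Rightarrow> ('h \<Rightarrow> 'h \<Rightarrow> int) \<Rightarrow> 'e::real_vector set \<Rightarrow>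
   ('e \<Rightarrow> ('h \<times> real \<Rightarrow>\<^sub>0 int) set) \<Rightarrow> ('e \<times> 'e \<Rightarrow>\<^sub>0 int) set set \<Rightarrow> 'h \<Rightarrow> 'e" where
  "D_star H I W q = duality H I (add_group UNIV) \<circ>
     hom_by (ext_quot W) (tensor H (add_group UNIV)) UNIV (\<lambda>(X, Y). qwedge W X Y)
       (\<lambda>(X, Y). real_tens H UNIV (q X) Y \<otimes>\<^bsub>tensor H (add_group UNIV)\<^esub>
          inv\<^bsub>tensor H (add_group UNIV)\<^esub> real_tens H UNIV (q Y) X)"

text \<open>The identification of \<open>(\<gg> \<and> W) / \<And>\<^sup>2 W\<close> with \<open>H \<otimes> W\<close>, \<open>X \<and> Y \<mapsto> q(X) \<otimes> Y\<close> for \<open>Y \<in> W\<close>.\<close>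

definition mixed_wedge_iso ::
  "('h, 'm) monoid_scheme \<Rightarrow> 'e::real_vector set \<Rightarrow> ('e \<Rightarrow> ('h \<times> real \<Rightarrow>\<^sub>0 int) set) \<Rightarrow>
   ('e \<times> 'e \<Rightarrow>\<^sub>0 int) set set \<Rightarrow> ('h \<times> 'e \<Rightarrow>\<^sub>0 int) set" where
  "mixed_wedge_iso H W q = hom_by (mixed_wedge W) (tensor H (add_group W)) (UNIV \<times> W)
     (\<lambda>(X, Y). qwedge W X Y) (\<lambda>(X, Y). real_tens H W (q X) Y)"

end

theory Submission
  imports Defs "HOL-Computational_Algebra.Formal_Power_Series" "HOL-Computational_Algebra.Polynomial"
begin

text \<open>For \<open>X\<close> in the Lie algebra \<open>\<gg>\<close> and \<open>h\<close> in \<open>H\<close>, let \<open>\<kappa> X h\<close> be the pairing of the class of \<open>X\<close> in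
  \<open>H \<otimes> \<real>\<close> with \<open>h\<close>. The map \<open>D\<^sub>*\<close> sends \<open>X \<and> Y\<close> to \<open>h \<mapsto> \<kappa> X h Y - \<kappa> Y h X\<close>. The logarithms of the
  generators span a complement of the derived algebra \<open>W\<close>, and this splitting yields an explicit left inverse
  of \<open>D\<^sub>*\<close> (\<open>Rinv_D\<close>). Hence an element of \<open>\<And>\<^sup>2 \<gg> / \<And>\<^sup>2 W\<close> is determined by the values of its image, it is a
  mixed wedge when these values lie in \<open>W\<close> (\<open>mem_mixed_wedge\<close>), and every assertion of the theorem can be
  checked on values at elements of \<open>H\<close>. In particular \<open>D\<^sub>* \<omega> = \<xi>\<close> amounts to evaluating both sides on a
  symplectic basis (\<open>D_\<omega>_eq_\<xi>\<close>).

  A mapping class fixes the boundary loop, which is the product of the commutators of the generators. The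
  integral Heisenberg group detects the bivector \<open>\<Sum> [a\<^sub>i] \<and> [b\<^sub>i]\<close> in such a product
  (\<open>boundary_word_invariant\<close>). So the action on \<open>H\<close> fixes this bivector and therefore preserves the intersection
  form (\<open>T_symplectic\<close>), and \<open>D\<^sub>*\<close> is equivariant (\<open>D_\<rho>\<close>). The value of \<open>D\<^sub>*(d\<omega> f)\<close> at \<open>f h\<close> is the difference
  of the \<open>f\<close>-image of \<open>\<xi> h\<close> and \<open>\<xi> (f h)\<close>; it belongs to \<open>\<Lambda>\<close> and has zero class in \<open>H \<otimes> \<real>\<close> (\<open>d\<omega>_M\<close>). If \<open>f\<close> acts
  trivially on \<open>\<Gamma>\<^sub>k\<close>, then for a generator \<open>s\<close> this value is \<open>log (f(s) s\<^sup>-\<^sup>1)\<close>, since \<open>f(s) s\<^sup>-\<^sup>1\<close> is central in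
  \<open>\<Gamma>\<^sub>k\<^sub>+\<^sub>1\<close> and the logarithm is additive on commuting elements; this is the Johnson homomorphism
  (\<open>D_d\<omega>_johnson\<close>).

  By injectivity of \<open>D\<^sub>*\<close>, the range of \<open>d\<omega>\<close> embeds in \<open>Hom(H, \<Lambda>)\<close>, and a finitely generated torsion-free abelian
  group is free (\<open>torsion_free_fg_free\<close>). What has to be shown is that \<open>\<Lambda>\<close> is finitely generated,
  although the logarithm is not a homomorphism (\<open>log_of_fg_subgroup\<close>). In exponential coordinates the adjoint
  action is linear and unipotent, and the velocity of a curve \<open>exp (t Y) x\<close>, expressed through the adjoint
  action, is a polynomial in it (\<open>translate_has_vector_derivative\<close>). It follows that the logarithm is a
  polynomial map in the sense that its iterated differences along group elements eventually vanish
  (\<open>poly_map_id\<close>); the values of such a map on a finitely generated subgroup are integral combinations of its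
  finitely many differences along lists of generators (\<open>poly_map_fg_range\<close>).\<close>

section \<open>Homomorphisms and generating sets\<close>

lemma hom_eq_on_generate:
  assumes "Group.group A" "Group.group C" "f \<in> hom A C" "h \<in> hom A C" "X \<subseteq> carrier A"
    "\<And>x. x \<in> X \<Longrightarrow> f x = h x" "x \<in> generate A X"
  shows "f x = h x"
proof -
  interpret f: group_hom A C f using assms by (simp add: group_hom_def group_hom_axioms_def)
  interpret h: group_hom A C h using assms by (simp add: group_hom_def group_hom_axioms_def)
  show ?thesis using assms(7)
  proof (induction rule: generate.induct)
    case (eng h1 h2)
    then show ?case using group.generate_incl[OF assms(1,5)] by (auto simp: subset_iff)
  qed (use assms(5,6) in \<open>auto simp: subset_iff\<close>)
qed

lemma generate_subset_subgroup:
  assumes "subgroup K G" "X \<subseteq> K" "Group.group G"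
  shows "generate G X \<subseteq> K"
  using group.generate_subgroup_incl[OF assms(3,2,1)] .

lemma hom_finprod:
  assumes "comm_group A" "comm_group C" "h \<in> hom A C" "f \<in> J \<rightarrow> carrier A"
  shows "h (finprod A f J) = finprod C (\<lambda>i. h (f i)) J"
proof -
  interpret A: comm_group A by fact
  interpret C: comm_group C by fact
  interpret group_hom A C h using assms(3) by unfold_locales
  show ?thesis using assms(4)
  proof (induction J rule: infinite_finite_induct)
    case (infinite J)
    then show ?case by simp
  next
    case empty
    then show ?case by simp
  next
    case (insert j J)
    then have f: "f \<in> J \<rightarrow> carrier A" "f j \<in> carrier A" by auto
    then have "(\<lambda>i. h (f i)) \<in> J \<rightarrow> carrier C" by (auto simp: Pi_iff)
    then show ?case using insert f by simp
  qed
qed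

lemma finprod_delta:
  assumes "comm_group C" "finite J" "j \<in> J" "a \<in> carrier C"
    "\<And>i. i \<in> J \<Longrightarrow> f i = (if i = j then a else \<one>\<^bsub>C\<^esub>)"
  shows "finprod C f J = a"
proof -
  interpret comm_group C by fact
  have "finprod C f J = finprod C (\<lambda>i. if j = i then a else \<one>\<^bsub>C\<^esub>) J"
    by (rule finprod_cong') (use assms in auto)
  also have "\<dots> = a" using finprod_singleton[of j J "\<lambda>i. a"] assms by simp
  finally show ?thesis .
qed

section \<open>Quotients\<close>

lemma quotient_universal:
  assumes "comm_group A" "Group.group C" "T \<subseteq> carrier A" "f \<in> hom A C" "\<And>t. t \<in> T \<Longrightarrow> f t = \<one>\<^bsub>C\<^esub>"
  shows "\<exists>h\<in>hom (A Mod generate A T) C. \<forall>x\<in>carrier A. h (generate A T #>\<^bsub>A\<^esub> x) = f x"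
proof -
  interpret A: comm_group A by fact
  interpret C: Group.group C by fact
  interpret f: group_hom A C f using assms by unfold_locales
  let ?N = "generate A T"
  have N: "subgroup ?N A" by (rule A.generate_is_subgroup) fact
  then have normal: "?N \<lhd> A" by (simp add: A.normal_iff_subgroup)
  have "?N \<subseteq> kernel A C f"
    by (rule generate_subset_subgroup[OF f.subgroup_kernel _ A.group_axioms]) (use assms in \<open>auto simp: kernel_def\<close>)
  then have ker: "f n = \<one>\<^bsub>C\<^esub>" if "n \<in> ?N" for n using that by (auto simp: kernel_def)
  have "f x = f y" if xy: "x \<in> carrier A" "y \<in> carrier A" "?N #>\<^bsub>A\<^esub> x = ?N #>\<^bsub>A\<^esub> y" for x y
  proof -
    have "x \<in> ?N #>\<^bsub>A\<^esub> y" using A.rcos_self[OF xy(1) N] xy(3) by simp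
    then obtain n where "n \<in> ?N" "x = n \<otimes>\<^bsub>A\<^esub> y" by (auto simp: r_coset_def)
    then show ?thesis using ker xy subgroup.subset[OF N] by (auto simp: subset_iff)
  qed
  from FactGroup_universal[OF assms(4) normal this] obtain h where
    "h \<in> hom (A Mod ?N) C" "\<And>x. x \<in> carrier A \<Longrightarrow> h (?N #>\<^bsub>A\<^esub> x) = f x" by blast
  then show ?thesis by blast
qed

lemma quotient_generate:
  assumes "N \<lhd> A" "X \<subseteq> carrier A" "generate A X = carrier A"
  shows "generate (A Mod N) ((\<lambda>x. N #>\<^bsub>A\<^esub> x) ` X) = carrier (A Mod N)"
proof -
  interpret normal N A by fact
  interpret Q: Group.group "A Mod N" by (rule factorgroup_is_group)
  interpret h: group_hom A "A Mod N" "\<lambda>x. N #>\<^bsub>A\<^esub> x" using r_coset_hom_Mod by unfold_locales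
  show ?thesis using h.generate_img[OF assms(2)] assms(3) by (simp add: carrier_FactGroup)
qed

lemma coset_eq_iff:
  assumes "N \<lhd> A" "x \<in> carrier A" "y \<in> carrier A"
  shows "N #>\<^bsub>A\<^esub> x = N #>\<^bsub>A\<^esub> y \<longleftrightarrow> x \<otimes>\<^bsub>A\<^esub> inv\<^bsub>A\<^esub> y \<in> N"
proof -
  interpret N: normal N A by fact
  show ?thesis
  proof
    assume "N #>\<^bsub>A\<^esub> x = N #>\<^bsub>A\<^esub> y"
    then have "x \<in> N #>\<^bsub>A\<^esub> y" using N.rcos_self[OF assms(2) N.subgroup_axioms] by simp
    then obtain n where "n \<in> N" "x = n \<otimes>\<^bsub>A\<^esub> y" by (auto simp: r_coset_def)
    then show "x \<otimes>\<^bsub>A\<^esub> inv\<^bsub>A\<^esub> y \<in> N" using assms N.subset by (auto simp: N.m_assoc subset_iff)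
  next
    assume n: "x \<otimes>\<^bsub>A\<^esub> inv\<^bsub>A\<^esub> y \<in> N"
    have "x = (x \<otimes>\<^bsub>A\<^esub> inv\<^bsub>A\<^esub> y) \<otimes>\<^bsub>A\<^esub> y" using assms by (simp add: N.m_assoc)
    then have "x \<in> N #>\<^bsub>A\<^esub> y" using n unfolding r_coset_def by blast
    then show "N #>\<^bsub>A\<^esub> x = N #>\<^bsub>A\<^esub> y"
      using N.repr_independence[OF _ assms(3) N.subgroup_axioms] by simp
  qed
qed

section \<open>Subgroups of finitely generated abelian groups\<close>

context comm_group
begin

lemma generate_insert_form:
  assumes "t \<in> carrier G" "T \<subseteq> carrier G" "x \<in> generate G (insert t T)"
  shows "\<exists>y\<in>generate G T. \<exists>n::int. x = y \<otimes> t [^] n"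
proof -
  have sub: "generate G T \<subseteq> carrier G" using generate_incl[OF assms(2)] .
  let ?K = "{y \<otimes> t [^] n | y n. y \<in> generate G T \<and> n \<in> (UNIV :: int set)}"
  have "subgroup ?K G"
  proof (rule subgroupI)
    show "?K \<subseteq> carrier G" using sub assms by auto
    show "?K \<noteq> {}" using generate.one by blast
  next
    fix a assume "a \<in> ?K"
    then obtain y and n :: int where a: "a = y \<otimes> t [^] n" "y \<in> generate G T" by blast
    have yc: "y \<in> carrier G" using a(2) sub by auto
    have "inv a = inv y \<otimes> t [^] (- n)"
      unfolding a(1) int_pow_neg[OF assms(1)] using yc assms(1) by (simp add: inv_mult)
    moreover have "inv y \<in> generate G T" using a assms(2) generate_m_inv_closed by blast
    ultimately show "inv a \<in> ?K" by blast
  next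
    fix a a' assume "a \<in> ?K" "a' \<in> ?K"
    then obtain y n y' n' where a: "a = y \<otimes> t [^] (n::int)" "y \<in> generate G T" "a' = y' \<otimes> t [^] (n'::int)" "y' \<in> generate G T" by blast
    have yc: "y \<in> carrier G" "y' \<in> carrier G" using a(2,4) sub by auto
    have "a \<otimes> a' = (y \<otimes> y') \<otimes> t [^] (n + n')"
      unfolding a(1,3) int_pow_mult[OF assms(1)] using yc assms(1) by (simp add: m_ac)
    moreover have "y \<otimes> y' \<in> generate G T" using generate.eng[OF a(2,4)] .
    ultimately show "a \<otimes> a' \<in> ?K" by blast
  qed
  moreover have "insert t T \<subseteq> ?K"
  proof -
    have "t = \<one> \<otimes> t [^] (1::int)" using assms by simp
    then have "t \<in> ?K" using generate.one[of G T] by blast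
    moreover have "s \<in> ?K" if "s \<in> T" for s
    proof -
      have "s = s \<otimes> t [^] (0::int)" using assms that by auto
      then show ?thesis using generate.incl[OF that, of G] by blast
    qed
    ultimately show ?thesis by blast
  qed
  ultimately have "generate G (insert t T) \<subseteq> ?K" by (rule generate_subset_subgroup) (rule group_axioms)
  then show ?thesis using assms(3) by blast
qed

text \<open>By induction on the generators. Among the exponents with which the new generator \<open>t\<close> occurs in elements of
  \<open>K\<close>, the least positive one divides all others; an element of \<open>K\<close> realising it, together with generators
  of \<open>K \<inter> generate G T\<close>, generates \<open>K\<close>.\<close>

lemma fg_subgroup:
  assumes "finite T" "T \<subseteq> carrier G" "subgroup K G" "K \<subseteq> generate G T"
  shows "\<exists>T'. finite T' \<and> T' \<subseteq> K \<and> generate G T' = K"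
  using assms
proof (induction T arbitrary: K rule: finite_induct)
  case empty
  then have "K = {\<one>}" using generate_empty subgroup.one_closed by auto
  then show ?case using generate_empty by (intro exI[of _ "{}"]) auto
next
  case (insert t T)
  have t: "t \<in> carrier G" and T: "T \<subseteq> carrier G" using insert by auto
  have gT: "subgroup (generate G T) G" using generate_is_subgroup[OF T] .
  have genc: "generate G T \<subseteq> carrier G" using subgroup.subset[OF gT] .
  have K: "subgroup K G" by fact
  have Kc: "K \<subseteq> carrier G" using subgroup.subset[OF K] .
  have "subgroup (K \<inter> generate G T) G" using K gT by (rule subgroups_Inter_pair)
  from insert.IH[OF T this] obtain T' where T': "finite T'" "T' \<subseteq> K \<inter> generate G T" "generate G T' = K \<inter> generate G T" by auto
  let ?N = "{n::int. \<exists>y\<in>generate G T. y \<otimes> t [^] n \<in> K}"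
  show ?case
  proof (cases "?N \<subseteq> {0}")
    case True
    have "K \<subseteq> generate G T"
    proof
      fix x assume x: "x \<in> K"
      then obtain y and n :: int where y: "y \<in> generate G T" "x = y \<otimes> t [^] n"
        using generate_insert_form[OF t T] insert.prems by blast
      then have "n = 0" using x True by blast
      then show "x \<in> generate G T" using y genc by auto
    qed
    then show ?thesis using T' by (intro exI[of _ T']) auto
  next
    case False
    then obtain n where n: "n \<in> ?N" "n \<noteq> 0" by blast
    have neg: "- n \<in> ?N" if "n \<in> ?N" for n
    proof -
      obtain y where y: "y \<in> generate G T" "y \<otimes> t [^] n \<in> K" using \<open>n \<in> ?N\<close> by blast
      then have "inv (y \<otimes> t [^] n) \<in> K" using K subgroup.m_inv_closed by metis
      moreover have "inv (y \<otimes> t [^] n) = inv y \<otimes> t [^] (- n)" using y genc t by (auto simp: inv_mult int_pow_neg)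
      ultimately show ?thesis using subgroup.m_inv_closed[OF gT y(1)] by auto
    qed
    have "\<exists>d::nat. d > 0 \<and> int d \<in> ?N"
    proof (cases "n > 0")
      case True
      then show ?thesis using n by (intro exI[of _ "nat n"]) auto
    next
      case False
      then show ?thesis using neg[OF n(1)] n(2) by (intro exI[of _ "nat (- n)"]) auto
    qed
    then have ex: "\<exists>d::nat. d > 0 \<and> int d \<in> ?N" .
    define d where "d = (LEAST d. d > 0 \<and> int d \<in> ?N)"
    have d: "d > 0" "int d \<in> ?N" using LeastI_ex[OF ex] unfolding d_def by simp_all
    have d_le: "d \<le> e" if "e > 0" "int e \<in> ?N" for e
      unfolding d_def by (rule Least_le) (use that in simp)
    from d(2) obtain y0 where y0: "y0 \<in> generate G T" "y0 \<otimes> t [^] int d \<in> K" by blast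
    define x0 where "x0 = y0 \<otimes> t [^] int d"
    have x0: "x0 \<in> K" "x0 \<in> carrier G" using y0 Kc x0_def by auto
    let ?T = "insert x0 T'"
    have "x \<in> generate G ?T" if x: "x \<in> K" for x
    proof -
      obtain y and n :: int where y: "y \<in> generate G T" "x = y \<otimes> t [^] n"
        using generate_insert_form[OF t T] insert.prems x by blast
      define r where "r = n mod int d"
      define e where "e = n div int d"
      have ne: "n = int d * e + r" by (simp add: r_def e_def)
      let ?z = "x \<otimes> x0 [^] (- e)"
      have yc: "y \<in> carrier G" "y0 \<in> carrier G" using y y0 genc by auto
      have x0e: "x0 [^] (- e) = y0 [^] (- e) \<otimes> t [^] (- (int d * e))"
        unfolding x0_def using yc t by (simp add: int_pow_distrib int_pow_pow)
      have "?z = (y \<otimes> y0 [^] (- e)) \<otimes> (t [^] n \<otimes> t [^] (- (int d * e)))"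
        unfolding x0e y(2) using yc t by (simp add: m_ac)
      also have "t [^] n \<otimes> t [^] (- (int d * e)) = t [^] r" using t by (simp add: ne flip: int_pow_mult)
      finally have z: "?z = (y \<otimes> y0 [^] (- e)) \<otimes> t [^] r" .
      have yy: "y \<otimes> y0 [^] (- e) \<in> generate G T"
        using generate.eng[OF y(1) subgroup_int_pow_closed[OF gT y0(1)]] .
      have "x0 [^] (- e) \<in> K" using subgroup_int_pow_closed[OF K x0(1)] .
      then have zK: "?z \<in> K" using x subgroup.m_closed[OF K] by blast
      have "r \<in> ?N" using zK yy unfolding z by blast
      moreover have r: "0 \<le> r" "r < int d" using d(1) by (auto simp: r_def)
      ultimately have "r = 0" using d_le[of "nat r"] by (cases "r = 0") simp_all
      then have "?z = y \<otimes> y0 [^] (- e)" unfolding z using yc by simp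
      then have "?z \<in> generate G T'" using zK yy unfolding T'(3) by (simp only: Int_iff)
      then have "?z \<in> generate G ?T" using mono_generate[of T' ?T] by blast
      moreover have "x0 [^] e \<in> generate G ?T"
      proof -
        have "?T \<subseteq> carrier G" using x0 T'(2) Kc by auto
        then show ?thesis
          by (intro subgroup_int_pow_closed generate_is_subgroup) (auto intro: generate.incl)
      qed
      ultimately have "?z \<otimes> x0 [^] e \<in> generate G ?T" by (rule generate.eng)
      moreover have "?z \<otimes> x0 [^] e = x"
        using x Kc x0 by (auto simp: m_assoc simp flip: int_pow_mult)
      ultimately show ?thesis by simp
    qed
    moreover have "generate G ?T \<subseteq> K"
      by (rule generate_subset_subgroup[OF K _ group_axioms]) (use x0 T' in auto)
    ultimately show ?thesis using T' x0 by (intro exI[of _ ?T]) auto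
  qed
qed

section \<open>Torsion-free finitely generated abelian groups\<close>

lemma finprod_split2:
  assumes "finite J" "i \<in> J" "j \<in> J" "i \<noteq> j" "f \<in> J \<rightarrow> carrier G"
  shows "finprod G f J = f i \<otimes> f j \<otimes> finprod G f (J - {i, j})"
proof -
  have J: "J = insert i (insert j (J - {i, j}))" using assms by auto
  have "finprod G f J = finprod G f (insert i (insert j (J - {i, j})))" using J by simp
  also have "\<dots> = f i \<otimes> (f j \<otimes> finprod G f (J - {i, j}))"
    using assms by (subst finprod_insert finprod_insert; auto simp: Pi_iff)+
  finally show ?thesis using assms by (subst m_assoc) (auto simp: Pi_iff intro!: finprod_closed)
qed

text \<open>Among all nontrivial relations between the members of generating families of least size, take one
  whose coefficients have the least sum of absolute values. If two coefficients are nonzero, the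
  substitution \<open>b j \<mapsto> b j \<otimes> b i [^] \<sigma>\<close>, a step of the Euclidean algorithm, makes the sum smaller. If only one
  is, then by torsion-freeness the corresponding generator is trivial and can be left out.\<close>

lemma torsion_free_fg_basis:
  assumes "finite T" "T \<subseteq> carrier G" "generate G T = carrier G"
    and tf: "\<And>x n. x \<in> carrier G \<Longrightarrow> n \<noteq> 0 \<Longrightarrow> x [^] (n::int) = \<one> \<Longrightarrow> x = \<one>"
  shows "\<exists>(J::nat set) b. finite J \<and> b ` J \<subseteq> carrier G \<and> generate G (b ` J) = carrier G \<and>
     (\<forall>c::nat \<Rightarrow> int. finprod G (\<lambda>j. b j [^] c j) J = \<one> \<longrightarrow> (\<forall>j\<in>J. c j = 0))"
proof -
  define gens where "gens n J b \<longleftrightarrow> finite (J::nat set) \<and> card J = n \<and> b ` J \<subseteq> carrier G \<and> generate G (b ` J) = carrier G" for n J b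
  obtain e where "bij_betw e {..<card T} T" using \<open>finite T\<close> ex_bij_betw_nat_finite[of T] by (metis atLeast0LessThan)
  then have "gens (card T) {..<card T} e" using assms unfolding gens_def bij_betw_def by auto
  then have "\<exists>n J b. gens n J b" by blast
  then obtain n where n: "\<exists>J b. gens n J b" "\<And>m. m < n \<Longrightarrow> \<not> (\<exists>J b. gens m J b)"
    using exists_least_iff[of "\<lambda>n. \<exists>J b. gens n J b"] by blast
  define rel where "rel s J b c \<longleftrightarrow> gens n J b \<and> finprod G (\<lambda>j. b j [^] c j) J = \<one> \<and> (\<exists>j\<in>J. c j \<noteq> 0) \<and>
    (\<Sum>j\<in>J. nat \<bar>c j\<bar>) = s" for s J b and c :: "nat \<Rightarrow> int"
  have "\<not> rel s J b c" for s J b c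
  proof
    assume "rel s J b c"
    then have "\<exists>s J b c. rel s J b c" by blast
    then obtain s where s: "\<exists>J b c. rel s J b c" "\<And>m. m < s \<Longrightarrow> \<not> (\<exists>J b c. rel m J b c)"
      using exists_least_iff[of "\<lambda>s. \<exists>J b c. rel s J b c"] by blast
    then obtain J b c where r: "rel s J b c" by blast
    have J: "finite J" "card J = n" "b ` J \<subseteq> carrier G" "generate G (b ` J) = carrier G"
      and rel0: "finprod G (\<lambda>j. b j [^] c j) J = \<one>" and sum: "(\<Sum>j\<in>J. nat \<bar>c j\<bar>) = s"
      using r unfolding rel_def gens_def by auto
    have bc: "b j \<in> carrier G" if "j \<in> J" for j using J(3) that by auto
    obtain i where i: "i \<in> J" "c i \<noteq> 0" using r unfolding rel_def by blast
    show False
    proof (cases "\<forall>j\<in>J. j \<noteq> i \<longrightarrow> c j = 0")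
      case True
      have "finprod G (\<lambda>j. b j [^] c j) J = b i [^] c i"
        by (rule finprod_delta[OF comm_group_axioms J(1) i(1)]) (use True bc i in auto)
      then have "b i = \<one>" using tf[of "b i" "c i"] bc i rel0 by simp
      have "b ` J \<subseteq> generate G (b ` (J - {i}))"
      proof clarify
        fix k assume "k \<in> J"
        then show "b k \<in> generate G (b ` (J - {i}))"
          using \<open>b i = \<one>\<close> by (cases "k = i") (auto intro: generate.one generate.incl)
      qed
      moreover have "b ` (J - {i}) \<subseteq> carrier G" using J(3) by auto
      ultimately have "generate G (b ` J) \<subseteq> generate G (b ` (J - {i}))"
        using generate_subset_subgroup[OF generate_is_subgroup _ group_axioms] by blast
      then have "generate G (b ` (J - {i})) = carrier G"
        using J(4) generate_incl[OF \<open>b ` (J - {i}) \<subseteq> carrier G\<close>] by simp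
      then have "gens (card (J - {i})) (J - {i}) b"
        unfolding gens_def using J(1) \<open>b ` (J - {i}) \<subseteq> carrier G\<close> by simp
      moreover have "card (J - {i}) < n" using J i by (metis card_Diff1_less)
      ultimately show False using n(2) by blast
    next
      case False
      then obtain i' where i': "i' \<in> J" "i' \<noteq> i" "c i' \<noteq> 0" by blast
      obtain i j where ij: "i \<in> J" "j \<in> J" "i \<noteq> j" "c i \<noteq> 0" "c j \<noteq> 0" "\<bar>c j\<bar> \<le> \<bar>c i\<bar>"
      proof (cases "\<bar>c i'\<bar> \<le> \<bar>c i\<bar>")
        case True
        then show ?thesis using that[of i i'] i i' by auto
      next
        case False
        then show ?thesis using that[of i' i] i i' by auto
      qed
      \<comment> \<open>with this sign, \<open>c i - \<sigma> c j\<close> is smaller than \<open>c i\<close> in absolute value\<close>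
      define \<sigma> where "\<sigma> = sgn (c i) * sgn (c j)"
      define b' where "b' = b(j := b j \<otimes> b i [^] \<sigma>)"
      define c' where "c' = c(i := c i - \<sigma> * c j)"
      have b'c: "b' k \<in> carrier G" if "k \<in> J" for k using bc that ij by (auto simp: b'_def)
      have less: "\<bar>c i - \<sigma> * c j\<bar> < \<bar>c i\<bar>"
        using ij(4,5,6) by (auto simp: \<sigma>_def sgn_if)
      have "(\<Sum>k\<in>J. nat \<bar>c' k\<bar>) < (\<Sum>k\<in>J. nat \<bar>c k\<bar>)"
        by (rule sum_strict_mono_ex1[OF J(1)]) (use ij less in \<open>auto simp: c'_def intro!: bexI[of _ i]\<close>)
      then have lt: "(\<Sum>k\<in>J. nat \<bar>c' k\<bar>) < s" using sum by simp
      have "finprod G (\<lambda>k. b' k [^] c' k) J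
          = b' i [^] c' i \<otimes> b' j [^] c' j \<otimes> finprod G (\<lambda>k. b' k [^] c' k) (J - {i, j})"
        by (rule finprod_split2) (use J ij b'c in auto)
      also have "finprod G (\<lambda>k. b' k [^] c' k) (J - {i, j}) = finprod G (\<lambda>k. b k [^] c k) (J - {i, j})"
        by (rule finprod_cong') (use bc in \<open>auto simp: b'_def c'_def\<close>)
      also have "b' i [^] c' i \<otimes> b' j [^] c' j = b i [^] c i \<otimes> b j [^] c j"
      proof -
        have "b' i [^] c' i \<otimes> b' j [^] c' j
            = b i [^] (c i - \<sigma> * c j) \<otimes> (b j [^] c j \<otimes> b i [^] (\<sigma> * c j))"
          using ij bc by (simp add: b'_def c'_def int_pow_distrib int_pow_pow)
        also have "\<dots> = b j [^] c j \<otimes> (b i [^] (c i - \<sigma> * c j) \<otimes> b i [^] (\<sigma> * c j))"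
          using ij bc by (simp add: m_ac)
        also have "b i [^] (c i - \<sigma> * c j) \<otimes> b i [^] (\<sigma> * c j) = b i [^] c i"
          using ij bc by (simp flip: int_pow_mult)
        finally show ?thesis using ij bc by (simp add: m_comm)
      qed
      also have "b i [^] c i \<otimes> b j [^] c j \<otimes> finprod G (\<lambda>k. b k [^] c k) (J - {i, j}) = finprod G (\<lambda>k. b k [^] c k) J"
        by (rule finprod_split2[symmetric]) (use J ij bc in auto)
      finally have rel': "finprod G (\<lambda>k. b' k [^] c' k) J = \<one>" using rel0 by simp
      have b'J: "b' ` J \<subseteq> carrier G" using b'c by auto
      have "b ` J \<subseteq> generate G (b' ` J)"
      proof
        fix x assume "x \<in> b ` J"
        then obtain k where k: "k \<in> J" "x = b k" by blast
        have g: "b' k \<in> generate G (b' ` J)" if "k \<in> J" for k using that by (auto intro: generate.incl)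
        show "x \<in> generate G (b' ` J)"
        proof (cases "k = j")
          case True
          have "b' i [^] (- \<sigma>) \<in> generate G (b' ` J)"
            by (rule subgroup_int_pow_closed[OF generate_is_subgroup[OF b'J] g[OF ij(1)]])
          then have "b' j \<otimes> b' i [^] (- \<sigma>) \<in> generate G (b' ` J)" using g[OF ij(2)] generate.eng by metis
          moreover have "b' j \<otimes> b' i [^] (- \<sigma>) = b j"
            using ij bc by (simp add: b'_def m_assoc flip: int_pow_mult)
          ultimately show ?thesis using k True by simp
        next
          case False
          then show ?thesis using g[OF k(1)] k by (simp add: b'_def)
        qed
      qed
      then have "generate G (b ` J) \<subseteq> generate G (b' ` J)"
        using generate_subset_subgroup[OF generate_is_subgroup[OF b'J] _ group_axioms] by blast
      then have "generate G (b' ` J) = carrier G" using J(4) generate_incl[OF b'J] by simp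
      then have "gens n J b'" unfolding gens_def using J(1,2) b'J by simp
      moreover have "\<exists>k\<in>J. c' k \<noteq> 0" using ij by (intro bexI[of _ j]) (auto simp: c'_def)
      ultimately have "rel (\<Sum>k\<in>J. nat \<bar>c' k\<bar>) J b' c'" using rel' unfolding rel_def by blast
      then show False using s(2) lt by blast
    qed
  qed
  moreover obtain J b where "gens n J b" using n(1) by (elim exE)
  ultimately have Jb: "gens n J b" "\<And>s c. \<not> rel s J b c" by auto
  have "\<forall>j\<in>J. c j = 0" if "finprod G (\<lambda>j. b j [^] c j) J = \<one>" for c :: "nat \<Rightarrow> int"
  proof (rule ccontr)
    assume "\<not> (\<forall>j\<in>J. c j = 0)"
    then have "rel (\<Sum>j\<in>J. nat \<bar>c j\<bar>) J b c" unfolding rel_def using Jb(1) that by simp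
    then show False using Jb(2) by simp
  qed
  then show ?thesis using Jb(1) unfolding gens_def by (intro exI[of _ J] exI[of _ b]) simp
qed

lemma torsion_free_fg_free:
  assumes "finite T" "T \<subseteq> carrier G" "generate G T = carrier G"
    and "\<And>x n. x \<in> carrier G \<Longrightarrow> n \<noteq> 0 \<Longrightarrow> x [^] (n::int) = \<one> \<Longrightarrow> x = \<one>"
  shows "\<exists>n::nat. G \<cong> free_Abelian_group {..<n}"
proof -
  have "\<exists>(J::nat set) b. finite J \<and> b ` J \<subseteq> carrier G \<and> generate G (b ` J) = carrier G \<and>
      (\<forall>c::nat \<Rightarrow> int. finprod G (\<lambda>j. b j [^] c j) J = \<one> \<longrightarrow> (\<forall>j\<in>J. c j = 0))"
    by (rule torsion_free_fg_basis[OF assms(1-3)]) (rule assms(4))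
  then obtain J :: "nat set" and b where Jb: "finite J \<and> b ` J \<subseteq> carrier G \<and> generate G (b ` J) = carrier G \<and>
      (\<forall>c::nat \<Rightarrow> int. finprod G (\<lambda>j. b j [^] c j) J = \<one> \<longrightarrow> (\<forall>j\<in>J. c j = 0))"
    by (elim exE)
  have J: "finite J" "b ` J \<subseteq> carrier G" "generate G (b ` J) = carrier G"
    using Jb by simp_all
  have ind: "\<forall>j\<in>J. c j = 0" if "finprod G (\<lambda>j. b j [^] c j) J = \<one>" for c :: "nat \<Rightarrow> int"
    using Jb that by simp
  have bc: "b j \<in> carrier G" if "j \<in> J" for j using J(2) that by auto
  let ?F = "free_Abelian_group J"
  define h where "h x = finprod G (\<lambda>j. b j [^] poly_mapping.lookup x j) J" for x :: "nat \<Rightarrow>\<^sub>0 int"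
  have hom: "h \<in> hom ?F G"
  proof (rule homI)
    show "h x \<in> carrier G" for x unfolding h_def using bc by (intro finprod_closed) auto
    show "h (x \<otimes>\<^bsub>?F\<^esub> y) = h x \<otimes> h y" for x y
    proof -
      have "h (x \<otimes>\<^bsub>?F\<^esub> y) = finprod G (\<lambda>j. b j [^] poly_mapping.lookup x j \<otimes> b j [^] poly_mapping.lookup y j) J"
        unfolding h_def by (rule finprod_cong') (use bc in \<open>auto simp: Poly_Mapping.lookup_add int_pow_mult\<close>)
      also have "\<dots> = h x \<otimes> h y"
        unfolding h_def by (rule finprod_multf) (use bc in auto)
      finally show ?thesis .
    qed
  qed
  interpret h: group_hom ?F G h
    using hom group_axioms by (simp add: group_hom_def group_hom_axioms_def)
  have "b j = h (frag_of j)" if "j \<in> J" for j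
    unfolding h_def by (rule finprod_delta[symmetric, OF comm_group_axioms J(1) that]) (use bc that in \<open>auto simp: lookup_single\<close>)
  then have "b ` J \<subseteq> h ` carrier ?F" by (auto intro!: imageI)
  then have "generate G (b ` J) \<subseteq> h ` carrier ?F"
    by (rule generate_subset_subgroup[OF h.img_is_subgroup _ group_axioms])
  then have "carrier G \<subseteq> h ` carrier ?F" unfolding J(3) .
  then have surj: "h ` carrier ?F = carrier G" by auto
  have "x = 0" if x: "x \<in> carrier ?F" "h x = \<one>" for x
  proof -
    have "\<forall>j\<in>J. poly_mapping.lookup x j = 0" using ind x(2) unfolding h_def by blast
    moreover have "poly_mapping.lookup x j = 0" if "j \<notin> J" for j using x(1) that by (auto simp: in_keys_iff)
    ultimately show ?thesis by (intro poly_mapping_eqI) (metis lookup_zero)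
  qed
  then have "inj_on h (carrier ?F)" using h.inj_on_one_iff by simp
  then have "h \<in> iso ?F G" using hom surj by (auto simp: iso_def bij_betw_def)
  then have "G \<cong> ?F" using h.G.iso_set_sym is_isoI by blast
  moreover have "?F \<cong> free_Abelian_group {..<card J}"
    using J(1) by (simp add: isomorphic_free_Abelian_groups eqpoll_iff_card)
  ultimately show ?thesis using iso_trans by blast
qed

end

section \<open>Free groups\<close>

definition word_map :: "('b, 'n) monoid_scheme \<Rightarrow> ('a \<Rightarrow> 'b) \<Rightarrow> ('a \<times> bool) list \<Rightarrow> 'b" where
  "word_map K f w = foldr (\<lambda>(s, e) x. (if e then f s else inv\<^bsub>K\<^esub> f s) \<otimes>\<^bsub>K\<^esub> x) w \<one>\<^bsub>K\<^esub>"

lemma word_value_word_map: "word_value G w = word_map G (\<lambda>s. s) w"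
  by (simp add: word_value_def word_map_def)

lemma word_map_Nil [simp]: "word_map K f [] = \<one>\<^bsub>K\<^esub>"
  and word_map_Cons [simp]: "word_map K f ((s, e) # w) = (if e then f s else inv\<^bsub>K\<^esub> f s) \<otimes>\<^bsub>K\<^esub> word_map K f w"
  by (simp_all add: word_map_def)

context Group.group
begin

lemma word_map_closed:
  "f ` fst ` set w \<subseteq> carrier G \<Longrightarrow> word_map G f w \<in> carrier G"
  by (induction w) auto

lemma word_map_append:
  "f ` fst ` set u \<subseteq> carrier G \<Longrightarrow> f ` fst ` set w \<subseteq> carrier G \<Longrightarrow>
     word_map G f (u @ w) = word_map G f u \<otimes> word_map G f w"
  by (induction u) (auto simp: m_assoc word_map_closed)

lemma word_map_inverse:
  "f ` fst ` set w \<subseteq> carrier G \<Longrightarrow>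
     word_map G f (rev (map (\<lambda>(s, e). (s, \<not> e)) w)) = inv (word_map G f w)"
proof (induction w)
  case (Cons a w)
  obtain s e where a: "a = (s, e)" by force
  have sub: "f ` fst ` set (rev (map (\<lambda>(s, e). (s, \<not> e)) w)) \<subseteq> carrier G" using Cons.prems by force
  then show ?case
    using Cons a by (auto simp: word_map_append inv_mult_group word_map_closed)
qed simp

lemma word_map_cancel:
  assumes "f ` fst ` set (u @ (s, e) # (s, \<not> e) # w) \<subseteq> carrier G"
  shows "word_map G f (u @ (s, e) # (s, \<not> e) # w) = word_map G f (u @ w)"
proof -
  have "word_map G f ((s, e) # (s, \<not> e) # w) = word_map G f w"
    using assms word_map_closed[of f w] by (cases e) (auto simp: image_Un m_assoc[symmetric])
  then show ?thesis
    using assms word_map_append[of f u "(s, e) # (s, \<not> e) # w"] word_map_append[of f u w]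
    by (auto simp: image_Un)
qed

end

lemma not_reduced_wordE:
  assumes "\<not> reduced_word w"
  obtains u s e v where "w = u @ (s, e) # (s, \<not> e) # v"
proof -
  obtain i where i: "Suc i < length w" "fst (w ! i) = fst (w ! Suc i)" "snd (w ! i) \<noteq> snd (w ! Suc i)"
    using assms by (auto simp: reduced_word_def)
  have "w = take i w @ w ! i # w ! Suc i # drop (Suc (Suc i)) w"
    using i(1) by (metis Cons_nth_drop_Suc Suc_lessD append_take_drop_id)
  moreover have "w ! i = (fst (w ! i), snd (w ! i))" "w ! Suc i = (fst (w ! i), \<not> snd (w ! i))"
    using i by (auto simp: prod_eq_iff)
  ultimately show ?thesis using that by metis
qed

text \<open>The homomorphism evaluates any word that represents the given element. This is well defined: a nonempty
  word of value \<open>\<one>\<close> in \<open>P\<close> is not reduced, and removing a cancelling pair of letters changes neither its value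
  in \<open>P\<close> nor the one in \<open>K\<close>, so by induction on the length its value in \<open>K\<close> is \<open>\<one>\<close> as well.\<close>

theorem free_group_universal:
  assumes P: "Group.group P" and free: "free_generating_set P S"
    and K: "Group.group K" and f: "f ` S \<subseteq> carrier K"
  shows "\<exists>h\<in>hom P K. \<forall>s\<in>S. h s = f s"
proof -
  interpret P: Group.group P by fact
  interpret K: Group.group K by fact
  let ?W = "{w. fst ` set w \<subseteq> S}"
  let ?v = "word_map P (\<lambda>s. s)" and ?k = "word_map K f"
  have SP: "S \<subseteq> carrier P" using free by (simp add: free_generating_set_def)
  have Pc: "(\<lambda>s. s) ` fst ` set w \<subseteq> carrier P" if "w \<in> ?W" for w using that SP by auto
  have Kc: "f ` fst ` set w \<subseteq> carrier K" if "w \<in> ?W" for w using that f by blast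
  have one: "?k w = \<one>\<^bsub>K\<^esub>" if "w \<in> ?W" "?v w = \<one>\<^bsub>P\<^esub>" for w
    using that
  proof (induction w rule: length_induct)
    case (1 w)
    show ?case
    proof (cases "w = []")
      case False
      then have "\<not> reduced_word w" using free 1 unfolding free_generating_set_def word_value_word_map by blast
      then obtain u s e v where w: "w = u @ (s, e) # (s, \<not> e) # v" by (rule not_reduced_wordE)
      have "?v (u @ v) = ?v w" unfolding w by (rule P.word_map_cancel[symmetric]) (use Pc 1(2) w in blast)
      moreover have "?k (u @ v) = ?k w" unfolding w by (rule K.word_map_cancel[symmetric]) (use Kc 1(2) w in blast)
      moreover have "u @ v \<in> ?W" "length (u @ v) < length w" using 1(2) w by auto
      ultimately show ?thesis using 1(1,3) by metis
    qed simp
  qed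
  have surj: "\<exists>w\<in>?W. ?v w = x" if "x \<in> carrier P" for x
  proof -
    have "x \<in> generate P S" using free that by (simp add: free_generating_set_def)
    then show ?thesis
    proof (induction rule: generate.induct)
      case one
      show ?case by (intro bexI[of _ "[]"]) auto
    next
      case (incl h)
      then show ?case using SP by (intro bexI[of _ "[(h, True)]"]) auto
    next
      case (inv h)
      then show ?case using SP by (intro bexI[of _ "[(h, False)]"]) auto
    next
      case (eng h1 h2)
      then obtain w1 w2 where "w1 \<in> ?W" "?v w1 = h1" "w2 \<in> ?W" "?v w2 = h2" by blast
      then show ?case
        using P.word_map_append[OF Pc Pc, of w1 w2] by (intro bexI[of _ "w1 @ w2"]) auto
    qed
  qed
  have eq: "?k w = ?k w'" if w: "w \<in> ?W" "w' \<in> ?W" "?v w = ?v w'" for w w'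
  proof -
    let ?i = "rev (map (\<lambda>(s, e). (s, \<not> e)) w')"
    have i: "?i \<in> ?W" using w(2) by force
    have "?v (w @ ?i) = ?v w \<otimes>\<^bsub>P\<^esub> inv\<^bsub>P\<^esub> ?v w'"
      using Pc[OF w(1)] Pc[OF i] Pc[OF w(2)] by (simp only: P.word_map_append P.word_map_inverse)
    also have "\<dots> = \<one>\<^bsub>P\<^esub>" using w(3) P.word_map_closed[OF Pc[OF w(2)]] by simp
    finally have v1: "?v (w @ ?i) = \<one>\<^bsub>P\<^esub>" .
    have "w @ ?i \<in> ?W"
      using w(1) i by (simp only: mem_Collect_eq set_append image_Un Un_subset_iff simp_thms)
    from one[OF this v1] have "?k (w @ ?i) = \<one>\<^bsub>K\<^esub>" .
    then have "?k w \<otimes>\<^bsub>K\<^esub> inv\<^bsub>K\<^esub> ?k w' = \<one>\<^bsub>K\<^esub>"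
      using Kc[OF w(1)] Kc[OF i] Kc[OF w(2)] by (simp only: K.word_map_append K.word_map_inverse)
    then show ?thesis using K.word_map_closed[OF Kc[OF w(1)]] K.word_map_closed[OF Kc[OF w(2)]]
      by (metis K.inv_closed K.inv_inv K.inv_equality)
  qed
  define word where "word x = (SOME w. w \<in> ?W \<and> ?v w = x)" for x
  have word: "word x \<in> ?W" "?v (word x) = x" if "x \<in> carrier P" for x
    using someI_ex[of "\<lambda>w. w \<in> ?W \<and> ?v w = x"] surj[OF that] by (auto simp: word_def)
  have "(\<lambda>x. ?k (word x)) \<in> hom P K"
  proof (rule homI)
    show "?k (word x) \<in> carrier K" if "x \<in> carrier P" for x
      using K.word_map_closed[OF Kc[OF word(1)[OF that]]] .
    show "?k (word (x \<otimes>\<^bsub>P\<^esub> y)) = ?k (word x) \<otimes>\<^bsub>K\<^esub> ?k (word y)" if xy: "x \<in> carrier P" "y \<in> carrier P" for x y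
    proof -
      have "?v (word x @ word y) = x \<otimes>\<^bsub>P\<^esub> y"
        using word[OF xy(1)] word[OF xy(2)] P.word_map_append[OF Pc Pc, of "word x" "word y"] by simp
      then have "?k (word (x \<otimes>\<^bsub>P\<^esub> y)) = ?k (word x @ word y)"
        using word xy by (intro eq) auto
      then show ?thesis using K.word_map_append[OF Kc[OF word(1)[OF xy(1)]] Kc[OF word(1)[OF xy(2)]]] by simp
    qed
  qed
  moreover have "?k (word s) = f s" if "s \<in> S" for s
  proof -
    have s: "s \<in> carrier P" using SP that by auto
    have "?k (word s) = ?k [(s, True)]"
      by (rule eq) (use that word s in auto)
    then show ?thesis using f that by auto
  qed
  ultimately show ?thesis by (intro bexI[of _ "\<lambda>x. ?k (word x)"] ballI)
qed

section \<open>Lower central series\<close>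

context Group.group
begin

lemma conjugate_commutator:
  assumes "x \<in> carrier G" "y \<in> carrier G" "z \<in> carrier G"
  shows "z \<otimes> commutator G x y \<otimes> inv z = commutator G (z \<otimes> x \<otimes> inv z) (z \<otimes> y \<otimes> inv z)"
proof -
  have "inv z \<otimes> (z \<otimes> u) = u" if "u \<in> carrier G" for u
    using assms that by (simp flip: m_assoc)
  then show ?thesis using assms by (simp add: commutator_def m_assoc inv_mult_group)
qed

lemma lower_central_normal: "lower_central G k \<lhd> G"
proof (induction k)
  case 0
  then show ?case using normal_self by simp
next
  case (Suc k)
  interpret K: normal "lower_central G k" G by fact
  show ?case unfolding lower_central.simps
  proof (rule normal_generateI)
    show "{commutator G x y |x y. x \<in> carrier G \<and> y \<in> lower_central G k} \<subseteq> carrier G"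
      using K.subset by (auto simp: commutator_def)
    fix h z assume "h \<in> {commutator G x y |x y. x \<in> carrier G \<and> y \<in> lower_central G k}" and z: "z \<in> carrier G"
    then obtain x y where xy: "x \<in> carrier G" "y \<in> lower_central G k" "h = commutator G x y" by blast
    have "z \<otimes> h \<otimes> inv z = commutator G (z \<otimes> x \<otimes> inv z) (z \<otimes> y \<otimes> inv z)"
      using xy z K.subset by (auto simp: conjugate_commutator)
    moreover have "z \<otimes> y \<otimes> inv z \<in> lower_central G k" using K.inv_op_closed2 xy z by blast
    ultimately show "z \<otimes> h \<otimes> inv z \<in> {commutator G x y |x y. x \<in> carrier G \<and> y \<in> lower_central G k}"
      using xy z by auto
  qed
qed

lemma lower_central_subset: "lower_central G k \<subseteq> carrier G"
  using lower_central_normal[of k] normal_imp_subgroup subgroup.subset by blast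

lemma commutator_lower_central:
  "x \<in> carrier G \<Longrightarrow> y \<in> lower_central G k \<Longrightarrow> commutator G x y \<in> lower_central G (Suc k)"
  by (auto intro: generate.incl)

lemma lower_central_Suc_subset: "lower_central G (Suc k) \<subseteq> lower_central G k"
proof -
  interpret K: normal "lower_central G k" G by (rule lower_central_normal)
  show ?thesis unfolding lower_central.simps
  proof (rule generate_subset_subgroup[OF K.subgroup_axioms _ group_axioms], clarify)
    fix x y assume xy: "x \<in> carrier G" "y \<in> lower_central G k"
    then have "x \<otimes> y \<otimes> inv x \<in> lower_central G k" using K.inv_op_closed2 by blast
    then show "commutator G x y \<in> lower_central G k" using xy by (simp add: commutator_def)
  qed
qed

lemma lower_central_antimono: "i \<le> j \<Longrightarrow> lower_central G j \<subseteq> lower_central G i"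
  by (induction j rule: dec_induct) (use lower_central_Suc_subset in blast)+

lemma group_nil_quot: "Group.group (nil_quot G k)"
  unfolding nil_quot_def by (rule normal.factorgroup_is_group[OF lower_central_normal])

lemma nil_proj_hom: "nil_proj G k \<in> hom G (nil_quot G k)"
  using normal.r_coset_hom_Mod[OF lower_central_normal[of "k - 1"]]
  unfolding nil_proj_def[abs_def] nil_quot_def .

lemma carrier_nil_quot: "carrier (nil_quot G k) = nil_proj G k ` carrier G"
  unfolding nil_quot_def nil_proj_def carrier_FactGroup by simp

lemma nil_proj_eq_iff:
  "x \<in> carrier G \<Longrightarrow> y \<in> carrier G \<Longrightarrow>
    nil_proj G k x = nil_proj G k y \<longleftrightarrow> x \<otimes> inv y \<in> lower_central G (k - 1)"
  unfolding nil_proj_def by (rule coset_eq_iff[OF lower_central_normal])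

text \<open>The commutator of \<open>x\<close> and \<open>y\<close> lies in the next term of the series. For \<open>k = 0\<close>, where \<open>k - 1\<close> is
  truncated, the quotient is trivial.\<close>

lemma nil_proj_central:
  assumes "x \<in> carrier G" "y \<in> lower_central G (k - 1)"
  shows "nil_proj G (k + 1) (x \<otimes> y) = nil_proj G (k + 1) (y \<otimes> x)"
proof -
  have y: "y \<in> carrier G" using assms lower_central_subset by blast
  show ?thesis
  proof (cases k)
    case 0
    then show ?thesis using assms y by (subst nil_proj_eq_iff) auto
  next
    case (Suc j)
    have "x \<otimes> y \<otimes> inv (y \<otimes> x) = commutator G x y"
      using assms y by (simp add: commutator_def inv_mult_group m_assoc)
    then show ?thesis using commutator_lower_central[OF assms] assms(1) y Suc by (subst nil_proj_eq_iff) auto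
  qed
qed

lemma comm_group_nil_quot_2: "comm_group (nil_quot G 2)"
proof (rule group.group_comm_groupI[OF group_nil_quot])
  fix X Y assume "X \<in> carrier (nil_quot G 2)" "Y \<in> carrier (nil_quot G 2)"
  then obtain x y where xy: "x \<in> carrier G" "X = nil_proj G 2 x" "y \<in> carrier G" "Y = nil_proj G 2 y"
    by (auto simp: carrier_nil_quot)
  have "nil_proj G 2 (x \<otimes> y) = nil_proj G 2 (y \<otimes> x)"
    using nil_proj_central[of x y 1] xy by (simp add: numeral_2_eq_2)
  then show "X \<otimes>\<^bsub>nil_quot G 2\<^esub> Y = Y \<otimes>\<^bsub>nil_quot G 2\<^esub> X"
    using xy hom_mult[OF nil_proj_hom] by metis
qed

lemma nil_quot_generate:
  assumes "S \<subseteq> carrier G" "generate G S = carrier G"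
  shows "generate (nil_quot G k) (nil_proj G k ` S) = carrier (nil_quot G k)"
  using quotient_generate[OF lower_central_normal assms] unfolding nil_quot_def nil_proj_def .

end

section \<open>Group laws in exponential coordinates\<close>

text \<open>The product of a Lie group whose exponential map is a bijection, transported to the Lie algebra. All
  that is kept of differentiability is \<open>near_zero\<close>. It bounds the error by each of the two
  arguments separately, and so also controls long products in which one factor is much smaller than the
  other (\<open>product_estimate\<close> below).\<close>

locale exp_group =
  fixes mu :: "'e::euclidean_space \<Rightarrow> 'e \<Rightarrow> 'e"
  assumes assoc: "mu (mu x y) z = mu x (mu y z)"
    and one_param: "mu (s *\<^sub>R x) (t *\<^sub>R x) = (s + t) *\<^sub>R x"
    and cont: "continuous_on UNIV (\<lambda>p. mu (fst p) (snd p))"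
    and near_zero: "\<epsilon> > 0 \<Longrightarrow> \<exists>\<delta>>0. \<forall>x y. norm x < \<delta> \<longrightarrow> norm y < \<delta> \<longrightarrow>
          norm (mu x y - x - y) \<le> \<epsilon> * norm x \<and> norm (mu x y - x - y) \<le> \<epsilon> * norm y"
begin

lemma mu_0 [simp]: "mu 0 x = x" "mu x 0 = x"
  using one_param[of 0 x 1] one_param[of 1 x 0] by auto

lemma mu_minus [simp]: "mu x (- x) = 0" "mu (- x) x = 0"
  using one_param[of 1 x "-1"] one_param[of "-1" x 1] by auto

lemma mu_minus_assoc [simp]: "mu x (mu (- x) y) = y" "mu (- x) (mu x y) = y"
  by (simp_all flip: assoc)

lemma mu_inverse_unique: "mu x y = 0 \<Longrightarrow> y = - x"
  by (metis mu_0(2) mu_minus_assoc(2))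

lemma minus_mu: "- mu x y = mu (- y) (- x)"
  by (rule mu_inverse_unique[symmetric]) (simp add: assoc)

lemma tendsto_mu:
  assumes "(f \<longlongrightarrow> a) F" "(h \<longlongrightarrow> b) F"
  shows "((\<lambda>x. mu (f x) (h x)) \<longlongrightarrow> mu a b) F"
proof -
  have "isCont (\<lambda>p. mu (fst p) (snd p)) (a, b)"
    using cont by (simp add: continuous_on_eq_continuous_at)
  from isCont_tendsto_compose[OF this tendsto_Pair[OF assms]] show ?thesis by simp
qed

lemma multiple_Suc: "real (Suc n) *\<^sub>R x = mu (real n *\<^sub>R x) x"
  using one_param[of "real n" x 1] by (simp add: algebra_simps)

definition Ad :: "'e \<Rightarrow> 'e \<Rightarrow> 'e" where
  "Ad g x = mu (mu g x) (- g)"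

lemma Ad_mu: "Ad g (mu x y) = mu (Ad g x) (Ad g y)"
  by (simp add: Ad_def assoc)

lemma Ad_Ad: "Ad (mu g h) x = Ad g (Ad h x)"
  by (simp add: Ad_def assoc minus_mu)

lemma Ad_0 [simp]: "Ad 0 x = x" "Ad g 0 = 0"
  by (simp_all add: Ad_def)

lemma tendsto_Ad:
  assumes "(f \<longlongrightarrow> a) F" "(h \<longlongrightarrow> b) F"
  shows "((\<lambda>x. Ad (f x) (h x)) \<longlongrightarrow> Ad a b) F"
  unfolding Ad_def by (intro tendsto_mu tendsto_minus assms)

lemma Ad_nat: "Ad g (real n *\<^sub>R x) = real n *\<^sub>R Ad g x"
proof (induction n)
  case (Suc n)
  then show ?case by (simp only: multiple_Suc Ad_mu)
qed simp

lemma Ad_minus: "Ad g (- x) = - Ad g x"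
  by (rule mu_inverse_unique) (simp flip: Ad_mu)

lemma Ad_int: "Ad g (of_int i *\<^sub>R x) = of_int i *\<^sub>R Ad g x"
proof (cases i rule: int_cases2)
  case (nonneg n)
  then show ?thesis by (simp add: Ad_nat)
next
  case (nonpos n)
  then show ?thesis by (simp add: Ad_nat Ad_minus)
qed

text \<open>Conjugation commutes with taking powers, hence with multiplication by integers, and roots are unique in
  exponential coordinates.\<close>

lemma Ad_rat:
  assumes "n > 0"
  shows "Ad g ((of_int i / real n) *\<^sub>R x) = (of_int i / real n) *\<^sub>R Ad g x"
proof -
  have "real n *\<^sub>R Ad g ((of_int i / real n) *\<^sub>R x) = Ad g (of_int i *\<^sub>R x)"
    using assms by (simp flip: Ad_nat)
  then have "real n *\<^sub>R Ad g ((of_int i / real n) *\<^sub>R x) = real n *\<^sub>R ((of_int i / real n) *\<^sub>R Ad g x)"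
    using assms by (simp add: Ad_int)
  then show ?thesis by (rule scaleR_left_imp_eq[rotated]) (use assms in simp)
qed

lemma floor_approx: "(\<lambda>n. of_int \<lfloor>real (Suc n) * t\<rfloor> / real (Suc n)) \<longlonglongrightarrow> (t::real)"
proof (rule tendsto_sandwich)
  show "\<forall>\<^sub>F n in sequentially. t - 1 / real (Suc n) \<le> of_int \<lfloor>real (Suc n) * t\<rfloor> / real (Suc n)"
  proof (intro always_eventually allI)
    fix n
    have "real (Suc n) * t - 1 \<le> of_int \<lfloor>real (Suc n) * t\<rfloor>" by linarith
    then have "(real (Suc n) * t - 1) / real (Suc n) \<le> of_int \<lfloor>real (Suc n) * t\<rfloor> / real (Suc n)"
      by (rule divide_right_mono) simp
    then show "t - 1 / real (Suc n) \<le> of_int \<lfloor>real (Suc n) * t\<rfloor> / real (Suc n)"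
      by (simp add: diff_divide_distrib del: of_nat_Suc)
  qed
  show "\<forall>\<^sub>F n in sequentially. of_int \<lfloor>real (Suc n) * t\<rfloor> / real (Suc n) \<le> t"
  proof (intro always_eventually allI)
    fix n
    have "of_int \<lfloor>real (Suc n) * t\<rfloor> \<le> real (Suc n) * t" by linarith
    then show "of_int \<lfloor>real (Suc n) * t\<rfloor> / real (Suc n) \<le> t"
      by (simp add: field_simps del: of_nat_Suc)
  qed
  have "(\<lambda>n. t - 1 / real (Suc n)) \<longlonglongrightarrow> t - 0"
    by (intro tendsto_diff tendsto_const) (use LIMSEQ_inverse_real_of_nat in \<open>simp add: inverse_eq_divide\<close>)
  then show "(\<lambda>n. t - 1 / real (Suc n)) \<longlonglongrightarrow> t" by simp
qed simp

lemma Ad_scaleR: "Ad g (t *\<^sub>R x) = t *\<^sub>R Ad g x"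
proof (rule LIMSEQ_unique)
  let ?r = "\<lambda>n. of_int \<lfloor>real (Suc n) * t\<rfloor> / real (Suc n)"
  show "(\<lambda>n. Ad g (?r n *\<^sub>R x)) \<longlonglongrightarrow> Ad g (t *\<^sub>R x)"
    by (intro tendsto_Ad tendsto_scaleR tendsto_const floor_approx)
  have "(\<lambda>n. ?r n *\<^sub>R Ad g x) \<longlonglongrightarrow> t *\<^sub>R Ad g x"
    by (intro tendsto_scaleR tendsto_const floor_approx)
  moreover have "Ad g (?r n *\<^sub>R x) = ?r n *\<^sub>R Ad g x" for n
    by (rule Ad_rat) simp
  ultimately show "(\<lambda>n. Ad g (?r n *\<^sub>R x)) \<longlonglongrightarrow> t *\<^sub>R Ad g x" by simp
qed

text \<open>The argument \<open>x / n\<close> is small of order \<open>1 / n\<close>, and the error allowed by \<open>near_zero\<close> is of smaller order.\<close>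

lemma trotter: "(\<lambda>n. real (Suc n) *\<^sub>R mu (x /\<^sub>R real (Suc n)) (y /\<^sub>R real (Suc n))) \<longlonglongrightarrow> x + y"
proof (rule LIMSEQ_I)
  fix r :: real assume "r > 0"
  define \<epsilon> where "\<epsilon> = r / 2 / (norm x + 1)"
  have "\<epsilon> > 0" using \<open>r > 0\<close> by (simp add: \<epsilon>_def add_nonneg_pos)
  from near_zero[OF this] obtain \<delta> where \<delta>: "\<delta> > 0"
    "\<And>x y. norm x < \<delta> \<Longrightarrow> norm y < \<delta> \<Longrightarrow> norm (mu x y - x - y) \<le> \<epsilon> * norm x" by blast
  obtain N :: nat where N: "(norm x + norm y + 1) / \<delta> < real N" using reals_Archimedean2 by blast
  show "\<exists>no. \<forall>n\<ge>no. norm (real (Suc n) *\<^sub>R mu (x /\<^sub>R real (Suc n)) (y /\<^sub>R real (Suc n)) - (x + y)) < r"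
  proof (intro exI allI impI)
    fix n assume "N \<le> n"
    let ?n = "real (Suc n)"
    have "norm x + norm y + 1 < \<delta> * ?n"
    proof -
      have "norm x + norm y + 1 < \<delta> * real N" using N \<delta>(1) by (simp add: field_simps)
      also have "\<dots> \<le> \<delta> * ?n" using \<open>N \<le> n\<close> \<delta>(1) by simp
      finally show ?thesis .
    qed
    then have "norm x < \<delta> * ?n" "norm y < \<delta> * ?n"
      using norm_ge_zero[of x] norm_ge_zero[of y] by linarith+
    then have "norm (x /\<^sub>R ?n) < \<delta>" "norm (y /\<^sub>R ?n) < \<delta>"
      by (simp_all add: divide_simps mult.commute del: of_nat_Suc)
    from \<delta>(2)[OF this] have "norm (mu (x /\<^sub>R ?n) (y /\<^sub>R ?n) - x /\<^sub>R ?n - y /\<^sub>R ?n) \<le> \<epsilon> * norm x / ?n"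
      by (simp add: divide_inverse mult_ac del: of_nat_Suc)
    then have "?n * norm (mu (x /\<^sub>R ?n) (y /\<^sub>R ?n) - x /\<^sub>R ?n - y /\<^sub>R ?n) \<le> \<epsilon> * norm x"
      by (simp add: field_simps del: of_nat_Suc)
    moreover have "?n *\<^sub>R mu (x /\<^sub>R ?n) (y /\<^sub>R ?n) - (x + y) = ?n *\<^sub>R (mu (x /\<^sub>R ?n) (y /\<^sub>R ?n) - x /\<^sub>R ?n - y /\<^sub>R ?n)"
      by (simp add: scaleR_diff_right del: of_nat_Suc)
    ultimately have "norm (?n *\<^sub>R mu (x /\<^sub>R ?n) (y /\<^sub>R ?n) - (x + y)) \<le> \<epsilon> * norm x" by (simp del: of_nat_Suc)
    also have "\<epsilon> * norm x < r"
    proof -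
      have p: "norm x + 1 > 0" by (simp add: add_nonneg_pos)
      have "\<epsilon> * norm x \<le> \<epsilon> * (norm x + 1)" using \<open>\<epsilon> > 0\<close> by simp
      also have "\<dots> = r / 2" unfolding \<epsilon>_def using p by (simp del: divide_divide_eq_left)
      finally show ?thesis using \<open>r > 0\<close> by simp
    qed
    finally show "norm (?n *\<^sub>R mu (x /\<^sub>R ?n) (y /\<^sub>R ?n) - (x + y)) < r" .
  qed
qed

text \<open>The automorphism \<open>Ad g\<close> is continuous and commutes with scaling, so it can be applied under the limit
  that expresses the sum through the product.\<close>

lemma Ad_add: "Ad g (x + y) = Ad g x + Ad g y"
proof (rule LIMSEQ_unique)
  let ?z = "\<lambda>n. real (Suc n) *\<^sub>R mu (x /\<^sub>R real (Suc n)) (y /\<^sub>R real (Suc n))"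
  show "(\<lambda>n. Ad g (?z n)) \<longlonglongrightarrow> Ad g (x + y)"
    by (intro tendsto_Ad tendsto_const trotter)
  have "Ad g (?z n) = real (Suc n) *\<^sub>R mu (Ad g x /\<^sub>R real (Suc n)) (Ad g y /\<^sub>R real (Suc n))" for n
    by (simp only: Ad_scaleR Ad_mu)
  then show "(\<lambda>n. Ad g (?z n)) \<longlonglongrightarrow> Ad g x + Ad g y"
    using trotter[of "Ad g x" "Ad g y"] by presburger
qed

lemma linear_Ad: "linear (Ad g)"
  by (rule linearI) (simp_all add: Ad_add Ad_scaleR)

lemma Ad_eq_iff_commute: "Ad x y = y \<longleftrightarrow> mu x y = mu y x"
proof
  assume "Ad x y = y"
  then have "mu (Ad x y) x = mu y x" by simp
  then show "mu x y = mu y x" by (simp add: Ad_def assoc)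
next
  assume "mu x y = mu y x"
  then show "Ad x y = y" by (simp add: Ad_def assoc)
qed

lemma commute_scaleR:
  assumes "mu x y = mu y x"
  shows "mu (s *\<^sub>R x) (t *\<^sub>R y) = mu (t *\<^sub>R y) (s *\<^sub>R x)"
proof -
  have "Ad x (t *\<^sub>R y) = t *\<^sub>R y" using assms by (simp add: Ad_scaleR Ad_eq_iff_commute)
  then have "mu (t *\<^sub>R y) x = mu x (t *\<^sub>R y)" by (simp add: Ad_eq_iff_commute)
  then have "Ad (t *\<^sub>R y) (s *\<^sub>R x) = s *\<^sub>R x" by (simp add: Ad_scaleR Ad_eq_iff_commute)
  then show ?thesis by (simp add: Ad_eq_iff_commute)
qed

lemma commute_multiple:
  assumes "mu x y = mu y x"
  shows "real n *\<^sub>R mu x y = mu (real n *\<^sub>R x) (real n *\<^sub>R y)"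
proof (induction n)
  case (Suc n)
  have c: "mu (real n *\<^sub>R y) x = mu x (real n *\<^sub>R y)"
    using commute_scaleR[OF assms, of 1 "real n"] by simp
  have "real (Suc n) *\<^sub>R mu x y = mu (mu (real n *\<^sub>R x) (real n *\<^sub>R y)) (mu x y)"
    by (simp only: multiple_Suc Suc)
  also have "\<dots> = mu (real n *\<^sub>R x) (mu (mu (real n *\<^sub>R y) x) y)" by (simp add: assoc)
  also have "\<dots> = mu (mu (real n *\<^sub>R x) x) (mu (real n *\<^sub>R y) y)" unfolding c by (simp add: assoc)
  finally show ?case by (simp only: multiple_Suc)
qed simp

text \<open>If \<open>x\<close> and \<open>y\<close> commute, so do their multiples, and the sequence converging to \<open>x + y\<close> is constant.\<close>

lemma mu_commuting:
  assumes "mu x y = mu y x"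
  shows "mu x y = x + y"
proof -
  have "real (Suc n) *\<^sub>R mu (x /\<^sub>R real (Suc n)) (y /\<^sub>R real (Suc n)) = mu x y" for n
    by (subst commute_multiple) (auto intro: commute_scaleR assms simp del: of_nat_Suc)
  then have "(\<lambda>n. mu x y) \<longlonglongrightarrow> x + y" using trotter[of x y] by presburger
  then show ?thesis by (simp add: LIMSEQ_const_iff)
qed

end

section \<open>Power series at nilpotent operators\<close>

text \<open>The value of the power series \<open>p\<close> at an operator \<open>B\<close> with \<open>B ^^ N = 0\<close>, for which the truncation at \<open>N\<close> is
  harmless and \<open>p \<mapsto> p(B)\<close> is multiplicative.\<close>

definition fps_op :: "nat \<Rightarrow> real fps \<Rightarrow> ('v::real_vector \<Rightarrow> 'v) \<Rightarrow> 'v \<Rightarrow> 'v" where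
  "fps_op N p B v = (\<Sum>i<N. fps_nth p i *\<^sub>R (B ^^ i) v)"

lemma linear_funpow: "linear B \<Longrightarrow> linear (B ^^ i)"
  for B :: "'v::real_vector \<Rightarrow> 'v"
proof (induction i)
  case 0
  then show ?case by (simp add: linear_id[unfolded id_def])
next
  case (Suc i)
  then show ?case using linear_compose[of "B ^^ i" B] by (simp only: funpow.simps)
qed

lemma linear_fps_op: "linear B \<Longrightarrow> linear (fps_op N p B)"
  unfolding fps_op_def
  by (intro linear_compose_sum linear_compose_scale_right linear_funpow ballI) auto

lemma fps_op_mult:
  assumes "linear B" and nil: "\<And>v. (B ^^ N) v = 0"
  shows "fps_op N (p * q) B v = fps_op N p B (fps_op N q B v)"
proof -
  have nil': "(B ^^ i) v = 0" if "i \<ge> N" for i v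
  proof -
    have "(B ^^ i) v = (B ^^ (N + (i - N))) v" using that by simp
    then show ?thesis by (simp only: funpow_add o_apply nil)
  qed
  let ?t = "\<lambda>i j. (fps_nth p i * fps_nth q j) *\<^sub>R (B ^^ (i + j)) v"
  have "fps_op N p B (fps_op N q B v) = (\<Sum>i<N. \<Sum>j<N. ?t i j)"
    unfolding fps_op_def
    by (simp add: linear_sum[OF linear_funpow[OF assms(1)]] linear_scale[OF linear_funpow[OF assms(1)]]
        scaleR_sum_right funpow_add)
  also have "\<dots> = (\<Sum>(i, j)\<in>{..<N} \<times> {..<N}. ?t i j)" by (simp add: sum.cartesian_product)
  also have "\<dots> = (\<Sum>(i, j)\<in>{(i, j). i + j < N}. ?t i j)"
    by (rule sum.mono_neutral_right) (auto, metis nil' not_le)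
  also have "\<dots> = (\<Sum>k<N. \<Sum>i\<le>k. ?t i (k - i))"
    by (rule sum.triangle_reindex)
  also have "\<dots> = fps_op N (p * q) B v"
    unfolding fps_op_def by (simp add: fps_mult_nth scaleR_sum_left atLeast0AtMost)
  finally show ?thesis ..
qed

lemma fps_op_add: "fps_op N (p + q) B v = fps_op N p B v + fps_op N q B v"
  by (simp add: fps_op_def scaleR_add_left sum.distrib)

lemma fps_op_const: "fps_op N (fps_const c * p) B v = c *\<^sub>R fps_op N p B v"
  by (simp add: fps_op_def scaleR_sum_right)

lemma fps_op_sum: "fps_op N (\<Sum>j\<in>J. p j) B v = (\<Sum>j\<in>J. fps_op N (p j) B v)"
  by (simp add: fps_op_def fps_sum_nth scaleR_sum_left sum.swap[of _ J])

lemma fps_op_1: assumes "\<And>v. (B ^^ N) v = 0" shows "fps_op N 1 B v = v"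
proof (cases N)
  case 0
  then show ?thesis using assms[of v] by (simp add: fps_op_def)
next
  case (Suc n)
  show ?thesis unfolding fps_op_def Suc
    by (subst sum.lessThan_Suc_shift) simp
qed

lemma fps_op_1_X:
  assumes "\<And>v. (B ^^ N) v = 0"
  shows "fps_op N (1 + fps_X) B v = v + B v"
proof -
  have "fps_op N fps_X B v = B v"
  proof (cases "N \<le> 1")
    case True
    then have "N = 0 \<or> N = 1" by auto
    then show ?thesis using assms[of v] assms[of "B v"] by (auto simp: fps_op_def)
  next
    case False
    have "fps_op N fps_X B v = (\<Sum>i<N. if i = 1 then (B ^^ i) v else 0)"
      unfolding fps_op_def fps_X_def by (rule sum.cong) auto
    then show ?thesis using False by simp
  qed
  then show ?thesis by (simp add: fps_op_add fps_op_1[OF assms])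
qed

text \<open>The powers of a unipotent operator are given by the binomial series, in a form that also makes sense
  for exponents that are not natural numbers.\<close>

lemma fps_op_funpow:
  assumes "linear B" and nil: "\<And>v. (B ^^ N) v = 0"
  shows "((\<lambda>v. v + B v) ^^ n) v = fps_op N (fps_binomial (real n)) B v"
proof (induction n arbitrary: v)
  case 0
  then show ?case by (simp add: fps_op_1[OF nil])
next
  case (Suc n)
  have "fps_binomial (real (Suc n)) = (1 + fps_X) * fps_binomial (real n)"
    using fps_binomial_add_mult[of 1 "real n"] by (simp add: fps_binomial_1)
  then show ?case using Suc
    by (simp add: fps_op_mult[OF assms] fps_op_1_X[OF nil])
qed

lemma gchoose_poly: "\<exists>p::real poly. \<forall>y. poly p y = (a * y) gchoose i"
proof
  show "\<forall>y. poly (Polynomial.smult (1 / fact i) (\<Prod>k<i. [:- of_nat k, a:])) y = (a * y) gchoose i"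
    by (simp add: gbinomial_prod_rev poly_prod atLeast0LessThan algebra_simps)
qed

lemma gchoose_combination_poly:
  "\<exists>p::real poly. \<forall>y. poly p y = (\<Sum>i<N. ((a * y) gchoose i) * c i)"
proof -
  obtain p where p: "\<And>i y. poly (p i) y = (a * y) gchoose i"
    using gchoose_poly[of a] by metis
  show ?thesis
    by (rule exI[of _ "\<Sum>i<N. Polynomial.smult (c i) (p i)"]) (simp add: poly_sum p mult.commute)
qed

text \<open>Both sides of the hypothesis are polynomials in \<open>m\<close>, so the identity persists when \<open>m\<close> is replaced by the
  fraction \<open>j / n\<close>.\<close>

lemma gchoose_combinations_eq:
  fixes c d :: "nat \<Rightarrow> real"
  assumes "n > 0"
    and eq: "\<And>m. (\<Sum>i<N. (real (n * m) gchoose i) * c i) = (\<Sum>i<N. (real m gchoose i) * d i)"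
  shows "(\<Sum>i<N. (real j gchoose i) * c i) = (\<Sum>i<N. ((real j / real n) gchoose i) * d i)"
proof -
  obtain p where p: "\<And>y. poly p y = (\<Sum>i<N. ((1 * y) gchoose i) * c i)"
    using gchoose_combination_poly[where N = N and a = 1 and c = c] by metis
  obtain q where q: "\<And>y. poly q y = (\<Sum>i<N. ((1 / real n * y) gchoose i) * d i)"
    using gchoose_combination_poly[where N = N and a = "1 / real n" and c = d] by metis
  have "p - q = 0"
  proof (rule ccontr)
    assume "p - q \<noteq> 0"
    then have "finite {y. poly (p - q) y = 0}" by (rule poly_roots_finite)
    moreover have "range (\<lambda>m. real (n * m)) \<subseteq> {y. poly (p - q) y = 0}"
      using eq \<open>n > 0\<close> by (auto simp: p q)
    ultimately have "finite (range (\<lambda>m. real (n * m)))" by (rule finite_subset[rotated])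
    moreover have "inj (\<lambda>m. real (n * m))" using \<open>n > 0\<close> by (auto intro!: injI)
    ultimately show False using finite_imageD infinite_UNIV_nat by blast
  qed
  then have "poly p (real j) = poly q (real j)" by simp
  then show ?thesis by (simp add: p q)
qed

section \<open>Nilpotent groups: the differential of the logarithm\<close>

text \<open>The sets \<open>K i\<close> play the role of the logarithms of the lower central series. They are neither assumed
  to be closed nor to be subspaces.\<close>

locale nilpotent_exp_group = exp_group +
  fixes K :: "nat \<Rightarrow> 'a set" and N :: nat
  assumes K_0: "K 0 = UNIV" and K_N: "K N = {0}"
    and K_mu: "x \<in> K i \<Longrightarrow> y \<in> K i \<Longrightarrow> mu x y \<in> K i"
    and K_zero: "0 \<in> K i"
    and K_commutator: "y \<in> K i \<Longrightarrow> mu (mu (mu x y) (- x)) (- y) \<in> K (Suc i)"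
begin

text \<open>The largest set of lines in the closure of \<open>K i\<close>. It replaces the terms of the lower central series of the Lie
  algebra: invariance under scaling is built in, and \<open>Ad g - 1\<close> raises the index because \<open>Ad g\<close> is linear and the
  commutators of \<open>g\<close> with elements of \<open>K i\<close> lie in \<open>K (Suc i)\<close>.\<close>

definition Kspace :: "nat \<Rightarrow> 'a set" where
  "Kspace i = {x. \<forall>t. t *\<^sub>R x \<in> closure (K i)}"

lemma closure_K_mu: "x \<in> closure (K i) \<Longrightarrow> y \<in> closure (K i) \<Longrightarrow> mu x y \<in> closure (K i)"
proof -
  assume "x \<in> closure (K i)" "y \<in> closure (K i)"
  then obtain f h where "\<And>n. f n \<in> K i" "f \<longlonglongrightarrow> x" "\<And>n. h n \<in> K i" "h \<longlonglongrightarrow> y"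
    by (auto simp: closure_sequential)
  then show ?thesis unfolding closure_sequential
    by (intro exI[of _ "\<lambda>n. mu (f n) (h n)"]) (auto intro: K_mu tendsto_mu)
qed

lemma closure_K_multiple: "x \<in> closure (K i) \<Longrightarrow> real n *\<^sub>R x \<in> closure (K i)"
proof (induction n)
  case 0
  then show ?case using K_zero closure_subset by auto
next
  case (Suc n)
  then show ?case by (simp only: multiple_Suc closure_K_mu)
qed

lemma closure_K_commutator:
  assumes "y \<in> closure (K i)"
  shows "mu (Ad x y) (- y) \<in> closure (K (Suc i))"
proof -
  obtain f where "\<And>n. f n \<in> K i" "f \<longlonglongrightarrow> y"
    using assms by (auto simp: closure_sequential)
  then show ?thesis unfolding closure_sequential
    by (intro exI[of _ "\<lambda>n. mu (Ad x (f n)) (- f n)"])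
      (auto intro!: tendsto_mu tendsto_Ad tendsto_minus tendsto_const simp: Ad_def K_commutator)
qed

lemma Kspace_0: "Kspace 0 = UNIV"
  by (simp add: Kspace_def K_0)

lemma Kspace_N: "Kspace N = {0}"
proof -
  have "x = 0" if "\<forall>t. t *\<^sub>R x = 0" for x :: 'a using that[rule_format, of 1] by simp
  then show ?thesis by (auto simp: Kspace_def K_N)
qed

text \<open>For \<open>y = t x / n\<close> the commutator of \<open>g\<close> and \<open>y\<close> is close to \<open>Ad g y - y\<close>, and its \<open>n\<close>-th power
  converges to \<open>t (Ad g x - x)\<close>.\<close>

lemma Ad_diff_Kspace:
  assumes "x \<in> Kspace i"
  shows "Ad g x - x \<in> Kspace (Suc i)"
  unfolding Kspace_def
proof (intro CollectI allI)
  fix t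
  let ?z = "\<lambda>n. mu ((t *\<^sub>R Ad g x) /\<^sub>R real (Suc n)) (- (t *\<^sub>R x) /\<^sub>R real (Suc n))"
  have "real (Suc n) *\<^sub>R ?z n \<in> closure (K (Suc i))" for n
  proof -
    have "(t / real (Suc n)) *\<^sub>R x \<in> closure (K i)" using assms by (simp add: Kspace_def)
    then have "mu (Ad g ((t / real (Suc n)) *\<^sub>R x)) (- ((t / real (Suc n)) *\<^sub>R x)) \<in> closure (K (Suc i))"
      by (rule closure_K_commutator)
    then have "?z n \<in> closure (K (Suc i))"
      by (simp add: Ad_scaleR divide_inverse mult.commute del: of_nat_Suc)
    then show ?thesis by (rule closure_K_multiple)
  qed
  moreover have "(\<lambda>n. real (Suc n) *\<^sub>R ?z n) \<longlonglongrightarrow> t *\<^sub>R Ad g x + - (t *\<^sub>R x)"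
    by (rule trotter)
  ultimately have "t *\<^sub>R Ad g x + - (t *\<^sub>R x) \<in> closure (K (Suc i))"
    by (rule closed_sequentially[OF closed_closure])
  then show "t *\<^sub>R (Ad g x - x) \<in> closure (K (Suc i))" by (simp add: scaleR_diff_right)
qed

definition adm :: "'a \<Rightarrow> 'a \<Rightarrow> 'a" where
  "adm g v = Ad g v - v"

lemma linear_adm: "linear (adm g)"
  unfolding adm_def by (intro linear_compose_sub linear_Ad) (simp add: linear_id[unfolded id_def])

lemma adm_nilpotent: "(adm g ^^ N) v = 0"
proof -
  have "(adm g ^^ i) v \<in> Kspace i" for i
    by (induction i) (auto simp: Kspace_0 adm_def Ad_diff_Kspace)
  then show ?thesis using Kspace_N by blast
qed

lemma Ad_multiple: "Ad (real n *\<^sub>R x) v = fps_op N (fps_binomial (real n)) (adm x) v"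
proof -
  have "Ad (real n *\<^sub>R x) v = ((\<lambda>v. v + adm x v) ^^ n) v"
  proof (induction n arbitrary: v)
    case (Suc n)
    then show ?case by (simp only: multiple_Suc Ad_Ad funpow_Suc_right o_apply) (simp add: adm_def)
  qed simp
  then show ?thesis by (simp add: fps_op_funpow[OF linear_adm adm_nilpotent])
qed

text \<open>The operator \<open>Ad (m x)\<close> is a polynomial in \<open>m\<close>, both in terms of \<open>x\<close> and in terms of \<open>x / n\<close>, and the two
  polynomials agree at the multiples of \<open>n\<close>.\<close>

lemma Ad_fraction:
  assumes "n > 0"
  shows "Ad ((real j / real n) *\<^sub>R x) v = fps_op N (fps_binomial (real j / real n)) (adm x) v"
proof (rule euclidean_eqI)
  fix b :: 'a assume "b \<in> Basis"
  have l: "Ad (real m *\<^sub>R (x /\<^sub>R real n)) v \<bullet> b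
      = (\<Sum>i<N. (real m gchoose i) * ((adm (x /\<^sub>R real n) ^^ i) v \<bullet> b))" for m
    unfolding Ad_multiple fps_op_def by (simp add: inner_sum_left)
  have r: "Ad (real m *\<^sub>R x) v \<bullet> b = (\<Sum>i<N. (real m gchoose i) * ((adm x ^^ i) v \<bullet> b))" for m
    unfolding Ad_multiple fps_op_def by (simp add: inner_sum_left)
  have "(\<Sum>i<N. (real j gchoose i) * ((adm (x /\<^sub>R real n) ^^ i) v \<bullet> b))
      = (\<Sum>i<N. ((real j / real n) gchoose i) * ((adm x ^^ i) v \<bullet> b))"
  proof (rule gchoose_combinations_eq[OF assms])
    fix m
    have "real (n * m) *\<^sub>R (x /\<^sub>R real n) = real m *\<^sub>R x" using assms by simp
    then show "(\<Sum>i<N. (real (n * m) gchoose i) * ((adm (x /\<^sub>R real n) ^^ i) v \<bullet> b))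
        = (\<Sum>i<N. (real m gchoose i) * ((adm x ^^ i) v \<bullet> b))"
      by (simp only: l[symmetric] r[symmetric])
  qed
  then have "Ad (real j *\<^sub>R (x /\<^sub>R real n)) v \<bullet> b
      = fps_op N (fps_binomial (real j / real n)) (adm x) v \<bullet> b"
    unfolding l fps_op_def by (simp add: inner_sum_left)
  then show "Ad ((real j / real n) *\<^sub>R x) v \<bullet> b
      = fps_op N (fps_binomial (real j / real n)) (adm x) v \<bullet> b"
    by (simp add: divide_inverse)
qed

text \<open>The series \<open>n ((1 + X)\<^bsup>1/n\<^esup> - 1) / X\<close>. For large \<open>n\<close> its coefficients approach \<open>logcoeff\<close>, those of
  \<open>log (1 + X) / X\<close>.\<close>

definition logser :: "nat \<Rightarrow> real fps" where
  "logser n = fps_shift 1 (fps_const (real n) * (fps_binomial (1 / real n) - 1))"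

definition logcoeff :: "nat \<Rightarrow> real" where
  "logcoeff i = (\<Prod>j=1..i. - real j) / fact (Suc i)"

text \<open>With \<open>c = (1 + X)\<^bsup>1/n\<^esup>\<close> this is the geometric sum \<open>(c - 1) (1 + c + \<dots> + c\<^bsup>n-1\<^esup>) = X\<close>.\<close>

lemma logser_mult:
  assumes "n > 0"
  shows "logser n * (fps_const (1 / real n) * (\<Sum>j<n. fps_binomial (real j / real n))) = 1"
proof -
  let ?c = "fps_binomial (1 / real n) :: real fps"
  have X: "fps_X * logser n = fps_const (real n) * (?c - 1)"
    unfolding logser_def by (intro fps_ext) simp
  have pw: "fps_binomial (real j / real n) = ?c ^ j" for j
    by (simp add: fps_binomial_power)
  have "fps_X * (logser n * (fps_const (1 / real n) * (\<Sum>j<n. fps_binomial (real j / real n))))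
      = (fps_const (real n) * fps_const (1 / real n)) * ((?c - 1) * (\<Sum>j<n. ?c ^ j))"
    by (simp only: X pw mult.assoc[symmetric]) (simp only: mult_ac)
  also have "fps_const (real n) * fps_const (1 / real n) = 1" using assms by simp
  also have "(?c - 1) * (\<Sum>j<n. ?c ^ j) = ?c ^ n - 1" by (simp add: power_diff_1_eq)
  also have "?c ^ n = 1 + fps_X" using assms by (simp add: fps_binomial_power fps_binomial_1)
  finally show ?thesis by simp
qed

lemma logser_tendsto: "(\<lambda>n. fps_nth (logser (Suc n)) i) \<longlonglongrightarrow> logcoeff i"
proof -
  have "fps_nth (logser (Suc n)) i = (\<Prod>j=1..i. 1 / real (Suc n) - real j) / fact (Suc i)" for n
  proof -
    have "fps_nth (logser (Suc n)) i = real (Suc n) * ((1 / real (Suc n)) gchoose Suc i)"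
      by (simp add: logser_def del: of_nat_Suc)
    also have "\<dots> = (\<Prod>j=1..i. 1 / real (Suc n) - real j) / fact (Suc i)"
      unfolding gbinomial_Suc
      by (subst prod.atLeast_Suc_atMost) (simp_all del: of_nat_Suc)
    finally show ?thesis .
  qed
  moreover have "(\<lambda>n. (\<Prod>j=1..i. 1 / real (Suc n) - real j) / fact (Suc i)) \<longlonglongrightarrow> (\<Prod>j=1..i. 0 - real j) / fact (Suc i)"
    by (intro tendsto_divide tendsto_prod tendsto_diff tendsto_const)
      (use LIMSEQ_inverse_real_of_nat in \<open>simp_all add: inverse_eq_divide\<close>)
  ultimately show ?thesis by (simp add: logcoeff_def)
qed

text \<open>The inverse of the operator \<open>(exp B - 1) / B\<close> with \<open>B = log (Ad x)\<close>, which is the differential of the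
  exponential map at \<open>x\<close>, translated back to the identity.\<close>

definition Log_op :: "'a \<Rightarrow> 'a \<Rightarrow> 'a" where
  "Log_op x v = (\<Sum>i<N. logcoeff i *\<^sub>R (adm x ^^ i) v)"

lemma adm_power_bound: "\<exists>C>0. \<forall>i<N. \<forall>v. norm ((adm x ^^ i) v) \<le> C * norm v"
proof -
  have "\<exists>C. \<forall>v. norm ((adm x ^^ i) v) \<le> C * norm v" for i
    using linear_bounded[OF linear_funpow[OF linear_adm]] by blast
  then obtain C where C: "\<And>i v. norm ((adm x ^^ i) v) \<le> C i * norm v" by metis
  have "C i \<le> 1 + (\<Sum>i<N. \<bar>C i\<bar>)" if "i < N" for i
  proof -
    have "\<bar>C i\<bar> \<le> (\<Sum>i<N. \<bar>C i\<bar>)" using that by (intro member_le_sum) auto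
    then show ?thesis by linarith
  qed
  then have "norm ((adm x ^^ i) v) \<le> (1 + (\<Sum>i<N. \<bar>C i\<bar>)) * norm v" if "i < N" for i v
    using C[of i v] that by (meson mult_right_mono norm_ge_zero order_trans)
  moreover have "1 + (\<Sum>i<N. \<bar>C i\<bar>) > 0" by (simp add: add_pos_nonneg sum_nonneg)
  ultimately show ?thesis by blast
qed

lemma Ad_bound: "\<exists>C\<ge>1. \<forall>t\<in>{0..1}. \<forall>v. norm (Ad (t *\<^sub>R x) v) \<le> C * norm v"
proof -
  have "continuous_on ({0..1} \<times> sphere 0 1) (\<lambda>p. Ad (fst p *\<^sub>R x) (snd p))"
    unfolding continuous_on_def
    by (intro ballI tendsto_Ad tendsto_scaleR tendsto_const tendsto_fst tendsto_snd tendsto_ident_at)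
  then have "compact ((\<lambda>p. Ad (fst p *\<^sub>R x) (snd p)) ` ({0..1::real} \<times> sphere 0 1))"
    by (rule compact_continuous_image) (simp add: compact_Times)
  then have "bounded ((\<lambda>p. Ad (fst p *\<^sub>R x) (snd p)) ` ({0..1::real} \<times> sphere 0 1))"
    by (rule compact_imp_bounded)
  then obtain C where C: "\<And>t v. t \<in> {0..1} \<Longrightarrow> norm v = 1 \<Longrightarrow> norm (Ad (t *\<^sub>R x) v) \<le> C"
    by (fastforce simp: bounded_iff)
  have "norm (Ad (t *\<^sub>R x) v) \<le> max 1 C * norm v" if "t \<in> {0..1}" for t v
  proof (cases "v = 0")
    case False
    have "Ad (t *\<^sub>R x) v = norm v *\<^sub>R Ad (t *\<^sub>R x) (v /\<^sub>R norm v)"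
      using False by (simp flip: Ad_scaleR)
    then have "norm (Ad (t *\<^sub>R x) v) = norm v * norm (Ad (t *\<^sub>R x) (v /\<^sub>R norm v))" by simp
    also have "\<dots> \<le> norm v * max 1 C"
      by (rule mult_left_mono) (use C[OF that, of "v /\<^sub>R norm v"] False in auto)
    finally show ?thesis by (simp add: mult.commute)
  qed simp
  then show ?thesis by (intro exI[of _ "max 1 C"]) auto
qed

lemma small_product:
  assumes "\<delta> > 0" shows "\<exists>\<eta>>0. \<forall>x y. norm x < \<eta> \<longrightarrow> norm y < \<eta> \<longrightarrow> norm (mu x y) < \<delta>"
proof -
  obtain \<delta>1 where d1: "\<delta>1 > 0" "\<And>x y. norm x < \<delta>1 \<Longrightarrow> norm y < \<delta>1 \<Longrightarrow> norm (mu x y - x - y) \<le> 1 * norm x"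
    using near_zero[of 1] by force
  have "norm (mu x y) < \<delta>" if "norm x < min \<delta>1 (\<delta> / 3)" "norm y < min \<delta>1 (\<delta> / 3)" for x y
  proof -
    have "norm (mu x y - x - y) \<le> 1 * norm x" using that by (intro d1(2)) auto
    moreover have "norm (mu x y) \<le> norm (mu x y - x - y) + norm x + norm y"
      by norm
    ultimately show ?thesis using that by simp
  qed
  then show ?thesis using d1(1) assms by (intro exI[of _ "min \<delta>1 (\<delta> / 3)"]) auto
qed

text \<open>This is \<open>a\<^bsup>n+1\<^esup> b\<^bsup>-(n+1)\<^esup> = a\<^bsup>n\<^esup> b\<^bsup>-n\<^esup> \<cdot> b\<^bsup>n\<^esup> (a b\<^bsup>-1\<^esup>) b\<^bsup>-n\<^esup>\<close>; iterated, it writes \<open>a\<^bsup>n\<^esup> b\<^bsup>-n\<^esup>\<close> as a product of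
  conjugates of \<open>a b\<^bsup>-1\<^esup>\<close>.\<close>

lemma multiple_quotient:
  "mu (real (Suc n) *\<^sub>R a) (- (real (Suc n) *\<^sub>R b)) =
   mu (mu (real n *\<^sub>R a) (- (real n *\<^sub>R b))) (Ad (real n *\<^sub>R b) (mu a (- b)))"
  unfolding multiple_Suc by (simp add: Ad_def assoc minus_mu)

lemma product_estimate:
  assumes est: "\<And>x y. norm x < \<delta> \<Longrightarrow> norm y < \<delta> \<Longrightarrow> norm (mu x y - x - y) \<le> \<epsilon> * norm y"
    and q: "q 0 = 0" "\<And>j. j < n \<Longrightarrow> q (Suc j) = mu (q j) (u j)"
    and u: "\<And>j. j < n \<Longrightarrow> norm (u j) \<le> r" and "r < \<delta>" "(1 + \<epsilon>) * (real n * r) < \<delta>"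
    and "\<epsilon> > 0" "r \<ge> 0" "j \<le> n"
  shows "norm (q j - (\<Sum>i<j. u i)) \<le> \<epsilon> * (real j * r)"
  using \<open>j \<le> n\<close>
proof (induction j)
  case 0
  then show ?case by (simp add: q)
next
  case (Suc j)
  have IH: "norm (q j - (\<Sum>i<j. u i)) \<le> \<epsilon> * (real j * r)" using Suc by simp
  have "norm (\<Sum>i<j. u i) \<le> real j * r"
    using sum_norm_bound[of "{..<j}" u r] u Suc.prems by auto
  then have "norm (q j) \<le> (1 + \<epsilon>) * (real j * r)"
    using IH norm_triangle_sub[of "q j" "\<Sum>i<j. u i"] by (simp add: algebra_simps)
  also have "\<dots> \<le> (1 + \<epsilon>) * (real n * r)"
    using Suc.prems \<open>\<epsilon> > 0\<close> \<open>r \<ge> 0\<close> by (intro mult_left_mono mult_right_mono) auto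
  finally have qj: "norm (q j) < \<delta>" using assms(6) by simp
  have "norm (u j) < \<delta>" using u[of j] Suc.prems \<open>r < \<delta>\<close> by simp
  from est[OF qj this] have "norm (q (Suc j) - q j - u j) \<le> \<epsilon> * norm (u j)"
    using q Suc.prems by simp
  also have "\<dots> \<le> \<epsilon> * r" using u[of j] Suc.prems \<open>\<epsilon> > 0\<close> by simp
  finally have "norm (q (Suc j) - q j - u j) \<le> \<epsilon> * r" .
  moreover have eq: "q (Suc j) - (\<Sum>i<Suc j. u i) = (q (Suc j) - q j - u j) + (q j - (\<Sum>i<j. u i))" by simp
  have "norm (q (Suc j) - (\<Sum>i<Suc j. u i)) \<le> norm (q (Suc j) - q j - u j) + norm (q j - (\<Sum>i<j. u i))"
    unfolding eq by (rule norm_triangle_ineq)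
  ultimately have "norm (q (Suc j) - (\<Sum>i<Suc j. u i)) \<le> \<epsilon> * r + \<epsilon> * (real j * r)"
    using IH by linarith
  then show ?case by (simp add: algebra_simps)
qed

lemma logser_op_average:
  assumes "n > 0"
  shows "fps_op N (logser n) (adm x) (\<Sum>j<n. Ad ((real j / real n) *\<^sub>R x) (v /\<^sub>R real n)) = v"
proof -
  have "(\<Sum>j<n. Ad ((real j / real n) *\<^sub>R x) (v /\<^sub>R real n))
     = fps_op N (fps_const (1 / real n) * (\<Sum>j<n. fps_binomial (real j / real n))) (adm x) v"
    unfolding fps_op_const fps_op_sum
    by (simp add: Ad_fraction[OF assms, symmetric] Ad_scaleR scaleR_sum_right inverse_eq_divide)
  then show ?thesis
    by (simp only: fps_op_mult[OF linear_adm adm_nilpotent, symmetric] logser_mult[OF assms] fps_op_1[OF adm_nilpotent])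
qed

text \<open>With \<open>a = (x + v) / n\<close> and \<open>b = x / n\<close>, the quotient of \<open>x + v\<close> and \<open>x\<close> in the group is \<open>a\<^bsup>n\<^esup> b\<^bsup>-n\<^esup>\<close>, a product
  of \<open>n\<close> conjugates \<open>Ad (j x / n) (a b\<^bsup>-1\<^esup>)\<close>. Each factor is small, so the product is nearly the sum, and \<open>a b\<^bsup>-1\<^esup>\<close> is
  nearly \<open>v / n\<close>. So the quotient is nearly the average of the vectors \<open>Ad (j x / n) v\<close>, which
  the operator \<open>logser n\<close> inverts exactly.\<close>

lemma dexp_estimate:
  assumes "\<epsilon> > 0"
  shows "\<exists>\<delta>>0. \<forall>v. norm v < \<delta> \<longrightarrow> norm (Log_op x (mu (x + v) (- x)) - v) \<le> \<epsilon> * norm v"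
proof -
  obtain C where C: "C \<ge> 1" "\<And>t v. t \<in> {0..1} \<Longrightarrow> norm (Ad (t *\<^sub>R x) v) \<le> C * norm v"
    using Ad_bound[of x] by blast
  obtain D where D: "D > 0" "\<And>i v. i < N \<Longrightarrow> norm ((adm x ^^ i) v) \<le> D * norm v"
    using adm_power_bound[of x] by blast
  have op_bound: "norm (\<Sum>i<N. c i *\<^sub>R (adm x ^^ i) v) \<le> (\<Sum>i<N. \<bar>c i\<bar>) * (D * norm v)" for c v
  proof -
    have "norm (\<Sum>i<N. c i *\<^sub>R (adm x ^^ i) v) \<le> (\<Sum>i<N. \<bar>c i\<bar> * (D * norm v))"
      by (rule sum_norm_le) (auto intro!: mult_left_mono D(2))
    then show ?thesis by (simp add: sum_distrib_right)
  qed
  define L where "L = 1 + (\<Sum>i<N. \<bar>logcoeff i\<bar>)"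
  \<comment> \<open>the two summands of the denominator absorb the errors from replacing the quotient by the average
      and from replacing \<open>logser n\<close> by its limit\<close>
  define \<epsilon>1 where "\<epsilon>1 = min (1 / 2) (\<epsilon> / (4 * C * D * L + 4 * C * D))"
  have "L \<ge> 1" by (simp add: L_def sum_nonneg)
  have den: "4 * C * D * L + 4 * C * D > 0" using C(1) D(1) \<open>L \<ge> 1\<close> by (intro add_pos_pos mult_pos_pos) auto
  have e1: "\<epsilon>1 > 0" "\<epsilon>1 \<le> 1 / 2" using \<open>\<epsilon> > 0\<close> den unfolding \<epsilon>1_def by (simp_all only: min.cobounded1 min_less_iff_conj) simp_all
  have "\<epsilon>1 \<le> \<epsilon> / (4 * C * D * L + 4 * C * D)" by (simp add: \<epsilon>1_def)
  then have e1': "\<epsilon>1 * (4 * C * D * L + 4 * C * D) \<le> \<epsilon>" using den by (simp add: pos_le_divide_eq)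
  obtain \<delta>1 where d1: "\<delta>1 > 0"
    "\<And>x y. norm x < \<delta>1 \<Longrightarrow> norm y < \<delta>1 \<Longrightarrow> norm (mu x y - x - y) \<le> \<epsilon>1 * norm x"
    "\<And>x y. norm x < \<delta>1 \<Longrightarrow> norm y < \<delta>1 \<Longrightarrow> norm (mu x y - x - y) \<le> \<epsilon>1 * norm y"
    using near_zero[OF e1(1)] by blast
  obtain \<delta>2 where d2: "\<delta>2 > 0" "\<And>x y. norm x < \<delta>2 \<Longrightarrow> norm y < \<delta>2 \<Longrightarrow> norm (mu x y) < \<delta>1"
    using small_product[OF d1(1)] by blast
  define \<delta> where "\<delta> = min 1 (\<delta>1 / (4 * C))"
  have "\<delta> > 0" using d1(1) C(1) by (simp add: \<delta>_def)
  have "(\<lambda>n. \<Sum>i<N. \<bar>fps_nth (logser (Suc n)) i - logcoeff i\<bar>) \<longlonglongrightarrow> (\<Sum>i<N. \<bar>logcoeff i - logcoeff i\<bar>)"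
    by (intro tendsto_sum tendsto_rabs tendsto_diff tendsto_const logser_tendsto)
  then have "(\<lambda>n. \<Sum>i<N. \<bar>fps_nth (logser (Suc n)) i - logcoeff i\<bar>) \<longlonglongrightarrow> 0" by simp
  from LIMSEQ_D[OF this e1(1)] obtain n0 where n0:
    "\<And>n. n \<ge> n0 \<Longrightarrow> (\<Sum>i<N. \<bar>fps_nth (logser (Suc n)) i - logcoeff i\<bar>) < \<epsilon>1"
    by (auto simp: sum_nonneg)
  obtain n1 :: nat where n1: "(norm x + 1) / min \<delta>1 \<delta>2 < real n1" using reals_Archimedean2 by blast
  \<comment> \<open>\<open>n0\<close> makes the coefficients of \<open>logser n\<close> close to their limits, and \<open>n1\<close> makes \<open>x / n\<close> small\<close>
  define n where "n = Suc (max n0 n1)"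
  have "n > 0" by (simp add: n_def)
  have coeff: "(\<Sum>i<N. \<bar>fps_nth (logser n) i - logcoeff i\<bar>) < \<epsilon>1"
    unfolding n_def by (rule n0) simp
  have coeff': "(\<Sum>i<N. \<bar>fps_nth (logser n) i\<bar>) \<le> L"
  proof -
    have "(\<Sum>i<N. \<bar>fps_nth (logser n) i\<bar>) \<le> (\<Sum>i<N. \<bar>fps_nth (logser n) i - logcoeff i\<bar> + \<bar>logcoeff i\<bar>)"
      by (rule sum_mono) linarith
    then show ?thesis using coeff e1(2) by (simp add: L_def sum.distrib)
  qed
  have small: "norm y / real n < min \<delta>1 \<delta>2" if "norm y \<le> norm x + 1" for y :: 'a
  proof -
    have "(norm x + 1) / min \<delta>1 \<delta>2 < real n" using n1 by (simp add: n_def max_def)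
    then have "norm x + 1 < real n * min \<delta>1 \<delta>2" using d1(1) d2(1) by (simp only: pos_divide_less_eq min_less_iff_conj simp_thms)
    then show ?thesis using that \<open>n > 0\<close> by (simp only: pos_divide_less_eq of_nat_0_less_iff mult.commute)
  qed
  show ?thesis
  proof (intro exI conjI allI impI)
    show "\<delta> > 0" by fact
    fix v :: 'a assume v: "norm v < \<delta>"
    then have "norm v < 1" "norm v < \<delta>1 / (4 * C)" by (auto simp: \<delta>_def)
    then have v': "4 * C * norm v < \<delta>1" using C(1) by (simp add: field_simps)
    let ?a = "(x + v) /\<^sub>R real n" and ?b = "x /\<^sub>R real n"
    define w where "w = mu ?a (- ?b)"
    have na: "norm ?a < min \<delta>1 \<delta>2"
      using small[of "x + v"] norm_triangle_ineq[of x v] \<open>norm v < 1\<close> by (simp add: divide_inverse mult.commute)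
    have nb: "norm ?b < min \<delta>1 \<delta>2"
      using small[of x] by (simp add: divide_inverse mult.commute)
    have "norm w < \<delta>1" unfolding w_def using na nb by (intro d2(2)) auto
    moreover have "mu w ?b = ?a" by (simp add: w_def assoc)
    ultimately have "norm (?a - w - ?b) \<le> \<epsilon>1 * norm w" using d1(2)[of w ?b] nb by simp
    moreover have "?a - w - ?b = v /\<^sub>R real n - w" by (simp add: scaleR_add_right)
    ultimately have wv: "norm (v /\<^sub>R real n - w) \<le> \<epsilon>1 * norm w" by simp
    have "\<epsilon>1 * norm w \<le> 1 / 2 * norm w" using e1(2) by (intro mult_right_mono) auto
    then have "norm w \<le> norm (v /\<^sub>R real n) + 1 / 2 * norm w"
      using wv norm_triangle_sub[of w "v /\<^sub>R real n"] unfolding norm_minus_commute[of w] by linarith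
    moreover have "norm (v /\<^sub>R real n) = norm v / real n" by (simp add: divide_inverse_commute)
    ultimately have "norm w \<le> norm v / real n + 1 / 2 * norm w" by (simp only:)
    then have "norm w \<le> 2 * (norm v / real n)" by linarith
    then have w_le: "norm w \<le> 2 * norm v / real n" by (simp only: times_divide_eq_right)
    have wv': "norm (w - v /\<^sub>R real n) \<le> \<epsilon>1 * (2 * norm v / real n)"
      using wv mult_left_mono[OF w_le less_imp_le[OF e1(1)]] unfolding norm_minus_commute[of w] by linarith
    let ?u = "\<lambda>j. Ad ((real j / real n) *\<^sub>R x) w"
    let ?q = "\<lambda>j. mu (real j *\<^sub>R ?a) (- (real j *\<^sub>R ?b))"
    let ?r = "C * (2 * norm v / real n)"
    have tj: "real j / real n \<in> {0..1}" if "j < n" for j using that by auto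
    have est: "norm (?q n - (\<Sum>i<n. ?u i)) \<le> \<epsilon>1 * (real n * ?r)"
    proof (rule product_estimate[where \<delta> = \<delta>1 and n = n and u = ?u and q = ?q])
      show "?q (Suc j) = mu (?q j) (?u j)" for j
        using multiple_quotient[of j ?a ?b] by (simp only: scaleR_scaleR divide_inverse w_def)
      show "norm (?u j) \<le> ?r" if "j < n" for j
        using C(2)[OF tj[OF that], of w] mult_left_mono[OF w_le, of C] C(1) by linarith
      have "real n * ?r = 2 * C * norm v" using \<open>n > 0\<close> by simp
      moreover have "(1 + \<epsilon>1) * (2 * C * norm v) \<le> 2 * (2 * C * norm v)"
        using e1 C(1) by (intro mult_right_mono) auto
      moreover have "2 * (2 * C * norm v) < \<delta>1" using v' by linarith
      ultimately show "(1 + \<epsilon>1) * (real n * ?r) < \<delta>1" by (simp only:)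
      have "?r \<le> 2 * C * norm v"
        using \<open>n > 0\<close> C(1) by (simp add: divide_le_eq mult_le_cancel_left1)
      moreover have "0 \<le> 2 * C * norm v" using C(1) by simp
      ultimately show "?r < \<delta>1" using v' by linarith
      show "?r \<ge> 0" using C(1) by simp
    qed (use d1(3) e1 in auto)
    let ?avg = "\<Sum>j<n. Ad ((real j / real n) *\<^sub>R x) (v /\<^sub>R real n)"
    have "norm ((\<Sum>i<n. ?u i) - ?avg) \<le> (\<Sum>i<n. C * (\<epsilon>1 * (2 * norm v / real n)))"
      unfolding sum_subtractf[symmetric]
    proof (rule sum_norm_le)
      fix j assume "j \<in> {..<n}"
      then have "norm (Ad ((real j / real n) *\<^sub>R x) (w - v /\<^sub>R real n)) \<le> C * norm (w - v /\<^sub>R real n)"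
        by (intro C(2) tj) simp
      also have "\<dots> \<le> C * (\<epsilon>1 * (2 * norm v / real n))" using wv' C(1) by (intro mult_left_mono) auto
      finally show "norm (?u j - Ad ((real j / real n) *\<^sub>R x) (v /\<^sub>R real n)) \<le> C * (\<epsilon>1 * (2 * norm v / real n))"
        by (simp only: linear_diff[OF linear_Ad])
    qed
    moreover have "(\<Sum>i<n. C * (\<epsilon>1 * (2 * norm v / real n))) = \<epsilon>1 * (2 * C * norm v)"
      using \<open>n > 0\<close> by simp
    ultimately have est2: "norm ((\<Sum>i<n. ?u i) - ?avg) \<le> \<epsilon>1 * (2 * C * norm v)" by (simp only:)
    have nr: "real n * ?r = 2 * C * norm v" using \<open>n > 0\<close> by simp
    have qn: "?q n = mu (x + v) (- x)" using \<open>n > 0\<close> by simp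
    have "mu (x + v) (- x) - ?avg = (?q n - (\<Sum>i<n. ?u i)) + ((\<Sum>i<n. ?u i) - ?avg)"
      unfolding qn by (simp only: diff_add_cancel add_diff_eq)
    then have "norm (mu (x + v) (- x) - ?avg) \<le> norm (?q n - (\<Sum>i<n. ?u i)) + norm ((\<Sum>i<n. ?u i) - ?avg)"
      by (simp only: norm_triangle_ineq)
    then have qavg: "norm (mu (x + v) (- x) - ?avg) \<le> \<epsilon>1 * (4 * C * norm v)"
      using est est2 unfolding nr by linarith
    have "norm (\<Sum>i<n. ?u i) \<le> real n * ?r"
    proof -
      have "norm (?u j) \<le> ?r" if "j < n" for j
        using C(2)[OF tj[OF that], of w] mult_left_mono[OF w_le, of C] C(1) by linarith
      then show ?thesis using sum_norm_bound[of "{..<n}" ?u ?r] by simp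
    qed
    then have qbound: "norm (mu (x + v) (- x)) \<le> 4 * C * norm v"
    proof -
      assume a: "norm (\<Sum>i<n. ?u i) \<le> real n * ?r"
      have nr: "real n * ?r = 2 * C * norm v" using \<open>n > 0\<close> by simp
      have "norm (?q n) \<le> norm (?q n - (\<Sum>i<n. ?u i)) + norm (\<Sum>i<n. ?u i)"
        using norm_triangle_sub[of "?q n" "\<Sum>i<n. ?u i"] by linarith
      also have "\<dots> \<le> \<epsilon>1 * (2 * C * norm v) + 2 * C * norm v"
        using est a unfolding nr by linarith
      also have "\<epsilon>1 * (2 * C * norm v) \<le> 1 * (2 * C * norm v)"
        using e1 C(1) by (intro mult_right_mono) auto
      finally show ?thesis unfolding qn by simp
    qed
    let ?w = "mu (x + v) (- x)"
    have "norm (fps_op N (logser n) (adm x) ?w - v) = norm (fps_op N (logser n) (adm x) (?w - ?avg))"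
      by (simp only: linear_diff[OF linear_fps_op[OF linear_adm]] logser_op_average[OF \<open>n > 0\<close>])
    also have "\<dots> \<le> (\<Sum>i<N. \<bar>fps_nth (logser n) i\<bar>) * (D * norm (?w - ?avg))"
      unfolding fps_op_def by (rule op_bound)
    also have "\<dots> \<le> L * (D * (\<epsilon>1 * (4 * C * norm v)))"
      using coeff' qavg D(1) \<open>L \<ge> 1\<close> by (intro mult_mono) auto
    finally have 1: "norm (fps_op N (logser n) (adm x) ?w - v) \<le> L * (D * (\<epsilon>1 * (4 * C * norm v)))" .
    have "norm (Log_op x ?w - fps_op N (logser n) (adm x) ?w)
        = norm (\<Sum>i<N. (logcoeff i - fps_nth (logser n) i) *\<^sub>R (adm x ^^ i) ?w)"
      by (simp add: Log_op_def fps_op_def scaleR_diff_left sum_subtractf)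
    also have "\<dots> \<le> (\<Sum>i<N. \<bar>logcoeff i - fps_nth (logser n) i\<bar>) * (D * norm ?w)" by (rule op_bound)
    also have "\<dots> \<le> \<epsilon>1 * (D * (4 * C * norm v))"
      using coeff qbound D(1) e1(1) by (intro mult_mono) (auto simp: abs_minus_commute)
    finally have 2: "norm (Log_op x ?w - fps_op N (logser n) (adm x) ?w) \<le> \<epsilon>1 * (D * (4 * C * norm v))" .
    have "norm (Log_op x ?w - v) \<le> norm (Log_op x ?w - fps_op N (logser n) (adm x) ?w)
        + norm (fps_op N (logser n) (adm x) ?w - v)"
      by (rule norm_diff_triangle_le[OF order_refl order_refl])
    also have "\<dots> \<le> \<epsilon>1 * (4 * C * D * L + 4 * C * D) * norm v" 
    proof -
      have "\<epsilon>1 * (4 * C * D * L + 4 * C * D) * norm v = \<epsilon>1 * (D * (4 * C * norm v)) + L * (D * (\<epsilon>1 * (4 * C * norm v)))"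
        by (simp only: distrib_left distrib_right mult_ac)
      then show ?thesis using 1 2 by linarith
    qed
    also have "\<dots> \<le> \<epsilon> * norm v" using e1' by (intro mult_right_mono) auto
    finally show "norm (Log_op x ?w - v) \<le> \<epsilon> * norm v" .
  qed
qed

lemma linear_Log_op: "linear (Log_op x)"
  unfolding Log_op_def
  by (intro linear_compose_sum linear_compose_scale_right linear_funpow linear_adm ballI)

text \<open>The quotient of the values at \<open>t + s\<close> and \<open>t\<close> of this curve is exactly \<open>s y\<close>, so \<open>dexp_estimate\<close> compares its
  increment with \<open>s\<close> times the asserted velocity.\<close>

lemma translate_has_vector_derivative:
  "((\<lambda>t. mu (t *\<^sub>R y) x) has_vector_derivative Log_op (mu (t *\<^sub>R y) x) y) (at t)"
proof -
  define z where "z = mu (t *\<^sub>R y) x"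
  define V where "V s = mu (s *\<^sub>R y) z - z" for s
  have f: "mu ((t + s) *\<^sub>R y) x = z + V s" for s
    using one_param[of s y t] by (simp add: V_def z_def assoc[symmetric] add.commute)
  have quot: "mu (z + V s) (- z) = s *\<^sub>R y" for s by (simp add: V_def assoc)
  have "V \<midarrow>0\<rightarrow> mu (0 *\<^sub>R y) z - z"
    unfolding V_def by (intro tendsto_diff tendsto_mu tendsto_scaleR tendsto_const tendsto_ident_at)
  then have V0: "V \<midarrow>0\<rightarrow> 0" by simp
  let ?l = "Log_op z y"
  have "((\<lambda>t. mu (t *\<^sub>R y) x) has_derivative (\<lambda>s. s *\<^sub>R ?l)) (at t)"
    unfolding has_derivative_at_alt
  proof (intro conjI allI impI)
    show "bounded_linear (\<lambda>s. s *\<^sub>R ?l)" by (rule bounded_linear_scaleR_left)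
    fix \<epsilon> :: real assume "\<epsilon> > 0"
    \<comment> \<open>the bound \<open>1 / 2\<close> lets the increment be estimated by twice its linear part\<close>
    define \<epsilon>' where "\<epsilon>' = min (1 / 2) (\<epsilon> / (2 * norm ?l + 1))"
    have p: "2 * norm ?l + 1 > 0" by (simp add: add_nonneg_pos)
    have e': "\<epsilon>' > 0" "\<epsilon>' \<le> 1 / 2" using \<open>\<epsilon> > 0\<close> p unfolding \<epsilon>'_def by (simp_all only: min.cobounded1 min_less_iff_conj) simp_all
    have "\<epsilon>' \<le> \<epsilon> / (2 * norm ?l + 1)" by (simp add: \<epsilon>'_def)
    then have e'': "\<epsilon>' * (2 * norm ?l + 1) \<le> \<epsilon>" using p by (simp add: pos_le_divide_eq)
    obtain \<delta> where \<delta>: "\<delta> > 0"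
      "\<And>v. norm v < \<delta> \<Longrightarrow> norm (Log_op z (mu (z + v) (- z)) - v) \<le> \<epsilon>' * norm v"
      using dexp_estimate[OF e'(1), of z] by blast
    obtain \<eta> where \<eta>: "\<eta> > 0" "\<And>s. s \<noteq> 0 \<Longrightarrow> \<bar>s\<bar> < \<eta> \<Longrightarrow> norm (V s) < \<delta>"
      using LIM_D[OF V0 \<delta>(1)] by auto
    show "\<exists>d>0. \<forall>t'. norm (t' - t) < d \<longrightarrow>
        norm (mu (t' *\<^sub>R y) x - mu (t *\<^sub>R y) x - (t' - t) *\<^sub>R ?l) \<le> \<epsilon> * norm (t' - t)"
    proof (intro exI conjI allI impI)
      show "\<eta> > 0" by fact
      fix t' :: real assume t': "norm (t' - t) < \<eta>"
      define s where "s = t' - t"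
      have "norm (V s) < \<delta>"
      proof (cases "s = 0")
        case True
        then show ?thesis using \<delta>(1) by (simp add: V_def)
      qed (use \<eta>(2) t' s_def in auto)
      from \<delta>(2)[OF this] have d: "norm (s *\<^sub>R ?l - V s) \<le> \<epsilon>' * norm (V s)"
        by (simp add: quot linear_scale[OF linear_Log_op])
      have "\<epsilon>' * norm (V s) \<le> 1 / 2 * norm (V s)" using e'(2) by (intro mult_right_mono) auto
      then have "norm (V s) \<le> norm (s *\<^sub>R ?l) + 1 / 2 * norm (V s)"
        using d norm_triangle_sub[of "V s" "s *\<^sub>R ?l"] unfolding norm_minus_commute[of "V s"] by linarith
      then have V: "norm (V s) \<le> 2 * (\<bar>s\<bar> * norm ?l)" by simp
      have "norm (V s - s *\<^sub>R ?l) \<le> \<epsilon>' * (2 * (\<bar>s\<bar> * norm ?l))"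
        using d mult_left_mono[OF V less_imp_le[OF e'(1)]] unfolding norm_minus_commute[of "V s"] by linarith
      also have "\<dots> \<le> \<epsilon>' * (2 * norm ?l + 1) * \<bar>s\<bar>" using e'(1) by (simp add: algebra_simps)
      also have "\<dots> \<le> \<epsilon> * \<bar>s\<bar>" using e'' by (intro mult_right_mono) auto
      finally show "norm (mu (t' *\<^sub>R y) x - mu (t *\<^sub>R y) x - (t' - t) *\<^sub>R ?l) \<le> \<epsilon> * norm (t' - t)"
        using f[of s] f[of 0] by (simp add: s_def V_def)
    qed
  qed
  then show ?thesis by (simp add: has_vector_derivative_def z_def)
qed

end

context exp_group
begin

definition diff_map :: "'e \<Rightarrow> ('e \<Rightarrow> 'v::real_vector) \<Rightarrow> 'e \<Rightarrow> 'v" where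
  "diff_map g F x = F (mu g x) - F x"

primrec diff_maps :: "'e list \<Rightarrow> ('e \<Rightarrow> 'v::real_vector) \<Rightarrow> 'e \<Rightarrow> 'v" where
  "diff_maps [] F = F"
| "diff_maps (g # gs) F = diff_maps gs (diff_map g F)"

text \<open>Polynomial maps of degree less than \<open>d\<close>, for differences taken along left translations of the group.\<close>

definition poly_map :: "nat \<Rightarrow> ('e \<Rightarrow> 'v::real_vector) \<Rightarrow> bool" where
  "poly_map d F \<longleftrightarrow> (\<forall>gs. length gs = d \<longrightarrow> diff_maps gs F = (\<lambda>x. 0))"

lemma poly_map_0: "poly_map 0 F \<longleftrightarrow> F = (\<lambda>x. 0)"
  by (simp add: poly_map_def)

lemma poly_map_Suc: "poly_map (Suc d) F \<longleftrightarrow> (\<forall>g. poly_map d (diff_map g F))"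
proof (intro iffI allI)
  fix g assume F: "poly_map (Suc d) F"
  show "poly_map d (diff_map g F)" unfolding poly_map_def
  proof (intro allI impI)
    fix gs :: "'e list" assume "length gs = d"
    then show "diff_maps gs (diff_map g F) = (\<lambda>x. 0)"
      using F unfolding poly_map_def by (metis diff_maps.simps(2) length_Cons)
  qed
next
  assume "\<forall>g. poly_map d (diff_map g F)"
  then show "poly_map (Suc d) F" by (auto simp: poly_map_def length_Suc_conv)
qed

lemma diff_map_add: "diff_map g (\<lambda>x. F x + F' x) = (\<lambda>x. diff_map g F x + diff_map g F' x)"
  by (auto simp: diff_map_def)

lemma diff_maps_add: "diff_maps gs (\<lambda>x. F x + F' x) = (\<lambda>x. diff_maps gs F x + diff_maps gs F' x)"
  by (induction gs arbitrary: F F') (simp_all add: diff_map_add)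

lemma diff_maps_scaleR: "diff_maps gs (\<lambda>x. r *\<^sub>R F x) = (\<lambda>x. r *\<^sub>R diff_maps gs F x)"
proof (induction gs arbitrary: F)
  case (Cons g gs)
  have "diff_map g (\<lambda>x. r *\<^sub>R F x) = (\<lambda>x. r *\<^sub>R diff_map g F x)"
    by (auto simp: diff_map_def scaleR_diff_right)
  then show ?case using Cons by simp
qed simp

lemma diff_maps_zero [simp]: "diff_maps gs (\<lambda>x. 0) = (\<lambda>x. 0)"
  using diff_maps_scaleR[of gs 0 "\<lambda>x. 0"] by simp

lemma poly_map_add: "poly_map d F \<Longrightarrow> poly_map d F' \<Longrightarrow> poly_map d (\<lambda>x. F x + F' x)"
  by (simp add: poly_map_def diff_maps_add)

lemma poly_map_scaleR: "poly_map d F \<Longrightarrow> poly_map d (\<lambda>x. r *\<^sub>R F x)"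
  by (simp add: poly_map_def diff_maps_scaleR)

lemma poly_map_zero: "poly_map d (\<lambda>x. 0)"
  by (simp add: poly_map_def)

lemma poly_map_diff: "poly_map d F \<Longrightarrow> poly_map d F' \<Longrightarrow> poly_map d (\<lambda>x. F x - F' x)"
  using poly_map_add[of d F "\<lambda>x. (-1) *\<^sub>R F' x"] poly_map_scaleR[of d F' "-1"] by simp

lemma poly_map_sum:
  "(\<And>i. i \<in> J \<Longrightarrow> poly_map d (F i)) \<Longrightarrow> poly_map d (\<lambda>x. \<Sum>i\<in>J. F i x)"
  by (induction J rule: infinite_finite_induct) (auto intro: poly_map_add poly_map_zero)

lemma poly_map_Suc_I: "poly_map d F \<Longrightarrow> poly_map (Suc d) F"
proof (induction d arbitrary: F)
  case 0
  then show ?case by (simp add: poly_map_0 poly_map_zero)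
next
  case (Suc d)
  then show ?case by (metis poly_map_Suc)
qed

lemma poly_map_mono:
  assumes "poly_map d F" "d \<le> d'"
  shows "poly_map d' F"
  using assms(2,1) by (induction rule: dec_induct) (auto intro: poly_map_Suc_I)

lemma poly_map_translate: "poly_map d F \<Longrightarrow> poly_map d (\<lambda>x. F (mu g x))"
proof (induction d arbitrary: F)
  case 0
  then show ?case by (auto simp: poly_map_0 fun_eq_iff)
next
  case (Suc d)
  have "diff_map h (\<lambda>x. F (mu g x)) = (\<lambda>x. diff_map (Ad g h) F (mu g x))" for h
    by (auto simp: diff_map_def Ad_def assoc)
  then show ?case using Suc by (simp add: poly_map_Suc)
qed

lemma diff_maps_has_vector_derivative:
  fixes F :: "real \<Rightarrow> 'e \<Rightarrow> 'v::real_normed_vector"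
  assumes "\<And>x t. ((\<lambda>t. F t x) has_vector_derivative F' t x) (at t)"
  shows "((\<lambda>t. diff_maps gs (F t) x) has_vector_derivative diff_maps gs (F' t) x) (at t)"
  using assms
proof (induction gs arbitrary: F F' x t)
  case (Cons g gs)
  have "((\<lambda>t. diff_map g (F t) x) has_vector_derivative diff_map g (F' t) x) (at t)" for x t
    unfolding diff_map_def by (intro has_vector_derivative_diff Cons.prems)
  then show ?case using Cons.IH[of "\<lambda>t. diff_map g (F t)" "\<lambda>t. diff_map g (F' t)"] by simp
qed simp

end

context nilpotent_exp_group
begin

text \<open>By induction on \<open>j + d\<close>: the difference along \<open>g\<close> of \<open>x \<mapsto> L (Ad x (F x))\<close> is the sum of such a term with
  \<open>L\<close> replaced by \<open>L \<circ> (Ad g - 1)\<close>, which kills one more step of the filtration, and of one with \<open>F\<close> replaced by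
  its difference.\<close>

lemma poly_map_Ad_apply:
  assumes "linear L" "\<And>v. v \<in> Kspace j \<Longrightarrow> L v = 0" "poly_map d F"
  shows "poly_map (j + d) (\<lambda>x. L (Ad x (F x)) :: 'v::real_vector)"
  using assms
proof (induction "j + d" arbitrary: j d L F)
  case 0
  then show ?case by (simp add: poly_map_0 linear_0)
next
  case (Suc n)
  show ?case
  proof (cases "j = 0 \<or> d = 0")
    case True
    then have "(\<lambda>x. L (Ad x (F x))) = (\<lambda>x. 0)"
      using Suc.prems by (auto simp: Kspace_0 poly_map_0 linear_0)
    then show ?thesis by (simp add: poly_map_zero)
  next
    case False
    then obtain j' d' where j: "j = Suc j'" and d: "d = Suc d'" by (metis not0_implies_Suc)
    have "poly_map n (diff_map g (\<lambda>x. L (Ad x (F x))))" for g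
    proof -
      have eq: "diff_map g (\<lambda>x. L (Ad x (F x)))
          = (\<lambda>x. (\<lambda>v. L (adm g v)) (Ad x (F (mu g x))) + L (Ad x (diff_map g F x)))"
        by (auto simp: diff_map_def Ad_Ad adm_def linear_diff[OF Suc.prems(1)] linear_diff[OF linear_Ad])
      have l: "linear (\<lambda>v. L (adm g v))"
        using linear_compose[OF linear_adm Suc.prems(1)] by (simp add: o_def)
      have "poly_map (j' + d) (\<lambda>x. (\<lambda>v. L (adm g v)) (Ad x (F (mu g x))))"
        by (rule Suc.hyps(1)[OF _ l])
          (use Suc.hyps(2) Suc.prems j in \<open>auto simp: adm_def Ad_diff_Kspace intro: poly_map_translate\<close>)
      moreover have "poly_map (j + d') (\<lambda>x. L (Ad x (diff_map g F x)))"
        by (rule Suc.hyps(1)) (use Suc.hyps(2) Suc.prems d in \<open>auto simp: poly_map_Suc\<close>)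
      moreover have "j' + d = n" "j + d' = n" using Suc.hyps(2) j d by auto
      ultimately show ?thesis unfolding eq by (auto intro: poly_map_add)
    qed
    then show ?thesis using Suc.hyps(2)[symmetric] by (simp add: poly_map_Suc)
  qed
qed

lemma poly_map_adm_power: "poly_map (Suc (i * N)) (\<lambda>x. (adm (mu g x) ^^ i) v)"
proof (induction i)
  case 0
  show ?case by (auto simp: poly_map_Suc poly_map_0 diff_map_def)
next
  case (Suc i)
  have "poly_map (N + Suc (i * N)) (\<lambda>x. Ad g (Ad x ((adm (mu g x) ^^ i) v)))"
    by (rule poly_map_Ad_apply[OF linear_Ad]) (auto simp: Kspace_N Suc)
  then have "poly_map (Suc (Suc i * N)) (\<lambda>x. Ad g (Ad x ((adm (mu g x) ^^ i) v)) - (adm (mu g x) ^^ i) v)"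
    by (intro poly_map_diff) (auto intro: poly_map_mono[OF Suc])
  then show ?case
    by (simp only: funpow.simps o_apply) (simp only: adm_def[of _ "(adm (mu g _) ^^ i) v"] Ad_Ad)
qed

lemma poly_map_Log_op: "poly_map (Suc (N * N)) (\<lambda>x. Log_op (mu g x) v)"
  unfolding Log_op_def
  by (intro poly_map_sum poly_map_scaleR poly_map_mono[OF poly_map_adm_power]) auto

text \<open>The iterated differences of \<open>x \<mapsto> mu (t y) x\<close> have derivative zero in \<open>t\<close>, because the velocity is a polynomial
  map of \<open>x\<close>. Comparing \<open>t = 0\<close> and \<open>t = 1\<close> shows that the same differences of the increment
  of the identity along \<open>y\<close> vanish.\<close>

theorem poly_map_id: "poly_map (Suc (Suc (N * N))) (\<lambda>x. x)"
  unfolding poly_map_Suc[of "Suc (N * N)"] unfolding poly_map_def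
proof (intro allI impI ext)
  fix y x and gs :: "'a list" assume gs: "length gs = Suc (N * N)"
  let ?f = "\<lambda>t. diff_maps gs (\<lambda>x. mu (t *\<^sub>R y) x) x"
  have "(?f has_vector_derivative diff_maps gs (\<lambda>x. Log_op (mu (t *\<^sub>R y) x) y) x) (at t)" for t
    by (rule diff_maps_has_vector_derivative) (rule translate_has_vector_derivative)
  moreover have "diff_maps gs (\<lambda>x. Log_op (mu (t *\<^sub>R y) x) y) = (\<lambda>x. 0)" for t
    using poly_map_Log_op[of "t *\<^sub>R y" y] gs unfolding poly_map_def by blast
  ultimately have "(?f has_vector_derivative 0) (at t)" for t by simp
  then have "(?f has_derivative (\<lambda>h. 0)) (at t)" for t
    by (simp add: has_vector_derivative_def)
  then have "?f 1 = ?f 0"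
    using has_derivative_zero_unique[of UNIV ?f 1 0] by auto
  then have "diff_maps gs (\<lambda>x. mu y x) x = diff_maps gs (\<lambda>x. x) x" by simp
  moreover have "diff_maps gs (mu y) x = diff_maps gs (diff_map y (\<lambda>x. x)) x + diff_maps gs (\<lambda>x. x) x"
  proof -
    have "mu y = (\<lambda>x. diff_map y (\<lambda>x. x) x + x)" by (auto simp: diff_map_def)
    then show ?thesis using diff_maps_add[of gs "diff_map y (\<lambda>x. x)" "\<lambda>x. x"] by metis
  qed
  ultimately show "diff_maps gs (diff_map y (\<lambda>x. x)) x = 0" by simp
qed

end

definition add_subgroup :: "'v::ab_group_add set \<Rightarrow> bool" where
  "add_subgroup L \<longleftrightarrow> 0 \<in> L \<and> (\<forall>x\<in>L. \<forall>y\<in>L. x + y \<in> L \<and> x - y \<in> L)"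

context exp_group
begin

abbreviation mu_group :: "'e monoid" where
  "mu_group \<equiv> \<lparr>carrier = UNIV, mult = mu, one = 0\<rparr>"

lemma group_mu_group: "Group.group mu_group"
proof (rule groupI)
  show "\<exists>y\<in>carrier mu_group. y \<otimes>\<^bsub>mu_group\<^esub> x = \<one>\<^bsub>mu_group\<^esub>" for x
    by (rule bexI[of _ "- x"]) auto
qed (auto simp: assoc)

lemma inv_mu_group: "inv\<^bsub>mu_group\<^esub> x = - x"
proof -
  interpret Group.group mu_group by (rule group_mu_group)
  show ?thesis by (rule inv_equality) auto
qed

text \<open>This is \<open>gh - 1 = (g - 1) (h - 1) + (g - 1) + (h - 1)\<close> for translation operators.\<close>

lemma diff_map_product:
  "diff_map (mu g h) F = (\<lambda>x. diff_map h (diff_map g F) x + (diff_map g F x + diff_map h F x))"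
  by (auto simp: diff_map_def assoc)

lemma diff_maps_append: "diff_maps (us @ vs) F = diff_maps vs (diff_maps us F)"
  by (induction us arbitrary: F) auto

lemma diff_maps_product:
  "diff_maps (us @ mu g h # vs) F x = diff_maps (us @ g # h # vs) F x
     + (diff_maps (us @ g # vs) F x + diff_maps (us @ h # vs) F x)"
  by (simp add: diff_maps_append diff_map_product diff_maps_add)

text \<open>Take for \<open>T\<close> the differences at \<open>0\<close> along lists of generators of length at most \<open>D\<close>. By \<open>diff_map_product\<close>, a
  difference along a product of group elements is the sum of differences along the factors and of one along
  a longer list, so downward induction on the length of the list, starting where all differences vanish,
  reduces everything to \<open>T\<close>.\<close>

lemma poly_map_fg_range:
  assumes "poly_map D F" "finite S"
  shows "\<exists>T. finite T \<and> (\<forall>L. add_subgroup L \<longrightarrow> T \<subseteq> L \<longrightarrow> F ` generate mu_group S \<subseteq> L)"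
proof -
  define T where "T = (\<lambda>us. diff_maps us F 0) ` {us. set us \<subseteq> S \<and> length us \<le> D}"
  let ?K = "generate mu_group S"
  have "finite T" unfolding T_def by (intro finite_imageI finite_lists_length_le assms)
  moreover have "F ` ?K \<subseteq> L" if L: "add_subgroup L" and "T \<subseteq> L" for L
  proof -
    have L0: "0 \<in> L" and Ladd: "\<And>x y. x \<in> L \<Longrightarrow> y \<in> L \<Longrightarrow> x + y \<in> L"
      and Ldiff: "\<And>x y. x \<in> L \<Longrightarrow> y \<in> L \<Longrightarrow> x - y \<in> L"
      using L by (auto simp: add_subgroup_def)
    have zero: "diff_maps us F x = 0" if "D \<le> length us" for us x
    proof -
      have "diff_maps (take D us) F = (\<lambda>x. 0)" using assms(1) that by (auto simp: poly_map_def)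
      then have "diff_maps (take D us @ drop D us) F x = 0" unfolding diff_maps_append by simp
      then show ?thesis by simp
    qed
    have SK: "S \<subseteq> ?K" by (auto intro: generate.incl)
    have claim: "\<forall>ls. set ls \<subseteq> ?K \<longrightarrow> length ls = n \<longrightarrow> diff_maps ls F 0 \<in> L" if "n \<le> D" for n
      using that
    proof (induction n rule: inc_induct)
      case base
      then show ?case using zero L0 by auto
    next
      case (step n)
      have IH: "diff_maps ls F 0 \<in> L" if "set ls \<subseteq> ?K" "length ls = Suc n" for ls
        using step.IH that by blast
      have "diff_maps (us @ vs) F 0 \<in> L" if "set us \<subseteq> S" "set vs \<subseteq> ?K" "length (us @ vs) = n" for us vs
        using that
      proof (induction vs arbitrary: us)
        case Nil
        then have "diff_maps us F 0 \<in> T" using step.hyps unfolding T_def by auto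
        then show ?case using \<open>T \<subseteq> L\<close> by auto
      next
        case (Cons k vs)
        then have k: "k \<in> generate mu_group S" by simp
        from k Cons.prems(1,3) have "k \<in> ?K \<and> diff_maps (us @ k # vs) F 0 \<in> L"
        proof (induction k rule: generate.induct)
          case one
          have "diff_map 0 (diff_maps us F) = (\<lambda>x. 0)" by (auto simp: diff_map_def)
          then show ?case using L0 generate.one[of mu_group S] by (simp add: diff_maps_append)
        next
          case (incl h)
          then have "diff_maps ((us @ [h]) @ vs) F 0 \<in> L"
            using Cons.prems Cons.IH[of "us @ [h]"] by simp
          then show ?case using incl SK by auto
        next
          case (inv h)
          then have hK: "h \<in> ?K" "- h \<in> ?K" using generate.incl[of h S mu_group] generate.inv[of h S mu_group] by (auto simp: inv_mu_group)
          have "diff_maps ((us @ [h]) @ vs) F 0 \<in> L"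
            using Cons.prems inv Cons.IH[of "us @ [h]"] by simp
          then have 1: "diff_maps (us @ h # vs) F 0 \<in> L" by simp
          have 2: "diff_maps (us @ h # - h # vs) F 0 \<in> L"
            by (rule IH) (use inv Cons.prems hK SK in auto)
          have "diff_map (mu h (- h)) (diff_maps us F) = (\<lambda>x. 0)" by (auto simp: diff_map_def)
          then have "diff_maps (us @ mu h (- h) # vs) F 0 = 0" by (simp add: diff_maps_append)
          then have sum0: "diff_maps (us @ h # - h # vs) F 0 + (diff_maps (us @ h # vs) F 0 + diff_maps (us @ - h # vs) F 0) = 0"
            unfolding diff_maps_product .
          have "diff_maps (us @ - h # vs) F 0 = (diff_maps (us @ h # - h # vs) F 0 + (diff_maps (us @ h # vs) F 0 + diff_maps (us @ - h # vs) F 0))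
              - diff_maps (us @ h # - h # vs) F 0 - diff_maps (us @ h # vs) F 0" by simp
          then have "diff_maps (us @ - h # vs) F 0 = 0 - diff_maps (us @ h # - h # vs) F 0 - diff_maps (us @ h # vs) F 0"
            unfolding sum0 .
          then show ?case using Ldiff[OF Ldiff[OF L0 2] 1] hK by (simp add: inv_mu_group)
        next
          case (eng h1 h2)
          have h: "h1 \<in> ?K" "h2 \<in> ?K" using eng by auto
          have "diff_maps (us @ h1 # h2 # vs) F 0 \<in> L"
            by (rule IH) (use eng h Cons.prems SK in auto)
          then show ?case
            using eng Ladd generate.eng[OF h] by (auto simp: diff_maps_product)
        qed
        then show ?case by blast
      qed
      from this[of "[]"] show ?case by auto
    qed
    show ?thesis
    proof clarify
      fix k assume k: "k \<in> ?K"
      have "diff_maps [k] F 0 \<in> L"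
      proof (cases "1 \<le> D")
        case True
        show ?thesis by (rule claim[OF True, rule_format]) (use k in auto)
      next
        case False
        then show ?thesis using zero[of "[k]"] L0 by auto
      qed
      moreover have "diff_maps [] F 0 \<in> L" using claim[of 0] by auto
      ultimately have "diff_maps [k] F 0 + diff_maps [] F 0 \<in> L" by (rule Ladd)
      then show "F k \<in> L" by (simp add: diff_map_def)
    qed
  qed
  ultimately show ?thesis by blast
qed

end

section \<open>Maps of class \<open>C\<^sup>n\<close>\<close>

lemma frechet_derivative_eqI: "(f has_derivative f') (at x) \<Longrightarrow> frechet_derivative f (at x) = f'"
  using frechet_derivative_at by metis

lemma C_on_subset: "C_on n f U \<Longrightarrow> V \<subseteq> U \<Longrightarrow> C_on n f V"
  by (induction n arbitrary: f) (auto intro: continuous_on_subset)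

lemma C_on_cong:
  assumes "open U" "C_on n f U" "\<And>x. x \<in> U \<Longrightarrow> f x = h x"
  shows "C_on n h U"
  using assms(2,3)
proof (induction n arbitrary: f h)
  case 0
  then show ?case using continuous_on_cong[of U U f h] by simp
next
  case (Suc n)
  have d: "(h has_derivative frechet_derivative f (at x)) (at x)" if "x \<in> U" for x
  proof -
    have "(f has_derivative frechet_derivative f (at x)) (at x)"
      using Suc.prems(1) that by (simp add: frechet_derivative_works)
    then show ?thesis
      by (rule has_derivative_transform_within_open[OF _ \<open>open U\<close> that]) (use Suc.prems in auto)
  qed
  have "C_on n (\<lambda>x. frechet_derivative h (at x) v) U" for v
  proof (rule Suc.IH)
    show "C_on n (\<lambda>x. frechet_derivative f (at x) v) U" using Suc.prems by simp
    show "frechet_derivative f (at x) v = frechet_derivative h (at x) v" if "x \<in> U" for x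
      using frechet_derivative_eqI[OF d[OF that]] by simp
  qed
  then show ?case using d by (auto simp: differentiable_def)
qed

text \<open>The definition refers to the chosen derivative \<open>frechet_derivative\<close>; this rule allows any formula for the
  derivative.\<close>

lemma C_on_Suc_I:
  assumes "open U"
    and d: "\<And>x. x \<in> U \<Longrightarrow> (f has_derivative f' x) (at x)"
    and c: "\<And>v. C_on n (\<lambda>x. f' x v) U"
  shows "C_on (Suc n) f U"
proof -
  have "C_on n (\<lambda>x. frechet_derivative f (at x) v) U" for v
    by (rule C_on_cong[OF \<open>open U\<close> c[of v]]) (simp add: frechet_derivative_eqI[OF d])
  then show ?thesis using d by (auto simp: differentiable_def)
qed

lemma C_on_Suc_D: "C_on (Suc n) f U \<Longrightarrow> C_on n f U"
proof (induction n arbitrary: f)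
  case 0
  then show ?case
    by (auto intro!: continuous_at_imp_continuous_on differentiable_imp_continuous_within)
next
  case (Suc n)
  then show ?case by simp
qed

lemma C_on_Suc_derivative:
  "C_on (Suc n) f U \<Longrightarrow> x \<in> U \<Longrightarrow> (f has_derivative frechet_derivative f (at x)) (at x)"
  by (simp add: frechet_derivative_works)

lemma C_on_const: "open U \<Longrightarrow> C_on n (\<lambda>x. k) U"
proof (induction n arbitrary: k)
  case (Suc n)
  show ?case by (rule C_on_Suc_I[OF Suc.prems has_derivative_const]) (rule Suc.IH[OF Suc.prems])
qed simp

lemma C_on_linear:
  assumes "open U" "bounded_linear L" "C_on n f U"
  shows "C_on n (\<lambda>x. L (f x)) U"
  using assms(3)
proof (induction n arbitrary: f)
  case 0
  then show ?case using bounded_linear.continuous_on[OF assms(2)] by simp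
next
  case (Suc n)
  show ?case
  proof (rule C_on_Suc_I[OF \<open>open U\<close>])
    show "((\<lambda>x. L (f x)) has_derivative (\<lambda>v. L (frechet_derivative f (at x) v))) (at x)" if "x \<in> U" for x
      using bounded_linear.has_derivative[OF assms(2) C_on_Suc_derivative[OF Suc.prems that]] .
    show "C_on n (\<lambda>x. L (frechet_derivative f (at x) v)) U" for v
      using Suc by simp
  qed
qed

lemma C_on_add:
  assumes "open U" "C_on n f U" "C_on n h U"
  shows "C_on n (\<lambda>x. f x + h x) U"
  using assms(2,3)
proof (induction n arbitrary: f h)
  case 0
  then show ?case by (simp add: continuous_on_add)
next
  case (Suc n)
  show ?case
  proof (rule C_on_Suc_I[OF \<open>open U\<close>])
    show "((\<lambda>x. f x + h x) has_derivative (\<lambda>v. frechet_derivative f (at x) v + frechet_derivative h (at x) v)) (at x)"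
      if "x \<in> U" for x
      using that Suc.prems by (intro has_derivative_add C_on_Suc_derivative)
    show "C_on n (\<lambda>x. frechet_derivative f (at x) v + frechet_derivative h (at x) v) U" for v
      using Suc by simp
  qed
qed

lemma C_on_sum:
  assumes "open U" "\<And>i. i \<in> J \<Longrightarrow> C_on n (f i) U"
  shows "C_on n (\<lambda>x. \<Sum>i\<in>J. f i x) U"
  using assms(2)
  by (induction J rule: infinite_finite_induct) (auto intro: C_on_add C_on_const assms(1))

lemma C_on_scaleR:
  assumes "open U" "C_on n r U" "C_on n h U"
  shows "C_on n (\<lambda>x. r x *\<^sub>R h x) U"
  using assms(2,3)
proof (induction n arbitrary: r h)
  case 0
  then show ?case by (simp add: continuous_on_scaleR)
next
  case (Suc n)
  show ?case
  proof (rule C_on_Suc_I[OF \<open>open U\<close>])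
    show "((\<lambda>x. r x *\<^sub>R h x) has_derivative
        (\<lambda>v. r x *\<^sub>R frechet_derivative h (at x) v + frechet_derivative r (at x) v *\<^sub>R h x)) (at x)"
      if "x \<in> U" for x
      using that Suc.prems by (intro has_derivative_scaleR C_on_Suc_derivative)
    show "C_on n (\<lambda>x. r x *\<^sub>R frechet_derivative h (at x) v + frechet_derivative r (at x) v *\<^sub>R h x) U" for v
    proof (rule C_on_add[OF \<open>open U\<close>])
      show "C_on n (\<lambda>x. r x *\<^sub>R frechet_derivative h (at x) v) U"
        by (rule Suc.IH) (use Suc.prems C_on_Suc_D in auto)
      show "C_on n (\<lambda>x. frechet_derivative r (at x) v *\<^sub>R h x) U"
        by (rule Suc.IH) (use Suc.prems C_on_Suc_D in auto)
    qed
  qed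
qed

text \<open>The chain rule is used in coordinates, in order that the derivative of the composite is built by sums
  and scalar multiples from functions covered by the induction hypothesis.\<close>

lemma C_on_compose:
  fixes f :: "'a::euclidean_space \<Rightarrow> 'b::euclidean_space" and h :: "'b \<Rightarrow> 'c::euclidean_space"
  assumes "open U" "open V" "C_on n h V" "C_on n f U" "f ` U \<subseteq> V"
  shows "C_on n (\<lambda>x. h (f x)) U"
  using assms(3,4)
proof (induction n arbitrary: h)
  case 0
  then show ?case using assms(5) continuous_on_compose2 by auto
next
  case (Suc n)
  have lin: "linear (frechet_derivative h (at y))" if "y \<in> V" for y
    using Suc.prems(1) that by (simp add: linear_frechet_derivative)
  show ?case
  proof (rule C_on_Suc_I[OF \<open>open U\<close>])
    fix x assume x: "x \<in> U"
    let ?h' = "frechet_derivative h (at (f x))" and ?f' = "frechet_derivative f (at x)"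
    have "(h \<circ> f has_derivative ?h' \<circ> ?f') (at x)"
      by (rule diff_chain_at) (use x Suc.prems assms(5) C_on_Suc_derivative in blast)+
    moreover have "?h' (?f' v) = (\<Sum>b\<in>Basis. (?f' v \<bullet> b) *\<^sub>R ?h' b)" for v
    proof -
      have l: "linear ?h'" using lin x assms(5) by blast
      have "?h' (\<Sum>b\<in>Basis. (?f' v \<bullet> b) *\<^sub>R b) = (\<Sum>b\<in>Basis. (?f' v \<bullet> b) *\<^sub>R ?h' b)"
        by (simp add: linear_sum[OF l] linear_scale[OF l])
      then show ?thesis by (simp add: euclidean_representation)
    qed
    ultimately show "((\<lambda>x. h (f x)) has_derivative (\<lambda>v. \<Sum>b\<in>Basis. (?f' v \<bullet> b) *\<^sub>R ?h' b)) (at x)"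
      by (simp add: o_def)
  next
    fix v
    show "C_on n (\<lambda>x. \<Sum>b\<in>Basis. (frechet_derivative f (at x) v \<bullet> b) *\<^sub>R frechet_derivative h (at (f x)) b) U"
    proof (intro C_on_sum C_on_scaleR assms(1))
      fix b :: 'b
      show "C_on n (\<lambda>x. frechet_derivative f (at x) v \<bullet> b) U"
        by (rule C_on_linear[OF assms(1) bounded_linear_inner_left]) (use Suc.prems in simp)
      show "C_on n (\<lambda>x. frechet_derivative h (at (f x)) b) U"
        by (rule Suc.IH) (use Suc.prems C_on_Suc_D in auto)
    qed
  qed
qed

text \<open>The mean value inequality for \<open>f - f'\<close> on a ball where the derivative varies by less than \<open>\<epsilon>\<close>.\<close>

lemma C_on_strict_derivative:
  fixes f :: "'a::euclidean_space \<Rightarrow> 'b::euclidean_space"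
  assumes "open U" "p \<in> U" "C_on 1 f U" "(f has_derivative f') (at p)" "\<epsilon> > 0"
  shows "\<exists>\<delta>>0. ball p \<delta> \<subseteq> U \<and>
    (\<forall>x\<in>ball p \<delta>. \<forall>y\<in>ball p \<delta>. norm (f x - f y - f' (x - y)) \<le> \<epsilon> * norm (x - y))"
proof -
  let ?d = "\<lambda>x. frechet_derivative f (at x)"
  have f': "f' = ?d p" using frechet_derivative_eqI[OF assms(4)] by simp
  have C: "C_on (Suc 0) f U" using assms(3) by simp
  define \<eta> where "\<eta> = \<epsilon> / real DIM('a)"
  have "\<eta> > 0" using \<open>\<epsilon> > 0\<close> by (simp add: \<eta>_def)
  have "\<exists>\<delta>>0. \<forall>x. dist x p < \<delta> \<longrightarrow> dist (?d x b) (?d p b) < \<eta>" for b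
  proof -
    have "isCont (\<lambda>x. ?d x b) p"
      using C assms(1,2) by (simp add: continuous_on_eq_continuous_at)
    then show ?thesis using \<open>\<eta> > 0\<close> by (simp add: continuous_at_eps_delta)
  qed
  then obtain d where d: "\<And>b. d b > 0" "\<And>b x. dist x p < d b \<Longrightarrow> dist (?d x b) (?d p b) < \<eta>"
    by metis
  obtain r where r: "r > 0" "ball p r \<subseteq> U" using assms(1,2) open_contains_ball by blast
  define \<delta> where "\<delta> = min r (Min (d ` Basis))"
  have "\<delta> > 0" using r(1) d(1) by (simp add: \<delta>_def)
  have sub: "ball p \<delta> \<subseteq> U" using r(2) by (auto simp: \<delta>_def)
  have close: "norm (?d x v - ?d p v) \<le> \<epsilon> * norm v" if x: "x \<in> ball p \<delta>" for x v
  proof -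
    have l: "linear (\<lambda>v. ?d x v - ?d p v)"
      by (intro linear_compose_sub linear_frechet_derivative) (use C sub x assms(2) in auto)
    have "?d x v - ?d p v = (\<lambda>v. ?d x v - ?d p v) (\<Sum>b\<in>Basis. (v \<bullet> b) *\<^sub>R b)"
      by (simp add: euclidean_representation)
    also have "\<dots> = (\<Sum>b\<in>Basis. (v \<bullet> b) *\<^sub>R (?d x b - ?d p b))"
      by (subst linear_sum[OF l], subst linear_scale[OF l]) simp
    also have "norm \<dots> \<le> (\<Sum>b\<in>(Basis::'a set). norm v * \<eta>)"
    proof (rule sum_norm_le)
      fix b :: 'a assume b: "b \<in> Basis"
      have "dist x p < d b" using x b by (auto simp: \<delta>_def dist_commute)
      then have "norm (?d x b - ?d p b) \<le> \<eta>" using d(2) by (simp add: dist_norm less_imp_le)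
      then show "norm ((v \<bullet> b) *\<^sub>R (?d x b - ?d p b)) \<le> norm v * \<eta>"
        using Basis_le_norm[OF b, of v] \<open>\<eta> > 0\<close> by (simp add: mult_mono)
    qed
    also have "\<dots> = \<epsilon> * norm v" by (simp add: \<eta>_def)
    finally show ?thesis .
  qed
  have "norm (f x - f y - f' (x - y)) \<le> \<epsilon> * norm (x - y)" if "x \<in> ball p \<delta>" "y \<in> ball p \<delta>" for x y
  proof -
    have l: "linear f'" using assms(4) by (simp add: has_derivative_linear)
    have "norm ((\<lambda>x. f x - f' x) x - (\<lambda>x. f x - f' x) y) \<le> \<epsilon> * norm (x - y)"
    proof (rule differentiable_bound[where S = "ball p \<delta>"])
      show "((\<lambda>x. f x - f' x) has_derivative (\<lambda>v. ?d z v - f' v)) (at z within ball p \<delta>)"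
        if "z \<in> ball p \<delta>" for z
      proof (rule has_derivative_at_withinI, rule has_derivative_diff)
        show "(f has_derivative ?d z) (at z)" using C_on_Suc_derivative[OF C] sub that by blast
        show "(f' has_derivative f') (at z)"
          using linear_imp_has_derivative[OF l] .
      qed
      show "onorm (\<lambda>v. ?d z v - f' v) \<le> \<epsilon>" if "z \<in> ball p \<delta>" for z
        by (rule onorm_le) (use close[OF that] f' in auto)
    qed (use that in auto)
    moreover have "f x - f y - f' (x - y) = (f x - f' x) - (f y - f' y)"
      by (simp add: linear_diff[OF l])
    ultimately show ?thesis by (simp only:)
  qed
  then show ?thesis using \<open>\<delta> > 0\<close> sub by blast
qed

lemma smooth_on_openD:
  assumes "smooth_on S f" "open S" "p \<in> S"
  shows "\<exists>U. open U \<and> p \<in> U \<and> U \<subseteq> S \<and> (\<forall>n. C_on n f U)"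
proof -
  obtain U F where U: "open U" "p \<in> U" "\<And>n. C_on n F U" "\<And>y. y \<in> S \<inter> U \<Longrightarrow> F y = f y"
    using assms unfolding smooth_on_def by metis
  have "C_on n f (S \<inter> U)" for n
    by (rule C_on_cong[of _ _ F]) (use U assms in \<open>auto intro: C_on_subset\<close>)
  then show ?thesis using U assms by (intro exI[of _ "S \<inter> U"]) auto
qed

section \<open>Lie groups with a global logarithm\<close>

locale exp_lie_group =
  fixes G :: "'b::t2_space monoid" and B :: "('b, 'e::euclidean_space) chart set"
    and c :: "('b, 'e) chart" and ex :: "'e \<Rightarrow> 'b" and lg :: "'b \<Rightarrow> 'e"
  assumes lie: "lie_group G B" and c: "c \<in> B" and one_c: "\<one>\<^bsub>G\<^esub> \<in> fst c"
    and exp: "exponential_map G B c ex" and log: "logarithm_map G ex lg"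
begin

sublocale Group.group G using lie by (simp add: lie_group_def)

lemma lg_ex [simp]: "lg (ex x) = x" and ex_lg [simp]: "y \<in> carrier G \<Longrightarrow> ex (lg y) = y"
  using log by (auto simp: logarithm_map_def)

lemma ex_carrier [simp, intro]: "ex x \<in> carrier G"
  using exp by (auto simp: exponential_map_def smooth_map_def)

lemma ex_add: "ex ((s + t) *\<^sub>R x) = ex (s *\<^sub>R x) \<otimes>\<^bsub>G\<^esub> ex (t *\<^sub>R x)"
  using exp by (auto simp: exponential_map_def)

lemma ex_0 [simp]: "ex 0 = \<one>\<^bsub>G\<^esub>"
proof -
  have "ex 0 \<otimes>\<^bsub>G\<^esub> ex 0 = ex 0" using ex_add[of 0 0 0] by simp
  then show ?thesis using ex_carrier by (metis r_cancel_one')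
qed

lemma lg_one [simp]: "lg \<one>\<^bsub>G\<^esub> = 0"
  using lg_ex[of 0] by simp

lemma ex_eq_iff [simp]: "ex x = ex y \<longleftrightarrow> x = y"
  by (metis lg_ex)

lemma ex_minus: "ex (- x) = inv\<^bsub>G\<^esub> ex x"
  using ex_add[of 1 "-1" x] ex_add[of "-1" 1 x] by (intro inv_equality[symmetric]) auto

definition mu :: "'e \<Rightarrow> 'e \<Rightarrow> 'e" where
  "mu x y = lg (ex x \<otimes>\<^bsub>G\<^esub> ex y)"

lemma ex_mu: "ex (mu x y) = ex x \<otimes>\<^bsub>G\<^esub> ex y"
  by (simp add: mu_def)

lemma atlas: "smooth_atlas UNIV (carrier G) B"
  using lie by (simp add: lie_group_def)

lemma chart:
  assumes "(V, \<psi>) \<in> B"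
  shows "openin (top_of_set (carrier G)) V" "V \<subseteq> carrier G" "open (\<psi> ` V)"
    "continuous_on V \<psi>" "inj_on \<psi> V" "continuous_on (\<psi> ` V) (inv_into V \<psi>)"
proof -
  have 1: "openin (top_of_set (carrier G)) V \<and> open (\<psi> ` V) \<and> (\<exists>h. homeomorphism V (\<psi> ` V) \<psi> h)"
    using atlas assms by (auto simp: smooth_atlas_def)
  then show "openin (top_of_set (carrier G)) V" "open (\<psi> ` V)" by auto
  then show "V \<subseteq> carrier G" using openin_subset by fastforce
  obtain h where h: "homeomorphism V (\<psi> ` V) \<psi> h" using 1 by auto
  then show "continuous_on V \<psi>" by (simp add: homeomorphism_def)
  have inv: "h (\<psi> v) = v" if "v \<in> V" for v using h that by (simp add: homeomorphism_def)
  then show inj: "inj_on \<psi> V" by (rule inj_on_inverseI)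
  have "continuous_on (\<psi> ` V) h" using h by (simp add: homeomorphism_def)
  moreover have "h y = inv_into V \<psi> y" if "y \<in> \<psi> ` V" for y
    using that inv inj by auto
  ultimately show "continuous_on (\<psi> ` V) (inv_into V \<psi>)" using continuous_on_cong by blast
qed

lemma chart_at: "x \<in> carrier G \<Longrightarrow> \<exists>V \<psi>. (V, \<psi>) \<in> B \<and> x \<in> V"
  using atlas unfolding smooth_atlas_def by blast

lemma continuous_ex: "continuous_on UNIV ex"
  using exp by (auto simp: exponential_map_def smooth_map_def)

lemma open_ex_vimage:
  assumes "openin (top_of_set (carrier G)) V"
  shows "open (ex -` V)"
proof -
  obtain T where T: "open T" "V = carrier G \<inter> T" using assms by (auto simp: openin_open)
  then have "ex -` V = ex -` T" by auto
  then show ?thesis using T(1) continuous_ex by (simp add: continuous_on_open_vimage)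
qed

text \<open>In a chart the exponential map becomes a continuous injection between open subsets of a Euclidean space,
  which is open by invariance of domain.\<close>

lemma continuous_lg: "continuous_on (carrier G) lg"
  unfolding continuous_openin_preimage_eq
proof (intro allI impI)
  fix W :: "'e set" assume "open W"
  have "\<exists>V. openin (top_of_set (carrier G)) V \<and> y \<in> V \<and> V \<subseteq> carrier G \<inter> lg -` W"
    if y: "y \<in> carrier G \<inter> lg -` W" for y
  proof -
    obtain V \<psi> where V: "(V, \<psi>) \<in> B" "y \<in> V" using chart_at y by blast
    let ?O = "W \<inter> ex -` V"
    have "open ?O" using \<open>open W\<close> open_ex_vimage[OF chart(1)[OF V(1)]] by auto
    moreover have "continuous_on ?O (\<psi> \<circ> ex)"
      by (rule continuous_on_compose) (use chart(4)[OF V(1)] continuous_ex in \<open>auto intro: continuous_on_subset\<close>)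
    moreover have "inj_on (\<psi> \<circ> ex) ?O"
      using chart(5)[OF V(1)] by (auto simp: inj_on_def) (metis lg_ex)
    ultimately have "open ((\<psi> \<circ> ex) ` ?O)" by (intro invariance_of_domain)
    then have o: "openin (top_of_set V) (V \<inter> \<psi> -` ((\<psi> \<circ> ex) ` ?O))"
      using chart(4)[OF V(1)] continuous_openin_preimage_gen by blast
    have eq: "V \<inter> \<psi> -` ((\<psi> \<circ> ex) ` ?O) = ex ` ?O"
    proof
      show "V \<inter> \<psi> -` ((\<psi> \<circ> ex) ` ?O) \<subseteq> ex ` ?O"
      proof
        fix z assume z: "z \<in> V \<inter> \<psi> -` ((\<psi> \<circ> ex) ` ?O)"
        then obtain w where "w \<in> ?O" "\<psi> z = \<psi> (ex w)" by auto
        then show "z \<in> ex ` ?O" using chart(5)[OF V(1)] z by (auto simp: inj_on_def)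
      qed
    qed auto
    have "openin (top_of_set (carrier G)) (ex ` ?O)"
      using o unfolding eq using chart(1)[OF V(1)] openin_trans by blast
    moreover have "y \<in> ex ` ?O" using y V(2) by (auto intro!: image_eqI[of y ex "lg y"])
    moreover have "ex ` ?O \<subseteq> carrier G \<inter> lg -` W" by auto
    ultimately show ?thesis by blast
  qed
  then show "openin (top_of_set (carrier G)) (carrier G \<inter> lg -` W)"
    by (subst openin_subopen) blast
qed

lemma continuous_mult: "continuous_on (carrier G \<times> carrier G) (\<lambda>(x, y). x \<otimes>\<^bsub>G\<^esub> y)"
  using lie by (auto simp: lie_group_def smooth_map_def)

lemma continuous_mu: "continuous_on UNIV (\<lambda>p. mu (fst p) (snd p))"
proof -
  have "continuous_on UNIV (\<lambda>p::'e \<times> 'e. (ex (fst p), ex (snd p)))"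
    by (intro continuous_intros continuous_on_compose2[OF continuous_ex]) auto
  then have "continuous_on UNIV (\<lambda>p. (\<lambda>(x, y). x \<otimes>\<^bsub>G\<^esub> y) (ex (fst p), ex (snd p)))"
    by (rule continuous_on_compose2[OF continuous_mult]) auto
  then have "continuous_on UNIV (\<lambda>p. lg ((\<lambda>(x, y). x \<otimes>\<^bsub>G\<^esub> y) (ex (fst p), ex (snd p))))"
    by (rule continuous_on_compose2[OF continuous_lg]) auto
  then show ?thesis by (simp add: mu_def)
qed

abbreviation "U \<equiv> fst c"
abbreviation "\<phi> \<equiv> snd c"

lemma Uc: "(U, \<phi>) \<in> B" using c by simp

text \<open>The exponential map in the given chart at the identity; \<open>m\<close> below is the product in this chart.\<close>

definition E :: "'e \<Rightarrow> 'e" where "E x = \<phi> (ex x)"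

lemma E_smooth: "\<exists>W. open W \<and> 0 \<in> W \<and> W \<subseteq> ex -` U \<and> (\<forall>n. C_on n E W)"
proof -
  have "smooth_on (id ` (UNIV \<inter> ex -` U)) (\<phi> \<circ> ex \<circ> inv_into UNIV id)"
    using exp Uc by (fastforce simp: exponential_map_def smooth_map_def)
  then have "smooth_on (ex -` U) E" by (simp add: E_def[abs_def] o_def flip: id_def)
  from smooth_on_openD[OF this open_ex_vimage[OF chart(1)[OF Uc]], of 0] one_c
  show ?thesis by auto
qed

lemma has_derivative_E: "(E has_derivative (\<lambda>v. v)) (at 0)"
proof -
  obtain W where W: "open W" "0 \<in> W" "C_on (Suc 0) E W" using E_smooth by metis
  let ?D = "frechet_derivative E (at 0)"
  have D: "(E has_derivative ?D) (at 0)" using C_on_Suc_derivative[OF W(3,2)] .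
  have "?D v = v" for v
  proof -
    have "((\<lambda>t::real. t *\<^sub>R v) has_derivative (\<lambda>t. t *\<^sub>R v)) (at 0)"
      by (intro bounded_linear_imp_has_derivative bounded_linear_scaleR_left)
    moreover have "(E has_derivative ?D) (at ((\<lambda>t::real. t *\<^sub>R v) 0))" using D by simp
    ultimately have "((\<lambda>t. E (t *\<^sub>R v)) has_derivative (\<lambda>t. ?D (t *\<^sub>R v))) (at 0)"
      by (rule has_derivative_compose)
    moreover have "((\<lambda>t. E (t *\<^sub>R v)) has_vector_derivative v) (at 0)"
      using exp by (simp add: exponential_map_def E_def)
    ultimately have "(\<lambda>t. ?D (t *\<^sub>R v)) = (\<lambda>t. t *\<^sub>R v)"
      unfolding has_vector_derivative_def using has_derivative_unique by blast
    then have "?D (1 *\<^sub>R v) = 1 *\<^sub>R v" by (rule fun_cong)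
    then show ?thesis by simp
  qed
  then have "?D = (\<lambda>v. v)" by auto
  then show ?thesis using D by simp
qed

definition m :: "'e \<times> 'e \<Rightarrow> 'e" where
  "m p = \<phi> (inv_into U \<phi> (fst p) \<otimes>\<^bsub>G\<^esub> inv_into U \<phi> (snd p))"

abbreviation "o0 \<equiv> \<phi> \<one>\<^bsub>G\<^esub>"

lemma inv_chart [simp]: "x \<in> U \<Longrightarrow> inv_into U \<phi> (\<phi> x) = x"
  using chart(5)[OF Uc] by simp

lemma m_smooth: "\<exists>W. open W \<and> (o0, o0) \<in> W \<and> W \<subseteq> \<phi> ` U \<times> \<phi> ` U \<and> (\<forall>n. C_on n m W)"
proof -
  let ?mult = "\<lambda>(x, y). x \<otimes>\<^bsub>G\<^esub> y"
  let ?S = "map_prod \<phi> \<phi> ` (U \<times> U \<inter> ?mult -` U)"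
  have "(U \<times> U, map_prod \<phi> \<phi>) \<in> prod_atlas B B"
    unfolding prod_atlas_def using Uc by (intro image_eqI[of _ _ "(c, c)"]) (auto simp: case_prod_unfold c)
  then have sm: "smooth_on ?S (\<phi> \<circ> ?mult \<circ> inv_into (U \<times> U) (map_prod \<phi> \<phi>))"
    using lie Uc unfolding lie_group_def smooth_map_def by fast
  have inj: "inj_on (map_prod \<phi> \<phi>) (U \<times> U)" using chart(5)[OF Uc] by (auto simp: inj_on_def)
  have S_eq: "?S = (\<phi> ` U \<times> \<phi> ` U) \<inter> (\<lambda>p. inv_into U \<phi> (fst p) \<otimes>\<^bsub>G\<^esub> inv_into U \<phi> (snd p)) -` U"
    by force
  have "continuous_on (\<phi> ` U \<times> \<phi> ` U) (\<lambda>p. (inv_into U \<phi> (fst p), inv_into U \<phi> (snd p)))"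
    by (intro continuous_on_Pair continuous_on_compose2[OF chart(6)[OF Uc]] continuous_intros) auto
  then have "continuous_on (\<phi> ` U \<times> \<phi> ` U) (\<lambda>p. ?mult (inv_into U \<phi> (fst p), inv_into U \<phi> (snd p)))"
    by (rule continuous_on_compose2[OF continuous_mult]) (use chart(2)[OF Uc] in auto)
  then have cm: "continuous_on (\<phi> ` U \<times> \<phi> ` U) (\<lambda>p. inv_into U \<phi> (fst p) \<otimes>\<^bsub>G\<^esub> inv_into U \<phi> (snd p))" by simp
  have "openin (top_of_set (\<phi> ` U \<times> \<phi> ` U)) ?S"
    unfolding S_eq
    by (rule continuous_openin_preimage[OF cm _ chart(1)[OF Uc]])
      (use chart(2)[OF Uc] in \<open>auto simp: subset_iff\<close>)
  then have "open ?S" using chart(3)[OF Uc] by (simp add: open_Times openin_open_eq)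
  have "(o0, o0) \<in> ?S" using one_c by (intro image_eqI[of _ _ "(\<one>\<^bsub>G\<^esub>, \<one>\<^bsub>G\<^esub>)"]) auto
  from smooth_on_openD[OF sm \<open>open ?S\<close> this] obtain W where W: "open W" "(o0, o0) \<in> W" "W \<subseteq> ?S"
    "\<And>n. C_on n (\<phi> \<circ> ?mult \<circ> inv_into (U \<times> U) (map_prod \<phi> \<phi>)) W" by blast
  have "C_on n m W" for n
  proof (rule C_on_cong[OF W(1,4)])
    fix p assume "p \<in> W"
    then obtain x y where "x \<in> U" "y \<in> U" "p = map_prod \<phi> \<phi> (x, y)" using W(3) by auto
    moreover then have "inv_into (U \<times> U) (map_prod \<phi> \<phi>) p = (x, y)" using inj by (simp only: inv_into_f_f mem_Sigma_iff)
    ultimately show "(\<phi> \<circ> ?mult \<circ> inv_into (U \<times> U) (map_prod \<phi> \<phi>)) p = m p" by (simp add: m_def)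
  qed
  then show ?thesis using W S_eq by blast
qed

lemma m_o0: "p \<in> \<phi> ` U \<Longrightarrow> m (p, o0) = p" "p \<in> \<phi> ` U \<Longrightarrow> m (o0, p) = p"
  using one_c chart(2)[OF Uc] by (auto simp: m_def subset_iff)

lemma has_derivative_m: "(m has_derivative (\<lambda>(h, k). h + k)) (at (o0, o0))"
proof -
  obtain W where W: "open W" "(o0, o0) \<in> W" "C_on (Suc 0) m W" using m_smooth by metis
  let ?D = "frechet_derivative m (at (o0, o0))"
  have D: "(m has_derivative ?D) (at (o0, o0))" using C_on_Suc_derivative[OF W(3,2)] .
  have o0: "open (\<phi> ` U)" "o0 \<in> \<phi> ` U" using chart(3)[OF Uc] one_c by auto
  have "((\<lambda>p. m (p, o0)) has_derivative (\<lambda>h. ?D (h, 0))) (at o0)"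
    by (rule has_derivative_compose[of "\<lambda>p. (p, o0)" "\<lambda>h. (h, 0)", OF _ D]) (auto intro!: derivative_eq_intros)
  then have "((\<lambda>p. p) has_derivative (\<lambda>h. ?D (h, 0))) (at o0)"
    by (rule has_derivative_transform_within_open[OF _ o0]) (simp add: m_o0)
  then have 1: "?D (h, 0) = h" for h using has_derivative_unique[OF _ has_derivative_ident] by metis
  have "((\<lambda>p. m (o0, p)) has_derivative (\<lambda>h. ?D (0, h))) (at o0)"
    by (rule has_derivative_compose[of "\<lambda>p. (o0, p)" "\<lambda>h. (0, h)", OF _ D]) (auto intro!: derivative_eq_intros)
  then have "((\<lambda>p. p) has_derivative (\<lambda>h. ?D (0, h))) (at o0)"
    by (rule has_derivative_transform_within_open[OF _ o0]) (simp add: m_o0)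
  then have 2: "?D (0, h) = h" for h using has_derivative_unique[OF _ has_derivative_ident] by metis
  have "?D (h, k) = h + k" for h k
  proof -
    have "?D ((h, 0) + (0, k)) = ?D (h, 0) + ?D (0, k)"
      by (rule linear_add[OF has_derivative_linear[OF D]])
    then show ?thesis by (simp add: 1 2)
  qed
  then have "?D = (\<lambda>(h, k). h + k)" by auto
  then show ?thesis using D by simp
qed

lemma mu_zero: "mu x 0 = x" "mu 0 x = x"
  by (simp_all add: mu_def)

text \<open>Both \<open>E\<close> at \<open>0\<close> and \<open>m\<close> at the identity are strictly differentiable, the latter with derivative
  \<open>(h, k) \<mapsto> h + k\<close>. Comparing \<open>m (E x, E y)\<close> with \<open>m (E x, o0)\<close> gives a bound by \<open>y\<close> alone, and comparing it with
  \<open>m (o0, E y)\<close> one by \<open>x\<close> alone.\<close>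

lemma mu_strict:
  assumes "\<epsilon> > 0"
  shows "\<exists>\<delta>>0. \<forall>x y. norm x < \<delta> \<longrightarrow> norm y < \<delta> \<longrightarrow> 
     norm (mu x y - x - y) \<le> \<epsilon> * norm y \<and> norm (mu x y - x - y) \<le> \<epsilon> * norm x"
proof -
  \<comment> \<open>three errors of size \<open>\<eta>\<close> accumulate; \<open>7\<close> covers the resulting constants when \<open>\<eta> \<le> 1 / 2\<close>\<close>
  define \<eta> where "\<eta> = min (1 / 2) (\<epsilon> / 7)"
  have \<eta>: "\<eta> > 0" "\<eta> \<le> 1 / 2" "7 * \<eta> \<le> \<epsilon>" using assms by (auto simp: \<eta>_def min_def)
  obtain W where W: "open W" "0 \<in> W" "W \<subseteq> ex -` U" "C_on 1 E W" using E_smooth by metis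
  obtain \<delta>1 where d1: "\<delta>1 > 0" "ball 0 \<delta>1 \<subseteq> W"
    "\<And>x y. x \<in> ball 0 \<delta>1 \<Longrightarrow> y \<in> ball 0 \<delta>1 \<Longrightarrow> norm (E x - E y - (x - y)) \<le> \<eta> * norm (x - y)"
    using C_on_strict_derivative[OF W(1,2,4) has_derivative_E \<eta>(1)] by blast
  obtain W' where W': "open W'" "(o0, o0) \<in> W'" "W' \<subseteq> \<phi> ` U \<times> \<phi> ` U" "C_on 1 m W'" using m_smooth by metis
  obtain \<delta>2 where d2: "\<delta>2 > 0" "ball (o0, o0) \<delta>2 \<subseteq> W'"
    "\<And>p q. p \<in> ball (o0, o0) \<delta>2 \<Longrightarrow> q \<in> ball (o0, o0) \<delta>2 \<Longrightarrow>
        norm (m p - m q - (\<lambda>(h, k). h + k) (p - q)) \<le> \<eta> * norm (p - q)"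
    using C_on_strict_derivative[OF W'(1,2,4) has_derivative_m \<eta>(1)] by blast
  have E0: "E 0 = o0" by (simp add: E_def)
  have "isCont (\<lambda>p. mu (fst p) (snd p)) (0, 0)"
    using continuous_mu by (simp add: continuous_on_eq_continuous_at)
  then obtain \<delta>3 where d3: "\<delta>3 > 0" "\<And>p. dist p (0, 0) < \<delta>3 \<Longrightarrow> dist (mu (fst p) (snd p)) 0 < \<delta>1"
    unfolding continuous_at_eps_delta using d1(1) by (auto simp: mu_zero)
  have "isCont E 0" using has_derivative_continuous[OF has_derivative_E] .
  then obtain \<delta>4 where d4: "\<delta>4 > 0" "\<And>x. dist x 0 < \<delta>4 \<Longrightarrow> dist (E x) o0 < \<delta>2 / 2"
    unfolding continuous_at_eps_delta using d2(1) E0 by (metis half_gt_zero)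
  define \<delta> where "\<delta> = min \<delta>1 (min (\<delta>3 / 2) \<delta>4)"
  have "norm (mu x y - x - y) \<le> \<epsilon> * norm y \<and> norm (mu x y - x - y) \<le> \<epsilon> * norm x"
    if x: "norm x < \<delta>" and y: "norm y < \<delta>" for x y
  proof -
    have in1: "x \<in> ball 0 \<delta>1" "y \<in> ball 0 \<delta>1" using x y by (auto simp: \<delta>_def)
    have "dist (x, y) (0, 0) < \<delta>3"
      using x y norm_Pair_le[of x y] by (simp add: dist_norm \<delta>_def)
    from d3(2)[OF this] have mu1: "mu x y \<in> ball 0 \<delta>1" by simp
    have exU: "ex z \<in> U" if "z \<in> ball 0 \<delta>1" for z using that d1(2) W(3) by auto
    have in2: "(E x, E y) \<in> ball (o0, o0) \<delta>2" "(E x, o0) \<in> ball (o0, o0) \<delta>2" "(o0, E y) \<in> ball (o0, o0) \<delta>2"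
    proof -
      have "dist (E x) o0 < \<delta>2 / 2" "dist (E y) o0 < \<delta>2 / 2" using x y d4(2)[of x] d4(2)[of y] by (simp_all add: \<delta>_def)
      then have "norm (o0 - E x) < \<delta>2 / 2" "norm (o0 - E y) < \<delta>2 / 2" by (simp_all add: dist_norm norm_minus_commute)
      then show "(E x, E y) \<in> ball (o0, o0) \<delta>2" "(E x, o0) \<in> ball (o0, o0) \<delta>2" "(o0, E y) \<in> ball (o0, o0) \<delta>2"
        using norm_Pair_le[of "o0 - E x" "o0 - E y"] norm_Pair_le[of "o0 - E x" 0] norm_Pair_le[of 0 "o0 - E y"] d2(1)
        by (auto simp: dist_norm)
    qed
    have m: "m (E x, E y) = E (mu x y)" using exU in1 by (simp add: m_def E_def ex_mu)
    have mx: "m (E x, o0) = E x" "m (o0, E y) = E y" using exU in1 by (auto intro!: m_o0 simp: E_def)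
    have bound: "norm (z - y) \<le> \<epsilon> * norm y" if z: "norm (Ez - Ey) \<le> \<eta> * norm Ey" "norm (Ez - z) \<le> \<eta> * norm z"
      "norm (Ey - y) \<le> \<eta> * norm y" for z y Ez Ey :: 'e
    proof -
      have Ey: "norm Ey \<le> (1 + \<eta>) * norm y"
        using z(3) norm_triangle_sub[of Ey y] by (simp add: algebra_simps)
      have "norm (Ez - Ey) \<le> \<eta> * ((1 + \<eta>) * norm y)"
        using z(1) mult_left_mono[OF Ey less_imp_le[OF \<eta>(1)]] by linarith
      moreover have "(1 + \<eta>) * norm y \<le> 3 / 2 * norm y" using \<eta> by (intro mult_right_mono) auto
      then have "\<eta> * ((1 + \<eta>) * norm y) \<le> \<eta> * (3 / 2 * norm y)" using \<eta> by (intro mult_left_mono) auto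
      moreover have "norm z \<le> norm (z - y) + norm y" using norm_triangle_sub[of z y] by linarith
      then have "\<eta> * norm z \<le> \<eta> * (norm (z - y) + norm y)" using \<eta> by (intro mult_left_mono) auto
      then have "\<eta> * norm z \<le> \<eta> * norm (z - y) + \<eta> * norm y" by (simp only: distrib_left)
      moreover have "\<eta> * norm (z - y) \<le> 1 / 2 * norm (z - y)" using \<eta> by (intro mult_right_mono) auto
      moreover have "norm (z - y) \<le> norm (Ez - z) + norm (Ez - Ey) + norm (Ey - y)"
      proof -
        have "z - y = (Ez - Ey) + (Ey - y) - (Ez - z)" by simp
        then have "norm (z - y) = norm ((Ez - Ey) + (Ey - y) - (Ez - z))" by (rule arg_cong)
        then show ?thesis using norm_triangle_ineq4[of "(Ez - Ey) + (Ey - y)" "Ez - z"]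
            norm_triangle_ineq[of "Ez - Ey" "Ey - y"] by linarith
      qed
      ultimately have "norm (z - y) \<le> 7 * (\<eta> * norm y)" using z(2,3) by linarith
      also have "\<dots> = (7 * \<eta>) * norm y" by simp
      also have "\<dots> \<le> \<epsilon> * norm y" using \<eta> by (intro mult_right_mono) auto
      finally show ?thesis .
    qed
    have z0: "0 \<in> ball (0::'e) \<delta>1" using d1(1) by simp
    have "norm (mu x y - x - y) \<le> \<epsilon> * norm y"
    proof (rule bound[where Ez = "E (mu x y) - E x" and Ey = "E y - o0"])
      show "norm (E (mu x y) - E x - (E y - o0)) \<le> \<eta> * norm (E y - o0)"
        using d2(3)[OF in2(1,2)] by (simp add: m mx norm_Pair)
      show "norm (E (mu x y) - E x - (mu x y - x)) \<le> \<eta> * norm (mu x y - x)"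
        by (rule d1(3)[OF mu1 in1(1)])
      show "norm (E y - o0 - y) \<le> \<eta> * norm y" using d1(3)[OF in1(2) z0] by (simp add: E0)
    qed
    moreover have "norm (mu x y - y - x) \<le> \<epsilon> * norm x"
    proof (rule bound[where Ez = "E (mu x y) - E y" and Ey = "E x - o0"])
      show "norm (E (mu x y) - E y - (E x - o0)) \<le> \<eta> * norm (E x - o0)"
        using d2(3)[OF in2(1,3)] by (simp add: m mx norm_Pair)
      show "norm (E (mu x y) - E y - (mu x y - y)) \<le> \<eta> * norm (mu x y - y)"
        by (rule d1(3)[OF mu1 in1(2)])
      show "norm (E x - o0 - x) \<le> \<eta> * norm x" using d1(3)[OF in1(1) z0] by (simp add: E0)
    qed
    moreover have "mu x y - y - x = mu x y - x - y" by simp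
    ultimately show ?thesis by metis
  qed
  moreover have "\<delta> > 0" using d1(1) d3(1) d4(1) by (simp add: \<delta>_def)
  ultimately show ?thesis by blast
qed

sublocale exp_group mu
proof
  show "mu (mu x y) z = mu x (mu y z)" for x y z
    unfolding ex_eq_iff[symmetric] ex_mu by (simp add: m_assoc)
  show "mu (s *\<^sub>R x) (t *\<^sub>R x) = (s + t) *\<^sub>R x" for s t x
    by (simp add: mu_def flip: ex_add)
  show "continuous_on UNIV (\<lambda>p. mu (fst p) (snd p))" by (rule continuous_mu)
  show "\<exists>\<delta>>0. \<forall>x y. norm x < \<delta> \<longrightarrow> norm y < \<delta> \<longrightarrow>
        norm (mu x y - x - y) \<le> \<epsilon> * norm x \<and> norm (mu x y - x - y) \<le> \<epsilon> * norm y"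
    if "\<epsilon> > 0" for \<epsilon>
    using mu_strict[OF that] by blast
qed

lemma lg_mult: "x \<in> carrier G \<Longrightarrow> y \<in> carrier G \<Longrightarrow> lg (x \<otimes>\<^bsub>G\<^esub> y) = mu (lg x) (lg y)"
  by (simp add: mu_def)

lemma lg_inv: "x \<in> carrier G \<Longrightarrow> lg (inv\<^bsub>G\<^esub> x) = - lg x"
  using ex_minus[of "lg x"] by (metis ex_lg lg_ex)

lemma lg_mult_commuting:
  assumes "x \<in> carrier G" "y \<in> carrier G" "x \<otimes>\<^bsub>G\<^esub> y = y \<otimes>\<^bsub>G\<^esub> x"
  shows "lg (x \<otimes>\<^bsub>G\<^esub> y) = lg x + lg y"
  using mu_commuting[of "lg x" "lg y"] assms by (simp add: mu_def)

lemma nilpotent_exp_group_of_nilpotent: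
  assumes "lower_central G N = {\<one>\<^bsub>G\<^esub>}"
  shows "nilpotent_exp_group mu (\<lambda>i. lg ` lower_central G i) N"
proof
  show "lg ` lower_central G 0 = UNIV" by (auto intro!: image_eqI[of _ _ "ex _"])
  show "lg ` lower_central G N = {0}" using assms by simp
  show "0 \<in> lg ` lower_central G i" for i
  proof (cases i)
    case 0
    then show ?thesis by (auto intro!: image_eqI[of _ _ "\<one>\<^bsub>G\<^esub>"])
  next
    case (Suc j)
    then show ?thesis by (auto intro!: image_eqI[of _ _ "\<one>\<^bsub>G\<^esub>"] generate.one)
  qed
  have mult: "x \<otimes>\<^bsub>G\<^esub> y \<in> lower_central G i" if "x \<in> lower_central G i" "y \<in> lower_central G i" for x y i
  proof (cases i)
    case 0
    then show ?thesis using that by simp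
  next
    case (Suc j)
    then show ?thesis using that generate.eng[of x G _ y] by simp
  qed
  show "mu x y \<in> lg ` lower_central G i" if "x \<in> lg ` lower_central G i" "y \<in> lg ` lower_central G i" for x y i
  proof -
    obtain u v where u: "u \<in> lower_central G i" "x = lg u" and v: "v \<in> lower_central G i" "y = lg v"
      using \<open>x \<in> _\<close> \<open>y \<in> _\<close> by blast
    then have "mu x y = lg (u \<otimes>\<^bsub>G\<^esub> v)" using lower_central_subset by (metis lg_mult subsetD)
    then show ?thesis using mult[OF u(1) v(1)] by simp
  qed
  show "mu (mu (mu x y) (- x)) (- y) \<in> lg ` lower_central G (Suc i)" if y: "y \<in> lg ` lower_central G i" for x y i
  proof -
    obtain z where z: "z \<in> lower_central G i" "y = lg z" using y by blast
    then have zc: "z \<in> carrier G" using lower_central_subset by blast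
    have "commutator G (ex x) z \<in> lower_central G (Suc i)"
      unfolding lower_central.simps using z by (intro generate.incl) blast
    moreover have "lg (commutator G (ex x) z) = mu (mu (mu x y) (- x)) (- y)"
      using zc z(2) by (simp add: commutator_def lg_mult lg_inv)
    ultimately show ?thesis by (metis imageI)
  qed
qed

text \<open>The logarithm becomes the identity map in exponential coordinates, which is a polynomial map.\<close>

theorem log_of_fg_subgroup:
  assumes "nilpotent_group G" "finite S" "S \<subseteq> carrier G"
  shows "\<exists>T. finite T \<and> (\<forall>L. add_subgroup L \<longrightarrow> T \<subseteq> L \<longrightarrow> lg ` generate G S \<subseteq> L)"
proof -
  obtain N where "lower_central G N = {\<one>\<^bsub>G\<^esub>}" using assms(1) by (auto simp: nilpotent_group_def)
  then interpret nilpotent_exp_group mu "\<lambda>i. lg ` lower_central G i" N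
    by (rule nilpotent_exp_group_of_nilpotent)
  have "lg x \<in> generate mu_group (lg ` S)" if "x \<in> generate G S" for x
    using that
  proof (induction rule: generate.induct)
    case one
    then show ?case using generate.one[of mu_group] by simp
  next
    case (incl h)
    then show ?case by (auto intro: generate.incl)
  next
    case (inv h)
    then have "inv\<^bsub>mu_group\<^esub> lg h \<in> generate mu_group (lg ` S)" by (auto intro: generate.inv)
    then show ?case using inv assms(3) by (auto simp: lg_inv inv_mu_group)
  next
    case (eng h1 h2)
    then have "h1 \<in> carrier G" "h2 \<in> carrier G" using generate_incl[OF assms(3)] by auto
    then show ?case using generate.eng[OF eng.IH] by (simp add: lg_mult)
  qed
  moreover obtain T where "finite T"
    "\<And>L. add_subgroup L \<Longrightarrow> T \<subseteq> L \<Longrightarrow> (\<lambda>x. x) ` generate mu_group (lg ` S) \<subseteq> L"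
    using poly_map_fg_range[OF poly_map_id, of "lg ` S"] assms(2) by auto
  ultimately show ?thesis by (intro exI[of _ T]) blast
qed

end

section \<open>Presented abelian groups\<close>

lemma free_Abelian_group_generate:
  "generate (free_Abelian_group S) (frag_of ` S) = carrier (free_Abelian_group S)"
proof
  interpret comm_group "free_Abelian_group S" by (rule abelian_free_Abelian_group)
  have sub: "frag_of ` S \<subseteq> carrier (free_Abelian_group S)" by auto
  show "generate (free_Abelian_group S) (frag_of ` S) \<subseteq> carrier (free_Abelian_group S)"
    by (rule generate_incl[OF sub])
  show "carrier (free_Abelian_group S) \<subseteq> generate (free_Abelian_group S) (frag_of ` S)"
  proof
    fix x assume "x \<in> carrier (free_Abelian_group S)"
    then have "Poly_Mapping.keys x \<subseteq> S" by simp
    then show "x \<in> generate (free_Abelian_group S) (frag_of ` S)"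
    proof (induction x rule: free_Abelian_group_induct[consumes 1, case_names zero diff gen])
      case zero
      then show ?case using generate.one[of "free_Abelian_group S" "frag_of ` S"] by simp
    next
      case (diff x y)
      then have "x \<otimes>\<^bsub>free_Abelian_group S\<^esub> inv\<^bsub>free_Abelian_group S\<^esub> y \<in> generate (free_Abelian_group S) (frag_of ` S)"
        by (intro generate.eng generate_m_inv_closed[OF sub]) auto
      then show ?case using diff by simp
    next
      case (gen a)
      then show ?case by (auto intro: generate.incl)
    qed
  qed
qed

lemma diff_free_Abelian_group:
  assumes "x \<in> carrier (free_Abelian_group S)" "y \<in> carrier (free_Abelian_group S)"
  shows "x - y = x \<otimes>\<^bsub>free_Abelian_group S\<^esub> inv\<^bsub>free_Abelian_group S\<^esub> y"
  using assms by simp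

lemma diff_closed_free_Abelian_group:
  assumes "x \<in> carrier (free_Abelian_group S)" "y \<in> carrier (free_Abelian_group S)"
  shows "x - y \<in> carrier (free_Abelian_group S)"
proof -
  interpret comm_group "free_Abelian_group S" by (rule abelian_free_Abelian_group)
  show ?thesis unfolding diff_free_Abelian_group[OF assms] using assms by (intro m_closed inv_closed)
qed

lemma hom_free_Abelian_group_diff:
  assumes "Group.group C" "h \<in> hom (free_Abelian_group S) C"
    "x \<in> carrier (free_Abelian_group S)" "y \<in> carrier (free_Abelian_group S)"
  shows "h (x - y) = h x \<otimes>\<^bsub>C\<^esub> inv\<^bsub>C\<^esub> h y"
proof -
  interpret h: group_hom "free_Abelian_group S" C h using assms by (simp add: group_hom_def group_hom_axioms_def)
  show ?thesis unfolding diff_free_Abelian_group[OF assms(3,4)]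
    by (simp only: h.hom_mult[OF assms(3) h.G.inv_closed[OF assms(4)]] h.hom_inv[OF assms(4)])
qed

text \<open>The abelian group with generators \<open>S\<close> and relations \<open>R\<close>. Tensor products and exterior squares are both of
  this form, and receive their universal properties from here.\<close>

locale presented =
  fixes S :: "'a set" and R :: "('a \<Rightarrow>\<^sub>0 int) set"
  assumes R: "R \<subseteq> carrier (free_Abelian_group S)"
begin

abbreviation "F \<equiv> free_Abelian_group S"
abbreviation "Q \<equiv> F Mod generate F R"
definition cls :: "'a \<Rightarrow> ('a \<Rightarrow>\<^sub>0 int) set" where "cls x = generate F R #>\<^bsub>F\<^esub> frag_of x"

sublocale F: comm_group F by (rule abelian_free_Abelian_group)

lemma N_subgroup: "subgroup (generate F R) F" by (rule F.generate_is_subgroup[OF R])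
lemma N_normal: "generate F R \<lhd> F" using N_subgroup by (simp add: F.normal_iff_subgroup)

sublocale Q: comm_group Q by (rule F.abelian_FactGroup[OF N_subgroup])

lemma proj_hom: "(\<lambda>u. generate F R #>\<^bsub>F\<^esub> u) \<in> hom F Q"
  by (rule normal.r_coset_hom_Mod[OF N_normal])

lemma cls_closed: "x \<in> S \<Longrightarrow> cls x \<in> carrier Q"
  unfolding cls_def by (rule hom_in_carrier[OF proj_hom]) simp

lemma cls_generate: "generate Q (cls ` S) = carrier Q"
proof -
  have "generate Q ((\<lambda>x. generate F R #>\<^bsub>F\<^esub> x) ` frag_of ` S) = carrier Q"
    by (rule quotient_generate[OF N_normal _ free_Abelian_group_generate]) auto
  then show ?thesis by (simp add: image_image cls_def)
qed

lemma proj_rel: "r \<in> R \<Longrightarrow> generate F R #>\<^bsub>F\<^esub> r = \<one>\<^bsub>Q\<^esub>"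
  using F.coset_join2[OF _ N_subgroup] R generate.incl[of r R F] by auto

lemma cls_rel1: "frag_of a \<in> R \<Longrightarrow> cls a = \<one>\<^bsub>Q\<^esub>"
  unfolding cls_def by (rule proj_rel)

lemma frag_closed: "a \<in> S \<Longrightarrow> frag_of a \<in> carrier F"
  by simp

lemma cls_rel2:
  assumes "frag_of a - frag_of b \<in> R" "a \<in> S" "b \<in> S"
  shows "cls a = cls b"
proof -
  have "cls a \<otimes>\<^bsub>Q\<^esub> inv\<^bsub>Q\<^esub> cls b = \<one>\<^bsub>Q\<^esub>"
    using hom_free_Abelian_group_diff[OF Q.group_axioms proj_hom frag_closed[OF assms(2)] frag_closed[OF assms(3)]]
    unfolding proj_rel[OF assms(1)] cls_def by (rule sym)
  then show ?thesis
    using cls_closed assms by (metis Q.inv_closed Q.inv_equality Q.inv_inv)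
qed

lemma cls_rel3:
  assumes "frag_of a - frag_of b - frag_of d \<in> R" "a \<in> S" "b \<in> S" "d \<in> S"
  shows "cls a = cls b \<otimes>\<^bsub>Q\<^esub> cls d"
proof -
  note fc = frag_closed[OF assms(2)] frag_closed[OF assms(3)] frag_closed[OF assms(4)]
  have c: "cls a \<in> carrier Q" "cls b \<in> carrier Q" "cls d \<in> carrier Q"
    by (rule cls_closed, fact)+
  have "generate F R #>\<^bsub>F\<^esub> (frag_of a - frag_of b - frag_of d) = cls a \<otimes>\<^bsub>Q\<^esub> inv\<^bsub>Q\<^esub> cls b \<otimes>\<^bsub>Q\<^esub> inv\<^bsub>Q\<^esub> cls d"
    unfolding cls_def hom_free_Abelian_group_diff[OF Q.group_axioms proj_hom diff_closed_free_Abelian_group[OF fc(1,2)] fc(3)]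
      hom_free_Abelian_group_diff[OF Q.group_axioms proj_hom fc(1,2)] ..
  then have "cls a \<otimes>\<^bsub>Q\<^esub> (inv\<^bsub>Q\<^esub> cls b \<otimes>\<^bsub>Q\<^esub> inv\<^bsub>Q\<^esub> cls d) = \<one>\<^bsub>Q\<^esub>"
    unfolding proj_rel[OF assms(1)] using Q.m_assoc[OF c(1) Q.inv_closed[OF c(2)] Q.inv_closed[OF c(3)]] by metis
  then have "cls a \<otimes>\<^bsub>Q\<^esub> inv\<^bsub>Q\<^esub> (cls b \<otimes>\<^bsub>Q\<^esub> cls d) = \<one>\<^bsub>Q\<^esub>"
    unfolding Q.inv_mult[OF c(2,3)] .
  then have "inv\<^bsub>Q\<^esub> (inv\<^bsub>Q\<^esub> (cls b \<otimes>\<^bsub>Q\<^esub> cls d)) = cls a"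
    by (rule Q.inv_equality) (intro Q.inv_closed Q.m_closed c)+
  then show ?thesis using Q.inv_inv[OF Q.m_closed[OF c(2,3)]] by metis
qed

lemma hom_rel2:
  assumes "comm_group C" "h \<in> hom F C" "a \<in> S" "b \<in> S" "h (frag_of a) = h (frag_of b)"
  shows "h (frag_of a - frag_of b) = \<one>\<^bsub>C\<^esub>"
proof -
  interpret C: comm_group C by fact
  have "h (frag_of b) \<in> carrier C" by (rule hom_in_carrier[OF assms(2) frag_closed[OF assms(4)]])
  then show ?thesis
    unfolding hom_free_Abelian_group_diff[OF C.group_axioms assms(2) frag_closed[OF assms(3)] frag_closed[OF assms(4)]] assms(5)
    by (rule C.r_inv)
qed

lemma hom_rel3:
  assumes C: "comm_group C" and h: "h \<in> hom F C" and abd: "a \<in> S" "b \<in> S" "d \<in> S"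
    and eq: "h (frag_of a) = h (frag_of b) \<otimes>\<^bsub>C\<^esub> h (frag_of d)"
  shows "h (frag_of a - frag_of b - frag_of d) = \<one>\<^bsub>C\<^esub>"
proof -
  interpret C: comm_group C by fact
  note fc = frag_closed[OF abd(1)] frag_closed[OF abd(2)] frag_closed[OF abd(3)]
  have c: "h (frag_of a) \<in> carrier C" "h (frag_of b) \<in> carrier C" "h (frag_of d) \<in> carrier C"
    by (rule hom_in_carrier[OF h], fact)+
  have "h (frag_of a - frag_of b - frag_of d) = h (frag_of a) \<otimes>\<^bsub>C\<^esub> inv\<^bsub>C\<^esub> h (frag_of b) \<otimes>\<^bsub>C\<^esub> inv\<^bsub>C\<^esub> h (frag_of d)"
    unfolding hom_free_Abelian_group_diff[OF C.group_axioms h diff_closed_free_Abelian_group[OF fc(1,2)] fc(3)]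
      hom_free_Abelian_group_diff[OF C.group_axioms h fc(1,2)] ..
  also have "\<dots> = h (frag_of b) \<otimes>\<^bsub>C\<^esub> h (frag_of d) \<otimes>\<^bsub>C\<^esub> inv\<^bsub>C\<^esub> (h (frag_of b) \<otimes>\<^bsub>C\<^esub> h (frag_of d))"
    unfolding eq using c by (simp add: C.inv_mult C.m_assoc)
  also have "\<dots> = \<one>\<^bsub>C\<^esub>" using c by simp
  finally show ?thesis .
qed

lemma universal:
  assumes C: "comm_group C" and f: "f ` S \<subseteq> carrier C"
    and rel: "\<And>h r. h \<in> hom F C \<Longrightarrow> (\<And>x. x \<in> S \<Longrightarrow> h (frag_of x) = f x) \<Longrightarrow> r \<in> R \<Longrightarrow> h r = \<one>\<^bsub>C\<^esub>"
  shows "\<exists>h\<in>hom Q C. \<forall>x\<in>S. h (cls x) = f x"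
proof -
  obtain h where h: "h \<in> hom F C" "\<And>x. x \<in> S \<Longrightarrow> h (frag_of x) = f x"
    using comm_group.free_Abelian_group_universal[OF C f] by blast
  have "Group.group C" using C by (simp add: comm_group_def)
  then have "\<exists>h'\<in>hom Q C. \<forall>x\<in>carrier F. h' (generate F R #>\<^bsub>F\<^esub> x) = h x"
    by (rule quotient_universal[OF abelian_free_Abelian_group _ R h(1)]) (rule rel[OF h])
  then obtain h' where h': "h' \<in> hom Q C" "\<forall>x\<in>carrier F. h' (generate F R #>\<^bsub>F\<^esub> x) = h x"
    by (elim bexE)
  show ?thesis
  proof (intro bexI[of _ h'] ballI)
    fix x assume x: "x \<in> S"
    then show "h' (cls x) = f x" using h'(2) frag_closed[OF x] h(2)[OF x] by (simp only: cls_def)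
  qed (rule h'(1))
qed

end

lemma hom_by_spec:
  assumes "\<exists>h\<in>hom A B. \<forall>i\<in>J. h (s i) = t i"
  shows "hom_by A B J s t \<in> hom A B" "i \<in> J \<Longrightarrow> hom_by A B J s t (s i) = t i"
  using someI_ex[of "\<lambda>h. h \<in> hom A B \<and> (\<forall>i\<in>J. h (s i) = t i)"] assms unfolding hom_by_def by blast+

section \<open>Additive groups and groups of homomorphisms\<close>

lemma add_group_simps [simp]:
  "carrier (add_group V) = V" "x \<otimes>\<^bsub>add_group V\<^esub> y = x + y" "\<one>\<^bsub>add_group V\<^esub> = 0"
  by (simp_all add: add_group_def)

lemma comm_group_add_group: "add_subgroup V \<Longrightarrow> comm_group (add_group V)"
proof (rule group.group_comm_groupI)
  assume V: "add_subgroup V"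
  show "Group.group (add_group V)"
  proof (rule groupI)
    fix x assume x: "x \<in> carrier (add_group V)"
    then have "0 - x \<in> V" using V unfolding add_subgroup_def add_group_simps by blast
    then show "\<exists>y\<in>carrier (add_group V). y \<otimes>\<^bsub>add_group V\<^esub> x = \<one>\<^bsub>add_group V\<^esub>"
      by (intro bexI[of _ "- x"]) auto
  qed (use V in \<open>auto simp: add_subgroup_def add.assoc\<close>)
qed (auto simp: add.commute)

lemma inv_add_group:
  assumes "add_subgroup V" "x \<in> V" shows "inv\<^bsub>add_group V\<^esub> x = - x"
proof -
  interpret comm_group "add_group V" by (rule comm_group_add_group) fact
  have "0 - x \<in> V" using assms unfolding add_subgroup_def by blast
  then show ?thesis using assms by (intro inv_equality) auto
qed

lemma int_pow_add_group:
  fixes V :: "'v::real_vector set"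
  assumes "add_subgroup V" "x \<in> V" shows "x [^]\<^bsub>add_group V\<^esub> (n::int) = of_int n *\<^sub>R x"
proof -
  interpret comm_group "add_group V" by (rule comm_group_add_group) fact
  have nat: "x [^]\<^bsub>add_group V\<^esub> (k::nat) = real k *\<^sub>R x" for k
    by (induction k) (simp_all add: algebra_simps)
  show ?thesis
  proof (cases n rule: int_cases2)
    case (nonneg k)
    then show ?thesis by (simp add: int_pow_int nat)
  next
    case (nonpos k)
    have "x [^]\<^bsub>add_group V\<^esub> k \<in> V" using nat_pow_closed[of x k] assms by simp
    then show ?thesis using nonpos assms by (simp add: int_pow_neg int_pow_int inv_add_group nat)
  qed
qed

lemma add_subgroup_UNIV [simp]: "add_subgroup UNIV"
  by (simp add: add_subgroup_def)

lemma subspace_add_subgroup: "subspace V \<Longrightarrow> add_subgroup V"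
  by (auto simp: add_subgroup_def subspace_0 subspace_add subspace_diff)

lemma Hom_group_simps:
  "carrier (Hom_group A B) = hom A B \<inter> extensional (carrier A)"
  "f \<otimes>\<^bsub>Hom_group A B\<^esub> f' = (\<lambda>x\<in>carrier A. f x \<otimes>\<^bsub>B\<^esub> f' x)"
  "\<one>\<^bsub>Hom_group A B\<^esub> = (\<lambda>x\<in>carrier A. \<one>\<^bsub>B\<^esub>)"
  by (simp_all add: Hom_group_def)

lemma restrict_hom: "Group.group A \<Longrightarrow> f \<in> hom A B \<Longrightarrow> restrict f (carrier A) \<in> hom A B"
  by (auto simp: hom_def Pi_iff group.is_monoid monoid.m_closed)

lemma comm_group_Hom_group:
  assumes "Group.group A" "comm_group B"
  shows "comm_group (Hom_group A B)"
proof -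
  interpret A: Group.group A by fact
  interpret B: comm_group B by fact
  have closed: "f x \<in> carrier B" if "f \<in> hom A B" "x \<in> carrier A" for f x using that by (rule hom_in_carrier)
  show ?thesis
  proof (rule comm_groupI, unfold Hom_group_simps)
    fix f h assume f: "f \<in> hom A B \<inter> extensional (carrier A)" and h: "h \<in> hom A B \<inter> extensional (carrier A)"
    show "(\<lambda>x\<in>carrier A. f x \<otimes>\<^bsub>B\<^esub> h x) \<in> hom A B \<inter> extensional (carrier A)"
      using f h closed by (auto intro!: restrict_hom[OF assms(1)] homI simp: hom_mult B.m_ac)
    show "(\<lambda>x\<in>carrier A. f x \<otimes>\<^bsub>B\<^esub> h x) = (\<lambda>x\<in>carrier A. h x \<otimes>\<^bsub>B\<^esub> f x)"
      using f h closed by (auto intro!: restrict_ext simp: B.m_comm)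
    fix k assume k: "k \<in> hom A B \<inter> extensional (carrier A)"
    show "(\<lambda>x\<in>carrier A. (\<lambda>x\<in>carrier A. f x \<otimes>\<^bsub>B\<^esub> h x) x \<otimes>\<^bsub>B\<^esub> k x) =
        (\<lambda>x\<in>carrier A. f x \<otimes>\<^bsub>B\<^esub> (\<lambda>x\<in>carrier A. h x \<otimes>\<^bsub>B\<^esub> k x) x)"
      using f h k closed by (auto intro!: restrict_ext simp: B.m_assoc)
  next
    show "(\<lambda>x\<in>carrier A. \<one>\<^bsub>B\<^esub>) \<in> hom A B \<inter> extensional (carrier A)"
      by (auto intro!: restrict_hom[OF assms(1)] homI)
    fix f assume f: "f \<in> hom A B \<inter> extensional (carrier A)"
    then show "(\<lambda>x\<in>carrier A. (\<lambda>x\<in>carrier A. \<one>\<^bsub>B\<^esub>) x \<otimes>\<^bsub>B\<^esub> f x) = f"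
      using closed by (auto simp: restrict_def extensional_def fun_eq_iff)
    show "\<exists>h\<in>hom A B \<inter> extensional (carrier A). (\<lambda>x\<in>carrier A. h x \<otimes>\<^bsub>B\<^esub> f x) = (\<lambda>x\<in>carrier A. \<one>\<^bsub>B\<^esub>)"
    proof (rule bexI[of _ "\<lambda>x\<in>carrier A. inv\<^bsub>B\<^esub> f x"])
      show "(\<lambda>x\<in>carrier A. (\<lambda>x\<in>carrier A. inv\<^bsub>B\<^esub> f x) x \<otimes>\<^bsub>B\<^esub> f x) = (\<lambda>x\<in>carrier A. \<one>\<^bsub>B\<^esub>)"
        using f closed by (auto intro!: restrict_ext)
      show "(\<lambda>x\<in>carrier A. inv\<^bsub>B\<^esub> f x) \<in> hom A B \<inter> extensional (carrier A)"
        using f closed by (auto intro!: restrict_hom[OF assms(1)] homI simp: hom_mult B.inv_mult)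
    qed
  qed
qed

lemma Hom_group_eval:
  assumes "Group.group A" "comm_group B" "x \<in> carrier A"
  shows "(\<lambda>f. f x) \<in> hom (Hom_group A B) B"
  by (rule homI) (use assms in \<open>auto simp: Hom_group_simps hom_in_carrier\<close>)

lemma Hom_group_eqI:
  assumes "f \<in> carrier (Hom_group A B)" "h \<in> carrier (Hom_group A B)" "\<And>x. x \<in> carrier A \<Longrightarrow> f x = h x"
  shows "f = h"
  using assms by (auto simp: Hom_group_simps intro: extensionalityI)

section \<open>Tensor products\<close>

locale tensor_pair = A: comm_group A + B: comm_group B for A :: "('a, 'm) monoid_scheme" and B :: "('b, 'n) monoid_scheme"
begin

lemma tensor_rels_closed: "tensor_rels A B \<subseteq> carrier (free_Abelian_group (carrier A \<times> carrier B))"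
proof -
  have "frag_of a - frag_of b - frag_of d \<in> carrier (free_Abelian_group (carrier A \<times> carrier B))"
    if "a \<in> carrier A \<times> carrier B" "b \<in> carrier A \<times> carrier B" "d \<in> carrier A \<times> carrier B" for a b d
    using that by (intro diff_closed_free_Abelian_group) (simp_all only: frag_of_in_free_Abelian_group)
  then show ?thesis unfolding tensor_rels_def by (auto simp del: carrier_free_Abelian_group_iff)
qed

sublocale T: presented "carrier A \<times> carrier B" "tensor_rels A B"
  by unfold_locales (rule tensor_rels_closed)

lemma tensor_eq: "tensor A B = T.Q"
  by (simp add: tensor_def tensor_subgroup_def)

lemma tens_eq: "tens A B x y = T.cls (x, y)"
  by (simp add: tens_def T.cls_def tensor_subgroup_def)

lemma comm_group_tensor: "comm_group (tensor A B)"
  unfolding tensor_eq by (rule T.Q.comm_group_axioms)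

lemma tens_closed: "x \<in> carrier A \<Longrightarrow> y \<in> carrier B \<Longrightarrow> tens A B x y \<in> carrier (tensor A B)"
  unfolding tens_eq tensor_eq by (rule T.cls_closed) simp

lemma tens_mult_left:
  "x \<in> carrier A \<Longrightarrow> x' \<in> carrier A \<Longrightarrow> y \<in> carrier B \<Longrightarrow>
     tens A B (x \<otimes>\<^bsub>A\<^esub> x') y = tens A B x y \<otimes>\<^bsub>tensor A B\<^esub> tens A B x' y"
  unfolding tens_eq tensor_eq by (rule T.cls_rel3) (auto simp: tensor_rels_def)

lemma tens_mult_right:
  "x \<in> carrier A \<Longrightarrow> y \<in> carrier B \<Longrightarrow> y' \<in> carrier B \<Longrightarrow>
     tens A B x (y \<otimes>\<^bsub>B\<^esub> y') = tens A B x y \<otimes>\<^bsub>tensor A B\<^esub> tens A B x y'"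
  unfolding tens_eq tensor_eq by (rule T.cls_rel3) (auto simp: tensor_rels_def)

lemma tens_hom_left: "y \<in> carrier B \<Longrightarrow> (\<lambda>x. tens A B x y) \<in> hom A (tensor A B)"
  by (rule homI) (simp_all add: tens_closed tens_mult_left)

lemma tens_hom_right: "x \<in> carrier A \<Longrightarrow> tens A B x \<in> hom B (tensor A B)"
  by (rule homI) (simp_all add: tens_closed tens_mult_right)

lemma tensor_generate:
  "generate (tensor A B) {tens A B x y | x y. x \<in> carrier A \<and> y \<in> carrier B} = carrier (tensor A B)"
proof -
  have "{tens A B x y | x y. x \<in> carrier A \<and> y \<in> carrier B} = T.cls ` (carrier A \<times> carrier B)"
    by (auto simp: tens_eq)
  then show ?thesis unfolding tensor_eq using T.cls_generate by simp
qed

lemma tensor_universal: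
  assumes C: "comm_group C"
    and closed: "\<And>x y. x \<in> carrier A \<Longrightarrow> y \<in> carrier B \<Longrightarrow> f x y \<in> carrier C"
    and left: "\<And>x x' y. x \<in> carrier A \<Longrightarrow> x' \<in> carrier A \<Longrightarrow> y \<in> carrier B \<Longrightarrow> f (x \<otimes>\<^bsub>A\<^esub> x') y = f x y \<otimes>\<^bsub>C\<^esub> f x' y"
    and right: "\<And>x y y'. x \<in> carrier A \<Longrightarrow> y \<in> carrier B \<Longrightarrow> y' \<in> carrier B \<Longrightarrow> f x (y \<otimes>\<^bsub>B\<^esub> y') = f x y \<otimes>\<^bsub>C\<^esub> f x y'"
  shows "\<exists>h\<in>hom (tensor A B) C. \<forall>p\<in>carrier A \<times> carrier B. h (case p of (x, y) \<Rightarrow> tens A B x y) = (case p of (x, y) \<Rightarrow> f x y)"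
proof -
  interpret C: comm_group C by fact
  have "\<exists>h\<in>hom T.Q C. \<forall>p\<in>carrier A \<times> carrier B. h (T.cls p) = case_prod f p"
  proof (rule T.universal[OF C])
    show "case_prod f ` (carrier A \<times> carrier B) \<subseteq> carrier C" using closed by auto
    fix h r assume h: "h \<in> hom T.F C" and hf: "\<And>p. p \<in> carrier A \<times> carrier B \<Longrightarrow> h (frag_of p) = case_prod f p"
      and r: "r \<in> tensor_rels A B"
    from r consider
      (l) x x' y where "r = frag_of (x \<otimes>\<^bsub>A\<^esub> x', y) - frag_of (x, y) - frag_of (x', y)" "x \<in> carrier A" "x' \<in> carrier A" "y \<in> carrier B"
      | (r) x y y' where "r = frag_of (x, y \<otimes>\<^bsub>B\<^esub> y') - frag_of (x, y) - frag_of (x, y')" "x \<in> carrier A" "y \<in> carrier B" "y' \<in> carrier B"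
      unfolding tensor_rels_def by blast
    then show "h r = \<one>\<^bsub>C\<^esub>"
    proof cases
      case l
      show ?thesis unfolding l(1) by (rule T.hom_rel3[OF C.comm_group_axioms h]) (use l(2-) in \<open>auto simp: hf left\<close>)
    next
      case r
      show ?thesis unfolding r(1) by (rule T.hom_rel3[OF C.comm_group_axioms h]) (use r(2-) in \<open>auto simp: hf right\<close>)
    qed
  qed
  then show ?thesis by (auto simp: tens_eq tensor_eq)
qed

end

lemma tensor_map_spec:
  assumes "comm_group A" "comm_group B" "comm_group B'" "f \<in> hom B B'"
  shows "tensor_map A B B' f \<in> hom (tensor A B) (tensor A B')"
    "x \<in> carrier A \<Longrightarrow> y \<in> carrier B \<Longrightarrow> tensor_map A B B' f (tens A B x y) = tens A B' x (f y)"
proof -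
  interpret AB: tensor_pair A B using assms by (simp add: tensor_pair_def)
  interpret AB': tensor_pair A B' using assms by (simp add: tensor_pair_def)
  have f: "f y \<in> carrier B'" if "y \<in> carrier B" for y using hom_in_carrier[OF assms(4) that] .
  have ex: "\<exists>h\<in>hom (tensor A B) (tensor A B'). \<forall>p\<in>carrier A \<times> carrier B.
      h (case p of (x, y) \<Rightarrow> tens A B x y) = (case p of (x, y) \<Rightarrow> tens A B' x (f y))"
    by (rule AB.tensor_universal[OF AB'.comm_group_tensor])
      (auto simp: f AB'.tens_closed AB'.tens_mult_left AB'.tens_mult_right hom_mult[OF assms(4)])
  show "tensor_map A B B' f \<in> hom (tensor A B) (tensor A B')"
    unfolding tensor_map_def by (rule hom_by_spec(1)[OF ex])
  show "tensor_map A B B' f (tens A B x y) = tens A B' x (f y)" if "x \<in> carrier A" "y \<in> carrier B"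
    using hom_by_spec(2)[OF ex, of "(x, y)"] that by (simp add: tensor_map_def)
qed

section \<open>The exterior square and its quotient\<close>

interpretation ext: presented UNIV "ext_rels :: ('v::real_vector \<times> 'v \<Rightarrow>\<^sub>0 int) set"
  by unfold_locales (simp add: subset_iff)

lemma ext_square_eq: "ext_square = ext.Q"
  by (simp add: ext_square_def)

lemma wedge_eq: "wedge x y = ext.cls (x, y)"
  by (simp add: wedge_def ext.cls_def)

lemma comm_group_ext_square: "comm_group ext_square"
  unfolding ext_square_eq by (rule ext.Q.comm_group_axioms)

lemma group_ext_square: "Group.group ext_square"
  using comm_group_ext_square by (rule comm_group.axioms(2))

lemma wedge_closed: "wedge x y \<in> carrier ext_square"
  unfolding ext_square_eq wedge_eq by (rule ext.cls_closed) simp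

lemma wedge_add_left: "wedge (x + x') y = wedge x y \<otimes>\<^bsub>ext_square\<^esub> wedge x' y"
  unfolding ext_square_eq wedge_eq by (rule ext.cls_rel3) (unfold ext_rels_def, blast+)

lemma wedge_add_right: "wedge x (y + y') = wedge x y \<otimes>\<^bsub>ext_square\<^esub> wedge x y'"
  unfolding ext_square_eq wedge_eq by (rule ext.cls_rel3) (unfold ext_rels_def, blast+)

lemma wedge_scaleR: "wedge (r *\<^sub>R x) y = wedge x (r *\<^sub>R y)"
  unfolding wedge_eq by (rule ext.cls_rel2) (unfold ext_rels_def, blast+)

lemma wedge_self: "wedge x x = \<one>\<^bsub>ext_square\<^esub>"
  unfolding ext_square_eq wedge_eq by (rule ext.cls_rel1) (unfold ext_rels_def, blast)

lemma wedge_generate: "generate ext_square {wedge x y | x y. True} = carrier ext_square"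
proof -
  have eq: "{wedge x y | x y. True} = ext.cls ` UNIV" by (auto simp: wedge_eq)
  show ?thesis unfolding ext_square_eq eq by (rule ext.cls_generate)
qed

lemma ext_square_universal:
  fixes f :: "'v::real_vector \<Rightarrow> 'v \<Rightarrow> 'c" and C :: "('c, 'm) monoid_scheme"
  assumes C: "comm_group C" and closed: "\<And>x y. f x y \<in> carrier C"
    and left: "\<And>x x' y. f (x + x') y = f x y \<otimes>\<^bsub>C\<^esub> f x' y"
    and right: "\<And>x y y'. f x (y + y') = f x y \<otimes>\<^bsub>C\<^esub> f x y'"
    and scale: "\<And>r x y. f (r *\<^sub>R x) y = f x (r *\<^sub>R y)"
    and self: "\<And>x. f x x = \<one>\<^bsub>C\<^esub>"
  shows "\<exists>h\<in>hom ext_square C. \<forall>x y. h (wedge x y) = f x y"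
proof -
  have "\<exists>h\<in>hom ext.Q C. \<forall>p\<in>UNIV. h (ext.cls p) = case_prod f p"
  proof (rule ext.universal[OF C])
    show "case_prod f ` UNIV \<subseteq> carrier C" using closed by auto
    fix h :: "('v \<times> 'v \<Rightarrow>\<^sub>0 int) \<Rightarrow> 'c" and r :: "'v \<times> 'v \<Rightarrow>\<^sub>0 int"
    assume h: "h \<in> hom ext.F C" and hf': "\<And>p. p \<in> UNIV \<Longrightarrow> h (frag_of p) = case_prod f p"
      and r: "r \<in> ext_rels"
    have hf: "h (frag_of (x, y)) = f x y" for x y using hf'[of "(x, y)"] by simp
    from r consider
      (1) x x' y where "r = frag_of (x + x', y) - frag_of (x, y) - frag_of (x', y)"
      | (2) x y y' where "r = frag_of (x, y + y') - frag_of (x, y) - frag_of (x, y')"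
      | (3) s x y where "r = frag_of (s *\<^sub>R x, y) - frag_of (x, s *\<^sub>R y)"
      | (4) x where "r = frag_of (x, x)"
      unfolding ext_rels_def by blast
    then show "h r = \<one>\<^bsub>C\<^esub>"
    proof cases
      case 1
      show ?thesis unfolding 1 by (rule ext.hom_rel3[OF C h]) (simp_all only: UNIV_I hf left)
    next
      case 2
      show ?thesis unfolding 2 by (rule ext.hom_rel3[OF C h]) (simp_all only: UNIV_I hf right)
    next
      case 3
      show ?thesis unfolding 3 by (rule ext.hom_rel2[OF C h]) (simp_all only: UNIV_I hf scale)
    next
      case 4
      show ?thesis unfolding 4 by (simp only: hf self)
    qed
  qed
  then show ?thesis by (simp add: wedge_eq ext_square_eq)
qed

abbreviation "wedges W \<equiv> {wedge x y | x y. x \<in> W \<and> y \<in> W}"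

lemma wedges_closed: "wedges W \<subseteq> carrier ext_square"
  using wedge_closed by auto

lemma ext_quot_eq: "ext_quot W = ext_square Mod generate ext_square (wedges W)"
  by (simp add: ext_quot_def ext_square_of_def)

lemma ext_square_of_subgroup: "subgroup (ext_square_of W) ext_square"
  unfolding ext_square_of_def
  by (rule group.generate_is_subgroup[OF group_ext_square wedges_closed])

lemma ext_square_of_normal: "ext_square_of W \<lhd> ext_square"
  using comm_group.normal_iff_subgroup[OF comm_group_ext_square] ext_square_of_subgroup by blast

lemma comm_group_ext_quot: "comm_group (ext_quot W)"
  unfolding ext_quot_def by (rule comm_group.abelian_FactGroup[OF comm_group_ext_square ext_square_of_subgroup])

lemma group_ext_quot: "Group.group (ext_quot W)"
  using comm_group_ext_quot by (rule comm_group.axioms(2))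

lemma ext_proj_hom: "(\<lambda>u. ext_square_of W #>\<^bsub>ext_square\<^esub> u) \<in> hom ext_square (ext_quot W)"
  unfolding ext_quot_def by (rule normal.r_coset_hom_Mod[OF ext_square_of_normal])

lemma qwedge_closed: "qwedge W x y \<in> carrier (ext_quot W)"
  unfolding qwedge_def by (rule hom_in_carrier[OF ext_proj_hom wedge_closed])

lemma qwedge_add_left: "qwedge W (x + x') y = qwedge W x y \<otimes>\<^bsub>ext_quot W\<^esub> qwedge W x' y"
  unfolding qwedge_def wedge_add_left by (rule hom_mult[OF ext_proj_hom wedge_closed wedge_closed])

lemma qwedge_add_right: "qwedge W x (y + y') = qwedge W x y \<otimes>\<^bsub>ext_quot W\<^esub> qwedge W x y'"
  unfolding qwedge_def wedge_add_right by (rule hom_mult[OF ext_proj_hom wedge_closed wedge_closed])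

lemma qwedge_scaleR: "qwedge W (r *\<^sub>R x) y = qwedge W x (r *\<^sub>R y)"
  unfolding qwedge_def wedge_scaleR ..

lemma qwedge_self: "qwedge W x x = \<one>\<^bsub>ext_quot W\<^esub>"
proof -
  interpret group_hom ext_square "ext_quot W" "\<lambda>u. ext_square_of W #>\<^bsub>ext_square\<^esub> u"
    by (intro group_hom.intro group_hom_axioms.intro group_ext_square group_ext_quot ext_proj_hom)
  show ?thesis unfolding qwedge_def wedge_self by (rule hom_one)
qed

lemma qwedge_W: "x \<in> W \<Longrightarrow> y \<in> W \<Longrightarrow> qwedge W x y = \<one>\<^bsub>ext_quot W\<^esub>"
proof -
  assume "x \<in> W" "y \<in> W"
  then have "wedge x y \<in> ext_square_of W" unfolding ext_square_of_def by (intro generate.incl) blast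
  then show ?thesis
    using group.coset_join2[OF group_ext_square wedge_closed ext_square_of_subgroup]
    by (simp add: qwedge_def ext_quot_def)
qed

lemma ext_quot_generate: "generate (ext_quot W) {qwedge W x y | x y. True} = carrier (ext_quot W)"
proof -
  have "generate (ext_quot W) ((\<lambda>u. ext_square_of W #>\<^bsub>ext_square\<^esub> u) ` {wedge x y | x y. True}) = carrier (ext_quot W)"
    unfolding ext_quot_def by (rule quotient_generate[OF ext_square_of_normal _ wedge_generate]) (use wedge_closed in auto)
  moreover have "(\<lambda>u. ext_square_of W #>\<^bsub>ext_square\<^esub> u) ` {wedge x y | x y. True} = {qwedge W x y | x y. True}"
    by (auto simp: qwedge_def)
  ultimately show ?thesis by simp
qed

text \<open>Stated with pairs, so that it feeds \<open>hom_by_spec\<close> directly.\<close>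

lemma ext_quot_universal:
  assumes C: "comm_group C" and closed: "\<And>x y. f x y \<in> carrier C"
    and "\<And>x x' y. f (x + x') y = f x y \<otimes>\<^bsub>C\<^esub> f x' y"
    and "\<And>x y y'. f x (y + y') = f x y \<otimes>\<^bsub>C\<^esub> f x y'"
    and "\<And>r x y. f (r *\<^sub>R x) y = f x (r *\<^sub>R y)"
    and "\<And>x. f x x = \<one>\<^bsub>C\<^esub>"
    and W: "\<And>x y. x \<in> W \<Longrightarrow> y \<in> W \<Longrightarrow> f x y = \<one>\<^bsub>C\<^esub>"
  shows "\<exists>h\<in>hom (ext_quot W) C. \<forall>p\<in>UNIV. h (case p of (x, y) \<Rightarrow> qwedge W x y) = (case p of (x, y) \<Rightarrow> f x y)"
proof -
  obtain h where h: "h \<in> hom ext_square C" "\<And>x y. h (wedge x y) = f x y"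
    using ext_square_universal[of C f, OF assms(1-6)] by blast
  have "\<exists>h'\<in>hom (ext_quot W) C. \<forall>x\<in>carrier ext_square. h' (generate ext_square (wedges W) #>\<^bsub>ext_square\<^esub> x) = h x"
    unfolding ext_quot_eq
    by (rule quotient_universal[OF comm_group_ext_square _ wedges_closed h(1)])
      (use C W h(2) in \<open>auto simp: comm_group_def\<close>)
  then obtain h' where h': "h' \<in> hom (ext_quot W) C"
    "\<forall>x\<in>carrier ext_square. h' (generate ext_square (wedges W) #>\<^bsub>ext_square\<^esub> x) = h x" by (elim bexE)
  have "h' (qwedge W x y) = f x y" for x y
    using h'(2) wedge_closed[of x y] h(2) by (simp only: qwedge_def ext_square_of_def)
  then show ?thesis using h'(1) by (intro bexI[of _ h']) auto
qed

section \<open>Duality on a symplectic lattice\<close>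

locale symplectic_basis = H: comm_group H for H :: "('h, 'm) monoid_scheme" +
  fixes g :: nat and \<alpha> \<beta> :: "nat \<Rightarrow> 'h" and I :: "'h \<Rightarrow> 'h \<Rightarrow> int"
  assumes \<alpha> [simp]: "i \<in> {1..g} \<Longrightarrow> \<alpha> i \<in> carrier H" and \<beta> [simp]: "i \<in> {1..g} \<Longrightarrow> \<beta> i \<in> carrier H"
    and gen: "generate H (\<alpha> ` {1..g} \<union> \<beta> ` {1..g}) = carrier H"
    and form: "intersection_form g H \<alpha> \<beta> I"
begin

lemma I_mult: "x \<in> carrier H \<Longrightarrow> y \<in> carrier H \<Longrightarrow> z \<in> carrier H \<Longrightarrow> I (x \<otimes>\<^bsub>H\<^esub> y) z = I x z + I y z"
  "x \<in> carrier H \<Longrightarrow> y \<in> carrier H \<Longrightarrow> z \<in> carrier H \<Longrightarrow> I z (x \<otimes>\<^bsub>H\<^esub> y) = I z x + I z y"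
  using form by (auto simp: intersection_form_def)

lemma I_self: "x \<in> carrier H \<Longrightarrow> I x x = 0"
  using form by (auto simp: intersection_form_def)

lemma I_skew: assumes "x \<in> carrier H" "y \<in> carrier H" shows "I y x = - I x y"
proof -
  have "I (x \<otimes>\<^bsub>H\<^esub> y) (x \<otimes>\<^bsub>H\<^esub> y) = 0" using assms by (intro I_self) simp
  then have "I x x + I x y + (I y x + I y y) = 0" using assms by (simp add: I_mult)
  then show ?thesis using I_self[OF assms(1)] I_self[OF assms(2)] by linarith
qed

lemma I_basis:
  assumes "i \<in> {1..g}" "j \<in> {1..g}"
  shows "I (\<alpha> i) (\<alpha> j) = 0" "I (\<beta> i) (\<beta> j) = 0" "I (\<alpha> i) (\<beta> j) = (if i = j then 1 else 0)"
    "I (\<beta> i) (\<alpha> j) = (if i = j then -1 else 0)"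
proof -
  show "I (\<alpha> i) (\<alpha> j) = 0" "I (\<beta> i) (\<beta> j) = 0" "I (\<alpha> i) (\<beta> j) = (if i = j then 1 else 0)"
    using form assms by (auto simp: intersection_form_def)
  have "I (\<beta> i) (\<alpha> j) = - I (\<alpha> j) (\<beta> i)" by (rule I_skew) (use assms in auto)
  also have "I (\<alpha> j) (\<beta> i) = (if i = j then 1 else 0)"
    using form assms by (auto simp: intersection_form_def)
  finally show "I (\<beta> i) (\<alpha> j) = (if i = j then -1 else 0)" by simp
qed

lemma hom_eqI:
  assumes "Group.group K" "f \<in> hom H K" "h \<in> hom H K"
    "\<And>i. i \<in> {1..g} \<Longrightarrow> f (\<alpha> i) = h (\<alpha> i)" "\<And>i. i \<in> {1..g} \<Longrightarrow> f (\<beta> i) = h (\<beta> i)" "x \<in> carrier H"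
  shows "f x = h x"
  by (rule hom_eq_on_generate[OF H.group_axioms assms(1-3), of "\<alpha> ` {1..g} \<union> \<beta> ` {1..g}"])
    (use assms(4-6) gen in auto)

lemma pow_hom_left:
  assumes "comm_group M" "m \<in> carrier M" "y \<in> carrier H"
  shows "(\<lambda>x. m [^]\<^bsub>M\<^esub> I x y) \<in> hom H M"
proof -
  interpret comm_group M by fact
  show ?thesis by (rule homI) (use assms in \<open>auto simp: I_mult int_pow_mult\<close>)
qed

lemma pow_hom_right:
  assumes "comm_group M" "m \<in> carrier M" "x \<in> carrier H"
  shows "(\<lambda>y. m [^]\<^bsub>M\<^esub> I x y) \<in> hom H M"
proof -
  interpret comm_group M by fact
  show ?thesis by (rule homI) (use assms in \<open>auto simp: I_mult int_pow_mult\<close>)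
qed

lemma finprod_hom:
  assumes "comm_group M" "\<And>i. i \<in> J \<Longrightarrow> f i \<in> hom H M"
  shows "(\<lambda>y. finprod M (\<lambda>i. f i y) J) \<in> hom H M"
proof -
  interpret comm_group M by fact
  have c: "f i y \<in> carrier M" if "i \<in> J" "y \<in> carrier H" for i y using hom_in_carrier[OF assms(2)] that by blast
  show ?thesis
  proof (rule homI)
    show "finprod M (\<lambda>i. f i y) J \<in> carrier M" if "y \<in> carrier H" for y
      using c that by (intro finprod_closed) auto
    fix x y assume xy: "x \<in> carrier H" "y \<in> carrier H"
    have "finprod M (\<lambda>i. f i (x \<otimes>\<^bsub>H\<^esub> y)) J = finprod M (\<lambda>i. f i x \<otimes>\<^bsub>M\<^esub> f i y) J"
      by (rule finprod_cong') (use c xy hom_mult[OF assms(2)] in auto)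
    also have "\<dots> = finprod M (\<lambda>i. f i x) J \<otimes>\<^bsub>M\<^esub> finprod M (\<lambda>i. f i y) J"
      by (rule finprod_multf) (use c xy in auto)
    finally show "finprod M (\<lambda>i. f i (x \<otimes>\<^bsub>H\<^esub> y)) J = finprod M (\<lambda>i. f i x) J \<otimes>\<^bsub>M\<^esub> finprod M (\<lambda>i. f i y) J" .
  qed
qed

lemma hom_mult_hom:
  assumes "comm_group M" "f \<in> hom H M" "f' \<in> hom H M"
  shows "(\<lambda>y. f y \<otimes>\<^bsub>M\<^esub> f' y) \<in> hom H M"
proof -
  interpret comm_group M by fact
  show ?thesis
    by (rule homI) (use assms hom_in_carrier[OF assms(2)] hom_in_carrier[OF assms(3)] in \<open>auto simp: hom_mult m_ac\<close>)
qed

text \<open>Both sides are homomorphisms in \<open>y\<close>, and for \<open>y\<close> in the basis only one factor of the product survives.\<close>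

lemma expansion:
  assumes M: "comm_group M" and \<phi>: "\<phi> \<in> hom H M" and y: "y \<in> carrier H"
  shows "\<phi> y = finprod M (\<lambda>i. \<phi> (\<beta> i) [^]\<^bsub>M\<^esub> I (\<alpha> i) y \<otimes>\<^bsub>M\<^esub> \<phi> (\<alpha> i) [^]\<^bsub>M\<^esub> I y (\<beta> i)) {1..g}"
proof -
  interpret M: comm_group M by fact
  have c: "\<phi> x \<in> carrier M" if "x \<in> carrier H" for x using hom_in_carrier[OF \<phi> that] .
  have "(\<lambda>y. finprod M (\<lambda>i. \<phi> (\<beta> i) [^]\<^bsub>M\<^esub> I (\<alpha> i) y \<otimes>\<^bsub>M\<^esub> \<phi> (\<alpha> i) [^]\<^bsub>M\<^esub> I y (\<beta> i)) {1..g}) \<in> hom H M"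
    by (intro finprod_hom hom_mult_hom pow_hom_left pow_hom_right M) (auto intro: c)
  then show ?thesis
  proof (rule hom_eqI[OF M.group_axioms \<phi> _ _ _ y])
    fix j assume j: "j \<in> {1..g}"
    show "\<phi> (\<alpha> j) = finprod M (\<lambda>i. \<phi> (\<beta> i) [^]\<^bsub>M\<^esub> I (\<alpha> i) (\<alpha> j) \<otimes>\<^bsub>M\<^esub> \<phi> (\<alpha> i) [^]\<^bsub>M\<^esub> I (\<alpha> j) (\<beta> i)) {1..g}"
      by (rule finprod_delta[symmetric, OF M _ j]) (use j c in \<open>auto simp: I_basis\<close>)
    show "\<phi> (\<beta> j) = finprod M (\<lambda>i. \<phi> (\<beta> i) [^]\<^bsub>M\<^esub> I (\<alpha> i) (\<beta> j) \<otimes>\<^bsub>M\<^esub> \<phi> (\<alpha> i) [^]\<^bsub>M\<^esub> I (\<beta> j) (\<beta> i)) {1..g}"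
      by (rule finprod_delta[symmetric, OF M _ j]) (use j c in \<open>auto simp: I_basis\<close>)
  qed
qed

lemma I_nondegenerate:
  assumes "x \<in> carrier H" "\<And>y. y \<in> carrier H \<Longrightarrow> I y x = 0"
  shows "x = \<one>\<^bsub>H\<^esub>"
proof -
  have 0: "I x y = 0" if "y \<in> carrier H" for y using assms I_skew[OF that assms(1)] that by simp
  have "x = finprod H (\<lambda>i. \<beta> i [^]\<^bsub>H\<^esub> I (\<alpha> i) x \<otimes>\<^bsub>H\<^esub> \<alpha> i [^]\<^bsub>H\<^esub> I x (\<beta> i)) {1..g}"
    by (rule expansion[OF H.comm_group_axioms, of "\<lambda>x. x"]) (use assms in \<open>auto intro: homI\<close>)
  also have "\<dots> = finprod H (\<lambda>i. \<one>\<^bsub>H\<^esub>) {1..g}"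
    by (rule H.finprod_cong') (use assms 0 in auto)
  also have "\<dots> = \<one>\<^bsub>H\<^esub>" by simp
  finally show ?thesis .
qed

abbreviation "dual M \<equiv> duality H I M"

lemma tensor_pair_H: "comm_group M \<Longrightarrow> tensor_pair H M"
  by (simp add: tensor_pair_def H.comm_group_axioms)

lemma comm_group_Hom: "comm_group M \<Longrightarrow> comm_group (Hom_group H M)"
  by (rule comm_group_Hom_group[OF H.group_axioms])

lemma
  assumes M: "comm_group M"
  shows dual_hom: "dual M \<in> hom (tensor H M) (Hom_group H M)"
    and dual_tens: "\<And>x m. x \<in> carrier H \<Longrightarrow> m \<in> carrier M \<Longrightarrow>
      dual M (tens H M x m) = (\<lambda>y\<in>carrier H. m [^]\<^bsub>M\<^esub> I x y)"
proof -
  interpret M: comm_group M by fact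
  interpret T: tensor_pair H M by (rule tensor_pair_H) fact
  have ex: "\<exists>h\<in>hom (tensor H M) (Hom_group H M). \<forall>p\<in>carrier H \<times> carrier M.
      h (case p of (x, y) \<Rightarrow> tens H M x y) = (case p of (x, m) \<Rightarrow> (\<lambda>y\<in>carrier H. m [^]\<^bsub>M\<^esub> I x y))"
  proof (rule T.tensor_universal[OF comm_group_Hom[OF M]])
    show "(\<lambda>y\<in>carrier H. m [^]\<^bsub>M\<^esub> I x y) \<in> carrier (Hom_group H M)" if "x \<in> carrier H" "m \<in> carrier M" for x m
      using that pow_hom_right[OF M] by (auto simp: Hom_group_simps intro!: restrict_hom[OF H.group_axioms])
  qed (auto simp: Hom_group_simps I_mult M.int_pow_mult M.int_pow_distrib intro!: restrict_ext)
  show "dual M \<in> hom (tensor H M) (Hom_group H M)" unfolding duality_def by (rule hom_by_spec(1)[OF ex])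
  show "dual M (tens H M x m) = (\<lambda>y\<in>carrier H. m [^]\<^bsub>M\<^esub> I x y)" if "x \<in> carrier H" "m \<in> carrier M" for x m
    using hom_by_spec(2)[OF ex, of "(x, m)"] that by (simp add: duality_def)
qed

lemma dual_eval_hom:
  assumes M: "comm_group M" and y: "y \<in> carrier H"
  shows "(\<lambda>t. dual M t y) \<in> hom (tensor H M) M"
  using hom_compose[OF dual_hom[OF M] Hom_group_eval[OF H.group_axioms M y]] by (simp add: o_def)

text \<open>The inverse of the duality: \<open>\<phi>\<close> corresponds to \<open>\<Sum> \<alpha>\<^sub>i \<otimes> \<phi>(\<beta>\<^sub>i) - \<beta>\<^sub>i \<otimes> \<phi>(\<alpha>\<^sub>i)\<close>.\<close>

definition coeval :: "('b, 'n) monoid_scheme \<Rightarrow> ('h \<Rightarrow> 'b) \<Rightarrow> ('h \<times> 'b \<Rightarrow>\<^sub>0 int) set" where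
  "coeval M \<phi> = finprod (tensor H M) (\<lambda>i. tens H M (\<alpha> i) (\<phi> (\<beta> i)) \<otimes>\<^bsub>tensor H M\<^esub>
      inv\<^bsub>tensor H M\<^esub> tens H M (\<beta> i) (\<phi> (\<alpha> i))) {1..g}"

lemma coeval_closed:
  assumes M: "comm_group M" and \<phi>: "\<phi> \<in> carrier (Hom_group H M)"
  shows "coeval M \<phi> \<in> carrier (tensor H M)"
proof -
  interpret T: tensor_pair H M by (rule tensor_pair_H) fact
  interpret TM: comm_group "tensor H M" by (rule T.comm_group_tensor)
  have "\<phi> y \<in> carrier M" if "y \<in> carrier H" for y using \<phi> that by (auto simp: Hom_group_simps intro: hom_in_carrier)
  then show ?thesis unfolding coeval_def by (intro TM.finprod_closed) (auto simp: T.tens_closed)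
qed

lemma dual_coeval:
  assumes M: "comm_group M" and \<phi>: "\<phi> \<in> carrier (Hom_group H M)"
  shows "dual M (coeval M \<phi>) = \<phi>"
proof (rule Hom_group_eqI)
  interpret M: comm_group M by fact
  interpret T: tensor_pair H M by (rule tensor_pair_H) fact
  interpret TM: comm_group "tensor H M" by (rule T.comm_group_tensor)
  have \<phi>H: "\<phi> \<in> hom H M" using \<phi> by (simp add: Hom_group_simps)
  have c: "\<phi> y \<in> carrier M" if "y \<in> carrier H" for y using hom_in_carrier[OF \<phi>H that] .
  show "dual M (coeval M \<phi>) \<in> carrier (Hom_group H M)"
    by (rule hom_in_carrier[OF dual_hom[OF M] coeval_closed[OF M \<phi>]])
  show "\<phi> \<in> carrier (Hom_group H M)" by fact
  fix y assume y: "y \<in> carrier H"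
  interpret E: group_hom "tensor H M" M "\<lambda>t. dual M t y"
    using dual_eval_hom[OF M y] by unfold_locales
  have tc: "tens H M x m \<in> carrier (tensor H M)" if "x \<in> carrier H" "m \<in> carrier M" for x m
    using that by (rule T.tens_closed)
  have "dual M (coeval M \<phi>) y = finprod M (\<lambda>i. dual M (tens H M (\<alpha> i) (\<phi> (\<beta> i)) \<otimes>\<^bsub>tensor H M\<^esub>
      inv\<^bsub>tensor H M\<^esub> tens H M (\<beta> i) (\<phi> (\<alpha> i))) y) {1..g}"
    unfolding coeval_def
    by (rule hom_finprod[OF TM.comm_group_axioms M dual_eval_hom[OF M y]]) (auto simp: tc c)
  also have "\<dots> = finprod M (\<lambda>i. \<phi> (\<beta> i) [^]\<^bsub>M\<^esub> I (\<alpha> i) y \<otimes>\<^bsub>M\<^esub> \<phi> (\<alpha> i) [^]\<^bsub>M\<^esub> I y (\<beta> i)) {1..g}"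
  proof (rule M.finprod_cong')
    fix i assume i: "i \<in> {1..g}"
    have "dual M (tens H M (\<alpha> i) (\<phi> (\<beta> i)) \<otimes>\<^bsub>tensor H M\<^esub> inv\<^bsub>tensor H M\<^esub> tens H M (\<beta> i) (\<phi> (\<alpha> i))) y
        = dual M (tens H M (\<alpha> i) (\<phi> (\<beta> i))) y \<otimes>\<^bsub>M\<^esub> inv\<^bsub>M\<^esub> dual M (tens H M (\<beta> i) (\<phi> (\<alpha> i))) y"
      using i tc c by (simp add: E.hom_mult E.hom_inv)
    also have "\<dots> = \<phi> (\<beta> i) [^]\<^bsub>M\<^esub> I (\<alpha> i) y \<otimes>\<^bsub>M\<^esub> inv\<^bsub>M\<^esub> (\<phi> (\<alpha> i) [^]\<^bsub>M\<^esub> I (\<beta> i) y)"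
      using i y c by (simp add: dual_tens[OF M])
    also have "inv\<^bsub>M\<^esub> (\<phi> (\<alpha> i) [^]\<^bsub>M\<^esub> I (\<beta> i) y) = \<phi> (\<alpha> i) [^]\<^bsub>M\<^esub> I y (\<beta> i)"
      using i y c I_skew[of "\<beta> i" y] by (simp add: M.int_pow_neg)
    finally show "dual M (tens H M (\<alpha> i) (\<phi> (\<beta> i)) \<otimes>\<^bsub>tensor H M\<^esub> inv\<^bsub>tensor H M\<^esub> tens H M (\<beta> i) (\<phi> (\<alpha> i))) y
        = \<phi> (\<beta> i) [^]\<^bsub>M\<^esub> I (\<alpha> i) y \<otimes>\<^bsub>M\<^esub> \<phi> (\<alpha> i) [^]\<^bsub>M\<^esub> I y (\<beta> i)" .
  qed (use c in auto)
  also have "\<dots> = \<phi> y" by (rule expansion[OF M \<phi>H y, symmetric])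
  finally show "dual M (coeval M \<phi>) y = \<phi> y" .
qed

lemma coeval_hom:
  assumes M: "comm_group M"
  shows "coeval M \<in> hom (Hom_group H M) (tensor H M)"
proof (rule homI)
  interpret T: tensor_pair H M by (rule tensor_pair_H) fact
  interpret TM: comm_group "tensor H M" by (rule T.comm_group_tensor)
  fix \<phi> \<psi> assume \<phi>: "\<phi> \<in> carrier (Hom_group H M)" and \<psi>: "\<psi> \<in> carrier (Hom_group H M)"
  have c: "\<phi> y \<in> carrier M" "\<psi> y \<in> carrier M" if "y \<in> carrier H" for y
    using \<phi> \<psi> that by (auto simp: Hom_group_simps intro: hom_in_carrier)
  let ?t = "\<lambda>\<phi> i. tens H M (\<alpha> i) (\<phi> (\<beta> i)) \<otimes>\<^bsub>tensor H M\<^esub> inv\<^bsub>tensor H M\<^esub> tens H M (\<beta> i) (\<phi> (\<alpha> i))"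
  have tc: "tens H M x m \<in> carrier (tensor H M)" if "x \<in> carrier H" "m \<in> carrier M" for x m
    using that by (rule T.tens_closed)
  have "coeval M (\<phi> \<otimes>\<^bsub>Hom_group H M\<^esub> \<psi>) = finprod (tensor H M) (\<lambda>i. ?t \<phi> i \<otimes>\<^bsub>tensor H M\<^esub> ?t \<psi> i) {1..g}"
    unfolding coeval_def
    by (rule TM.finprod_cong')
      (use c tc in \<open>auto simp: Hom_group_simps T.tens_mult_right TM.inv_mult TM.m_ac\<close>)
  also have "\<dots> = coeval M \<phi> \<otimes>\<^bsub>tensor H M\<^esub> coeval M \<psi>"
    unfolding coeval_def by (rule TM.finprod_multf) (use c tc in auto)
  finally show "coeval M (\<phi> \<otimes>\<^bsub>Hom_group H M\<^esub> \<psi>) = coeval M \<phi> \<otimes>\<^bsub>tensor H M\<^esub> coeval M \<psi>" .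
qed (rule coeval_closed[OF M])

lemma coeval_dual:
  assumes M: "comm_group M" and t: "t \<in> carrier (tensor H M)"
  shows "coeval M (dual M t) = t"
proof -
  interpret M: comm_group M by fact
  interpret T: tensor_pair H M by (rule tensor_pair_H) fact
  interpret TM: comm_group "tensor H M" by (rule T.comm_group_tensor)
  let ?X = "{tens H M x y | x y. x \<in> carrier H \<and> y \<in> carrier M}"
  have "(coeval M \<circ> dual M) t = id t"
  proof (rule hom_eq_on_generate[where f = "coeval M \<circ> dual M" and h = id and x = t and X = ?X,
        OF TM.group_axioms TM.group_axioms])
    show "coeval M \<circ> dual M \<in> hom (tensor H M) (tensor H M)"
      by (rule hom_compose[OF dual_hom[OF M] coeval_hom[OF M]])
    show "id \<in> hom (tensor H M) (tensor H M)" by (auto intro: homI)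
    show "?X \<subseteq> carrier (tensor H M)" using T.tens_closed by blast
    show "t \<in> generate (tensor H M) ?X" using t T.tensor_generate by simp
    fix u assume "u \<in> ?X"
    then obtain x m where u: "u = tens H M x m" and x: "x \<in> carrier H" and m: "m \<in> carrier M" by blast
    have tc: "tens H M x m \<in> carrier (tensor H M)" if "x \<in> carrier H" for x
      using that m by (rule T.tens_closed)
    have pw: "tens H M x (m [^]\<^bsub>M\<^esub> (n::int)) = tens H M x m [^]\<^bsub>tensor H M\<^esub> n" if "x \<in> carrier H" for x n
    proof -
      interpret h: group_hom M "tensor H M" "tens H M x" using T.tens_hom_right[OF that] by unfold_locales
      show ?thesis using h.hom_int_pow[OF m] .
    qed
    have "coeval M (dual M u) = finprod (tensor H M) (\<lambda>i. tens H M (\<beta> i) m [^]\<^bsub>tensor H M\<^esub> I (\<alpha> i) x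
        \<otimes>\<^bsub>tensor H M\<^esub> tens H M (\<alpha> i) m [^]\<^bsub>tensor H M\<^esub> I x (\<beta> i)) {1..g}"
      unfolding coeval_def u dual_tens[OF M x m]
    proof (rule TM.finprod_cong')
      fix i assume i: "i \<in> {1..g}"
      have "I (\<alpha> i) x = - I x (\<alpha> i)" by (rule I_skew) (use i x in auto)
      then show "tens H M (\<alpha> i) ((\<lambda>y\<in>carrier H. m [^]\<^bsub>M\<^esub> I x y) (\<beta> i)) \<otimes>\<^bsub>tensor H M\<^esub>
            inv\<^bsub>tensor H M\<^esub> tens H M (\<beta> i) ((\<lambda>y\<in>carrier H. m [^]\<^bsub>M\<^esub> I x y) (\<alpha> i))
          = tens H M (\<beta> i) m [^]\<^bsub>tensor H M\<^esub> I (\<alpha> i) x \<otimes>\<^bsub>tensor H M\<^esub> tens H M (\<alpha> i) m [^]\<^bsub>tensor H M\<^esub> I x (\<beta> i)"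
        using i tc by (simp add: pw TM.int_pow_neg TM.m_comm)
    qed (use tc in auto)
    also have "\<dots> = tens H M x m"
      by (rule expansion[OF TM.comm_group_axioms T.tens_hom_left[OF m] x, symmetric])
    finally show "(coeval M \<circ> dual M) u = id u" by (simp add: u)
  qed
  then show ?thesis by simp
qed

lemma dual_bij:
  assumes M: "comm_group M"
  shows "bij_betw (dual M) (carrier (tensor H M)) (carrier (Hom_group H M))"
  by (rule bij_betw_byWitness[where f' = "coeval M"])
    (use coeval_dual[OF M] dual_coeval[OF M] hom_in_carrier[OF dual_hom[OF M]] coeval_closed[OF M] in auto)

text \<open>Duality is natural in the coefficients; it is enough to check this on pure tensors.\<close>

lemma dual_tensor_map:
  assumes M: "comm_group M" and M': "comm_group M'" and f: "f \<in> hom M M'"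
    and t: "t \<in> carrier (tensor H M)" and y: "y \<in> carrier H"
  shows "dual M' (tensor_map H M M' f t) y = f (dual M t y)"
proof -
  interpret M: comm_group M by fact
  interpret M': comm_group M' by fact
  interpret f: group_hom M M' f using f by unfold_locales
  interpret T: tensor_pair H M by (rule tensor_pair_H) fact
  interpret TM: comm_group "tensor H M" by (rule T.comm_group_tensor)
  note tm = tensor_map_spec[OF H.comm_group_axioms M M' f]
  let ?X = "{tens H M x y | x y. x \<in> carrier H \<and> y \<in> carrier M}"
  have "((\<lambda>t. dual M' t y) \<circ> tensor_map H M M' f) t = (f \<circ> (\<lambda>t. dual M t y)) t"
  proof (rule hom_eq_on_generate[OF TM.group_axioms M'.group_axioms])
    show "(\<lambda>t. dual M' t y) \<circ> tensor_map H M M' f \<in> hom (tensor H M) M'"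
      by (rule hom_compose[OF tm(1) dual_eval_hom[OF M' y]])
    show "f \<circ> (\<lambda>t. dual M t y) \<in> hom (tensor H M) M'"
      by (rule hom_compose[OF dual_eval_hom[OF M y] f])
    show "?X \<subseteq> carrier (tensor H M)" using T.tens_closed by blast
    show "t \<in> generate (tensor H M) ?X" using t T.tensor_generate by simp
    fix u assume "u \<in> ?X"
    then obtain x m where u: "u = tens H M x m" and x: "x \<in> carrier H" and m: "m \<in> carrier M" by blast
    show "((\<lambda>t. dual M' t y) \<circ> tensor_map H M M' f) u = (f \<circ> (\<lambda>t. dual M t y)) u"
      using x m y by (simp add: u tm(2) dual_tens[OF M] dual_tens[OF M'] f.hom_int_pow)
  qed
  then show ?thesis by simp
qed

end

section \<open>The fundamental group\<close>

lemma homotopic_paths_const_left: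
  assumes "path p" "path_image p \<subseteq> S" "pathstart p = x"
  shows "homotopic_paths S p ((\<lambda>_. x) +++ p)"
proof (rule homotopic_paths_reparametrize[OF assms(1,2), where f = "\<lambda>t. max 0 (2 * t - 1)"])
  show "((\<lambda>_. x) +++ p) t = p (max 0 (2 * t - 1))" for t
    using assms(3) by (cases "t \<le> 1 / 2") (simp_all add: joinpaths_def pathstart_def)
qed (auto intro!: continuous_intros)

text \<open>At time \<open>s\<close> the homotopy runs along \<open>p\<close> up to the parameter \<open>s\<close> and back.\<close>

lemma homotopic_paths_reverse_right:
  assumes "path p" "path_image p \<subseteq> S" "pathstart p = x"
  shows "homotopic_paths S (\<lambda>_. x) (p +++ reversepath p)"
proof -
  have p: "continuous_on {0..1} p" using assms(1) by (simp add: path_def)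
  have in01: "s * min (2 * t) (2 - 2 * t) \<in> {0..1}" if "s \<in> {0..1}" "t \<in> {0..1}" for s t :: real
  proof -
    have "0 \<le> min (2 * t) (2 - 2 * t)" "min (2 * t) (2 - 2 * t) \<le> 1" using that by (auto simp: min_def)
    then show ?thesis using that mult_le_one[of s "min (2 * t) (2 - 2 * t)"] by simp
  qed
  let ?h = "\<lambda>y::real \<times> real. p (fst y * min (2 * snd y) (2 - 2 * snd y))"
  show ?thesis unfolding homotopic_paths
  proof (intro exI[of _ ?h] conjI ballI)
    show "continuous_on ({0..1} \<times> {0..1}) ?h"
      by (rule continuous_on_compose2[OF p]) (use in01 in \<open>auto intro!: continuous_intros\<close>)
    show "?h \<in> {0..1} \<times> {0..1} \<rightarrow> S"
      using in01 assms(2) by (force simp: path_image_def)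
    show "?h (0, t) = x" for t using assms(3) by (simp add: pathstart_def)
    show "?h (1, t) = (p +++ reversepath p) t" if "t \<in> {0..1}" for t
      using that by (auto simp: joinpaths_def reversepath_def min_def)
    show "pathstart (?h \<circ> Pair t) = pathstart (\<lambda>_. x)" "pathfinish (?h \<circ> Pair t) = pathfinish (\<lambda>_. x)" for t
      using assms(3) by (auto simp: pathstart_def pathfinish_def)
  qed
qed

locale pointed_space =
  fixes X :: "'a::topological_space set" and x0 :: 'a
  assumes x0: "x0 \<in> X"
begin

definition loop :: "(real \<Rightarrow> 'a) \<Rightarrow> bool" where
  "loop p \<longleftrightarrow> path p \<and> path_image p \<subseteq> X \<and> pathstart p = x0 \<and> pathfinish p = x0"

abbreviation "P \<equiv> pi1 X x0"
abbreviation "cl \<equiv> loop_class X"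

lemma carrier_pi1: "carrier P = cl ` Collect loop"
proof -
  have "loop = (\<lambda>p. path p \<and> path_image p \<subseteq> X \<and> pathstart p = x0 \<and> pathfinish p = x0)"
    by (rule ext) (rule loop_def)
  then show ?thesis by (simp add: pi1_def setcompr_eq_image)
qed

lemma loop_class_eq_iff: "loop p \<Longrightarrow> cl p = cl q \<longleftrightarrow> homotopic_paths X p q"
proof
  assume p: "loop p" and "cl p = cl q"
  then have "p \<in> cl q" using p unfolding loop_class_def loop_def by auto
  then show "homotopic_paths X p q" unfolding loop_class_def using homotopic_paths_sym by blast
next
  assume "homotopic_paths X p q"
  then show "cl p = cl q" unfolding loop_class_def using homotopic_paths_trans homotopic_paths_sym by blast
qed

lemma loop_class_cong: "loop p \<Longrightarrow> homotopic_paths X p q \<Longrightarrow> cl q = cl p"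
  by (metis loop_class_eq_iff)

lemma mem_loop_class: "q \<in> cl p \<longleftrightarrow> homotopic_paths X p q"
  by (simp add: loop_class_def)

lemma loop_in_class: "loop p \<Longrightarrow> p \<in> cl p"
  by (simp add: mem_loop_class loop_def)

lemma loop_join: "loop p \<Longrightarrow> loop q \<Longrightarrow> loop (p +++ q)"
  by (auto simp: loop_def subset_path_image_join)

lemma loop_reverse: "loop p \<Longrightarrow> loop (reversepath p)"
  by (auto simp: loop_def)

lemma loop_const: "loop (\<lambda>_. x0)"
  using x0 by (auto simp: loop_def path_def path_image_def pathstart_def pathfinish_def)

lemma pi1_mult:
  assumes "loop p" "loop q"
  shows "cl p \<otimes>\<^bsub>P\<^esub> cl q = cl (p +++ q)"
proof -
  have eq: "cl (p' +++ q') = cl (p +++ q)" if "p' \<in> cl p" "q' \<in> cl q" for p' q'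
  proof -
    have "homotopic_paths X (p +++ q) (p' +++ q')"
      using that assms by (intro homotopic_paths_join) (auto simp: mem_loop_class loop_def)
    then show ?thesis by (rule loop_class_cong[OF loop_join[OF assms]])
  qed
  have "cl p \<otimes>\<^bsub>P\<^esub> cl q = (\<Union>p'\<in>cl p. \<Union>q'\<in>cl q. cl (p' +++ q'))" by (simp add: pi1_def)
  also have "\<dots> = cl (p +++ q)"
  proof
    show "(\<Union>p'\<in>cl p. \<Union>q'\<in>cl q. cl (p' +++ q')) \<subseteq> cl (p +++ q)" using eq by blast
    show "cl (p +++ q) \<subseteq> (\<Union>p'\<in>cl p. \<Union>q'\<in>cl q. cl (p' +++ q'))"
      using loop_in_class assms by blast
  qed
  finally show ?thesis .
qed

lemma pi1_one: "\<one>\<^bsub>P\<^esub> = cl (\<lambda>_. x0)"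
  by (simp add: pi1_def)

lemma group_pi1: "Group.group P"
proof (rule groupI, unfold carrier_pi1)
  fix u assume "u \<in> cl ` Collect loop"
  then obtain p where p: "u = cl p" "loop p" by blast
  show "\<one>\<^bsub>P\<^esub> \<otimes>\<^bsub>P\<^esub> u = u"
    unfolding pi1_one p(1) pi1_mult[OF loop_const p(2)]
    by (rule loop_class_cong[OF p(2)], rule homotopic_paths_const_left) (use p(2) in \<open>auto simp: loop_def\<close>)
  have r: "loop (reversepath p)" using p(2) by (rule loop_reverse)
  have "cl (reversepath p) \<otimes>\<^bsub>P\<^esub> u = \<one>\<^bsub>P\<^esub>"
    unfolding pi1_one p(1) pi1_mult[OF r p(2)]
    using loop_class_cong[OF loop_const homotopic_paths_reverse_right[of "reversepath p" X x0]] r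
    by (simp add: loop_def)
  then show "\<exists>v\<in>cl ` Collect loop. v \<otimes>\<^bsub>P\<^esub> u = \<one>\<^bsub>P\<^esub>" using r by blast
  fix v assume "v \<in> cl ` Collect loop"
  then obtain q where q: "v = cl q" "loop q" by blast
  show "u \<otimes>\<^bsub>P\<^esub> v \<in> cl ` Collect loop"
    using p q loop_join pi1_mult by auto
  fix w assume "w \<in> cl ` Collect loop"
  then obtain s where s: "w = cl s" "loop s" by blast
  have "homotopic_paths X (p +++ (q +++ s)) ((p +++ q) +++ s)"
    using p q s by (intro homotopic_paths_assoc) (auto simp: loop_def)
  then have "cl ((p +++ q) +++ s) = cl (p +++ (q +++ s))"
    by (intro loop_class_cong loop_join p q s)
  then show "u \<otimes>\<^bsub>P\<^esub> v \<otimes>\<^bsub>P\<^esub> w = u \<otimes>\<^bsub>P\<^esub> (v \<otimes>\<^bsub>P\<^esub> w)"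
    using p q s by (simp add: loop_join pi1_mult)
next
  show "\<one>\<^bsub>P\<^esub> \<in> cl ` Collect loop" using loop_const by (auto simp: pi1_one)
qed

lemma loop_compose:
  assumes "continuous_on X f" "f ` X \<subseteq> X" "f x0 = x0" "loop p"
  shows "loop (f \<circ> p)"
  using assms unfolding loop_def
  by (auto simp: path_image_compose pathstart_compose pathfinish_compose
      intro!: path_continuous_image intro: continuous_on_subset)

lemma homotopic_compose:
  assumes "continuous_on X f" "f ` X \<subseteq> X" "homotopic_paths X p q"
  shows "homotopic_paths X (f \<circ> p) (f \<circ> q)"
  using homotopic_paths_continuous_image[OF assms(3,1), of X] assms(2) by auto

end

section \<open>Smooth maps\<close>

lemma smooth_on_cong:
  assumes "smooth_on S f" "\<And>x. x \<in> S \<Longrightarrow> f x = h x"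
  shows "smooth_on S h"
  unfolding smooth_on_def
proof
  fix x assume x: "x \<in> S"
  then obtain U F where "open U" "x \<in> U" "\<forall>n. C_on n F U" "\<forall>y\<in>S \<inter> U. F y = f y"
    using assms(1) unfolding smooth_on_def by blast
  then show "\<exists>U F. open U \<and> x \<in> U \<and> (\<forall>n. C_on n F U) \<and> (\<forall>y\<in>S \<inter> U. F y = h y)"
    using assms(2) by (intro exI[of _ U] exI[of _ F]) auto
qed

locale smooth_manifold =
  fixes M :: "'e::euclidean_space set" and X :: "'a::topological_space set" and A :: "('a, 'e) chart set"
  assumes atlas: "smooth_atlas M X A"
begin

lemma chart:
  assumes "(U, \<phi>) \<in> A"
  shows "openin (top_of_set X) U" "U \<subseteq> X" "inj_on \<phi> U" "\<exists>\<psi>. homeomorphism U (\<phi> ` U) \<phi> \<psi>"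
proof -
  show o: "openin (top_of_set X) U" and h: "\<exists>\<psi>. homeomorphism U (\<phi> ` U) \<phi> \<psi>"
    using atlas assms by (auto simp: smooth_atlas_def)
  show "U \<subseteq> X" using openin_subset[OF o] by simp
  obtain \<psi> where "homeomorphism U (\<phi> ` U) \<phi> \<psi>" using h by blast
  then show "inj_on \<phi> U" by (metis homeomorphism_apply1 inj_onI)
qed

lemma chart_at: "x \<in> X \<Longrightarrow> \<exists>U \<phi>. (U, \<phi>) \<in> A \<and> x \<in> U"
  using atlas unfolding smooth_atlas_def by blast

lemma transition: "(U, \<phi>) \<in> A \<Longrightarrow> (V, \<psi>) \<in> A \<Longrightarrow> smooth_on (\<phi> ` (U \<inter> V)) (\<psi> \<circ> inv_into U \<phi>)"
  using atlas unfolding smooth_atlas_def by blast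

lemma smooth_mapD:
  assumes "smooth_map X A X A f" "(U, \<phi>) \<in> A" "(V, \<psi>) \<in> A"
  shows "smooth_on (\<phi> ` (U \<inter> f -` V)) (\<psi> \<circ> f \<circ> inv_into U \<phi>)"
  using assms unfolding smooth_map_def by blast

lemma smooth_map_id: "smooth_map X A X A id"
  unfolding smooth_map_def using transition by (auto simp: continuous_on_id)

lemma smooth_map_cong:
  assumes "smooth_map X A X A f" "\<And>x. x \<in> X \<Longrightarrow> f x = h x"
  shows "smooth_map X A X A h"
proof -
  have "smooth_on (\<phi> ` (U \<inter> h -` V)) (\<psi> \<circ> h \<circ> inv_into U \<phi>)" if U: "(U, \<phi>) \<in> A" and V: "(V, \<psi>) \<in> A" for U \<phi> V \<psi>
  proof -
    have "U \<inter> h -` V = U \<inter> f -` V" using assms(2) chart(2)[OF U] by auto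
    moreover have "smooth_on (\<phi> ` (U \<inter> f -` V)) (\<psi> \<circ> h \<circ> inv_into U \<phi>)"
    proof (rule smooth_on_cong[OF smooth_mapD[OF assms(1) U V]])
      fix y assume "y \<in> \<phi> ` (U \<inter> f -` V)"
      then have "inv_into U \<phi> y \<in> X" using chart(2)[OF U] inv_into_into[of y \<phi> U] by blast
      then show "(\<psi> \<circ> f \<circ> inv_into U \<phi>) y = (\<psi> \<circ> h \<circ> inv_into U \<phi>) y" using assms(2) by simp
    qed
    ultimately show ?thesis by simp
  qed
  moreover have "h ` X \<subseteq> X" "continuous_on X h"
    using assms continuous_on_cong[of X X f h] unfolding smooth_map_def by auto
  ultimately show ?thesis unfolding smooth_map_def by blast
qed

text \<open>Near a given point the composite is read through an intermediate chart \<open>\<theta>\<close> around the image of that point.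
  Smoothness on subsets of the model space that need not be open is witnessed by local \<open>C\<^sup>n\<close> extensions, and the composite of
  the extensions is an extension of the composite.\<close>

lemma smooth_map_compose:
  assumes f: "smooth_map X A X A f" and h: "smooth_map X A X A h"
  shows "smooth_map X A X A (h \<circ> f)"
proof -
  have fX: "f ` X \<subseteq> X" "continuous_on X f" and hX: "h ` X \<subseteq> X" "continuous_on X h"
    using f h by (auto simp: smooth_map_def)
  have 1: "(h \<circ> f) ` X \<subseteq> X" using fX hX by auto
  have 2: "continuous_on X (h \<circ> f)" unfolding o_def by (rule continuous_on_compose2[OF hX(2) fX(2,1)])
  have "smooth_on (\<phi> ` (U \<inter> (h \<circ> f) -` V)) (\<psi> \<circ> (h \<circ> f) \<circ> inv_into U \<phi>)" (is "smooth_on ?S _")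
    if U: "(U, \<phi>) \<in> A" and V: "(V, \<psi>) \<in> A" for U \<phi> V \<psi>
    unfolding smooth_on_def
  proof
    fix y assume "y \<in> ?S"
    then obtain x where x: "x \<in> U" "h (f x) \<in> V" "y = \<phi> x" by auto
    have "f x \<in> X" using x(1) chart(2)[OF U] fX by auto
    then obtain W \<theta> where W: "(W, \<theta>) \<in> A" "f x \<in> W" using chart_at by blast
    let ?S1 = "\<phi> ` (U \<inter> f -` W)"
    have "y \<in> ?S1" using x W by auto
    then obtain O1 F1 where O1: "open O1" "y \<in> O1" "\<And>n. C_on n F1 O1"
      "\<And>z. z \<in> ?S1 \<inter> O1 \<Longrightarrow> F1 z = (\<theta> \<circ> f \<circ> inv_into U \<phi>) z"
      using smooth_mapD[OF f U W(1)] unfolding smooth_on_def by metis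
    let ?S2 = "\<theta> ` (W \<inter> h -` V)"
    have "\<theta> (f x) \<in> ?S2" using x W by auto
    then obtain O2 F2 where O2: "open O2" "\<theta> (f x) \<in> O2" "\<And>n. C_on n F2 O2"
      "\<And>z. z \<in> ?S2 \<inter> O2 \<Longrightarrow> F2 z = (\<psi> \<circ> h \<circ> inv_into W \<theta>) z"
      using smooth_mapD[OF h W(1) V] unfolding smooth_on_def by metis
    obtain \<phi>' where \<phi>': "homeomorphism U (\<phi> ` U) \<phi> \<phi>'" using chart(4)[OF U] by blast
    have "openin (top_of_set X) (X \<inter> f -` W)"
      by (rule continuous_openin_preimage[OF fX(2) _ chart(1)[OF W(1)]]) (use fX(1) in auto)
    then obtain T where T: "open T" "X \<inter> f -` W = X \<inter> T" by (auto simp: openin_open)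
    then have "U \<inter> f -` W = U \<inter> T" using chart(2)[OF U] by auto
    then have "openin (top_of_set U) (U \<inter> f -` W)" using T(1) by (auto simp: openin_open)
    then have "openin (top_of_set (\<phi> ` U)) ?S1" by (rule homeomorphism_imp_open_map[OF \<phi>'])
    then obtain O3 where O3: "open O3" "?S1 = \<phi> ` U \<inter> O3" by (auto simp: openin_open)
    let ?O = "(O1 \<inter> F1 -` O2) \<inter> O3"
    have "continuous_on O1 F1" using O1(3)[of 0] by simp
    then have "open (O1 \<inter> F1 -` O2)" by (rule continuous_open_preimage[OF _ O1(1) O2(1)])
    then have "open ?O" using O3(1) by auto
    have invU: "inv_into U \<phi> (\<phi> z) = z" if "z \<in> U" for z using chart(3)[OF U] that by simp
    have invW: "inv_into W \<theta> (\<theta> z) = z" if "z \<in> W" for z using chart(3)[OF W(1)] that by simp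
    have "F1 y = \<theta> (f x)" using O1(4)[of y] O1(2) \<open>y \<in> ?S1\<close> x invU by auto
    then have "y \<in> ?O" using O1(2) O2(2) O3(2) \<open>y \<in> ?S1\<close> by auto
    moreover have "C_on n (\<lambda>z. F2 (F1 z)) ?O" for n
      by (rule C_on_compose[OF \<open>open ?O\<close> O2(1,3)]) (use O1(3) in \<open>auto intro: C_on_subset\<close>)
    moreover have "F2 (F1 z) = (\<psi> \<circ> (h \<circ> f) \<circ> inv_into U \<phi>) z" if z: "z \<in> ?S \<inter> ?O" for z
    proof -
      obtain x' where x': "x' \<in> U" "h (f x') \<in> V" "z = \<phi> x'" using z by auto
      have "z \<in> ?S1" using z x' O3(2) by auto
      then obtain x'' where "x'' \<in> U" "f x'' \<in> W" "z = \<phi> x''" by auto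
      then have fW: "f x' \<in> W" using x' chart(3)[OF U] by (auto simp: inj_on_def)
      have F1z: "F1 z = \<theta> (f x')" using O1(4)[of z] \<open>z \<in> ?S1\<close> z x' invU by auto
      have "\<theta> (f x') \<in> ?S2 \<inter> O2" using fW x'(2) z F1z by auto
      then have "F2 (\<theta> (f x')) = \<psi> (h (f x'))" using O2(4) invW[OF fW] by simp
      then show ?thesis using F1z x' invU by simp
    qed
    ultimately show "\<exists>O' F. open O' \<and> y \<in> O' \<and> (\<forall>n. C_on n F O') \<and>
        (\<forall>z\<in>?S \<inter> O'. F z = (\<psi> \<circ> (h \<circ> f) \<circ> inv_into U \<phi>) z)"
      using \<open>open ?O\<close> by (intro exI[of _ ?O] exI[of _ "\<lambda>z. F2 (F1 z)"]) auto
  qed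
  then show ?thesis unfolding smooth_map_def using 1 2 by blast
qed

lemma diffeo_id: "diffeo X A id"
proof -
  have "inj_on id X" by simp
  then have "id x = inv_into X id x" if "x \<in> X" for x using inv_into_f_f[of id X x] that by simp
  then show ?thesis unfolding diffeo_def
    using smooth_map_id smooth_map_cong[OF smooth_map_id, of "inv_into X id"] by auto
qed

lemma diffeo_compose:
  assumes "diffeo X A f" "diffeo X A h"
  shows "diffeo X A (f \<circ> h)"
proof -
  have b: "bij_betw f X X" "bij_betw h X X" using assms by (auto simp: diffeo_def)
  then have bfh: "bij_betw (f \<circ> h) X X" by (metis bij_betw_trans)
  have "(inv_into X h \<circ> inv_into X f) x = inv_into X (f \<circ> h) x" if x: "x \<in> X" for x
  proof -
    let ?y = "inv_into X h (inv_into X f x)"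
    have 1: "inv_into X f x \<in> X" "f (inv_into X f x) = x"
      using b(1) x by (auto simp: bij_betw_def inv_into_into f_inv_into_f)
    have 2: "?y \<in> X" "h ?y = inv_into X f x"
      using b(2) 1 by (auto simp: bij_betw_def inv_into_into f_inv_into_f)
    have "inv_into X (f \<circ> h) ((f \<circ> h) ?y) = ?y"
      by (rule inv_into_f_f) (use bfh 2 in \<open>auto simp: bij_betw_def\<close>)
    then show ?thesis using 1 2 by simp
  qed
  moreover have "smooth_map X A X A (inv_into X h \<circ> inv_into X f)"
    by (rule smooth_map_compose) (use assms in \<open>auto simp: diffeo_def\<close>)
  ultimately have "smooth_map X A X A (inv_into X (f \<circ> h))" using smooth_map_cong by blast
  then show ?thesis using bfh assms smooth_map_compose unfolding diffeo_def by blast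
qed

end

section \<open>The mapping class group and its action\<close>

locale pointed_surface = smooth_manifold half_plane X A for X :: "'a::t2_space set" and A :: "('a, real ^ 2) chart set" +
  fixes x0 :: 'a
  assumes x0_boundary: "x0 \<in> mfd_boundary A"
begin

lemma boundary_subset: "mfd_boundary A \<subseteq> X"
  using chart(2) by (auto simp: mfd_boundary_def)

sublocale pointed_space X x0
  by unfold_locales (use x0_boundary boundary_subset in auto)

abbreviation "D \<equiv> boundary_diffeos X A"
abbreviation "mc \<equiv> mapping_class X A"
abbreviation "Md \<equiv> mapping_class_group X A"
abbreviation "isotopic \<equiv> homotopic_with_canon (\<lambda>h. \<forall>x\<in>mfd_boundary A. h x = x) X X"

text \<open>The base point lies on the boundary and is therefore fixed by the diffeomorphisms and their inverses.\<close>

lemma D_facts: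
  assumes "f \<in> D"
  shows "continuous_on X f" "f ` X \<subseteq> X" "f x0 = x0" "\<And>x. x \<in> mfd_boundary A \<Longrightarrow> f x = x"
    "continuous_on X (inv_into X f)" "inv_into X f ` X \<subseteq> X" "inv_into X f x0 = x0"
    "\<And>x. x \<in> X \<Longrightarrow> f (inv_into X f x) = x" "\<And>x. x \<in> X \<Longrightarrow> inv_into X f (f x) = x"
proof -
  show "continuous_on X f" "f ` X \<subseteq> X" and fx0: "f x0 = x0" and "\<And>x. x \<in> mfd_boundary A \<Longrightarrow> f x = x"
    and "continuous_on X (inv_into X f)" "inv_into X f ` X \<subseteq> X"
    using assms x0_boundary by (auto simp: boundary_diffeos_def diffeo_def smooth_map_def)
  have b: "bij_betw f X X" using assms by (simp add: boundary_diffeos_def diffeo_def)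
  then show "\<And>x. x \<in> X \<Longrightarrow> f (inv_into X f x) = x" by (simp add: bij_betw_inv_into_right)
  show inv: "inv_into X f (f x) = x" if "x \<in> X" for x using b that by (simp add: bij_betw_inv_into_left)
  show "inv_into X f x0 = x0" using inv[OF x0] fx0 by simp
qed

lemma isotopic_refl: "f \<in> D \<Longrightarrow> isotopic f f"
  using D_facts(1,2,4) by (simp add: continuous_map_in_subtopology image_subset_iff_funcset)

lemma mem_mc: "f' \<in> mc f \<longleftrightarrow> f' \<in> D \<and> isotopic f f'"
  by (simp add: mapping_class_def)

lemma mc_eq: "isotopic f f' \<Longrightarrow> mc f = mc f'"
  unfolding mapping_class_def using homotopic_with_trans homotopic_with_symD by blast

lemma id_D: "id \<in> D"
  using diffeo_id by (simp add: boundary_diffeos_def)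

lemma compose_D: "f \<in> D \<Longrightarrow> h \<in> D \<Longrightarrow> f \<circ> h \<in> D"
  using diffeo_compose by (simp add: boundary_diffeos_def)

lemma isotopic_compose:
  assumes "f \<in> D" "f' \<in> D" "h \<in> D" "h' \<in> D" "isotopic f f'" "isotopic h h'"
  shows "isotopic (f \<circ> h) (f' \<circ> h')"
proof (rule homotopic_with_trans)
  show "isotopic (f \<circ> h) (f \<circ> h')"
    by (rule homotopic_with_compose_continuous_map_left[OF assms(6)])
      (use D_facts[OF assms(1)] in \<open>auto simp: continuous_map_in_subtopology\<close>)
  show "isotopic (f \<circ> h') (f' \<circ> h')"
    by (rule homotopic_with_compose_continuous_map_right[OF assms(5)])
      (use D_facts[OF assms(4)] in \<open>auto simp: continuous_map_in_subtopology\<close>)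
qed

lemma Md_carrier: "carrier Md = mc ` D"
  by (simp add: mapping_class_group_def)

lemma Md_one: "\<one>\<^bsub>Md\<^esub> = mc id"
  by (simp add: mapping_class_group_def)

lemma Md_mult:
  assumes "f \<in> D" "h \<in> D"
  shows "mc f \<otimes>\<^bsub>Md\<^esub> mc h = mc (f \<circ> h)"
proof -
  have "mc (f' \<circ> h') = mc (f \<circ> h)" if "f' \<in> mc f" "h' \<in> mc h" for f' h'
    using that assms isotopic_compose[of f f' h h'] mc_eq by (auto simp: mem_mc)
  moreover have "f \<in> mc f" "h \<in> mc h" using assms isotopic_refl by (auto simp: mem_mc)
  ultimately have "(\<Union>f'\<in>mc f. \<Union>h'\<in>mc h. mc (f' \<circ> h')) = mc (f \<circ> h)" by blast
  then show ?thesis by (simp add: mapping_class_group_def)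
qed

abbreviation "act \<equiv> mcg_act_pi1 X"

text \<open>An isotopy relative to the boundary moves a loop through loops with the same base point.\<close>

lemma act_mc:
  assumes f: "f \<in> D" and p: "loop p"
  shows "act (mc f) (cl p) = cl (f \<circ> p)"
proof -
  have fp: "loop (f \<circ> p)" using loop_compose[OF D_facts(1-3)[OF f] p] .
  have "cl (f' \<circ> p') = cl (f \<circ> p)" if "f' \<in> mc f" "p' \<in> cl p" for f' p'
  proof -
    have f': "f' \<in> D" "isotopic f f'" and p': "homotopic_paths X p p'" using that by (auto simp: mem_mc mem_loop_class)
    have "homotopic_paths X (f \<circ> p) (f' \<circ> p)"
      unfolding homotopic_paths_def
    proof (rule homotopic_with_compose_continuous_map_right[OF f'(2)])
      show "continuous_map (top_of_set {0..1}) (top_of_set X) p"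
        using p by (auto simp: loop_def path_def path_image_def continuous_map_in_subtopology)
      show "pathstart (j \<circ> p) = pathstart (f \<circ> p) \<and> pathfinish (j \<circ> p) = pathfinish (f \<circ> p)"
        if "\<forall>x\<in>mfd_boundary A. j x = x" for j
        using that p x0_boundary D_facts(3)[OF f] by (simp add: loop_def pathstart_compose pathfinish_compose)
    qed
    moreover have "homotopic_paths X (f' \<circ> p) (f' \<circ> p')" using homotopic_compose[OF D_facts(1,2)[OF f'(1)] p'] .
    ultimately have "homotopic_paths X (f \<circ> p) (f' \<circ> p')" by (rule homotopic_paths_trans)
    then show ?thesis by (rule loop_class_cong[OF fp])
  qed
  moreover have "f \<in> mc f" "p \<in> cl p" using f p isotopic_refl loop_in_class by (auto simp: mem_mc)
  ultimately have "(\<Union>f'\<in>mc f. \<Union>p'\<in>cl p. cl (f' \<circ> p')) = cl (f \<circ> p)" by blast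
  then show ?thesis by (simp add: mcg_act_pi1_def)
qed

lemma compose_join: "f \<circ> (p +++ q) = (f \<circ> p) +++ (f \<circ> q)"
  by (auto simp: joinpaths_def)

lemma act_hom:
  assumes "c \<in> carrier Md"
  shows "act c \<in> hom P P" "bij_betw (act c) (carrier P) (carrier P)"
proof -
  obtain f where f: "f \<in> D" "c = mc f" using assms by (auto simp: Md_carrier)
  note F = D_facts[OF f(1)]
  have closed: "act c u \<in> carrier P" if "u \<in> carrier P" for u
    using that act_mc[OF f(1)] loop_compose[OF F(1-3)] by (auto simp: carrier_pi1 f(2))
  show "act c \<in> hom P P"
  proof (rule homI[OF closed])
    fix u v assume "u \<in> carrier P" "v \<in> carrier P"
    then obtain p q where pq: "u = cl p" "loop p" "v = cl q" "loop q" by (auto simp: carrier_pi1)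
    show "act c (u \<otimes>\<^bsub>P\<^esub> v) = act c u \<otimes>\<^bsub>P\<^esub> act c v"
      using pq act_mc[OF f(1)] loop_compose[OF F(1-3)] by (simp add: pi1_mult loop_join f(2) compose_join)
  qed
  have inj: "u = v" if uv: "u \<in> carrier P" "v \<in> carrier P" "act c u = act c v" for u v
  proof -
    obtain p q where pq: "u = cl p" "loop p" "v = cl q" "loop q" using uv by (auto simp: carrier_pi1)
    let ?i = "inv_into X f"
    have "homotopic_paths X (f \<circ> p) (f \<circ> q)"
      using uv(3) pq act_mc[OF f(1)] loop_class_eq_iff[OF loop_compose[OF F(1-3) pq(2)]] by (simp add: f(2))
    then have 1: "homotopic_paths X (?i \<circ> (f \<circ> p)) (?i \<circ> (f \<circ> q))" by (rule homotopic_compose[OF F(5,6)])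
    have 2: "homotopic_paths X r (?i \<circ> (f \<circ> r))" if "loop r" for r
      by (rule homotopic_paths_eq) (use that F(9) in \<open>auto simp: loop_def path_image_def image_subset_iff\<close>)
    have "homotopic_paths X p q"
      using homotopic_paths_trans[OF homotopic_paths_trans[OF 2[OF pq(2)] 1] homotopic_paths_sym[OF 2[OF pq(4)]]] .
    then show ?thesis using pq loop_class_eq_iff by simp
  qed
  have surj: "\<exists>u\<in>carrier P. act c u = v" if v: "v \<in> carrier P" for v
  proof -
    obtain q where q: "v = cl q" "loop q" using v by (auto simp: carrier_pi1)
    let ?p = "inv_into X f \<circ> q"
    have p: "loop ?p" using loop_compose[OF F(5-7) q(2)] .
    have "homotopic_paths X q (f \<circ> ?p)"
      by (rule homotopic_paths_eq) (use q(2) F(8) in \<open>auto simp: loop_def path_image_def image_subset_iff\<close>)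
    then have "act c (cl ?p) = v" using act_mc[OF f(1) p] q loop_class_cong[OF q(2)] by (simp add: f(2))
    then show ?thesis using p by (auto simp: carrier_pi1)
  qed
  show "bij_betw (act c) (carrier P) (carrier P)"
    unfolding bij_betw_def inj_on_def using inj closed surj by blast
qed

lemma one_Md: "\<one>\<^bsub>Md\<^esub> \<in> carrier Md"
  by (simp add: Md_one Md_carrier id_D)

lemma mult_Md: "c \<in> carrier Md \<Longrightarrow> d \<in> carrier Md \<Longrightarrow> c \<otimes>\<^bsub>Md\<^esub> d \<in> carrier Md"
  using Md_mult compose_D by (auto simp: Md_carrier)

lemma act_one: "u \<in> carrier P \<Longrightarrow> act \<one>\<^bsub>Md\<^esub> u = u"
  using act_mc[OF id_D] by (auto simp: carrier_pi1 Md_one)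

lemma act_mult:
  assumes "c \<in> carrier Md" "d \<in> carrier Md" "u \<in> carrier P"
  shows "act (c \<otimes>\<^bsub>Md\<^esub> d) u = act c (act d u)"
proof -
  obtain f h p where "f \<in> D" "c = mc f" "h \<in> D" "d = mc h" "u = cl p" "loop p"
    using assms by (auto simp: Md_carrier carrier_pi1)
  then show ?thesis
    using act_mc loop_compose[OF D_facts(1-3)[of h]] by (simp add: Md_mult compose_D o_assoc)
qed

lemma act_boundary_loop:
  assumes "c \<in> carrier Md" "loop \<gamma>" "path_image \<gamma> \<subseteq> mfd_boundary A"
  shows "act c (cl \<gamma>) = cl \<gamma>"
proof -
  obtain f where f: "f \<in> D" "c = mc f" using assms by (auto simp: Md_carrier)
  have "homotopic_paths X \<gamma> (f \<circ> \<gamma>)"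
    by (rule homotopic_paths_eq)
      (use assms(2,3) D_facts(4)[OF f(1)] in \<open>auto simp: loop_def path_image_def image_subset_iff\<close>)
  then show ?thesis using act_mc[OF f(1) assms(2)] loop_class_cong[OF assms(2)] by (simp add: f(2))
qed

end

section \<open>Automorphisms preserving the boundary word are symplectic\<close>

text \<open>Commutators in this central extension of \<open>\<int>\<^sup>2\<close> by \<open>\<int>\<close> are central, with the determinant of the two
  \<open>\<int>\<^sup>2\<close>-components as their value.\<close>

definition heisenberg :: "(int \<times> int \<times> int) monoid" where
  "heisenberg = \<lparr>carrier = UNIV,
     mult = (\<lambda>(p, q, r) (p', q', r'). (p + p', q + q', r + r' + p * q')), one = (0, 0, 0)\<rparr>"

lemma heisenberg_simps [simp]:
  "carrier heisenberg = UNIV"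
  "(p, q, r) \<otimes>\<^bsub>heisenberg\<^esub> (p', q', r') = (p + p', q + q', r + r' + p * q')"
  "\<one>\<^bsub>heisenberg\<^esub> = (0, 0, 0)"
  by (simp_all add: heisenberg_def)

lemma heisenberg_projections:
  "fst (x \<otimes>\<^bsub>heisenberg\<^esub> y) = fst x + fst y"
  "fst (snd (x \<otimes>\<^bsub>heisenberg\<^esub> y)) = fst (snd x) + fst (snd y)"
  by (cases x, cases y, simp)+

lemma group_heisenberg: "Group.group heisenberg"
proof (rule groupI)
  fix x y z :: "int \<times> int \<times> int"
  obtain p q r p' q' r' p'' q'' r'' where [simp]: "x = (p, q, r)" "y = (p', q', r')" "z = (p'', q'', r'')"
    by (metis prod_cases3)
  show "x \<otimes>\<^bsub>heisenberg\<^esub> y \<otimes>\<^bsub>heisenberg\<^esub> z = x \<otimes>\<^bsub>heisenberg\<^esub> (y \<otimes>\<^bsub>heisenberg\<^esub> z)"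
    by (simp add: algebra_simps)
  show "\<exists>y\<in>carrier heisenberg. y \<otimes>\<^bsub>heisenberg\<^esub> x = \<one>\<^bsub>heisenberg\<^esub>"
    by (rule bexI[of _ "(- p, - q, - r + p * q)"]) auto
  show "\<one>\<^bsub>heisenberg\<^esub> \<otimes>\<^bsub>heisenberg\<^esub> x = x" by simp
qed auto

lemma heisenberg_commutator:
  "commutator heisenberg (p, q, r) (p', q', r') = (0, 0, p * q' - p' * q)"
proof -
  interpret Group.group heisenberg by (rule group_heisenberg)
  have inv: "inv\<^bsub>heisenberg\<^esub> (p, q, r) = (- p, - q, - r + p * q)" for p q r
    by (rule inv_equality) auto
  show ?thesis unfolding commutator_def inv by (simp add: algebra_simps)
qed

definition boundary_word :: "('a, 'm) monoid_scheme \<Rightarrow> nat \<Rightarrow> (nat \<Rightarrow> 'a) \<Rightarrow> (nat \<Rightarrow> 'a) \<Rightarrow> 'a" where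
  "boundary_word P g a b = foldr (\<lambda>i u. commutator P (a i) (b i) \<otimes>\<^bsub>P\<^esub> u) [1..<Suc g] \<one>\<^bsub>P\<^esub>"

context group_hom
begin

lemma hom_commutator:
  "x \<in> carrier G \<Longrightarrow> y \<in> carrier G \<Longrightarrow> h (commutator G x y) = commutator H (h x) (h y)"
  by (simp add: commutator_def)

lemma hom_boundary_word:
  assumes "\<And>i. i \<in> {1..g} \<Longrightarrow> a i \<in> carrier G \<and> b i \<in> carrier G"
  shows "h (boundary_word G g a b) = boundary_word H g (\<lambda>i. h (a i)) (\<lambda>i. h (b i))"
proof -
  have "foldr (\<lambda>i u. commutator G (a i) (b i) \<otimes>\<^bsub>G\<^esub> u) is \<one>\<^bsub>G\<^esub> \<in> carrier G \<and>
      h (foldr (\<lambda>i u. commutator G (a i) (b i) \<otimes>\<^bsub>G\<^esub> u) is \<one>\<^bsub>G\<^esub>)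
      = foldr (\<lambda>i u. commutator H (h (a i)) (h (b i)) \<otimes>\<^bsub>H\<^esub> u) is \<one>\<^bsub>H\<^esub>" if "set is \<subseteq> {1..g}" for "is"
    using that
  proof (induction "is")
    case (Cons i "is")
    have c: "a i \<in> carrier G" "b i \<in> carrier G" using assms[of i] Cons.prems by auto
    then have "commutator G (a i) (b i) \<in> carrier G" by (simp add: commutator_def)
    then show ?case using Cons c by (simp add: hom_commutator)
  qed simp
  note foldr_eq = this
  have "set [1..<Suc g] \<subseteq> {1..g}" by auto
  from foldr_eq[OF this] show ?thesis unfolding boundary_word_def by (rule conjunct2)
qed

end

lemma heisenberg_boundary_word:
  "boundary_word heisenberg g (\<lambda>i. (p i, q i, r i)) (\<lambda>i. (p' i, q' i, r' i))
     = (0, 0, \<Sum>i=1..g. p i * q' i - p' i * q i)"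
proof -
  have "foldr (\<lambda>i u. commutator heisenberg (p i, q i, r i) (p' i, q' i, r' i) \<otimes>\<^bsub>heisenberg\<^esub> u) is \<one>\<^bsub>heisenberg\<^esub>
      = (0, 0, \<Sum>i\<leftarrow>is. p i * q' i - p' i * q i)" for "is"
    by (induction "is") (simp_all add: heisenberg_commutator)
  then show ?thesis
    unfolding boundary_word_def
    by (simp only: sum_list_distinct_conv_sum_set distinct_upt set_upt atLeastLessThanSuc_atLeastAtMost)
qed

text \<open>As \<open>P\<close> is free, there is a homomorphism to the Heisenberg group whose first two components are \<open>u\<close> and \<open>v\<close>.
  It sends a product of \<open>g\<close> commutators to a central element, and the sums are its values on the two given words. The
  third components of the factors cancel in the commutators.\<close>

lemma boundary_word_invariant:
  assumes P: "Group.group P" and free: "free_generating_set P (a ` {1..g} \<union> b ` {1..g})"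
    and u: "u \<in> hom P integer_group" and v: "v \<in> hom P integer_group"
    and x: "\<And>i. i \<in> {1..g} \<Longrightarrow> x i \<in> carrier P \<and> y i \<in> carrier P"
    and eq: "boundary_word P g x y = boundary_word P g a b"
  shows "(\<Sum>i=1..g. u (x i) * v (y i) - u (y i) * v (x i)) = (\<Sum>i=1..g. u (a i) * v (b i) - u (b i) * v (a i))"
proof -
  interpret P: Group.group P by fact
  let ?S = "a ` {1..g} \<union> b ` {1..g}"
  have S: "?S \<subseteq> carrier P" "generate P ?S = carrier P" using free by (auto simp: free_generating_set_def)
  obtain h where h: "h \<in> hom P heisenberg" "\<forall>s\<in>?S. h s = (u s, v s, 0)"
    using free_group_universal[OF P free group_heisenberg, of "\<lambda>s. (u s, v s, 0)"] by auto
  interpret h: group_hom P heisenberg h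
    using h(1) by (intro group_hom.intro P group_heisenberg group_hom_axioms.intro)
  have comp: "\<exists>r. h w = (u w, v w, r)" if w: "w \<in> carrier P" for w
  proof -
    have "fst \<circ> h \<in> hom P integer_group" "(fst \<circ> snd) \<circ> h \<in> hom P integer_group"
      by (rule hom_compose[OF h(1)], auto intro!: homI simp: heisenberg_projections)+
    then have "(fst \<circ> h) w = u w" "((fst \<circ> snd) \<circ> h) w = v w"
      using hom_eq_on_generate[OF P group_integer_group _ u S(1), of _ w] 
        hom_eq_on_generate[OF P group_integer_group _ v S(1), of _ w] h(2) S(2) w by auto
    then show ?thesis by (metis comp_apply prod.collapse)
  qed
  have "\<exists>r. \<forall>w\<in>carrier P. h w = (u w, v w, r w)" using comp by (intro bchoice) blast
  then obtain r where r: "\<And>w. w \<in> carrier P \<Longrightarrow> h w = (u w, v w, r w)" by blast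
  have val: "h (boundary_word P g x y) = (0, 0, \<Sum>i=1..g. u (x i) * v (y i) - u (y i) * v (x i))"
    if x: "\<And>i. i \<in> {1..g} \<Longrightarrow> x i \<in> carrier P \<and> y i \<in> carrier P" for x y
  proof -
    have "h (boundary_word P g x y) = boundary_word heisenberg g (\<lambda>i. h (x i)) (\<lambda>i. h (y i))"
      by (rule h.hom_boundary_word) (rule x)
    also have "\<dots> = boundary_word heisenberg g (\<lambda>i. (u (x i), v (x i), r (x i))) (\<lambda>i. (u (y i), v (y i), r (y i)))"
      unfolding boundary_word_def by (rule foldr_cong) (use x r in auto)
    finally show ?thesis by (simp add: heisenberg_boundary_word)
  qed
  have "a i \<in> carrier P \<and> b i \<in> carrier P" if "i \<in> {1..g}" for i using S(1) that by auto
  from val[of a b, OF this] val[of x y, OF x] eq show ?thesis by simp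
qed

context symplectic_basis
begin

lemma I_hom_right: "x \<in> carrier H \<Longrightarrow> I x \<in> hom H integer_group"
  by (rule homI) (simp_all add: I_mult)

lemma I_hom_left: "y \<in> carrier H \<Longrightarrow> (\<lambda>x. I x y) \<in> hom H integer_group"
  by (rule homI) (simp_all add: I_mult)

lemma finprod_integer_group: "finprod integer_group f J = sum f J"
proof -
  interpret comm_group integer_group by (rule abelian_integer_group)
  show ?thesis by (induction J rule: infinite_finite_induct) auto
qed

lemma expansion_int:
  assumes "\<phi> \<in> hom H integer_group" "y \<in> carrier H"
  shows "\<phi> y = (\<Sum>i=1..g. \<phi> (\<beta> i) * I (\<alpha> i) y + \<phi> (\<alpha> i) * I y (\<beta> i))"
  using expansion[OF abelian_integer_group assms] by (simp add: finprod_integer_group mult.commute)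

lemma I_expansion:
  assumes "u \<in> carrier H" "v \<in> carrier H"
  shows "I u v = (\<Sum>i=1..g. I u (\<alpha> i) * I v (\<beta> i) - I u (\<beta> i) * I v (\<alpha> i))"
proof -
  have "I u v = (\<Sum>i=1..g. I u (\<beta> i) * I (\<alpha> i) v + I u (\<alpha> i) * I v (\<beta> i))"
    by (rule expansion_int[OF I_hom_right[OF assms(1)] assms(2)])
  also have "\<dots> = (\<Sum>i=1..g. I u (\<alpha> i) * I v (\<beta> i) - I u (\<beta> i) * I v (\<alpha> i))"
    by (rule sum.cong) (use assms I_skew[of v] in \<open>auto simp: algebra_simps\<close>)
  finally show ?thesis .
qed

text \<open>Let \<open>J x y = I (T x) (T y)\<close> and let \<open>z\<close> have the coordinates that \<open>y\<close> would have if the basis were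
  symplectic for \<open>J\<close>. The hypothesis says that \<open>T z\<close> and \<open>T y\<close> pair equally with every element of the image of \<open>T\<close>, so
  \<open>z = y\<close>; and pairing \<open>z\<close> with basis elements by \<open>I\<close> returns the values of \<open>J\<close>.\<close>

lemma symplectic_of_bivector:
  assumes T: "T \<in> hom H H" and bij: "bij_betw T (carrier H) (carrier H)"
    and inv: "\<And>u v. u \<in> carrier H \<Longrightarrow> v \<in> carrier H \<Longrightarrow>
      (\<Sum>i=1..g. I u (T (\<alpha> i)) * I v (T (\<beta> i)) - I u (T (\<beta> i)) * I v (T (\<alpha> i))) = I u v"
    and xy: "x \<in> carrier H" "y \<in> carrier H"
  shows "I (T x) (T y) = I x y"
proof -
  have Tc: "T x \<in> carrier H" if "x \<in> carrier H" for x using hom_in_carrier[OF T that] .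
  let ?J = "\<lambda>x y. I (T x) (T y)"
  have J_hom: "?J x \<in> hom H integer_group" if "x \<in> carrier H" for x
    using hom_compose[OF T I_hom_right[OF Tc[OF that]]] by (simp add: o_def)
  have J_hom': "(\<lambda>x. ?J x y) \<in> hom H integer_group" if "y \<in> carrier H" for y
    using hom_compose[OF T I_hom_left[OF Tc[OF that]]] by (simp add: o_def)
  have basis: "I x y = ?J x y" if x: "x \<in> \<alpha> ` {1..g} \<union> \<beta> ` {1..g}" and y: "y \<in> carrier H" for x y
  proof -
    \<comment> \<open>the coordinates of \<open>y\<close> with respect to \<open>J\<close>\<close>
    define z where "z = finprod H (\<lambda>i. \<alpha> i [^]\<^bsub>H\<^esub> ?J y (\<beta> i) \<otimes>\<^bsub>H\<^esub> \<beta> i [^]\<^bsub>H\<^esub> (- ?J y (\<alpha> i))) {1..g}"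
    have zc: "z \<in> carrier H" unfolding z_def by (rule H.finprod_closed) auto
    have hom_z: "\<phi> z = (\<Sum>i=1..g. ?J y (\<beta> i) * \<phi> (\<alpha> i) - ?J y (\<alpha> i) * \<phi> (\<beta> i))"
      if \<phi>: "\<phi> \<in> hom H integer_group" for \<phi>
    proof -
      interpret p: group_hom H integer_group \<phi> using \<phi> by (intro group_hom.intro H.group_axioms group_hom_axioms.intro) auto
      have pw: "\<phi> (s [^]\<^bsub>H\<^esub> (n::int)) = n * \<phi> s" if "s \<in> carrier H" for s n
        using p.hom_int_pow[OF that, of n] by (simp add: mult.commute)
      have "\<phi> z = (\<Sum>i=1..g. \<phi> (\<alpha> i [^]\<^bsub>H\<^esub> ?J y (\<beta> i) \<otimes>\<^bsub>H\<^esub> \<beta> i [^]\<^bsub>H\<^esub> (- ?J y (\<alpha> i))))"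
        unfolding z_def
        by (subst hom_finprod[OF H.comm_group_axioms abelian_integer_group \<phi>]) (auto simp: finprod_integer_group)
      also have "\<dots> = (\<Sum>i=1..g. ?J y (\<beta> i) * \<phi> (\<alpha> i) - ?J y (\<alpha> i) * \<phi> (\<beta> i))"
      proof (rule sum.cong)
        fix i assume i: "i \<in> {1..g}"
        have c: "\<alpha> i [^]\<^bsub>H\<^esub> n \<in> carrier H" "\<beta> i [^]\<^bsub>H\<^esub> n \<in> carrier H" for n :: int
          using \<alpha>[OF i] \<beta>[OF i] by auto
        show "\<phi> (\<alpha> i [^]\<^bsub>H\<^esub> ?J y (\<beta> i) \<otimes>\<^bsub>H\<^esub> \<beta> i [^]\<^bsub>H\<^esub> (- ?J y (\<alpha> i))) = ?J y (\<beta> i) * \<phi> (\<alpha> i) - ?J y (\<alpha> i) * \<phi> (\<beta> i)"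
          using p.hom_mult[OF c] pw[OF \<alpha>[OF i]] pw[OF \<beta>[OF i]] by simp
      qed simp
      finally show ?thesis .
    qed
    have "I w (T z) = I w (T y)" if w: "w \<in> carrier H" for w
    proof -
      obtain x where x: "x \<in> carrier H" "w = T x" using w bij by (auto simp: bij_betw_def)
      have "?J x z = (\<Sum>i=1..g. ?J x (\<alpha> i) * ?J y (\<beta> i) - ?J x (\<beta> i) * ?J y (\<alpha> i))"
        unfolding hom_z[OF J_hom[OF x(1)]] by (simp add: mult.commute)
      also have "\<dots> = ?J x y" by (rule inv[OF Tc[OF x(1)] Tc[OF y]])
      finally show ?thesis using x by simp
    qed
    then have "I w (T z \<otimes>\<^bsub>H\<^esub> inv\<^bsub>H\<^esub> T y) = 0" if w: "w \<in> carrier H" for w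
    proof -
      interpret p: group_hom H integer_group "I w"
        using I_hom_right[OF w] by (intro group_hom.intro H.group_axioms group_hom_axioms.intro) auto
      show ?thesis using \<open>\<And>w. w \<in> carrier H \<Longrightarrow> I w (T z) = I w (T y)\<close>[OF w] Tc[OF zc] Tc[OF y] by simp
    qed
    then have "T z \<otimes>\<^bsub>H\<^esub> inv\<^bsub>H\<^esub> T y = \<one>\<^bsub>H\<^esub>" using Tc zc y by (intro I_nondegenerate) auto
    then have "T z = T y" using Tc[OF zc] Tc[OF y] by (metis H.inv_closed H.inv_equality H.inv_inv)
    then have "z = y" using bij zc y by (auto simp: bij_betw_def inj_on_def)
    have yJ: "?J u y = - ?J y u" if "u \<in> carrier H" for u
      by (rule I_skew[OF Tc[OF y] Tc[OF that]])
    from x consider (a) j where "j \<in> {1..g}" "x = \<alpha> j" | (b) j where "j \<in> {1..g}" "x = \<beta> j" by blast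
    then show ?thesis
    proof cases
      case a
      have "I x z = (\<Sum>i=1..g. ?J y (\<beta> i) * I x (\<alpha> i) - ?J y (\<alpha> i) * I x (\<beta> i))"
        by (rule hom_z[OF I_hom_right]) (use a in simp)
      also have "\<dots> = (\<Sum>i=1..g. if j = i then - ?J y (\<alpha> i) else 0)"
        by (rule sum.cong) (use a in \<open>auto simp: I_basis\<close>)
      also have "\<dots> = - ?J y x" using a by simp
      finally show ?thesis using \<open>z = y\<close> yJ a by simp
    next
      case b
      have "I x z = (\<Sum>i=1..g. ?J y (\<beta> i) * I x (\<alpha> i) - ?J y (\<alpha> i) * I x (\<beta> i))"
        by (rule hom_z[OF I_hom_right]) (use b in simp)
      also have "\<dots> = (\<Sum>i=1..g. if j = i then - ?J y (\<beta> i) else 0)"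
        by (rule sum.cong) (use b in \<open>auto simp: I_basis\<close>)
      also have "\<dots> = - ?J y x" using b by simp
      finally show ?thesis using \<open>z = y\<close> yJ b by simp
    qed
  qed
  have "(\<lambda>x. I x y) x = (\<lambda>x. ?J x y) x"
    by (rule hom_eqI[OF group_integer_group I_hom_left J_hom']) (use basis xy in auto)
  then show ?thesis by simp
qed

end

section \<open>The map \<open>D\<^sub>*\<close>\<close>

lemma qwedge_zero_left: "qwedge W 0 y = \<one>\<^bsub>ext_quot W\<^esub>"
proof -
  interpret comm_group "ext_quot W" by (rule comm_group_ext_quot)
  show ?thesis using qwedge_add_left[of W 0 0 y] qwedge_closed[of W 0 y] by simp
qed

lemma qwedge_swap: "qwedge W (- x) y = qwedge W y x"
proof -
  interpret comm_group "ext_quot W" by (rule comm_group_ext_quot)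
  have "\<one>\<^bsub>ext_quot W\<^esub> = qwedge W (x + y) (x + y)" by (simp add: qwedge_self)
  also have "\<dots> = qwedge W x y \<otimes>\<^bsub>ext_quot W\<^esub> qwedge W y x"
    by (simp only: qwedge_add_left qwedge_add_right) (simp add: qwedge_self qwedge_closed m_comm)
  finally have "qwedge W y x \<otimes>\<^bsub>ext_quot W\<^esub> qwedge W x y = \<one>\<^bsub>ext_quot W\<^esub>" by (simp add: m_comm qwedge_closed)
  then have 1: "inv\<^bsub>ext_quot W\<^esub> qwedge W x y = qwedge W y x" by (rule inv_equality) (simp_all add: qwedge_closed)
  have "qwedge W (- x) y \<otimes>\<^bsub>ext_quot W\<^esub> qwedge W x y = \<one>\<^bsub>ext_quot W\<^esub>"
    by (simp flip: qwedge_add_left add: qwedge_zero_left)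
  then have "inv\<^bsub>ext_quot W\<^esub> qwedge W x y = qwedge W (- x) y" by (rule inv_equality) (simp_all add: qwedge_closed)
  then show ?thesis using 1 by simp
qed

lemma qwedge_sum_left: "qwedge W (\<Sum>i\<in>J. x i) y = finprod (ext_quot W) (\<lambda>i. qwedge W (x i) y) J"
proof -
  interpret comm_group "ext_quot W" by (rule comm_group_ext_quot)
  show ?thesis
    by (induction J rule: infinite_finite_induct) (simp_all add: qwedge_zero_left qwedge_add_left qwedge_closed)
qed

text \<open>Each of the two terms on the left contributes \<open>(1 / 2) s \<and> t\<close>, and \<open>(x - s) \<and> (y - t)\<close> vanishes modulo \<open>\<And>\<^sup>2 W\<close>. This
  is where the factor \<open>1 / 2\<close> in the left inverse of \<open>D\<^sub>*\<close> comes from.\<close>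

lemma qwedge_split:
  assumes "x - s \<in> W" "y - t \<in> W"
  shows "qwedge W s (y - (1 / 2) *\<^sub>R t) \<otimes>\<^bsub>ext_quot W\<^esub> qwedge W (- t) (x - (1 / 2) *\<^sub>R s) = qwedge W x y"
proof -
  interpret comm_group "ext_quot W" by (rule comm_group_ext_quot)
  let ?u = "x - s" and ?v = "y - t"
  have y: "y - (1 / 2) *\<^sub>R t = ?v + (1 / 2) *\<^sub>R t" and x: "x - (1 / 2) *\<^sub>R s = ?u + (1 / 2) *\<^sub>R s"
    by (simp_all add: algebra_simps flip: scaleR_add_left)
  have half: "qwedge W s t = qwedge W s ((1 / 2) *\<^sub>R t) \<otimes>\<^bsub>ext_quot W\<^esub> qwedge W s ((1 / 2) *\<^sub>R t)"
    by (simp flip: qwedge_add_right scaleR_add_left)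
  have "qwedge W (- t) ((1 / 2) *\<^sub>R s) = qwedge W s ((1 / 2) *\<^sub>R t)"
    by (simp add: qwedge_swap qwedge_scaleR)
  then have "qwedge W s (y - (1 / 2) *\<^sub>R t) \<otimes>\<^bsub>ext_quot W\<^esub> qwedge W (- t) (x - (1 / 2) *\<^sub>R s)
     = (qwedge W s ?v \<otimes>\<^bsub>ext_quot W\<^esub> qwedge W s ((1 / 2) *\<^sub>R t)) \<otimes>\<^bsub>ext_quot W\<^esub> (qwedge W ?u t \<otimes>\<^bsub>ext_quot W\<^esub> qwedge W s ((1 / 2) *\<^sub>R t))"
    unfolding x y by (simp only: qwedge_add_right qwedge_swap)
  also have "\<dots> = (qwedge W s t \<otimes>\<^bsub>ext_quot W\<^esub> qwedge W s ?v) \<otimes>\<^bsub>ext_quot W\<^esub> qwedge W ?u t"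
    unfolding half by (simp add: m_ac qwedge_closed)
  also have "\<dots> = qwedge W s y \<otimes>\<^bsub>ext_quot W\<^esub> qwedge W ?u y"
  proof -
    have "qwedge W s y = qwedge W s t \<otimes>\<^bsub>ext_quot W\<^esub> qwedge W s ?v" by (simp flip: qwedge_add_right)
    moreover have "qwedge W ?u y = qwedge W ?u t \<otimes>\<^bsub>ext_quot W\<^esub> qwedge W ?u ?v" by (simp flip: qwedge_add_right)
    ultimately show ?thesis using qwedge_W[OF assms] by (simp add: qwedge_closed)
  qed
  also have "\<dots> = qwedge W x y" by (simp flip: qwedge_add_left)
  finally show ?thesis .
qed

lemma int_pow_add_group_UNIV: "x [^]\<^bsub>add_group UNIV\<^esub> (n::int) = of_int n *\<^sub>R (x :: 'v::real_vector)"
  by (rule int_pow_add_group) auto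

lemma finprod_add_group:
  assumes "add_subgroup V" "f \<in> J \<rightarrow> V"
  shows "finprod (add_group V) f J = sum f J"
proof -
  interpret comm_group "add_group V" by (rule comm_group_add_group) fact
  show ?thesis using assms(2)
    by (induction J rule: infinite_finite_induct) (auto simp: Pi_iff)
qed

section \<open>The left inverse of \<open>D\<^sub>*\<close>\<close>

text \<open>The data that do not involve mapping classes: generators of \<open>P\<close> whose classes are a symplectic basis, the
  logarithms \<open>lp\<close>, and the projection \<open>q\<close> with kernel \<open>W\<close>.\<close>

locale malcev_projection = Group.group P for P :: "('p, 'pm) monoid_scheme" +
  fixes g :: nat and a b :: "nat \<Rightarrow> 'p" and I :: "'p set \<Rightarrow> 'p set \<Rightarrow> int"
    and lp :: "'p \<Rightarrow> 'e::real_vector" and W :: "'e set" and q :: "'e \<Rightarrow> ('p set \<times> real \<Rightarrow>\<^sub>0 int) set"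
  assumes gens_closed: "a ` {1..g} \<union> b ` {1..g} \<subseteq> carrier P"
    and gens: "generate P (a ` {1..g} \<union> b ` {1..g}) = carrier P"
    and I_form: "intersection_form g (nil_quot P 2) (\<lambda>i. nil_proj P 2 (a i)) (\<lambda>i. nil_proj P 2 (b i)) I"
    and q: "abelian_projection P lp W q" and W: "subspace W"
begin

abbreviation "H \<equiv> nil_quot P 2"
abbreviation "pr \<equiv> nil_proj P 2"
abbreviation "\<alpha> \<equiv> \<lambda>i. pr (a i)"
abbreviation "\<beta> \<equiv> \<lambda>i. pr (b i)"
abbreviation "R \<equiv> add_group (UNIV :: real set)"
abbreviation "V \<equiv> add_group (UNIV :: 'e set)"

lemma ab_closed [simp]: "i \<in> {1..g} \<Longrightarrow> a i \<in> carrier P" "i \<in> {1..g} \<Longrightarrow> b i \<in> carrier P"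
  using gens_closed by auto

lemma pr_closed [simp]: "x \<in> carrier P \<Longrightarrow> pr x \<in> carrier H"
  by (simp add: carrier_nil_quot)

sublocale symplectic_basis H g \<alpha> \<beta> I
proof (intro symplectic_basis.intro symplectic_basis_axioms.intro comm_group_nil_quot_2 I_form)
  show "generate H (\<alpha> ` {1..g} \<union> \<beta> ` {1..g}) = carrier H"
    using nil_quot_generate[OF gens_closed gens, of 2] by (simp add: image_Un image_image)
qed simp_all

lemma comm_R: "comm_group R" and comm_V: "comm_group V"
  by (simp_all add: comm_group_add_group)

lemma W_sub: "add_subgroup W" by (rule subspace_add_subgroup[OF W])
lemma comm_W: "comm_group (add_group W)" by (rule comm_group_add_group[OF W_sub])

lemma q_hom: "q \<in> hom V (tensor H R)"
  and q_scale: "q (r *\<^sub>R X) = real_tens H UNIV (q X) r"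
  and q_lp: "x \<in> carrier P \<Longrightarrow> q (lp x) = tens H R (pr x) 1"
  and q_kernel: "q X = \<one>\<^bsub>tensor H R\<^esub> \<longleftrightarrow> X \<in> W"
  using q by (auto simp: abelian_projection_def real_homology_def)

lemma q_closed: "q X \<in> carrier (tensor H R)"
  using hom_in_carrier[OF q_hom] by simp

text \<open>The pairing of the class of \<open>X\<close> in \<open>H \<otimes> \<real>\<close> with \<open>h\<close>.\<close>

definition \<kappa> :: "'e \<Rightarrow> 'p set \<Rightarrow> real" where
  "\<kappa> X h = dual R (q X) h"

lemma \<kappa>_hom: "h \<in> carrier H \<Longrightarrow> (\<lambda>X. \<kappa> X h) \<in> hom V R"
  using Group.hom_compose[OF q_hom dual_eval_hom[OF comm_R]] by (simp add: o_def \<kappa>_def)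

lemma \<kappa>_add: "h \<in> carrier H \<Longrightarrow> \<kappa> (X + Y) h = \<kappa> X h + \<kappa> Y h"
  using hom_mult[OF \<kappa>_hom[of h], of X Y] by simp

lemma \<kappa>_scale: "h \<in> carrier H \<Longrightarrow> \<kappa> (r *\<^sub>R X) h = r * \<kappa> X h"
proof -
  assume h: "h \<in> carrier H"
  have "(\<lambda>s::real. s *\<^sub>R r) \<in> hom R R" by (auto intro!: homI simp: algebra_simps)
  from dual_tensor_map[OF comm_R comm_R this q_closed h] show ?thesis
    by (simp add: \<kappa>_def q_scale real_tens_def)
qed

lemma \<kappa>_linear: "h \<in> carrier H \<Longrightarrow> linear (\<lambda>X. \<kappa> X h)"
  by (rule linearI) (simp_all add: \<kappa>_add \<kappa>_scale)

lemma \<kappa>_hom_right: "\<kappa> X \<in> hom H R"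
  using hom_in_carrier[OF dual_hom[OF comm_R] q_closed[of X]] unfolding \<kappa>_def[abs_def] Hom_group_simps by simp

lemma \<kappa>_lp: "x \<in> carrier P \<Longrightarrow> h \<in> carrier H \<Longrightarrow> \<kappa> (lp x) h = of_int (I (pr x) h)"
  by (simp add: \<kappa>_def q_lp dual_tens[OF comm_R] int_pow_add_group_UNIV)

lemma \<kappa>_expansion:
  assumes "h \<in> carrier H"
  shows "\<kappa> X h = (\<Sum>i=1..g. of_int (I (\<alpha> i) h) * \<kappa> X (\<beta> i) + of_int (I h (\<beta> i)) * \<kappa> X (\<alpha> i))"
  using expansion[OF comm_R \<kappa>_hom_right assms, of X]
  by (simp add: finprod_add_group int_pow_add_group_UNIV)

text \<open>Duality with real coefficients is injective, so the pairing \<open>\<kappa>\<close> detects the kernel of \<open>q\<close>.\<close>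

lemma W_iff: "X \<in> W \<longleftrightarrow> (\<forall>h\<in>carrier H. \<kappa> X h = 0)"
proof
  assume "X \<in> W"
  then have qX: "q X = \<one>\<^bsub>tensor H R\<^esub>" using q_kernel by simp
  show "\<forall>h\<in>carrier H. \<kappa> X h = 0"
  proof
    fix h assume h: "h \<in> carrier H"
    interpret T: tensor_pair H R by (rule tensor_pair_H[OF comm_R])
    interpret group_hom "tensor H R" R "\<lambda>t. dual R t h"
      by (intro group_hom.intro group_hom_axioms.intro dual_eval_hom[OF comm_R h]
          comm_group.axioms(2)[OF T.comm_group_tensor] comm_group.axioms(2)[OF comm_R])
    show "\<kappa> X h = 0" unfolding \<kappa>_def qX using hom_one by simp
  qed
next
  assume 0: "\<forall>h\<in>carrier H. \<kappa> X h = 0"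
  interpret T: tensor_pair H R by (rule tensor_pair_H[OF comm_R])
  interpret TR: comm_group "tensor H R" by (rule T.comm_group_tensor)
  interpret HR: comm_group "Hom_group H R" by (rule comm_group_Hom[OF comm_R])
  interpret d: group_hom "tensor H R" "Hom_group H R" "dual R"
    by (intro group_hom.intro group_hom_axioms.intro dual_hom[OF comm_R] TR.group_axioms HR.group_axioms)
  have "dual R (q X) = \<one>\<^bsub>Hom_group H R\<^esub>"
    by (rule Hom_group_eqI[OF d.hom_closed[OF q_closed] HR.one_closed]) (use 0 in \<open>auto simp: \<kappa>_def Hom_group_simps\<close>)
  also have "\<dots> = dual R \<one>\<^bsub>tensor H R\<^esub>" by (rule d.hom_one[symmetric])
  finally have "q X = \<one>\<^bsub>tensor H R\<^esub>"
    using dual_bij[OF comm_R] q_closed TR.one_closed by (auto simp: bij_betw_def inj_on_def)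
  then show "X \<in> W" using q_kernel by simp
qed

text \<open>The component of \<open>X\<close> in the span of the logarithms of the generators, along \<open>W\<close>.\<close>

definition E :: "'e \<Rightarrow> 'e" where
  "E X = (\<Sum>i=1..g. \<kappa> X (\<beta> i) *\<^sub>R lp (a i) - \<kappa> X (\<alpha> i) *\<^sub>R lp (b i))"

lemma \<kappa>_sum: "h \<in> carrier H \<Longrightarrow> \<kappa> (\<Sum>i\<in>J. f i) h = (\<Sum>i\<in>J. \<kappa> (f i) h)"
  using linear_sum[OF \<kappa>_linear] .

lemma \<kappa>_diff: "h \<in> carrier H \<Longrightarrow> \<kappa> (X - Y) h = \<kappa> X h - \<kappa> Y h"
  using linear_diff[OF \<kappa>_linear] .

lemma \<kappa>_E: "h \<in> carrier H \<Longrightarrow> \<kappa> (E X) h = \<kappa> X h"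
proof -
  assume h: "h \<in> carrier H"
  have "\<kappa> (E X) h = (\<Sum>i=1..g. of_int (I (\<alpha> i) h) * \<kappa> X (\<beta> i) + of_int (I h (\<beta> i)) * \<kappa> X (\<alpha> i))"
    unfolding E_def \<kappa>_sum[OF h]
  proof (rule sum.cong)
    fix i assume i: "i \<in> {1..g}"
    have "I h (\<beta> i) = - I (\<beta> i) h" by (rule I_skew) (use i h in auto)
    then show "\<kappa> (\<kappa> X (\<beta> i) *\<^sub>R lp (a i) - \<kappa> X (\<alpha> i) *\<^sub>R lp (b i)) h
        = of_int (I (\<alpha> i) h) * \<kappa> X (\<beta> i) + of_int (I h (\<beta> i)) * \<kappa> X (\<alpha> i)"
      using i h by (simp add: \<kappa>_diff \<kappa>_scale \<kappa>_lp)
  qed simp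
  then show ?thesis using \<kappa>_expansion[OF h, of X] by simp
qed

lemma diff_E: "X - E X \<in> W"
  by (simp add: W_iff \<kappa>_diff \<kappa>_E)

lemma E_W: "X \<in> W \<Longrightarrow> E X = 0"
  by (simp add: E_def W_iff)

lemma linear_E: "linear E"
  unfolding E_def
  by (rule linearI) (simp_all add: \<kappa>_add \<kappa>_scale algebra_simps sum.distrib sum_subtractf scaleR_sum_right)

text \<open>The image of \<open>X \<and> Y\<close> under \<open>D\<^sub>*\<close> (\<open>D_spec\<close> below).\<close>

definition \<delta> :: "'e \<Rightarrow> 'e \<Rightarrow> 'p set \<Rightarrow> 'e" where
  "\<delta> X Y = (\<lambda>h\<in>carrier H. \<kappa> X h *\<^sub>R Y - \<kappa> Y h *\<^sub>R X)"

lemma dual_real_tens: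
  assumes V': "subspace V'" and Y: "Y \<in> V'" and h: "h \<in> carrier H"
  shows "real_tens H V' (q X) Y \<in> carrier (tensor H (add_group V'))"
    "dual (add_group V') (real_tens H V' (q X) Y) h = \<kappa> X h *\<^sub>R Y"
proof -
  have c: "comm_group (add_group V')" by (rule comm_group_add_group[OF subspace_add_subgroup[OF V']])
  have f: "(\<lambda>s::real. s *\<^sub>R Y) \<in> hom R (add_group V')"
    by (auto intro!: homI simp: algebra_simps subspace_scale[OF V' Y])
  show "real_tens H V' (q X) Y \<in> carrier (tensor H (add_group V'))"
    unfolding real_tens_def by (rule hom_in_carrier[OF tensor_map_spec(1)[OF H.comm_group_axioms comm_R c f] q_closed])
  show "dual (add_group V') (real_tens H V' (q X) Y) h = \<kappa> X h *\<^sub>R Y"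
    unfolding real_tens_def \<kappa>_def by (rule dual_tensor_map[OF comm_R c f q_closed h])
qed

abbreviation "TV \<equiv> tensor H V"
abbreviation "HV \<equiv> Hom_group H V"
abbreviation "Q \<equiv> ext_quot W"

definition dt :: "'e \<Rightarrow> 'e \<Rightarrow> ('p set \<times> 'e \<Rightarrow>\<^sub>0 int) set" where
  "dt X Y = real_tens H UNIV (q X) Y \<otimes>\<^bsub>TV\<^esub> inv\<^bsub>TV\<^esub> real_tens H UNIV (q Y) X"

lemma TV: "comm_group TV" 
  using tensor_pair.comm_group_tensor[OF tensor_pair_H[OF comm_V]] .

lemma HV: "comm_group HV" by (rule comm_group_Hom[OF comm_V])

lemma Q: "comm_group Q" by (rule comm_group_ext_quot)

lemma dual_V_hom: "group_hom TV HV (dual V)"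
  by (intro group_hom.intro group_hom_axioms.intro dual_hom[OF comm_V] comm_group.axioms(2) TV HV)

lemma dual_V_eval: "h \<in> carrier H \<Longrightarrow> group_hom TV V (\<lambda>t. dual V t h)"
  by (intro group_hom.intro group_hom_axioms.intro dual_eval_hom[OF comm_V] comm_group.axioms(2)[OF comm_V] comm_group.axioms(2)[OF TV])

lemma dt_closed: "dt X Y \<in> carrier TV"
proof -
  interpret TV: comm_group TV by (rule TV)
  have "\<one>\<^bsub>H\<^esub> \<in> carrier H" by simp
  then show ?thesis unfolding dt_def by (intro TV.m_closed TV.inv_closed dual_real_tens subspace_UNIV UNIV_I)
qed

lemma dual_dt: "dual V (dt X Y) = \<delta> X Y"
proof (rule Hom_group_eqI)
  interpret d: group_hom TV HV "dual V" by (rule dual_V_hom)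
  show "dual V (dt X Y) \<in> carrier HV" by (rule d.hom_closed[OF dt_closed])
  have "(\<lambda>h. \<kappa> X h *\<^sub>R Y - \<kappa> Y h *\<^sub>R X) \<in> hom H V"
    by (rule homI) (use hom_mult[OF \<kappa>_hom_right] in \<open>auto simp: algebra_simps\<close>)
  then show "\<delta> X Y \<in> carrier HV"
    by (simp add: \<delta>_def Hom_group_simps restrict_hom[OF H.group_axioms])
  fix h assume h: "h \<in> carrier H"
  interpret e: group_hom TV V "\<lambda>t. dual V t h" by (rule dual_V_eval[OF h])
  note r = dual_real_tens[OF subspace_UNIV UNIV_I h]
  have "dual V (dt X Y) h = \<kappa> X h *\<^sub>R Y + inv\<^bsub>V\<^esub> (\<kappa> Y h *\<^sub>R X)"
    unfolding dt_def using e.hom_mult[OF r(1) group.inv_closed[OF comm_group.axioms(2)[OF TV] r(1)], of X Y Y X] e.hom_inv[OF r(1), of Y X] by (simp add: r(2))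
  then show "dual V (dt X Y) h = \<delta> X Y h" using h by (simp add: \<delta>_def inv_add_group)
qed

lemma tensor_eqI: "t \<in> carrier TV \<Longrightarrow> t' \<in> carrier TV \<Longrightarrow> dual V t = dual V t' \<Longrightarrow> t = t'"
  using dual_bij[OF comm_V] by (auto simp: bij_betw_def inj_on_def)

abbreviation "D \<equiv> D_star H I W q"

text \<open>The maps in the definition of \<open>D\<^sub>*\<close> are choices of homomorphisms with prescribed values. They exist because
  the required relations can be tested after applying the duality isomorphism, where they are evident from
  the formula for \<open>\<delta>\<close>.\<close>

lemma D_spec: "D \<in> hom Q HV" "D (qwedge W X Y) = \<delta> X Y"
proof -
  interpret TV: comm_group TV by (rule TV)
  interpret d: group_hom TV HV "dual V" by (rule dual_V_hom)
  have mult_eq: "dt X Y = dt X' Y' \<otimes>\<^bsub>TV\<^esub> dt X'' Y''" if "\<And>h. h \<in> carrier H \<Longrightarrow> \<delta> X Y h = \<delta> X' Y' h + \<delta> X'' Y'' h" for X Y X' Y' X'' Y''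
  proof (rule tensor_eqI[OF dt_closed TV.m_closed[OF dt_closed dt_closed]])
    show "dual V (dt X Y) = dual V (dt X' Y' \<otimes>\<^bsub>TV\<^esub> dt X'' Y'')"
      unfolding d.hom_mult[OF dt_closed dt_closed] dual_dt Hom_group_simps
      using that by (auto simp: \<delta>_def intro!: restrict_ext)
  qed
  have one_eq: "dt X Y = \<one>\<^bsub>TV\<^esub>" if "\<And>h. h \<in> carrier H \<Longrightarrow> \<delta> X Y h = 0" for X Y
  proof (rule tensor_eqI[OF dt_closed TV.one_closed])
    show "dual V (dt X Y) = dual V \<one>\<^bsub>TV\<^esub>"
      unfolding d.hom_one dual_dt Hom_group_simps using that by (auto simp: \<delta>_def intro!: restrict_ext)
  qed
  have ex: "\<exists>h\<in>hom Q TV. \<forall>p\<in>UNIV. h (case p of (x, y) \<Rightarrow> qwedge W x y) = (case p of (X, Y) \<Rightarrow> dt X Y)"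
  proof (rule ext_quot_universal[OF TV dt_closed])
    show "dt (x + x') y = dt x y \<otimes>\<^bsub>TV\<^esub> dt x' y" for x x' y
      by (rule mult_eq) (simp add: \<delta>_def \<kappa>_add algebra_simps)
    show "dt x (y + y') = dt x y \<otimes>\<^bsub>TV\<^esub> dt x y'" for x y y'
      by (rule mult_eq) (simp add: \<delta>_def \<kappa>_add algebra_simps)
    show "dt (r *\<^sub>R x) y = dt x (r *\<^sub>R y)" for r x y
      by (rule tensor_eqI[OF dt_closed dt_closed], unfold dual_dt)
        (auto simp: \<delta>_def \<kappa>_scale mult.commute intro!: restrict_ext)
    show "dt x x = \<one>\<^bsub>TV\<^esub>" for x by (rule one_eq) (simp add: \<delta>_def)
    show "dt x y = \<one>\<^bsub>TV\<^esub>" if "x \<in> W" "y \<in> W" for x y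
      by (rule one_eq) (use that in \<open>simp add: \<delta>_def W_iff\<close>)
  qed
  let ?h = "hom_by Q TV UNIV (\<lambda>(X, Y). qwedge W X Y) (\<lambda>(X, Y). dt X Y)"
  have D: "D = dual V \<circ> ?h" by (simp add: D_star_def dt_def)
  show "D \<in> hom Q HV" unfolding D by (rule Group.hom_compose[OF hom_by_spec(1)[OF ex] dual_hom[OF comm_V]])
  show "D (qwedge W X Y) = \<delta> X Y"
    using hom_by_spec(2)[OF ex, of "(X, Y)"] unfolding D by (simp add: dual_dt)
qed

lemma D_closed: "w \<in> carrier Q \<Longrightarrow> D w \<in> carrier HV"
  using hom_in_carrier[OF D_spec(1)] .

lemma D_hom_H: "w \<in> carrier Q \<Longrightarrow> D w \<in> hom H V"
  using D_closed by (simp add: Hom_group_simps)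

lemma D_eval_hom: "h \<in> carrier H \<Longrightarrow> group_hom Q V (\<lambda>w. D w h)"
  using Group.hom_compose[OF D_spec(1) Hom_group_eval[OF H.group_axioms comm_V]]
  by (intro group_hom.intro group_hom_axioms.intro comm_group.axioms(2)[OF Q] comm_group.axioms(2)[OF comm_V]) (auto simp: o_def)

lemma D_mult: "w \<in> carrier Q \<Longrightarrow> w' \<in> carrier Q \<Longrightarrow> h \<in> carrier H \<Longrightarrow> D (w \<otimes>\<^bsub>Q\<^esub> w') h = D w h + D w' h"
  using group_hom.hom_mult[OF D_eval_hom] by fastforce

lemma D_inv: "w \<in> carrier Q \<Longrightarrow> h \<in> carrier H \<Longrightarrow> D (inv\<^bsub>Q\<^esub> w) h = - D w h"
  using group_hom.hom_inv[OF D_eval_hom] by (fastforce simp: inv_add_group)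

definition half :: "'e \<Rightarrow> 'e" where "half X = X - (1 / 2) *\<^sub>R E X"

text \<open>For \<open>\<phi> = \<delta> X Y\<close>, the coefficients of \<open>X\<close> and \<open>Y\<close> in the values of \<open>\<phi>\<close> at \<open>\<alpha> i\<close> and \<open>\<beta> i\<close> are the coordinates of
  \<open>E X\<close> and \<open>E Y\<close>, so that the product telescopes to the left side of \<open>qwedge_split\<close>.\<close>

definition Rinv :: "('p set \<Rightarrow> 'e) \<Rightarrow> ('e \<times> 'e \<Rightarrow>\<^sub>0 int) set set" where
  "Rinv \<phi> = finprod Q (\<lambda>i. qwedge W (lp (a i)) (half (\<phi> (\<beta> i))) \<otimes>\<^bsub>Q\<^esub> qwedge W (lp (b i)) (half (- \<phi> (\<alpha> i)))) {1..g}"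

lemma linear_half: "linear half"
  unfolding half_def
  by (intro linear_compose_sub linear_compose_scale_right linear_E) (simp add: linear_id[unfolded id_def])

lemma Rinv_hom: "Rinv \<in> hom HV Q"
proof (rule homI)
  interpret Q: comm_group Q by (rule Q)
  show "Rinv \<phi> \<in> carrier Q" for \<phi>
    unfolding Rinv_def by (rule Q.finprod_closed) (simp add: qwedge_closed)
  fix \<phi> \<psi> assume "\<phi> \<in> carrier HV" "\<psi> \<in> carrier HV"
  have "Rinv (\<phi> \<otimes>\<^bsub>HV\<^esub> \<psi>) = finprod Q (\<lambda>i. (qwedge W (lp (a i)) (half (\<phi> (\<beta> i))) \<otimes>\<^bsub>Q\<^esub> qwedge W (lp (b i)) (half (- \<phi> (\<alpha> i))))
      \<otimes>\<^bsub>Q\<^esub> (qwedge W (lp (a i)) (half (\<psi> (\<beta> i))) \<otimes>\<^bsub>Q\<^esub> qwedge W (lp (b i)) (half (- \<psi> (\<alpha> i))))) {1..g}"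
    unfolding Rinv_def
  proof (rule Q.finprod_cong')
    fix i assume i: "i \<in> {1..g}"
    have e: "(\<phi> \<otimes>\<^bsub>HV\<^esub> \<psi>) (\<beta> i) = \<phi> (\<beta> i) + \<psi> (\<beta> i)" "- (\<phi> \<otimes>\<^bsub>HV\<^esub> \<psi>) (\<alpha> i) = - \<phi> (\<alpha> i) + - \<psi> (\<alpha> i)"
      using i by (simp_all add: Hom_group_simps)
    show "qwedge W (lp (a i)) (half ((\<phi> \<otimes>\<^bsub>HV\<^esub> \<psi>) (\<beta> i))) \<otimes>\<^bsub>Q\<^esub> qwedge W (lp (b i)) (half (- (\<phi> \<otimes>\<^bsub>HV\<^esub> \<psi>) (\<alpha> i)))
      = (qwedge W (lp (a i)) (half (\<phi> (\<beta> i))) \<otimes>\<^bsub>Q\<^esub> qwedge W (lp (b i)) (half (- \<phi> (\<alpha> i))))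
      \<otimes>\<^bsub>Q\<^esub> (qwedge W (lp (a i)) (half (\<psi> (\<beta> i))) \<otimes>\<^bsub>Q\<^esub> qwedge W (lp (b i)) (half (- \<psi> (\<alpha> i))))"
      unfolding e linear_add[OF linear_half] qwedge_add_right by (simp add: Q.m_ac qwedge_closed)
  qed (simp_all add: qwedge_closed)
  also have "\<dots> = Rinv \<phi> \<otimes>\<^bsub>Q\<^esub> Rinv \<psi>"
    unfolding Rinv_def by (rule Q.finprod_multf) (simp_all add: qwedge_closed)
  finally show "Rinv (\<phi> \<otimes>\<^bsub>HV\<^esub> \<psi>) = Rinv \<phi> \<otimes>\<^bsub>Q\<^esub> Rinv \<psi>" .
qed

lemma Rinv_\<delta>: "Rinv (\<delta> X Y) = qwedge W X Y"
proof -
  interpret Q: comm_group Q by (rule Q)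
  have "Rinv (\<delta> X Y) = finprod Q (\<lambda>i. qwedge W (\<kappa> X (\<beta> i) *\<^sub>R lp (a i) - \<kappa> X (\<alpha> i) *\<^sub>R lp (b i)) (half Y) \<otimes>\<^bsub>Q\<^esub>
      qwedge W (- (\<kappa> Y (\<beta> i) *\<^sub>R lp (a i) - \<kappa> Y (\<alpha> i) *\<^sub>R lp (b i))) (half X)) {1..g}"
    unfolding Rinv_def
  proof (rule Q.finprod_cong')
    fix i assume i: "i \<in> {1..g}"
    have 1: "half (\<delta> X Y (\<beta> i)) = \<kappa> X (\<beta> i) *\<^sub>R half Y + (- \<kappa> Y (\<beta> i)) *\<^sub>R half X"
      using i by (simp add: \<delta>_def linear_diff[OF linear_half] linear_scale[OF linear_half])
    have 2: "half (- \<delta> X Y (\<alpha> i)) = (- \<kappa> X (\<alpha> i)) *\<^sub>R half Y + \<kappa> Y (\<alpha> i) *\<^sub>R half X"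
      using i by (simp add: \<delta>_def linear_diff[OF linear_half] linear_scale[OF linear_half])
    have 3: "\<kappa> X (\<beta> i) *\<^sub>R lp (a i) - \<kappa> X (\<alpha> i) *\<^sub>R lp (b i) = \<kappa> X (\<beta> i) *\<^sub>R lp (a i) + (- \<kappa> X (\<alpha> i)) *\<^sub>R lp (b i)"
      "- (\<kappa> Y (\<beta> i) *\<^sub>R lp (a i) - \<kappa> Y (\<alpha> i) *\<^sub>R lp (b i)) = (- \<kappa> Y (\<beta> i)) *\<^sub>R lp (a i) + \<kappa> Y (\<alpha> i) *\<^sub>R lp (b i)"
      by simp_all
    show "qwedge W (lp (a i)) (half (\<delta> X Y (\<beta> i))) \<otimes>\<^bsub>Q\<^esub> qwedge W (lp (b i)) (half (- \<delta> X Y (\<alpha> i)))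
      = qwedge W (\<kappa> X (\<beta> i) *\<^sub>R lp (a i) - \<kappa> X (\<alpha> i) *\<^sub>R lp (b i)) (half Y) \<otimes>\<^bsub>Q\<^esub>
      qwedge W (- (\<kappa> Y (\<beta> i) *\<^sub>R lp (a i) - \<kappa> Y (\<alpha> i) *\<^sub>R lp (b i))) (half X)"
      unfolding 1 2 3 qwedge_add_left qwedge_add_right qwedge_scaleR by (simp only: Q.m_ac qwedge_closed Q.m_closed)
  qed (simp_all add: qwedge_closed)
  also have "\<dots> = qwedge W (E X) (half Y) \<otimes>\<^bsub>Q\<^esub> qwedge W (- E Y) (half X)"
    unfolding E_def sum_negf[symmetric] qwedge_sum_left
    by (rule Q.finprod_multf) (simp_all add: qwedge_closed)
  also have "\<dots> = qwedge W X Y"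
    unfolding half_def by (rule qwedge_split[OF diff_E diff_E])
  finally show ?thesis .
qed

lemma Rinv_D: "w \<in> carrier Q \<Longrightarrow> Rinv (D w) = w"
proof -
  assume w: "w \<in> carrier Q"
  have "(Rinv \<circ> D) w = id w"
  proof (rule hom_eq_on_generate[where f = "Rinv \<circ> D" and h = id and x = w and X = "{qwedge W x y | x y. True}",
        OF comm_group.axioms(2)[OF Q] comm_group.axioms(2)[OF Q]])
    show "Rinv \<circ> D \<in> hom Q Q" by (rule Group.hom_compose[OF D_spec(1) Rinv_hom])
    show "id \<in> hom Q Q" by (auto intro: homI)
    show "{qwedge W x y | x y. True} \<subseteq> carrier Q" using qwedge_closed by auto
    show "w \<in> generate Q {qwedge W x y | x y. True}" unfolding ext_quot_generate by (rule w)
    fix u assume "u \<in> {qwedge W x y | x y. True}"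
    then show "(Rinv \<circ> D) u = id u" by (auto simp: D_spec(2) Rinv_\<delta>)
  qed
  then show ?thesis by simp
qed

lemma D_eqI:
  assumes "w \<in> carrier Q" "w' \<in> carrier Q" "\<And>h. h \<in> carrier H \<Longrightarrow> D w h = D w' h"
  shows "w = w'"
proof -
  have "D w = D w'" by (rule Hom_group_eqI[OF D_closed D_closed]) (use assms in auto)
  then show ?thesis using Rinv_D assms by metis
qed

lemma carrier_mixed_wedge: "carrier (mixed_wedge W) = generate Q {qwedge W x y | x y. y \<in> W}"
  by (simp add: mixed_wedge_def)

lemma mixed_wedge_subgroup: "subgroup (carrier (mixed_wedge W)) Q"
  unfolding carrier_mixed_wedge
  by (rule group.generate_is_subgroup) (use comm_group.axioms(2)[OF Q] qwedge_closed in auto)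

text \<open>On values in \<open>W\<close> the map \<open>half\<close> is the identity, so \<open>Rinv (D w)\<close> is a product of mixed wedges.\<close>

lemma mem_mixed_wedge:
  assumes w: "w \<in> carrier Q" and DW: "\<And>h. h \<in> carrier H \<Longrightarrow> D w h \<in> W"
  shows "w \<in> carrier (mixed_wedge W)"
proof -
  interpret S: subgroup "carrier (mixed_wedge W)" Q by (rule mixed_wedge_subgroup)
  interpret Q: comm_group Q by (rule Q)
  have neg: "- x \<in> W" if "x \<in> W" for x using subspace_neg[OF W that] .
  have half: "half x = x" if "x \<in> W" for x using E_W[OF that] by (simp add: half_def)
  have gen: "qwedge W x y \<in> carrier (mixed_wedge W)" if "y \<in> W" for x y
    unfolding carrier_mixed_wedge using that by (intro generate.incl) blast
  have mem: "qwedge W (lp (a i)) (half (D w (\<beta> i))) \<otimes>\<^bsub>Q\<^esub> qwedge W (lp (b i)) (half (- D w (\<alpha> i))) \<in> carrier (mixed_wedge W)"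
    if "i \<in> {1..g}" for i
    by (intro S.m_closed gen) (use that DW neg half in auto)
  have fin: "finprod Q f J \<in> carrier (mixed_wedge W)" if "\<And>i. i \<in> J \<Longrightarrow> f i \<in> carrier (mixed_wedge W)" for f and J :: "nat set"
    using that
    by (induction J rule: infinite_finite_induct) (auto simp: Pi_iff S.subset[THEN subsetD])
  have "Rinv (D w) \<in> carrier (mixed_wedge W)" unfolding Rinv_def by (rule fin) (rule mem)
  then show ?thesis using Rinv_D[OF w] by simp
qed

lemma D_mixed: "w \<in> carrier (mixed_wedge W) \<Longrightarrow> h \<in> carrier H \<Longrightarrow> D w h \<in> W"
proof -
  assume w: "w \<in> carrier (mixed_wedge W)" and h: "h \<in> carrier H"
  interpret e: group_hom Q V "\<lambda>w. D w h" by (rule D_eval_hom[OF h])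
  have "generate Q {qwedge W x y | x y. y \<in> W} \<subseteq> {w \<in> carrier Q. D w h \<in> W}"
  proof (rule generate_subset_subgroup[OF _ _ comm_group.axioms(2)[OF Q]])
    show "subgroup {w \<in> carrier Q. D w h \<in> W} Q"
      by (rule group.subgroupI[OF comm_group.axioms(2)[OF Q]])
        (use h W D_mult D_inv e.hom_one in \<open>auto simp: subspace_add subspace_neg subspace_0 intro!: exI[of _ "\<one>\<^bsub>Q\<^esub>"]\<close>)
    show "{qwedge W x y | x y. y \<in> W} \<subseteq> {w \<in> carrier Q. D w h \<in> W}"
      using h W by (auto simp: qwedge_closed D_spec(2) \<delta>_def W_iff \<kappa>_diff \<kappa>_scale)
  qed
  then show ?thesis using w by (auto simp: carrier_mixed_wedge)
qed

text \<open>Under the duality isomorphism with coefficients in \<open>W\<close>, the element \<open>X \<and> Y\<close> and its image \<open>q X \<otimes> Y\<close> both become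
  \<open>h \<mapsto> \<kappa> X h Y\<close>, since \<open>\<kappa> Y\<close> vanishes for \<open>Y \<in> W\<close>.\<close>

lemma mixed_wedge_iso:
  assumes w: "w \<in> carrier (mixed_wedge W)"
  shows "mixed_wedge_iso H W q w \<in> carrier (tensor H (add_group W))"
    "\<And>h. h \<in> carrier H \<Longrightarrow> dual (add_group W) (mixed_wedge_iso H W q w) h = D w h"
proof -
  let ?AW = "add_group W" and ?MW = "mixed_wedge W"
  let ?HW = "Hom_group H ?AW"
  interpret S: subgroup "carrier ?MW" Q by (rule mixed_wedge_subgroup)
  interpret Q: comm_group Q by (rule Q)
  have gMW: "Group.group ?MW"
    using S.subgroup_is_group[OF Q.group_axioms] by (simp add: mixed_wedge_def)
  have mult: "x \<otimes>\<^bsub>?MW\<^esub> y = x \<otimes>\<^bsub>Q\<^esub> y" for x y by (simp add: mixed_wedge_def)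
  have T: "comm_group (tensor H ?AW)" using tensor_pair.comm_group_tensor[OF tensor_pair_H[OF comm_W]] .
  have DW: "D w \<in> carrier ?HW" if "w \<in> carrier ?MW" for w
    using that D_mixed D_hom_H[OF S.mem_carrier[OF that]] D_closed[OF S.mem_carrier[OF that]]
    by (auto simp: Hom_group_simps hom_def)
  have Dhom: "D \<in> hom ?MW ?HW"
  proof (rule homI)
    fix x y assume xy: "x \<in> carrier ?MW" "y \<in> carrier ?MW"
    then have "D (x \<otimes>\<^bsub>Q\<^esub> y) = D x \<otimes>\<^bsub>HV\<^esub> D y" by (intro hom_mult[OF D_spec(1)]) auto
    then show "D (x \<otimes>\<^bsub>?MW\<^esub> y) = D x \<otimes>\<^bsub>?HW\<^esub> D y" unfolding mult by (simp add: Hom_group_simps)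
  qed (rule DW)
  have co: "coeval ?AW \<circ> D \<in> hom ?MW (tensor H ?AW)"
    by (rule Group.hom_compose[OF Dhom coeval_hom[OF comm_W]])
  have val: "(coeval ?AW \<circ> D) (qwedge W X Y) = real_tens H W (q X) Y" if Y: "Y \<in> W" for X Y
  proof -
    have m: "qwedge W X Y \<in> carrier ?MW" unfolding carrier_mixed_wedge using Y by (intro generate.incl) blast
    have one: "\<one>\<^bsub>H\<^esub> \<in> carrier H" by simp
    have t: "real_tens H W (q X) Y \<in> carrier (tensor H ?AW)" by (rule dual_real_tens(1)[OF W Y one])
    have "dual ?AW (real_tens H W (q X) Y) = D (qwedge W X Y)"
    proof (rule Hom_group_eqI[OF hom_in_carrier[OF dual_hom[OF comm_W] t] DW[OF m]])
      fix h assume "h \<in> carrier H"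
      then show "dual ?AW (real_tens H W (q X) Y) h = D (qwedge W X Y) h"
        using Y by (simp add: dual_real_tens(2)[OF W Y] D_spec(2) \<delta>_def W_iff)
    qed
    then show ?thesis using coeval_dual[OF comm_W t] by simp
  qed
  have ex: "\<exists>h\<in>hom ?MW (tensor H ?AW). \<forall>p\<in>UNIV \<times> W. h (case p of (X, Y) \<Rightarrow> qwedge W X Y) = (case p of (X, Y) \<Rightarrow> real_tens H W (q X) Y)"
    by (rule bexI[OF _ co]) (use val in auto)
  note spec = hom_by_spec[OF ex]
  have iso: "mixed_wedge_iso H W q \<in> hom ?MW (tensor H ?AW)" unfolding mixed_wedge_iso_def by (rule spec(1))
  have "mixed_wedge_iso H W q w = (coeval ?AW \<circ> D) w"
  proof (rule hom_eq_on_generate[OF gMW comm_group.axioms(2)[OF T] iso co])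
    show "{qwedge W x y | x y. y \<in> W} \<subseteq> carrier ?MW"
      unfolding carrier_mixed_wedge by (auto intro: generate.incl)
    show "w \<in> generate ?MW {qwedge W x y | x y. y \<in> W}"
    proof -
      have "generate ?MW {qwedge W x y | x y. y \<in> W} = generate Q {qwedge W x y | x y. y \<in> W}"
        unfolding mixed_wedge_def
        by (rule Q.generate_consistent) (use mixed_wedge_subgroup in \<open>auto simp: mixed_wedge_def intro: generate.incl\<close>)
      then show ?thesis using w by (simp add: carrier_mixed_wedge)
    qed
    fix u assume "u \<in> {qwedge W x y | x y. y \<in> W}"
    then obtain X Y where u: "u = qwedge W X Y" "Y \<in> W" by blast
    then show "mixed_wedge_iso H W q u = (coeval ?AW \<circ> D) u"
      using val spec(2)[of "(X, Y)"] by (simp add: mixed_wedge_iso_def)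
  qed
  then have eq: "mixed_wedge_iso H W q w = coeval ?AW (D w)" by simp
  show "mixed_wedge_iso H W q w \<in> carrier (tensor H ?AW)" by (rule hom_in_carrier[OF iso w])
  show "dual ?AW (mixed_wedge_iso H W q w) h = D w h" if "h \<in> carrier H" for h
    unfolding eq dual_coeval[OF comm_W DW[OF w]] ..
qed

end

text \<open>A homomorphism to an abelian group kills commutators and thus factors through \<open>\<Gamma>\<^sub>2\<close>.\<close>

lemma (in Group.group) abelian_hom_factors:
  assumes C: "comm_group C" and \<phi>: "\<phi> \<in> hom G C" and xy: "x \<in> carrier G" "y \<in> carrier G"
    and eq: "nil_proj G 2 x = nil_proj G 2 y"
  shows "\<phi> x = \<phi> y"
proof -
  interpret C: comm_group C by fact
  interpret \<phi>: group_hom G C \<phi> by (intro group_hom.intro group_hom_axioms.intro \<phi> group_axioms C.group_axioms)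
  have z: "x \<otimes> inv y \<in> generate G {commutator G x y | x y. x \<in> carrier G \<and> y \<in> carrier G}"
    using eq xy by (simp add: nil_proj_eq_iff)
  have "\<phi> (x \<otimes> inv y) = (\<lambda>_. \<one>\<^bsub>C\<^esub>) (x \<otimes> inv y)"
  proof (rule hom_eq_on_generate[OF group_axioms C.group_axioms \<phi> _ _ _ z])
    show "(\<lambda>_. \<one>\<^bsub>C\<^esub>) \<in> hom G C" by (rule homI) auto
    show "{commutator G x y | x y. x \<in> carrier G \<and> y \<in> carrier G} \<subseteq> carrier G"
      by (auto simp: commutator_def)
    fix u assume "u \<in> {commutator G x y | x y. x \<in> carrier G \<and> y \<in> carrier G}"
    then obtain s t where u: "u = commutator G s t" "s \<in> carrier G" "t \<in> carrier G" by blast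
    have "\<phi> s \<otimes>\<^bsub>C\<^esub> \<phi> t \<otimes>\<^bsub>C\<^esub> inv\<^bsub>C\<^esub> \<phi> s \<otimes>\<^bsub>C\<^esub> inv\<^bsub>C\<^esub> \<phi> t
      = (\<phi> s \<otimes>\<^bsub>C\<^esub> inv\<^bsub>C\<^esub> \<phi> s) \<otimes>\<^bsub>C\<^esub> (\<phi> t \<otimes>\<^bsub>C\<^esub> inv\<^bsub>C\<^esub> \<phi> t)"
      using u by (simp only: C.m_ac C.m_closed C.inv_closed \<phi>.hom_closed)
    then show "\<phi> u = \<one>\<^bsub>C\<^esub>" using u by (simp add: commutator_def)
  qed
  then have "\<phi> x \<otimes>\<^bsub>C\<^esub> inv\<^bsub>C\<^esub> \<phi> y = \<one>\<^bsub>C\<^esub>" using xy by simp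
  then show ?thesis using xy by (metis C.inv_closed C.inv_equality C.inv_inv \<phi>.hom_closed)
qed

section \<open>The action of mapping classes\<close>

text \<open>A monoid \<open>Md\<close> acts on \<open>P\<close> by automorphisms \<open>pa c\<close> that fix the boundary word, and on the Lie algebra by maps
  \<open>va c\<close> compatible with logarithms. Since \<open>va c\<close> is prescribed only on logarithms, it is not assumed that \<open>va\<close> itself is
  an action. The hypothesis \<open>lp_fg\<close> says that the span of the logarithms is finitely generated, in a
  form that avoids naming the span.\<close>

locale mapping_class_action = malcev_projection P g a b I lp W q
  for P :: "('p, 'pm) monoid_scheme" and g a b I and lp :: "'p \<Rightarrow> 'e::real_vector" and W q +
  fixes Md :: "('c, 'cm) monoid_scheme" and pa :: "'c \<Rightarrow> 'p \<Rightarrow> 'p" and va :: "'c \<Rightarrow> 'e \<Rightarrow> 'e" and k :: nat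
  assumes k: "2 \<le> k"
    and free: "free_generating_set P (a ` {1..g} \<union> b ` {1..g})"
    and Md_one: "\<one>\<^bsub>Md\<^esub> \<in> carrier Md"
    and Md_mult: "\<And>c d. c \<in> carrier Md \<Longrightarrow> d \<in> carrier Md \<Longrightarrow> c \<otimes>\<^bsub>Md\<^esub> d \<in> carrier Md"
    and pa_hom: "\<And>c. c \<in> carrier Md \<Longrightarrow> pa c \<in> hom P P"
    and pa_bij: "\<And>c. c \<in> carrier Md \<Longrightarrow> bij_betw (pa c) (carrier P) (carrier P)"
    and pa_one: "\<And>x. x \<in> carrier P \<Longrightarrow> pa \<one>\<^bsub>Md\<^esub> x = x"
    and pa_mult: "\<And>c d x. c \<in> carrier Md \<Longrightarrow> d \<in> carrier Md \<Longrightarrow> x \<in> carrier P \<Longrightarrow> pa (c \<otimes>\<^bsub>Md\<^esub> d) x = pa c (pa d x)"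
    and pa_boundary: "\<And>c. c \<in> carrier Md \<Longrightarrow> pa c (boundary_word P g a b) = boundary_word P g a b"
    and va_linear: "\<And>c. c \<in> carrier Md \<Longrightarrow> linear (va c)"
    and va_W: "\<And>c X. c \<in> carrier Md \<Longrightarrow> X \<in> W \<Longrightarrow> va c X \<in> W"
    and va_lp: "\<And>c x. c \<in> carrier Md \<Longrightarrow> x \<in> carrier P \<Longrightarrow> va c (lp x) = lp (pa c x)"
    and lp_fg: "\<exists>T. finite T \<and> (\<forall>L. add_subgroup L \<longrightarrow> T \<subseteq> L \<longrightarrow> lp ` carrier P \<subseteq> L)"
    and lp_central: "\<And>x z. x \<in> carrier P \<Longrightarrow> z \<in> lower_central P (k - 1) \<Longrightarrow> lp (z \<otimes>\<^bsub>P\<^esub> x) = lp z + lp x"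
begin

definition \<Lambda> :: "'e set" where "\<Lambda> = generate V (lp ` carrier P)"

lemma add_subgroup_iff: "add_subgroup L \<longleftrightarrow> subgroup L V" for L :: "'e set"
proof
  interpret V: comm_group V by (rule comm_V)
  show "subgroup L V" if L: "add_subgroup L"
  proof (rule V.subgroupI)
    have "0 - x \<in> L" if "x \<in> L" for x using L that unfolding add_subgroup_def by blast
    then show "inv\<^bsub>V\<^esub> x \<in> L" if "x \<in> L" for x using that by (simp add: inv_add_group)
  qed (use L in \<open>auto simp: add_subgroup_def\<close>)
  show "add_subgroup L" if "subgroup L V"
    using subgroup.one_closed[OF that] subgroup.m_closed[OF that] subgroup.m_closed[OF that _ subgroup.m_inv_closed[OF that]]
    by (auto simp: add_subgroup_def inv_add_group)
qed

lemma \<Lambda>_add_subgroup: "add_subgroup \<Lambda>"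
  unfolding add_subgroup_iff \<Lambda>_def
  by (rule group.generate_is_subgroup[OF comm_group.axioms(2)[OF comm_V]]) simp

lemma \<Lambda>_least: "add_subgroup L \<Longrightarrow> lp ` carrier P \<subseteq> L \<Longrightarrow> \<Lambda> \<subseteq> L"
  unfolding add_subgroup_iff \<Lambda>_def
  by (rule generate_subset_subgroup[OF _ _ comm_group.axioms(2)[OF comm_V]])

lemma lp_\<Lambda>: "x \<in> carrier P \<Longrightarrow> lp x \<in> \<Lambda>"
  unfolding \<Lambda>_def by (intro generate.incl imageI)

lemma pa_closed: "c \<in> carrier Md \<Longrightarrow> x \<in> carrier P \<Longrightarrow> pa c x \<in> carrier P"
  using hom_in_carrier[OF pa_hom] .

lemma va_\<Lambda>: "c \<in> carrier Md \<Longrightarrow> X \<in> \<Lambda> \<Longrightarrow> va c X \<in> \<Lambda>"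
proof -
  assume c: "c \<in> carrier Md" and X: "X \<in> \<Lambda>"
  have "\<Lambda> \<subseteq> {X. va c X \<in> \<Lambda>}"
  proof (rule \<Lambda>_least)
    show "add_subgroup {X. va c X \<in> \<Lambda>}"
      using \<Lambda>_add_subgroup linear_0[OF va_linear[OF c]] linear_add[OF va_linear[OF c]] linear_diff[OF va_linear[OF c]]
      by (auto simp: add_subgroup_def)
  qed (auto simp: va_lp c lp_\<Lambda> pa_closed)
  then show ?thesis using X by blast
qed

lemma linear_eq_on_\<Lambda>:
  assumes "linear f" "linear h" "\<And>x. x \<in> carrier P \<Longrightarrow> f (lp x) = h (lp x)" "X \<in> \<Lambda>"
  shows "f X = h X"
proof -
  have "\<Lambda> \<subseteq> {X. f X = h X}"
  proof (rule \<Lambda>_least)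
    show "add_subgroup {X. f X = h X}"
      using linear_0[OF assms(1)] linear_0[OF assms(2)] linear_add[OF assms(1)] linear_add[OF assms(2)]
        linear_diff[OF assms(1)] linear_diff[OF assms(2)] by (auto simp: add_subgroup_def)
  qed (auto simp: assms(3))
  then show ?thesis using assms(4) by blast
qed

text \<open>The induced action on \<open>H\<close>.\<close>

definition rep :: "'p set \<Rightarrow> 'p" where "rep h = (SOME x. x \<in> carrier P \<and> pr x = h)"
definition T :: "'c \<Rightarrow> 'p set \<Rightarrow> 'p set" where "T c h = pr (pa c (rep h))"

lemma rep: "h \<in> carrier H \<Longrightarrow> rep h \<in> carrier P" "h \<in> carrier H \<Longrightarrow> pr (rep h) = h"
  unfolding rep_def using someI_ex[of "\<lambda>x. x \<in> carrier P \<and> pr x = h"] by (auto simp: carrier_nil_quot)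

lemma pr_hom: "pr \<in> hom P H" by (rule nil_proj_hom)

lemma T_pr: "c \<in> carrier Md \<Longrightarrow> x \<in> carrier P \<Longrightarrow> T c (pr x) = pr (pa c x)"
proof -
  assume c: "c \<in> carrier Md" and x: "x \<in> carrier P"
  have "(pr \<circ> pa c) (rep (pr x)) = (pr \<circ> pa c) x"
    by (rule abelian_hom_factors[OF H.comm_group_axioms Group.hom_compose[OF pa_hom[OF c] pr_hom]]) (use x rep in auto)
  then show ?thesis by (simp add: T_def)
qed

lemma T_hom: "c \<in> carrier Md \<Longrightarrow> T c \<in> hom H H"
proof (rule homI)
  assume c: "c \<in> carrier Md"
  show "T c h \<in> carrier H" if "h \<in> carrier H" for h
    using rep(1)[OF that] by (simp add: T_def pa_closed c)
  fix h h' assume h: "h \<in> carrier H" and h': "h' \<in> carrier H"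
  have "T c (h \<otimes>\<^bsub>H\<^esub> h') = T c (pr (rep h \<otimes>\<^bsub>P\<^esub> rep h'))"
    using hom_mult[OF pr_hom rep(1)[OF h] rep(1)[OF h']] rep h h' by simp
  also have "\<dots> = pr (pa c (rep h) \<otimes>\<^bsub>P\<^esub> pa c (rep h'))"
    using rep(1)[OF h] rep(1)[OF h'] by (simp add: T_pr c hom_mult[OF pa_hom[OF c]])
  also have "\<dots> = T c h \<otimes>\<^bsub>H\<^esub> T c h'"
    unfolding T_def by (rule hom_mult[OF pr_hom]) (use rep(1) h h' pa_closed c in auto)
  finally show "T c (h \<otimes>\<^bsub>H\<^esub> h') = T c h \<otimes>\<^bsub>H\<^esub> T c h'" .
qed

lemma T_closed: "c \<in> carrier Md \<Longrightarrow> h \<in> carrier H \<Longrightarrow> T c h \<in> carrier H"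
  using hom_in_carrier[OF T_hom] .

lemma T_bij: "c \<in> carrier Md \<Longrightarrow> bij_betw (T c) (carrier H) (carrier H)"
proof -
  assume c: "c \<in> carrier Md"
  let ?i = "inv_into (carrier P) (pa c)"
  have iso: "?i \<in> Group.iso P P"
    by (rule iso_set_sym) (use pa_hom pa_bij c in \<open>simp add: iso_def\<close>)
  have i: "?i \<in> hom P P" using iso by (simp add: iso_def)
  have inv1: "?i (pa c x) = x" if "x \<in> carrier P" for x using pa_bij[OF c] that by (simp add: bij_betw_def)
  have inv2: "pa c (?i x) = x" if "x \<in> carrier P" for x using pa_bij[OF c] that by (simp add: bij_betw_def f_inv_into_f)
  show ?thesis
  proof (rule bij_betw_imageI)
    show "inj_on (T c) (carrier H)"
    proof (rule inj_onI)
      fix h h' assume h: "h \<in> carrier H" and h': "h' \<in> carrier H" and "T c h = T c h'"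
      then have "pr (pa c (rep h)) = pr (pa c (rep h'))" by (simp add: T_def)
      then have "(pr \<circ> ?i) (pa c (rep h)) = (pr \<circ> ?i) (pa c (rep h'))"
        by (intro abelian_hom_factors[OF H.comm_group_axioms Group.hom_compose[OF i pr_hom]]) (use rep(1) h h' pa_closed c in auto)
      then show "h = h'" using rep h h' by (simp add: inv1)
    qed
    have "h \<in> T c ` carrier H" if h: "h \<in> carrier H" for h
    proof
      have ir: "?i (rep h) \<in> carrier P" using hom_in_carrier[OF i rep(1)[OF h]] .
      then show "pr (?i (rep h)) \<in> carrier H" by simp
      show "h = T c (pr (?i (rep h)))" unfolding T_pr[OF c ir] inv2[OF rep(1)[OF h]] rep(2)[OF h] ..
    qed
    then show "T c ` carrier H = carrier H" using T_closed[OF c] by auto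
  qed
qed

lemma T_onto: "c \<in> carrier Md \<Longrightarrow> h \<in> carrier H \<Longrightarrow> \<exists>h'\<in>carrier H. h = T c h'"
  using bij_betw_imp_surj_on[OF T_bij] by blast

text \<open>The homomorphisms \<open>I u\<close> and \<open>I v\<close>, pulled back to \<open>P\<close>, are tested on the boundary word and on its image.\<close>

lemma T_symplectic:
  assumes c: "c \<in> carrier Md" and h: "h \<in> carrier H" "h' \<in> carrier H"
  shows "I (T c h) (T c h') = I h h'"
proof (rule symplectic_of_bivector[OF T_hom[OF c] T_bij[OF c] _ h])
  fix u v assume uv: "u \<in> carrier H" "v \<in> carrier H"
  have hom: "I u \<circ> pr \<in> hom P integer_group" if "u \<in> carrier H" for u
    by (rule Group.hom_compose[OF pr_hom I_hom_right[OF that]])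
  interpret p: group_hom P P "pa c"
    by (intro group_hom.intro group_axioms group_hom_axioms.intro pa_hom c)
  have eq: "boundary_word P g (\<lambda>i. pa c (a i)) (\<lambda>i. pa c (b i)) = boundary_word P g a b"
    using pa_boundary[OF c] p.hom_boundary_word[of g a b] by simp
  have "(\<Sum>i=1..g. (I u \<circ> pr) (pa c (a i)) * (I v \<circ> pr) (pa c (b i)) - (I u \<circ> pr) (pa c (b i)) * (I v \<circ> pr) (pa c (a i)))
      = (\<Sum>i=1..g. (I u \<circ> pr) (a i) * (I v \<circ> pr) (b i) - (I u \<circ> pr) (b i) * (I v \<circ> pr) (a i))"
    by (rule boundary_word_invariant[OF group_axioms free hom[OF uv(1)] hom[OF uv(2)] _ eq]) (auto simp: pa_closed c)
  also have "\<dots> = I u v" unfolding I_expansion[OF uv] by simp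
  finally show "(\<Sum>i=1..g. I u (T c (\<alpha> i)) * I v (T c (\<beta> i)) - I u (T c (\<beta> i)) * I v (T c (\<alpha> i))) = I u v"
    by (simp add: T_pr c)
qed

text \<open>Modulo \<open>W\<close>, which is invariant, every vector is a combination of logarithms of generators, and for those the
  pairing is the intersection form.\<close>

lemma \<kappa>_va:
  assumes c: "c \<in> carrier Md" and h: "h \<in> carrier H"
  shows "\<kappa> (va c X) (T c h) = \<kappa> X h"
proof -
  note l = va_linear[OF c]
  have Th: "T c h \<in> carrier H" by (rule T_closed[OF c h])
  have 0: "\<kappa> (va c (X - E X)) (T c h) = 0" using va_W[OF c diff_E] Th by (simp add: W_iff)
  have "va c (E X) = (\<Sum>i=1..g. \<kappa> X (\<beta> i) *\<^sub>R lp (pa c (a i)) - \<kappa> X (\<alpha> i) *\<^sub>R lp (pa c (b i)))"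
    unfolding E_def linear_sum[OF l]
    by (rule sum.cong) (simp_all add: linear_diff[OF l] linear_scale[OF l] va_lp c)
  then have "\<kappa> (va c (E X)) (T c h) = (\<Sum>i=1..g. \<kappa> X (\<beta> i) * of_int (I (T c (\<alpha> i)) (T c h)) - \<kappa> X (\<alpha> i) * of_int (I (T c (\<beta> i)) (T c h)))"
    by (simp add: \<kappa>_sum[OF Th] \<kappa>_diff[OF Th] \<kappa>_scale[OF Th] \<kappa>_lp pa_closed c Th T_pr)
  also have "\<dots> = (\<Sum>i=1..g. \<kappa> X (\<beta> i) * of_int (I (\<alpha> i) h) - \<kappa> X (\<alpha> i) * of_int (I (\<beta> i) h))"
    by (rule sum.cong) (simp_all add: T_symplectic c h)
  also have "\<dots> = \<kappa> (E X) h"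
    by (simp add: E_def \<kappa>_sum[OF h] \<kappa>_diff[OF h] \<kappa>_scale[OF h] \<kappa>_lp h)
  also have "\<dots> = \<kappa> X h" by (rule \<kappa>_E[OF h])
  finally have "\<kappa> (va c (E X)) (T c h) = \<kappa> X h" .
  moreover have "va c X = va c (E X) + va c (X - E X)" by (simp flip: linear_add[OF l])
  ultimately show ?thesis using 0 by (simp add: \<kappa>_add[OF Th])
qed

abbreviation "\<rho> c \<equiv> ext_quot_map W (va c)"

lemma \<rho>_spec:
  assumes c: "c \<in> carrier Md"
  shows "\<rho> c \<in> hom Q Q" "\<rho> c (qwedge W X Y) = qwedge W (va c X) (va c Y)"
proof -
  note l = va_linear[OF c]
  have ex: "\<exists>h\<in>hom Q Q. \<forall>p\<in>UNIV. h (case p of (x, y) \<Rightarrow> qwedge W x y) = (case p of (X, Y) \<Rightarrow> qwedge W (va c X) (va c Y))"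
    by (rule ext_quot_universal[OF Q])
      (simp_all add: qwedge_closed linear_add[OF l] linear_scale[OF l] qwedge_add_left qwedge_add_right qwedge_scaleR qwedge_self qwedge_W va_W c)
  show "\<rho> c \<in> hom Q Q" unfolding ext_quot_map_def by (rule hom_by_spec(1)[OF ex])
  show "\<rho> c (qwedge W X Y) = qwedge W (va c X) (va c Y)"
    using hom_by_spec(2)[OF ex, of "(X, Y)"] by (simp add: ext_quot_map_def)
qed

lemma \<rho>_closed: "c \<in> carrier Md \<Longrightarrow> w \<in> carrier Q \<Longrightarrow> \<rho> c w \<in> carrier Q"
  using hom_in_carrier[OF \<rho>_spec(1)] .

text \<open>Equivariance of \<open>D\<^sub>*\<close>, tested on wedges.\<close>

lemma D_\<rho>:
  assumes c: "c \<in> carrier Md" and w: "w \<in> carrier Q" and h: "h \<in> carrier H"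
  shows "D (\<rho> c w) (T c h) = va c (D w h)"
proof -
  note l = va_linear[OF c]
  have Th: "T c h \<in> carrier H" by (rule T_closed[OF c h])
  have "((\<lambda>w. D w (T c h)) \<circ> \<rho> c) w = (va c \<circ> (\<lambda>w. D w h)) w"
  proof (rule hom_eq_on_generate[OF comm_group.axioms(2)[OF Q] comm_group.axioms(2)[OF comm_V]])
    show "(\<lambda>w. D w (T c h)) \<circ> \<rho> c \<in> hom Q V"
      by (rule Group.hom_compose[OF \<rho>_spec(1)[OF c] group_hom.homh[OF D_eval_hom[OF Th]]])
    have "va c \<in> hom V V" by (rule homI) (simp_all add: linear_add[OF l])
    then show "va c \<circ> (\<lambda>w. D w h) \<in> hom Q V" by (rule Group.hom_compose[OF group_hom.homh[OF D_eval_hom[OF h]]])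
    show "{qwedge W x y | x y. True} \<subseteq> carrier Q" using qwedge_closed by auto
    show "w \<in> generate Q {qwedge W x y | x y. True}" unfolding ext_quot_generate by (rule w)
    fix u assume "u \<in> {qwedge W x y | x y. True}"
    then obtain X Y where u: "u = qwedge W X Y" by blast
    show "((\<lambda>w. D w (T c h)) \<circ> \<rho> c) u = (va c \<circ> (\<lambda>w. D w h)) u"
      unfolding u o_def \<rho>_spec(2)[OF c] D_spec(2)
      by (simp add: \<delta>_def h Th \<kappa>_va c linear_diff[OF l] linear_scale[OF l])
  qed
  then show ?thesis by simp
qed

definition \<omega> :: "('e \<times> 'e \<Rightarrow>\<^sub>0 int) set set" where
  "\<omega> = finprod Q (\<lambda>i. qwedge W (lp (a i)) (lp (b i))) {1..g}"

lemma \<omega>_closed: "\<omega> \<in> carrier Q"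
  unfolding \<omega>_def by (rule comm_monoid.finprod_closed[OF comm_group.axioms(1)[OF Q]]) (simp add: qwedge_closed)

lemma D_\<omega>:
  assumes h: "h \<in> carrier H"
  shows "D \<omega> h = (\<Sum>i=1..g. of_int (I (\<alpha> i) h) *\<^sub>R lp (b i) - of_int (I (\<beta> i) h) *\<^sub>R lp (a i))"
proof -
  have "D \<omega> h = finprod V (\<lambda>i. D (qwedge W (lp (a i)) (lp (b i))) h) {1..g}"
    unfolding \<omega>_def by (rule hom_finprod[OF Q comm_V group_hom.homh[OF D_eval_hom[OF h]]]) (simp add: qwedge_closed)
  also have "\<dots> = (\<Sum>i=1..g. D (qwedge W (lp (a i)) (lp (b i))) h)" by (rule finprod_add_group) auto
  also have "\<dots> = (\<Sum>i=1..g. of_int (I (\<alpha> i) h) *\<^sub>R lp (b i) - of_int (I (\<beta> i) h) *\<^sub>R lp (a i))"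
    by (rule sum.cong) (simp_all add: D_spec(2) \<delta>_def h \<kappa>_lp)
  finally show ?thesis .
qed

lemma D_\<omega>_basis:
  assumes j: "j \<in> {1..g}"
  shows "D \<omega> (\<alpha> j) = lp (a j)" "D \<omega> (\<beta> j) = lp (b j)"
proof -
  have "D \<omega> (\<alpha> j) = (\<Sum>i=1..g. if i = j then lp (a j) else 0)"
    unfolding D_\<omega>[OF \<alpha>[OF j]] by (rule sum.cong) (use j in \<open>auto simp: I_basis\<close>)
  then show "D \<omega> (\<alpha> j) = lp (a j)" using j by simp
  have "D \<omega> (\<beta> j) = (\<Sum>i=1..g. if i = j then lp (b j) else 0)"
    unfolding D_\<omega>[OF \<beta>[OF j]] by (rule sum.cong) (use j in \<open>auto simp: I_basis\<close>)
  then show "D \<omega> (\<beta> j) = lp (b j)" using j by simp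
qed

lemma D_\<omega>_eq_\<xi>:
  "D \<omega> = (\<lambda>h\<in>carrier H. hom_by H V (a ` {1..g} \<union> b ` {1..g}) pr lp h)"
proof
  let ?\<xi> = "hom_by H V (a ` {1..g} \<union> b ` {1..g}) pr lp"
  have ex: "\<exists>f\<in>hom H V. \<forall>s\<in>a ` {1..g} \<union> b ` {1..g}. f (pr s) = lp s"
    by (rule bexI[OF _ D_hom_H[OF \<omega>_closed]]) (use D_\<omega>_basis in auto)
  note \<xi> = hom_by_spec[OF ex]
  have val: "?\<xi> (\<alpha> i) = lp (a i)" "?\<xi> (\<beta> i) = lp (b i)" if "i \<in> {1..g}" for i
    by (rule \<xi>(2), use that in blast)+
  fix h
  show "D \<omega> h = (\<lambda>h\<in>carrier H. ?\<xi> h) h"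
  proof (cases "h \<in> carrier H")
    case True
    have "D \<omega> h = ?\<xi> h"
      by (rule hom_eqI[OF comm_group.axioms(2)[OF comm_V] D_hom_H[OF \<omega>_closed] \<xi>(1) _ _ True])
        (simp_all only: D_\<omega>_basis val)
    then show ?thesis using True by simp
  next
    case False
    have "D \<omega> \<in> extensional (carrier H)" using D_closed[OF \<omega>_closed] unfolding Hom_group_simps by blast
    from extensional_arb[OF this False] show ?thesis using False by simp
  qed
qed

text \<open>The vector \<open>\<xi> h\<close> is a lift of \<open>h\<close>: its class in \<open>H \<otimes> \<real>\<close> is that of \<open>h\<close>.\<close>

lemma \<kappa>_D_\<omega>:
  assumes h: "h \<in> carrier H" and h': "h' \<in> carrier H"
  shows "\<kappa> (D \<omega> h) h' = of_int (I h h')"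
proof -
  have "\<kappa> (D \<omega> h) h' = of_int (\<Sum>i=1..g. I (\<alpha> i) h * I (\<beta> i) h' - I (\<beta> i) h * I (\<alpha> i) h')"
    unfolding D_\<omega>[OF h] by (simp add: \<kappa>_sum[OF h'] \<kappa>_diff[OF h'] \<kappa>_scale[OF h'] \<kappa>_lp h')
  also have "(\<Sum>i=1..g. I (\<alpha> i) h * I (\<beta> i) h' - I (\<beta> i) h * I (\<alpha> i) h') = I h h'"
    unfolding I_expansion[OF h h']
    by (rule sum.cong) (use I_skew[OF h] I_skew[OF h'] \<alpha> \<beta> in auto)
  finally show ?thesis .
qed

lemma D_\<omega>_\<Lambda>: "h \<in> carrier H \<Longrightarrow> D \<omega> h \<in> \<Lambda>"
proof -
  assume h: "h \<in> carrier H"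
  interpret d: group_hom H V "D \<omega>"
    by (intro group_hom.intro H.group_axioms comm_group.axioms(2)[OF comm_V] group_hom_axioms.intro D_hom_H \<omega>_closed)
  have S: "\<alpha> ` {1..g} \<union> \<beta> ` {1..g} \<subseteq> carrier H" by auto
  have "D \<omega> h \<in> generate V (D \<omega> ` (\<alpha> ` {1..g} \<union> \<beta> ` {1..g}))"
    using d.generate_img[OF S] h gen by auto
  moreover have "generate V (D \<omega> ` (\<alpha> ` {1..g} \<union> \<beta> ` {1..g})) \<subseteq> \<Lambda>"
    by (rule generate_subset_subgroup[OF \<Lambda>_add_subgroup[unfolded add_subgroup_iff] _ comm_group.axioms(2)[OF comm_V]])
      (auto simp: D_\<omega>_basis lp_\<Lambda>)
  ultimately show ?thesis by blast
qed

section \<open>The module of integral values\<close>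

definition M :: "('e \<times> 'e \<Rightarrow>\<^sub>0 int) set set monoid" where
  "M = Q\<lparr>carrier := {w \<in> carrier Q. D w \<in> carrier (Hom_group H (add_group (W \<inter> \<Lambda>)))}\<rparr>"

lemma M_simps: "x \<otimes>\<^bsub>M\<^esub> y = x \<otimes>\<^bsub>Q\<^esub> y" "\<one>\<^bsub>M\<^esub> = \<one>\<^bsub>Q\<^esub>"
  by (simp_all add: M_def)

lemma M_iff: "w \<in> carrier M \<longleftrightarrow> w \<in> carrier Q \<and> (\<forall>h\<in>carrier H. D w h \<in> W \<inter> \<Lambda>)"
  using D_closed[of w] by (auto simp: M_def Hom_group_simps hom_def Pi_iff)

lemma M_subgroup: "subgroup (carrier M) Q"
proof -
  interpret Q: comm_group Q by (rule Q)
  have 0: "D \<one>\<^bsub>Q\<^esub> h = 0" if "h \<in> carrier H" for h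
    using group_hom.hom_one[OF D_eval_hom[OF that]] by simp
  have W: "add_subgroup (W \<inter> \<Lambda>)"
    using W_sub \<Lambda>_add_subgroup by (auto simp: add_subgroup_def)
  have neg: "- x \<in> W \<inter> \<Lambda>" if "x \<in> W \<inter> \<Lambda>" for x
  proof -
    have "0 - x \<in> W \<inter> \<Lambda>" using W that unfolding add_subgroup_def by blast
    then show ?thesis by simp
  qed
  have add: "x + y \<in> W \<inter> \<Lambda>" if "x \<in> W \<inter> \<Lambda>" "y \<in> W \<inter> \<Lambda>" for x y
    using W that unfolding add_subgroup_def by blast
  have zero: "0 \<in> W \<inter> \<Lambda>" using W unfolding add_subgroup_def by blast
  show ?thesis
  proof (rule Q.subgroupI)
    have "\<one>\<^bsub>Q\<^esub> \<in> carrier M" using 0 zero by (simp add: M_iff)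
    then show "carrier M \<noteq> {}" by blast
    show "inv\<^bsub>Q\<^esub> x \<in> carrier M" if "x \<in> carrier M" for x
      unfolding M_iff
    proof (intro conjI ballI)
      show "inv\<^bsub>Q\<^esub> x \<in> carrier Q" using that by (simp add: M_iff)
      show "D (inv\<^bsub>Q\<^esub> x) h \<in> W \<inter> \<Lambda>" if h: "h \<in> carrier H" for h
        using \<open>x \<in> carrier M\<close> neg[of "D x h"] by (simp add: M_iff D_inv h)
    qed
    show "x \<otimes>\<^bsub>Q\<^esub> y \<in> carrier M" if "x \<in> carrier M" "y \<in> carrier M" for x y
      unfolding M_iff
    proof (intro conjI ballI)
      show "x \<otimes>\<^bsub>Q\<^esub> y \<in> carrier Q" using that by (simp add: M_iff)
      show "D (x \<otimes>\<^bsub>Q\<^esub> y) h \<in> W \<inter> \<Lambda>" if h: "h \<in> carrier H" for h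
        using \<open>x \<in> carrier M\<close> \<open>y \<in> carrier M\<close> add[of "D x h" "D y h"] by (simp add: M_iff D_mult h)
    qed
  qed (auto simp: M_iff)
qed

lemma M_eq: "M = Q\<lparr>carrier := carrier M\<rparr>"
  by (simp add: M_def)

lemma comm_group_M: "comm_group M"
proof -
  interpret Q: comm_group Q by (rule Q)
  interpret S: subgroup "carrier M" Q by (rule M_subgroup)
  have "Group.group M" using S.subgroup_is_group[OF Q.group_axioms] by (simp flip: M_eq)
  then show ?thesis by (rule group.group_comm_groupI) (simp add: M_simps Q.m_comm)
qed

lemma \<rho>_M: "c \<in> carrier Md \<Longrightarrow> w \<in> carrier M \<Longrightarrow> \<rho> c w \<in> carrier M"
proof -
  assume c: "c \<in> carrier Md" and w: "w \<in> carrier M"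
  have wQ: "w \<in> carrier Q" using w by (simp add: M_iff)
  have "D (\<rho> c w) h \<in> W \<inter> \<Lambda>" if h: "h \<in> carrier H" for h
  proof -
    obtain h' where h': "h' \<in> carrier H" "h = T c h'" using T_onto[OF c h] by blast
    have "D w h' \<in> W \<inter> \<Lambda>" using w h' by (simp add: M_iff)
    then show ?thesis unfolding h'(2) D_\<rho>[OF c wQ h'(1)] using va_W[OF c] va_\<Lambda>[OF c] by blast
  qed
  then show ?thesis using \<rho>_closed[OF c wQ] by (simp add: M_iff)
qed

lemma \<rho>_one:
  assumes m: "m \<in> carrier M"
  shows "\<rho> \<one>\<^bsub>Md\<^esub> m = m"
proof -
  have mQ: "m \<in> carrier Q" using m by (simp add: M_iff)
  show ?thesis
  proof (rule D_eqI[OF \<rho>_closed[OF Md_one mQ] mQ])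
    fix h assume h: "h \<in> carrier H"
    have Th: "T \<one>\<^bsub>Md\<^esub> h = h" using rep[OF h] by (simp add: T_def pa_one)
    have "D m h \<in> \<Lambda>" using m h by (simp add: M_iff)
    then have "va \<one>\<^bsub>Md\<^esub> (D m h) = id (D m h)"
      by (rule linear_eq_on_\<Lambda>[OF va_linear[OF Md_one] linear_id, rotated]) (simp add: va_lp Md_one pa_one)
    then show "D (\<rho> \<one>\<^bsub>Md\<^esub> m) h = D m h" using D_\<rho>[OF Md_one mQ h] Th by simp
  qed
qed

text \<open>The maps \<open>va (cd)\<close> and \<open>va c \<circ> va d\<close> are known to agree only on \<open>\<Lambda>\<close>. This suffices, because the elements of \<open>M\<close> are
  determined by the values of their images under \<open>D\<close>, which lie in \<open>\<Lambda>\<close>.\<close>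

lemma \<rho>_mult:
  assumes c: "c \<in> carrier Md" and d: "d \<in> carrier Md" and m: "m \<in> carrier M"
  shows "\<rho> (c \<otimes>\<^bsub>Md\<^esub> d) m = \<rho> c (\<rho> d m)"
proof -
  note cd = Md_mult[OF c d]
  have mQ: "m \<in> carrier Q" using m by (simp add: M_iff)
  show ?thesis
  proof (rule D_eqI[OF \<rho>_closed[OF cd mQ] \<rho>_closed[OF c \<rho>_closed[OF d mQ]]])
    fix h' assume "h' \<in> carrier H"
    then obtain h where h: "h \<in> carrier H" "h' = T (c \<otimes>\<^bsub>Md\<^esub> d) h" using T_onto[OF cd] by blast
    have Th: "h' = T c (T d h)"
      using rep(1)[OF h(1)] h(2) T_pr[OF c pa_closed[OF d rep(1)[OF h(1)]]] by (simp add: T_def[of d] T_def[of "c \<otimes>\<^bsub>Md\<^esub> d"] pa_mult c d)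
    have "D m h \<in> \<Lambda>" using m h by (simp add: M_iff)
    then have "va (c \<otimes>\<^bsub>Md\<^esub> d) (D m h) = (va c \<circ> va d) (D m h)"
      by (rule linear_eq_on_\<Lambda>[OF va_linear[OF cd] linear_compose[OF va_linear[OF d] va_linear[OF c]], rotated])
        (simp add: va_lp cd c d pa_mult pa_closed)
    moreover have "D (\<rho> (c \<otimes>\<^bsub>Md\<^esub> d) m) h' = va (c \<otimes>\<^bsub>Md\<^esub> d) (D m h)"
      unfolding h(2) by (rule D_\<rho>[OF cd mQ h(1)])
    moreover have "D (\<rho> c (\<rho> d m)) h' = va c (va d (D m h))"
      unfolding Th D_\<rho>[OF c \<rho>_closed[OF d mQ] T_closed[OF d h(1)]] D_\<rho>[OF d mQ h(1)] ..
    ultimately show "D (\<rho> (c \<otimes>\<^bsub>Md\<^esub> d) m) h' = D (\<rho> c (\<rho> d m)) h'" by simp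
  qed
qed

lemma is_module_M: "is_module Md \<rho> M"
  unfolding is_module_def
proof (intro conjI ballI comm_group_M \<rho>_one \<rho>_mult)
  fix c assume c: "c \<in> carrier Md"
  show "\<rho> c \<in> hom M M"
    by (rule homI) (use \<rho>_M[OF c] hom_mult[OF \<rho>_spec(1)[OF c]] in \<open>auto simp: M_simps M_iff\<close>)
qed

definition d\<omega> :: "'c \<Rightarrow> ('e \<times> 'e \<Rightarrow>\<^sub>0 int) set set" where
  "d\<omega> c = \<rho> c \<omega> \<otimes>\<^bsub>Q\<^esub> inv\<^bsub>Q\<^esub> \<omega>"

lemma inv_\<omega>_closed: "inv\<^bsub>Q\<^esub> \<omega> \<in> carrier Q"
  by (rule group.inv_closed[OF comm_group.axioms(2)[OF Q] \<omega>_closed])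

lemma D_d\<omega>:
  assumes c: "c \<in> carrier Md" and h: "h \<in> carrier H"
  shows "D (d\<omega> c) (T c h) = va c (D \<omega> h) - D \<omega> (T c h)"
  using D_mult[OF \<rho>_closed[OF c \<omega>_closed] inv_\<omega>_closed T_closed[OF c h]] D_inv[OF \<omega>_closed T_closed[OF c h]] D_\<rho>[OF c \<omega>_closed h]
  by (simp add: d\<omega>_def)

text \<open>Both \<open>va c (\<xi> h)\<close> and \<open>\<xi> (T c h)\<close> lie in \<open>\<Lambda>\<close> and are lifts of \<open>T c h\<close>.\<close>

lemma d\<omega>_M:
  assumes c: "c \<in> carrier Md"
  shows "d\<omega> c \<in> carrier M"
  unfolding M_iff
proof (intro conjI ballI)
  show "d\<omega> c \<in> carrier Q" unfolding d\<omega>_def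
    by (rule monoid.m_closed[OF group.is_monoid[OF comm_group.axioms(2)[OF Q]] \<rho>_closed[OF c \<omega>_closed] inv_\<omega>_closed])
  fix h' assume "h' \<in> carrier H"
  then obtain h where h: "h \<in> carrier H" and h': "h' = T c h" using T_onto[OF c] by blast
  note Th = T_closed[OF c h]
  have "va c (D \<omega> h) - D \<omega> (T c h) \<in> \<Lambda>"
    using \<Lambda>_add_subgroup va_\<Lambda>[OF c D_\<omega>_\<Lambda>[OF h]] D_\<omega>_\<Lambda>[OF Th] unfolding add_subgroup_def by blast
  moreover have "va c (D \<omega> h) - D \<omega> (T c h) \<in> W"
    unfolding W_iff
  proof
    fix u' assume "u' \<in> carrier H"
    then obtain u where u: "u \<in> carrier H" "u' = T c u" using T_onto[OF c] by blast
    show "\<kappa> (va c (D \<omega> h) - D \<omega> (T c h)) u' = 0"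
      unfolding u(2) by (simp add: \<kappa>_diff T_closed c u h \<kappa>_va \<kappa>_D_\<omega> T_symplectic)
  qed
  ultimately show "D (d\<omega> c) h' \<in> W \<inter> \<Lambda>" unfolding h' D_d\<omega>[OF c h] by blast
qed

lemma \<rho>_\<omega>: "c \<in> carrier Md \<Longrightarrow> \<rho> c \<omega> = finprod Q (\<lambda>i. qwedge W (lp (pa c (a i))) (lp (pa c (b i)))) {1..g}"
proof -
  assume c: "c \<in> carrier Md"
  interpret Q: comm_group Q by (rule Q)
  have "\<rho> c \<omega> = finprod Q (\<lambda>i. \<rho> c (qwedge W (lp (a i)) (lp (b i)))) {1..g}"
    unfolding \<omega>_def by (rule hom_finprod[OF Q Q \<rho>_spec(1)[OF c]]) (simp add: qwedge_closed)
  also have "\<dots> = finprod Q (\<lambda>i. qwedge W (lp (pa c (a i))) (lp (pa c (b i)))) {1..g}"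
    by (rule Q.finprod_cong') (simp_all add: qwedge_closed \<rho>_spec(2) c va_lp)
  finally show ?thesis .
qed

text \<open>Not an instance of \<open>\<rho>_mult\<close>, as \<open>\<omega>\<close> is not in \<open>M\<close>; but \<open>\<omega>\<close> is built from logarithms, on which \<open>va\<close> is functorial.\<close>

lemma \<rho>_\<omega>_mult:
  assumes c: "c \<in> carrier Md" and d: "d \<in> carrier Md"
  shows "\<rho> (c \<otimes>\<^bsub>Md\<^esub> d) \<omega> = \<rho> c (\<rho> d \<omega>)"
proof -
  interpret Q: comm_group Q by (rule Q)
  have "\<rho> c (\<rho> d \<omega>) = finprod Q (\<lambda>i. \<rho> c (qwedge W (lp (pa d (a i))) (lp (pa d (b i))))) {1..g}"
    unfolding \<rho>_\<omega>[OF d] by (rule hom_finprod[OF Q Q \<rho>_spec(1)[OF c]]) (simp add: qwedge_closed)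
  also have "\<dots> = finprod Q (\<lambda>i. qwedge W (lp (pa (c \<otimes>\<^bsub>Md\<^esub> d) (a i))) (lp (pa (c \<otimes>\<^bsub>Md\<^esub> d) (b i)))) {1..g}"
    by (rule Q.finprod_cong') (simp_all add: qwedge_closed \<rho>_spec(2) c d va_lp pa_closed pa_mult)
  finally show ?thesis unfolding \<rho>_\<omega>[OF Md_mult[OF c d]] by (rule sym)
qed

lemma crossed_hom_d\<omega>: "d\<omega> \<in> crossed_homs Md \<rho> M"
  unfolding crossed_homs_def mem_Collect_eq
proof (intro conjI ballI d\<omega>_M)
  interpret Q: comm_group Q by (rule Q)
  fix c d assume c: "c \<in> carrier Md" and d: "d \<in> carrier Md"
  interpret r: group_hom Q Q "\<rho> c" by (intro group_hom.intro group_hom_axioms.intro Q.group_axioms \<rho>_spec(1) c)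
  note cl = \<rho>_closed[OF c \<omega>_closed] \<rho>_closed[OF d \<omega>_closed] inv_\<omega>_closed
  have "\<rho> c (d\<omega> d) \<otimes>\<^bsub>M\<^esub> d\<omega> c = (\<rho> c (\<rho> d \<omega>) \<otimes>\<^bsub>Q\<^esub> inv\<^bsub>Q\<^esub> \<rho> c \<omega>) \<otimes>\<^bsub>Q\<^esub> (\<rho> c \<omega> \<otimes>\<^bsub>Q\<^esub> inv\<^bsub>Q\<^esub> \<omega>)"
    unfolding d\<omega>_def M_simps r.hom_mult[OF cl(2,3)] r.hom_inv[OF \<omega>_closed] ..
  also have "\<dots> = \<rho> c (\<rho> d \<omega>) \<otimes>\<^bsub>Q\<^esub> inv\<^bsub>Q\<^esub> \<omega>"
    using cl \<rho>_closed[OF c cl(2)] by (simp add: Q.m_assoc Q.inv_solve_left')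
  finally show "d\<omega> (c \<otimes>\<^bsub>Md\<^esub> d) = \<rho> c (d\<omega> d) \<otimes>\<^bsub>M\<^esub> d\<omega> c" by (simp add: d\<omega>_def \<rho>_\<omega>_mult c d)
qed

section \<open>Freeness\<close>

text \<open>The homomorphisms \<open>h \<mapsto> n(h) X\<close>, from which all homomorphisms \<open>H \<rightarrow> V\<close> are assembled by \<open>expansion\<close>.\<close>

definition coef :: "('p set \<Rightarrow> int) \<Rightarrow> 'e \<Rightarrow> 'p set \<Rightarrow> 'e" where
  "coef n X = (\<lambda>h\<in>carrier H. of_int (n h) *\<^sub>R X)"

lemma coef_hom: "n \<in> hom H integer_group \<Longrightarrow> coef n \<in> hom V HV"
proof (rule homI)
  assume n: "n \<in> hom H integer_group"
  show "coef n X \<in> carrier HV" for X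
  proof -
    have "(\<lambda>h. of_int (n h) *\<^sub>R X) \<in> hom H V"
      by (rule homI) (use hom_mult[OF n] in \<open>simp_all add: algebra_simps\<close>)
    then show ?thesis by (simp add: coef_def Hom_group_simps restrict_hom[OF H.group_axioms])
  qed
  show "coef n (X \<otimes>\<^bsub>V\<^esub> Y) = coef n X \<otimes>\<^bsub>HV\<^esub> coef n Y" for X Y
    by (auto simp: coef_def Hom_group_simps algebra_simps intro!: restrict_ext)
qed

lemma Hom_expansion:
  assumes \<phi>: "\<phi> \<in> carrier HV"
  shows "\<phi> = finprod HV (\<lambda>i. coef (I (\<alpha> i)) (\<phi> (\<beta> i)) \<otimes>\<^bsub>HV\<^esub> coef (\<lambda>h. I h (\<beta> i)) (\<phi> (\<alpha> i))) {1..g}"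
proof (rule Hom_group_eqI[OF \<phi>])
  interpret HV: comm_group HV by (rule HV)
  have cc: "coef (I (\<alpha> i)) X \<in> carrier HV" "coef (\<lambda>h. I h (\<beta> i)) X \<in> carrier HV" if "i \<in> {1..g}" for i X
    using hom_in_carrier[OF coef_hom[OF I_hom_right[OF \<alpha>[OF that]]], of X]
      hom_in_carrier[OF coef_hom[OF I_hom_left[OF \<beta>[OF that]]], of X] by simp_all
  then have Pi: "(\<lambda>i. coef (I (\<alpha> i)) (\<phi> (\<beta> i)) \<otimes>\<^bsub>HV\<^esub> coef (\<lambda>h. I h (\<beta> i)) (\<phi> (\<alpha> i))) \<in> {1..g} \<rightarrow> carrier HV"
    by (intro Pi_I HV.m_closed)
  show "finprod HV (\<lambda>i. coef (I (\<alpha> i)) (\<phi> (\<beta> i)) \<otimes>\<^bsub>HV\<^esub> coef (\<lambda>h. I h (\<beta> i)) (\<phi> (\<alpha> i))) {1..g} \<in> carrier HV"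
    by (rule HV.finprod_closed[OF Pi])
  fix h assume h: "h \<in> carrier H"
  have "finprod HV (\<lambda>i. coef (I (\<alpha> i)) (\<phi> (\<beta> i)) \<otimes>\<^bsub>HV\<^esub> coef (\<lambda>h. I h (\<beta> i)) (\<phi> (\<alpha> i))) {1..g} h
     = finprod V (\<lambda>i. (coef (I (\<alpha> i)) (\<phi> (\<beta> i)) \<otimes>\<^bsub>HV\<^esub> coef (\<lambda>h. I h (\<beta> i)) (\<phi> (\<alpha> i))) h) {1..g}"
    using hom_finprod[OF HV comm_V Hom_group_eval[OF H.group_axioms comm_V h] Pi] .
  also have "\<dots> = finprod V (\<lambda>i. \<phi> (\<beta> i) [^]\<^bsub>V\<^esub> I (\<alpha> i) h \<otimes>\<^bsub>V\<^esub> \<phi> (\<alpha> i) [^]\<^bsub>V\<^esub> I h (\<beta> i)) {1..g}"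
    by (simp add: Hom_group_simps coef_def h int_pow_add_group_UNIV)
  also have "\<dots> = \<phi> h"
    by (rule expansion[OF comm_V _ h, symmetric]) (use \<phi> in \<open>simp add: Hom_group_simps\<close>)
  finally show "\<phi> h = finprod HV (\<lambda>i. coef (I (\<alpha> i)) (\<phi> (\<beta> i)) \<otimes>\<^bsub>HV\<^esub> coef (\<lambda>h. I h (\<beta> i)) (\<phi> (\<alpha> i))) {1..g} h" by (rule sym)
qed

text \<open>A homomorphism with values in \<open>\<Lambda>\<close> is a product of homomorphisms \<open>coef n X\<close> with \<open>X \<in> \<Lambda>\<close> and \<open>n\<close> one of the \<open>2 g\<close>
  coordinates. As \<open>X \<mapsto> coef n X\<close> is additive, \<open>X\<close> may be restricted to generators of \<open>\<Lambda>\<close>.\<close>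

lemma Hom_\<Lambda>_fg: "\<exists>F. finite F \<and> F \<subseteq> carrier HV \<and> (\<forall>\<phi>\<in>carrier HV. (\<forall>h\<in>carrier H. \<phi> h \<in> \<Lambda>) \<longrightarrow> \<phi> \<in> generate HV F)"
proof -
  interpret HV: comm_group HV by (rule HV)
  obtain F0 where F0: "finite F0" "\<And>L. add_subgroup L \<Longrightarrow> F0 \<subseteq> L \<Longrightarrow> lp ` carrier P \<subseteq> L"
    using lp_fg by blast
  define N where "N = (\<lambda>i. I (\<alpha> i)) ` {1..g} \<union> (\<lambda>i h. I h (\<beta> i)) ` {1..g}"
  define F where "F = (\<lambda>(n, X). coef n X) ` (N \<times> F0)"
  have N: "n \<in> hom H integer_group" if "n \<in> N" for n
    using that I_hom_left I_hom_right by (auto simp: N_def)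
  have FH: "F \<subseteq> carrier HV" using hom_in_carrier[OF coef_hom[OF N]] by (auto simp: F_def)
  have K: "subgroup (generate HV F) HV" by (rule HV.generate_is_subgroup[OF FH])
  interpret K: subgroup "generate HV F" HV by (rule K)
  have co: "coef n X \<in> generate HV F" if n: "n \<in> N" and X: "X \<in> \<Lambda>" for n X
  proof -
    interpret c: group_hom V HV "coef n"
      by (intro group_hom.intro comm_group.axioms(2)[OF comm_V] HV.group_axioms group_hom_axioms.intro coef_hom N n)
    have add: "add_subgroup {X. coef n X \<in> generate HV F}"
    proof -
      have "coef n (- Y) = inv\<^bsub>HV\<^esub> coef n Y" for Y
        using c.hom_inv[of Y] by (simp add: inv_add_group)
      then have "coef n (X - Y) = coef n X \<otimes>\<^bsub>HV\<^esub> inv\<^bsub>HV\<^esub> coef n Y" for X Y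
        using c.hom_mult[of X "- Y"] by simp
      then show ?thesis unfolding add_subgroup_def
        using c.hom_mult c.hom_one by auto
    qed
    have "F0 \<subseteq> {X. coef n X \<in> generate HV F}"
      using n by (auto simp: F_def intro!: generate.incl image_eqI[of _ _ "(n, _)"])
    from \<Lambda>_least[OF add F0(2)[OF add this]] X show ?thesis by blast
  qed
  have fin: "finprod HV f J \<in> generate HV F" if "\<And>i. i \<in> J \<Longrightarrow> f i \<in> generate HV F" for f and J :: "nat set"
    using that by (induction J rule: infinite_finite_induct) (auto simp: Pi_iff K.subset[THEN subsetD])
  have mem: "\<phi> \<in> generate HV F" if \<phi>: "\<phi> \<in> carrier HV" and v: "\<And>h. h \<in> carrier H \<Longrightarrow> \<phi> h \<in> \<Lambda>" for \<phi>
  proof (subst Hom_expansion[OF \<phi>], rule fin, rule K.m_closed)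
    fix i assume i: "i \<in> {1..g}"
    show "coef (I (\<alpha> i)) (\<phi> (\<beta> i)) \<in> generate HV F" by (rule co) (use i v \<beta> in \<open>auto simp: N_def\<close>)
    show "coef (\<lambda>h. I h (\<beta> i)) (\<phi> (\<alpha> i)) \<in> generate HV F" by (rule co) (use i v \<alpha> in \<open>auto simp: N_def\<close>)
  qed
  have finF: "finite F" using F0(1) by (simp add: F_def N_def)
  show ?thesis
  proof (intro exI[of _ F] conjI ballI impI)
    show "\<phi> \<in> generate HV F" if "\<phi> \<in> carrier HV" "\<forall>h\<in>carrier H. \<phi> h \<in> \<Lambda>" for \<phi>
      by (rule mem[OF that(1) bspec[OF that(2)]])
  qed (rule finF, rule FH)
qed

text \<open>The left inverse of \<open>D\<close> transports generators of the homomorphisms with values in \<open>\<Lambda>\<close> to a finitely generated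
  group containing \<open>M\<close>. The values of \<open>D\<close> are vectors, so \<open>M\<close> is torsion-free.\<close>

lemma free_M: "free_abelian_finite_rank M"
  unfolding free_abelian_finite_rank_def
proof -
  interpret Q: comm_group Q by (rule Q)
  interpret M: comm_group M by (rule comm_group_M)
  interpret R: group_hom HV Q Rinv
    by (intro group_hom.intro group_hom_axioms.intro Q.group_axioms comm_group.axioms(2)[OF HV] Rinv_hom)
  from Hom_\<Lambda>_fg obtain F where F: "finite F" "F \<subseteq> carrier HV"
    and gen_F: "\<forall>\<phi>\<in>carrier HV. (\<forall>h\<in>carrier H. \<phi> h \<in> \<Lambda>) \<longrightarrow> \<phi> \<in> generate HV F"
    by (elim exE conjE)
  have RF: "Rinv ` F \<subseteq> carrier Q" using hom_in_carrier[OF Rinv_hom] F(2) by blast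
  have "carrier M \<subseteq> generate Q (Rinv ` F)"
  proof
    fix w assume w: "w \<in> carrier M"
    then have wQ: "w \<in> carrier Q" by (simp add: M_iff)
    have "D w \<in> generate HV F"
      by (rule mp[OF bspec[OF gen_F D_closed[OF wQ]]]) (use w in \<open>simp add: M_iff\<close>)
    then have "Rinv (D w) \<in> Rinv ` generate HV F" by (rule imageI)
    then show "w \<in> generate Q (Rinv ` F)" unfolding R.generate_img[OF F(2)] Rinv_D[OF wQ] .
  qed
  from Q.fg_subgroup[OF finite_imageI[OF F(1)] RF M_subgroup this]
  obtain X where X: "finite X" "X \<subseteq> carrier M" "generate Q X = carrier M" by blast
  have "generate M X = carrier M"
    using Q.generate_consistent[OF X(2) M_subgroup] X(3) by (simp flip: M_eq)
  then show "\<exists>n::nat. M \<cong> free_Abelian_group {..<n}"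
  proof (rule M.torsion_free_fg_free[OF X(1,2)])
    fix x and n :: int assume x: "x \<in> carrier M" and n: "n \<noteq> 0" and xn: "x [^]\<^bsub>M\<^esub> n = \<one>\<^bsub>M\<^esub>"
    have xQ: "x \<in> carrier Q" using x by (simp add: M_iff)
    have "D x h = D \<one>\<^bsub>Q\<^esub> h" if h: "h \<in> carrier H" for h
    proof -
      have Dh: "(\<lambda>w. D w h) \<in> hom M V"
        by (rule homI) (simp_all add: M_simps D_mult h M_iff)
      interpret e: group_hom M V "\<lambda>w. D w h"
        by (intro group_hom.intro group_hom_axioms.intro M.group_axioms comm_group.axioms(2)[OF comm_V] Dh)
      have "of_int n *\<^sub>R D x h = 0"
        using e.hom_int_pow[OF x, of n] e.hom_one xn by (simp add: int_pow_add_group_UNIV)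
      then have "D x h = 0" using n by simp
      then show ?thesis using e.hom_one by (simp add: M_simps)
    qed
    then show "x = \<one>\<^bsub>M\<^esub>" unfolding M_simps by (rule D_eqI[OF xQ Q.one_closed])
  qed
qed

section \<open>The Johnson homomorphism\<close>

abbreviation "LC \<equiv> lower_central P (k - Suc 0)"
abbreviation "pn \<equiv> nil_proj P (Suc k)"
abbreviation "L \<equiv> nil_layer P (Suc k)"
abbreviation "NQ \<equiv> nil_quot P (Suc k)"

lemma pn_central: "x \<in> carrier P \<Longrightarrow> z \<in> LC \<Longrightarrow> pn (x \<otimes>\<^bsub>P\<^esub> z) = pn (z \<otimes>\<^bsub>P\<^esub> x)"
  using nil_proj_central[of x z k] by simp

lemma lp_LC: "x \<in> carrier P \<Longrightarrow> z \<in> LC \<Longrightarrow> lp (z \<otimes>\<^bsub>P\<^esub> x) = lp z + lp x"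
  using lp_central[of x z] by simp

lemma LC_closed: "z \<in> LC \<Longrightarrow> z \<in> carrier P"
  using lower_central_subset by blast

lemma carrier_L: "carrier L = pn ` LC"
  using k by (simp add: nil_layer_def)

lemma pn_mult: "x \<in> carrier P \<Longrightarrow> y \<in> carrier P \<Longrightarrow> pn (x \<otimes>\<^bsub>P\<^esub> y) = pn x \<otimes>\<^bsub>L\<^esub> pn y"
  using hom_mult[OF nil_proj_hom[of "Suc k"]] by (simp add: nil_layer_def)

lemma comm_group_L: "comm_group L"
proof (rule group.group_comm_groupI)
  interpret NQ: Group.group NQ by (rule group_nil_quot)
  interpret p: group_hom P NQ pn
    by (intro group_hom.intro group_axioms NQ.group_axioms group_hom_axioms.intro nil_proj_hom)
  have "subgroup (pn ` LC) NQ"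
    by (rule p.subgroup_img_is_subgroup[OF normal_imp_subgroup[OF lower_central_normal]])
  then show "Group.group L"
    using subgroup.subgroup_is_group[OF _ NQ.group_axioms] k by (simp add: nil_layer_def)
  fix X Y assume "X \<in> carrier L" "Y \<in> carrier L"
  then obtain x y where xy: "x \<in> LC" "X = pn x" "y \<in> LC" "Y = pn y" by (auto simp: carrier_L)
  show "X \<otimes>\<^bsub>L\<^esub> Y = Y \<otimes>\<^bsub>L\<^esub> X"
    using pn_central[OF LC_closed[OF xy(1)] xy(3)] unfolding xy(2,4)
    by (simp only: pn_mult LC_closed xy(1,3))
qed

text \<open>Since \<open>k \<ge> 2\<close>, the elements of \<open>LC\<close> are trivial in \<open>H\<close>.\<close>

lemma lp_LC_W: "z \<in> LC \<Longrightarrow> lp z \<in> W"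
proof -
  assume z: "z \<in> LC"
  have "LC \<subseteq> lower_central P 1" by (rule lower_central_antimono) (use k in simp)
  then have "pr z = pr \<one>\<^bsub>P\<^esub>" using z LC_closed[OF z] by (subst nil_proj_eq_iff) (auto simp: numeral_2_eq_2)
  then have pz: "pr z = \<one>\<^bsub>H\<^esub>"
    using group_hom.hom_one[OF group_hom.intro[OF group_axioms H.group_axioms group_hom_axioms.intro[OF pr_hom]]] by simp
  have "I \<one>\<^bsub>H\<^esub> h = 0" if "h \<in> carrier H" for h
    using I_mult(1)[OF H.one_closed H.one_closed that] by simp
  then show ?thesis by (simp add: W_iff \<kappa>_lp LC_closed z pz)
qed

context
  fixes ll :: "'p set \<Rightarrow> 'e" and f :: 'c
  assumes ll: "\<And>x. x \<in> carrier P \<Longrightarrow> ll (pn x) = lp x"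
    and f: "f \<in> johnson_kernel Md pa P k"
begin

lemma f_Md: "f \<in> carrier Md" using f by (simp add: johnson_kernel_def)

text \<open>The element \<open>f(u) u\<^sup>-\<^sup>1\<close> that measures the effect of \<open>f\<close> on \<open>u\<close>.\<close>

definition dev :: "'p \<Rightarrow> 'p" where "dev u = pa f u \<otimes>\<^bsub>P\<^esub> inv\<^bsub>P\<^esub> u"

lemma dev_LC: "u \<in> carrier P \<Longrightarrow> dev u \<in> LC"
proof -
  assume u: "u \<in> carrier P"
  have "nil_proj P k u \<in> carrier (nil_quot P k)" using u by (simp add: carrier_nil_quot)
  then have "pa f ` nil_proj P k u = nil_proj P k u" using f by (simp add: johnson_kernel_def)
  moreover have "u \<in> nil_proj P k u"
    unfolding nil_proj_def by (rule rcos_self[OF u normal_imp_subgroup[OF lower_central_normal]])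
  ultimately have "pa f u \<in> LC #>\<^bsub>P\<^esub> u" unfolding nil_proj_def One_nat_def by blast
  then obtain n where "n \<in> LC" "pa f u = n \<otimes>\<^bsub>P\<^esub> u" by (auto simp: r_coset_def)
  then show ?thesis using u LC_closed by (simp add: dev_def m_assoc)
qed

lemma pa_f: "u \<in> carrier P \<Longrightarrow> pa f u = dev u \<otimes>\<^bsub>P\<^esub> u"
  by (simp add: dev_def m_assoc pa_closed f_Md)

lemma T_f: "h \<in> carrier H \<Longrightarrow> T f h = h"
proof -
  assume h: "h \<in> carrier H"
  have "LC \<subseteq> lower_central P 1" by (rule lower_central_antimono) (use k in simp)
  then have "pa f (rep h) \<otimes>\<^bsub>P\<^esub> inv\<^bsub>P\<^esub> rep h \<in> lower_central P 1" using dev_LC[OF rep(1)[OF h]] by (auto simp: dev_def)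
  then have "pr (pa f (rep h)) = pr (rep h)"
    by (subst nil_proj_eq_iff) (use rep(1)[OF h] pa_closed[OF f_Md] in \<open>auto simp: numeral_2_eq_2\<close>)
  then show ?thesis using rep(2)[OF h] by (simp add: T_def)
qed

text \<open>From \<open>f(uv) (uv)\<^sup>-\<^sup>1 = f(u) u\<^sup>-\<^sup>1 \<cdot> u (f(v) v\<^sup>-\<^sup>1) u\<^sup>-\<^sup>1\<close>, as \<open>f(v) v\<^sup>-\<^sup>1\<close> is central modulo the next term of the
  lower central series.\<close>

lemma dev_hom: "(\<lambda>u. pn (dev u)) \<in> hom P L"
proof (rule homI)
  show "pn (dev u) \<in> carrier L" if "u \<in> carrier P" for u
    using dev_LC[OF that] by (simp add: carrier_L)
  fix u v assume uv: "u \<in> carrier P" "v \<in> carrier P"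
  note z = LC_closed[OF dev_LC[OF uv(1)]] LC_closed[OF dev_LC[OF uv(2)]]
  interpret L: comm_group L by (rule comm_group_L)
  have c: "pn (u \<otimes>\<^bsub>P\<^esub> dev v) = pn (dev v \<otimes>\<^bsub>P\<^esub> u)" by (rule pn_central[OF uv(1) dev_LC[OF uv(2)]])
  have "dev (u \<otimes>\<^bsub>P\<^esub> v) = dev u \<otimes>\<^bsub>P\<^esub> ((u \<otimes>\<^bsub>P\<^esub> dev v) \<otimes>\<^bsub>P\<^esub> inv\<^bsub>P\<^esub> u)"
  proof -
    have "dev (u \<otimes>\<^bsub>P\<^esub> v) = (dev u \<otimes>\<^bsub>P\<^esub> u) \<otimes>\<^bsub>P\<^esub> (dev v \<otimes>\<^bsub>P\<^esub> v) \<otimes>\<^bsub>P\<^esub> inv\<^bsub>P\<^esub> (u \<otimes>\<^bsub>P\<^esub> v)"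
      unfolding dev_def[of "u \<otimes>\<^bsub>P\<^esub> v"] hom_mult[OF pa_hom[OF f_Md] uv] pa_f[OF uv(1)] pa_f[OF uv(2)] ..
    moreover have "v \<otimes>\<^bsub>P\<^esub> (inv\<^bsub>P\<^esub> v \<otimes>\<^bsub>P\<^esub> inv\<^bsub>P\<^esub> u) = inv\<^bsub>P\<^esub> u"
      using uv by (simp flip: m_assoc)
    ultimately show ?thesis using uv z by (simp add: inv_mult_group m_assoc)
  qed
  then have "pn (dev (u \<otimes>\<^bsub>P\<^esub> v)) = pn (dev u) \<otimes>\<^bsub>L\<^esub> (pn (u \<otimes>\<^bsub>P\<^esub> dev v) \<otimes>\<^bsub>L\<^esub> pn (inv\<^bsub>P\<^esub> u))"
    using uv z by (simp only: pn_mult m_closed inv_closed)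
  also have "\<dots> = pn (dev u) \<otimes>\<^bsub>L\<^esub> pn (dev v \<otimes>\<^bsub>P\<^esub> (u \<otimes>\<^bsub>P\<^esub> inv\<^bsub>P\<^esub> u))"
    unfolding c using uv z by (simp only: pn_mult[symmetric] m_closed inv_closed m_assoc)
  finally show "pn (dev (u \<otimes>\<^bsub>P\<^esub> v)) = pn (dev u) \<otimes>\<^bsub>L\<^esub> pn (dev v)" using uv z by simp
qed

abbreviation "jd \<equiv> johnson_delta P k (pa f)"

text \<open>The definition of the Johnson homomorphism evaluates \<open>dev\<close> at an arbitrary representative of a class in \<open>H\<close>; its
  class is independent of the choice, being a homomorphism to an abelian group.\<close>

lemma jd_pr: "u \<in> carrier P \<Longrightarrow> jd (pr u) = pn (dev u)"
proof -
  assume u: "u \<in> carrier P"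
  let ?r = "SOME x. x \<in> pr u"
  have N: "lower_central P (2 - 1) \<lhd> P" by (rule lower_central_normal)
  have "u \<in> pr u"
    unfolding nil_proj_def by (rule rcos_self[OF u normal_imp_subgroup[OF N]])
  then have "?r \<in> pr u" by (rule someI[of "\<lambda>x. x \<in> pr u"])
  moreover have "x \<in> carrier P" if "x \<in> pr u" for x
    using that u lower_central_subset[of "2 - 1"] unfolding nil_proj_def r_coset_def by blast
  moreover have "pr x = pr u" if "x \<in> pr u" for x
    using that unfolding nil_proj_def by (rule repr_independence[OF _ u normal_imp_subgroup[OF N], symmetric])
  ultimately have rc: "?r \<in> carrier P" and eq: "pr ?r = pr u" by blast+
  have "pn (dev ?r) = pn (dev u)"
    using abelian_hom_factors[OF comm_group_L dev_hom rc u eq] .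
  then show ?thesis using u by (simp add: johnson_delta_def Let_def dev_def)
qed

lemma jd_Hom: "jd \<in> carrier (Hom_group H L)"
proof -
  have "jd \<in> hom H L"
  proof (rule homI)
    show "jd h \<in> carrier L" if "h \<in> carrier H" for h
      using jd_pr[OF rep(1)[OF that]] hom_in_carrier[OF dev_hom rep(1)[OF that]] rep(2)[OF that] by simp
    fix h h' assume h: "h \<in> carrier H" and h': "h' \<in> carrier H"
    have "jd (pr (rep h) \<otimes>\<^bsub>H\<^esub> pr (rep h')) = jd (pr (rep h \<otimes>\<^bsub>P\<^esub> rep h'))"
      using hom_mult[OF pr_hom rep(1)[OF h] rep(1)[OF h']] by simp
    also have "\<dots> = jd (pr (rep h)) \<otimes>\<^bsub>L\<^esub> jd (pr (rep h'))"
      using rep(1)[OF h] rep(1)[OF h'] hom_mult[OF dev_hom rep(1)[OF h] rep(1)[OF h']] by (simp add: jd_pr)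
    finally show "jd (h \<otimes>\<^bsub>H\<^esub> h') = jd h \<otimes>\<^bsub>L\<^esub> jd h'" using rep(2) h h' by simp
  qed
  moreover have "jd \<in> extensional (carrier H)" by (simp add: johnson_delta_def)
  ultimately show ?thesis by (simp add: Hom_group_simps)
qed

abbreviation "\<tau> \<equiv> johnson_tau P I k (pa f)"

lemma \<tau>: "\<tau> \<in> carrier (tensor H L)" "dual L \<tau> = jd"
proof -
  have "jd \<in> dual L ` carrier (tensor H L)"
    using jd_Hom bij_betw_imp_surj_on[OF dual_bij[OF comm_group_L]] by blast
  then show "\<tau> \<in> carrier (tensor H L)" "dual L \<tau> = jd"
    unfolding johnson_tau_def Suc_eq_plus1[symmetric] by (rule inv_into_into, rule f_inv_into_f)
qed

lemma ll_hom: "ll \<in> hom L (add_group W)"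
proof (rule homI)
  show "ll X \<in> carrier (add_group W)" if "X \<in> carrier L" for X
    using that by (auto simp: carrier_L ll LC_closed lp_LC_W)
  fix X Y assume "X \<in> carrier L" "Y \<in> carrier L"
  then obtain x y where xy: "x \<in> LC" "X = pn x" "y \<in> LC" "Y = pn y" by (auto simp: carrier_L)
  have "ll (pn (x \<otimes>\<^bsub>P\<^esub> y)) = lp x + lp y"
    using xy LC_closed by (subst ll) (simp_all add: lp_LC)
  then show "ll (X \<otimes>\<^bsub>L\<^esub> Y) = ll X \<otimes>\<^bsub>add_group W\<^esub> ll Y"
    using xy LC_closed by (simp add: pn_mult[symmetric] ll)
qed

text \<open>Here \<open>T f\<close> is the identity, so \<open>D (d\<omega> f) h = va f (\<xi> h) - \<xi> h\<close>. At the class of a generator \<open>s\<close> this is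
  \<open>log (f(s)) - log s = log (f(s) s\<^sup>-\<^sup>1)\<close>.\<close>

lemma D_d\<omega>_johnson: "h \<in> carrier H \<Longrightarrow> D (d\<omega> f) h = ll (jd h)"
proof -
  assume h: "h \<in> carrier H"
  have dQ: "d\<omega> f \<in> carrier Q" using d\<omega>_M[OF f_Md] by (simp add: M_iff)
  have hom: "ll \<circ> jd \<in> hom H V"
  proof -
    have "ll \<circ> jd \<in> hom H (add_group W)"
      by (rule Group.hom_compose[OF _ ll_hom]) (use jd_Hom in \<open>simp add: Hom_group_simps\<close>)
    then show ?thesis by (auto simp: hom_def)
  qed
  have gen: "D (d\<omega> f) (pr s) = (ll \<circ> jd) (pr s)" if s: "s \<in> carrier P" and Ds: "D \<omega> (pr s) = lp s" for s
  proof -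
    have "D (d\<omega> f) (pr s) = lp (pa f s) - lp s"
      using D_d\<omega>[OF f_Md, of "pr s"] s by (simp add: T_f Ds va_lp f_Md)
    also have "\<dots> = lp (dev s)" using s by (simp add: pa_f lp_LC dev_LC)
    also have "\<dots> = (ll \<circ> jd) (pr s)" using s by (simp add: jd_pr ll LC_closed dev_LC)
    finally show ?thesis .
  qed
  have "D (d\<omega> f) h = (ll \<circ> jd) h"
  proof (rule hom_eqI[OF comm_group.axioms(2)[OF comm_V] D_hom_H[OF dQ] hom _ _ h])
    show "D (d\<omega> f) (\<alpha> i) = (ll \<circ> jd) (\<alpha> i)" if "i \<in> {1..g}" for i
      by (rule gen) (use that D_\<omega>_basis in auto)
    show "D (d\<omega> f) (\<beta> i) = (ll \<circ> jd) (\<beta> i)" if "i \<in> {1..g}" for i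
      by (rule gen) (use that D_\<omega>_basis in auto)
  qed
  then show ?thesis by simp
qed

text \<open>Both sides become \<open>h \<mapsto> log (\<delta>\<^sub>k(f)(h))\<close> under the duality isomorphism with coefficients in \<open>W\<close>.\<close>

lemma d\<omega>_extends_johnson:
  "d\<omega> f \<in> carrier (mixed_wedge W)"
  "mixed_wedge_iso H W q (d\<omega> f) = tensor_map H L (add_group W) ll \<tau>"
proof -
  have dM: "d\<omega> f \<in> carrier M" by (rule d\<omega>_M[OF f_Md])
  show mw: "d\<omega> f \<in> carrier (mixed_wedge W)"
    by (rule mem_mixed_wedge) (use dM in \<open>auto simp: M_iff\<close>)
  note iso = mixed_wedge_iso[OF mw]
  have t: "tensor_map H L (add_group W) ll \<tau> \<in> carrier (tensor H (add_group W))"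
    by (rule hom_in_carrier[OF tensor_map_spec(1)[OF H.comm_group_axioms comm_group_L comm_W ll_hom] \<tau>(1)])
  have "dual (add_group W) (mixed_wedge_iso H W q (d\<omega> f)) = dual (add_group W) (tensor_map H L (add_group W) ll \<tau>)"
  proof (rule Hom_group_eqI[OF hom_in_carrier[OF dual_hom[OF comm_W] iso(1)] hom_in_carrier[OF dual_hom[OF comm_W] t]])
    fix h assume h: "h \<in> carrier H"
    show "dual (add_group W) (mixed_wedge_iso H W q (d\<omega> f)) h = dual (add_group W) (tensor_map H L (add_group W) ll \<tau>) h"
      unfolding iso(2)[OF h] dual_tensor_map[OF comm_group_L comm_W ll_hom \<tau>(1) h] \<tau>(2) by (rule D_d\<omega>_johnson[OF h])
  qed
  then show "mixed_wedge_iso H W q (d\<omega> f) = tensor_map H L (add_group W) ll \<tau>"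
    using inj_onD[OF bij_betw_imp_inj_on[OF dual_bij[OF comm_W]] _ iso(1) t] by blast
qed

end

end

section \<open>The crossed homomorphism of the surface\<close>

theorem corollary3p14:
  fixes g k :: nat
    and \<Sigma> :: "'a::t2_space set" and A :: "('a, real ^ 2) chart set" and x0 :: 'a
    and a b :: "nat \<Rightarrow> (real \<Rightarrow> 'a) set"
    and I :: "(real \<Rightarrow> 'a) set set \<Rightarrow> (real \<Rightarrow> 'a) set set \<Rightarrow> int"
    and G :: "'b::t2_space monoid" and B :: "('b, 'e::euclidean_space) chart set"
    and c :: "('b, 'e) chart" and \<iota> :: "(real \<Rightarrow> 'a) set set \<Rightarrow> 'b"
    and ex :: "'e \<Rightarrow> 'b" and lg :: "'b \<Rightarrow> 'e"
    and q :: "'e \<Rightarrow> ((real \<Rightarrow> 'a) set set \<times> real \<Rightarrow>\<^sub>0 int) set"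
    and act :: "('a \<Rightarrow> 'a) set \<Rightarrow> 'e \<Rightarrow> 'e"
  assumes "k \<ge> 2" and "g \<ge> 1"
    \<comment> \<open>the surface, its fundamental group, its mapping class group, and its homology\<close>
    and "surface_one_boundary g \<Sigma> A" and "x0 \<in> mfd_boundary A"
    and P_def: "P = pi1 \<Sigma> x0"
    and Md_def: "Md = mapping_class_group \<Sigma> A"
    and H_def: "H = nil_quot P 2"
    and "standard_generators g \<Sigma> A x0 a b"
    and "intersection_form g H (\<lambda>i. nil_proj P 2 (a i)) (\<lambda>i. nil_proj P 2 (b i)) I"
    \<comment> \<open>\<open>G\<close> is the Mal'cev completion of \<open>\<Gamma>\<^sub>k\<^sub>+\<^sub>1\<close>; \<open>'e\<close> is its Lie algebra, with bracket \<open>br\<close>\<close>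
    and "malcev_completion (nil_quot P (k + 1)) G B \<iota>"
    and "c \<in> B" and "\<one>\<^bsub>G\<^esub> \<in> fst c"
    and "exponential_map G B c ex" and "logarithm_map G ex lg"
    and br_def: "br = lie_bracket G c"
    and W_def: "W = derived_algebra br"
    and lp_def: "lp = (\<lambda>x. lg (\<iota> (nil_proj P (k + 1) x)))"
    and Lambda_def: "\<Lambda> = generate (add_group UNIV) (lg ` \<iota> ` carrier (nil_quot P (k + 1)))"
    and "abelian_projection P lp W q"
    and "\<And>f. f \<in> carrier Md \<Longrightarrow> lie_automorphism br (act f) \<and>
           (\<forall>x\<in>carrier P. act f (lp x) = lp (mcg_act_pi1 \<Sigma> f x))"
    \<comment> \<open>the objects in the conclusion\<close>
    and xi_def: "\<xi> = (\<lambda>h\<in>carrier H.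
           hom_by H (add_group UNIV) (a ` {1..g} \<union> b ` {1..g}) (nil_proj P 2) lp h)"
    and omega_def: "\<omega> = finprod (ext_quot W) (\<lambda>i. qwedge W (lp (a i)) (lp (b i))) {1..g}"
    and D_def: "D = D_star H I W q"
    and rho_def: "\<rho> = (\<lambda>f. ext_quot_map W (act f))"
    and d_omega_def: "d\<omega> = (\<lambda>f. \<rho> f \<omega> \<otimes>\<^bsub>ext_quot W\<^esub> inv\<^bsub>ext_quot W\<^esub> \<omega>)"
    and M_def: "M = (ext_quot W)\<lparr>carrier :=
           {w \<in> carrier (ext_quot W). D w \<in> carrier (Hom_group H (add_group (W \<inter> \<Lambda>)))}\<rparr>"
    and v_def: "v = tensor_map H (nil_layer P (k + 1)) (add_group W) (\<lambda>x. lg (\<iota> x))"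
    and tau_def: "\<tau> = (\<lambda>f. johnson_tau P I k (mcg_act_pi1 \<Sigma> f))"
  shows "D \<omega> = \<xi> \<and>
         is_module Md \<rho> M \<and> d\<omega> \<in> crossed_homs Md \<rho> M \<and>
         (\<forall>f\<in>johnson_kernel Md (mcg_act_pi1 \<Sigma>) P k.
            d\<omega> f \<in> carrier (mixed_wedge W) \<and> mixed_wedge_iso H W q (d\<omega> f) = v (\<tau> f)) \<and>
         free_abelian_finite_rank M"
proof -
  let ?S = "a ` {1..g} \<union> b ` {1..g}"
  let ?N = "nil_quot P (k + 1)" and ?p = "nil_proj P (k + 1)"
  have lie: "lie_group G B" and nil: "nilpotent_group G" and \<iota>: "\<iota> \<in> hom ?N G"
    using \<open>malcev_completion ?N G B \<iota>\<close> by (auto simp: malcev_completion_def)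
  interpret X: exp_lie_group G B c ex lg
    by (rule exp_lie_group.intro) fact+
  interpret S: pointed_surface \<Sigma> A x0
    using \<open>surface_one_boundary g \<Sigma> A\<close> \<open>x0 \<in> mfd_boundary A\<close>
    by (intro pointed_surface.intro smooth_manifold.intro pointed_surface_axioms.intro)
      (auto simp: surface_one_boundary_def)
  have P: "Group.group P" unfolding P_def by (rule S.group_pi1)
  obtain \<gamma> where free: "free_generating_set P ?S"
    and \<gamma>: "simple_path \<gamma>" "path_image \<gamma> = mfd_boundary A" "pathstart \<gamma> = x0" "pathfinish \<gamma> = x0"
    and word: "boundary_word P g a b = loop_class \<Sigma> \<gamma>"
    using \<open>standard_generators g \<Sigma> A x0 a b\<close> unfolding standard_generators_def boundary_word_def P_def by blast
  have S: "?S \<subseteq> carrier P" "generate P ?S = carrier P" using free by (auto simp: free_generating_set_def)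
  have W: "subspace W" by (simp add: W_def derived_algebra_def)
  have loop: "S.loop \<gamma>" using \<gamma> S.boundary_subset by (auto simp: S.loop_def simple_path_imp_path)
  have N: "Group.group ?N" by (rule group.group_nil_quot[OF P])
  have p: "?p \<in> hom P ?N" by (rule group.nil_proj_hom[OF P])
  interpret \<iota>: group_hom ?N G \<iota> by (intro group_hom.intro group_hom_axioms.intro N X.group_axioms \<iota>)
  have lp: "lp x = lg (\<iota> (?p x))" for x by (simp add: lp_def)
  have act: "linear (act f)" "act f (br X Y) = br (act f X) (act f Y)" if "f \<in> carrier Md" for f X Y
    using assms(20)[OF that] by (simp_all add: lie_automorphism_def)
  interpret K: mapping_class_action P g a b I lp W q Md "mcg_act_pi1 \<Sigma>" act k
  proof (intro mapping_class_action.intro malcev_projection.intro malcev_projection_axioms.intro mapping_class_action_axioms.intro)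
    show "Group.group P" by (rule P)
    show "?S \<subseteq> carrier P" "generate P ?S = carrier P" by (fact S)+
    show "intersection_form g (nil_quot P 2) (\<lambda>i. nil_proj P 2 (a i)) (\<lambda>i. nil_proj P 2 (b i)) I"
      using assms(9) unfolding H_def .
    show "abelian_projection P lp W q" by fact
    show "subspace W" by (rule W)
    show "2 \<le> k" using \<open>k \<ge> 2\<close> .
    show "free_generating_set P ?S" by (rule free)
    show "\<one>\<^bsub>Md\<^esub> \<in> carrier Md" unfolding Md_def by (rule S.one_Md)
    show "c \<otimes>\<^bsub>Md\<^esub> d \<in> carrier Md" if "c \<in> carrier Md" "d \<in> carrier Md" for c d
      using that unfolding Md_def by (rule S.mult_Md)
    show "mcg_act_pi1 \<Sigma> c \<in> hom P P" "bij_betw (mcg_act_pi1 \<Sigma> c) (carrier P) (carrier P)" if "c \<in> carrier Md" for c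
      using that unfolding Md_def P_def by (rule S.act_hom)+
    show "mcg_act_pi1 \<Sigma> \<one>\<^bsub>Md\<^esub> x = x" if "x \<in> carrier P" for x
      using that unfolding Md_def P_def by (rule S.act_one)
    show "mcg_act_pi1 \<Sigma> (c \<otimes>\<^bsub>Md\<^esub> d) x = mcg_act_pi1 \<Sigma> c (mcg_act_pi1 \<Sigma> d x)"
      if "c \<in> carrier Md" "d \<in> carrier Md" "x \<in> carrier P" for c d x
      using that unfolding Md_def P_def by (rule S.act_mult)
    show "mcg_act_pi1 \<Sigma> c (boundary_word P g a b) = boundary_word P g a b" if "c \<in> carrier Md" for c
      unfolding word using S.act_boundary_loop[OF that[unfolded Md_def] loop] \<gamma>(2) by simp
    show "linear (act f)" if "f \<in> carrier Md" for f by (rule act(1)[OF that])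
    show "act f X \<in> W" if f: "f \<in> carrier Md" and X: "X \<in> W" for f X
    proof -
      have "act f ` {br x y | x y. True} \<subseteq> {br x y | x y. True}" using act(2)[OF f] by blast
      then have "span (act f ` {br x y | x y. True}) \<subseteq> W"
        unfolding W_def derived_algebra_def by (rule span_mono)
      moreover have "act f X \<in> act f ` W" using X by (rule imageI)
      ultimately show ?thesis
        unfolding linear_span_image[OF act(1)[OF f]] W_def derived_algebra_def by blast
    qed
    show "act f (lp x) = lp (mcg_act_pi1 \<Sigma> f x)" if "f \<in> carrier Md" "x \<in> carrier P" for f x
      using assms(20)[OF that(1)] that(2) by blast
    show "\<exists>T. finite T \<and> (\<forall>L. add_subgroup L \<longrightarrow> T \<subseteq> L \<longrightarrow> lp ` carrier P \<subseteq> L)"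
    proof -
      have pS: "?p ` ?S \<subseteq> carrier ?N" using hom_in_carrier[OF p] S(1) by blast
      have "generate G (\<iota> ` ?p ` ?S) = \<iota> ` ?p ` carrier P"
        unfolding \<iota>.generate_img[OF pS] group.nil_quot_generate[OF P S] group.carrier_nil_quot[OF P] ..
      then have "lg ` generate G (\<iota> ` ?p ` ?S) = lp ` carrier P" by (simp add: image_image lp)
      moreover have "\<exists>T. finite T \<and> (\<forall>L. add_subgroup L \<longrightarrow> T \<subseteq> L \<longrightarrow> lg ` generate G (\<iota> ` ?p ` ?S) \<subseteq> L)"
      proof (rule X.log_of_fg_subgroup[OF nil])
        show "finite (\<iota> ` ?p ` ?S)" by simp
        show "\<iota> ` ?p ` ?S \<subseteq> carrier G"
          by (rule image_subsetI) (rule \<iota>.hom_closed[OF subsetD[OF pS]])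
      qed
      ultimately show ?thesis by simp
    qed
    show "lp (z \<otimes>\<^bsub>P\<^esub> x) = lp z + lp x" if x: "x \<in> carrier P" and z: "z \<in> lower_central P (k - 1)" for x z
    proof -
      have zc: "z \<in> carrier P" using z group.lower_central_subset[OF P] by blast
      have m: "\<iota> (?p (u \<otimes>\<^bsub>P\<^esub> v)) = \<iota> (?p u) \<otimes>\<^bsub>G\<^esub> \<iota> (?p v)" if "u \<in> carrier P" "v \<in> carrier P" for u v
        unfolding hom_mult[OF p that] by (rule \<iota>.hom_mult) (use that hom_in_carrier[OF p] in auto)
      have "\<iota> (?p z) \<otimes>\<^bsub>G\<^esub> \<iota> (?p x) = \<iota> (?p x) \<otimes>\<^bsub>G\<^esub> \<iota> (?p z)"
        unfolding m[OF zc x, symmetric] m[OF x zc, symmetric] group.nil_proj_central[OF P x z] ..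
      then show ?thesis
        unfolding lp m[OF zc x] by (intro X.lg_mult_commuting \<iota>.hom_closed hom_in_carrier[OF p] x zc)
    qed
  qed
  have \<omega>: "K.\<omega> = \<omega>" unfolding K.\<omega>_def omega_def ..
  have D: "D = D_star (nil_quot P 2) I W q" unfolding D_def H_def ..
  have \<Lambda>: "K.\<Lambda> = \<Lambda>"
    unfolding K.\<Lambda>_def Lambda_def group.carrier_nil_quot[OF P] by (simp add: image_image lp)
  have M: "K.M = M" unfolding K.M_def M_def D \<Lambda> H_def ..
  have d\<omega>: "K.d\<omega> = d\<omega>" by (rule ext) (simp only: K.d\<omega>_def d_omega_def rho_def \<omega>)
  have "D \<omega> = \<xi>" using K.D_\<omega>_eq_\<xi> unfolding \<omega> D xi_def H_def .
  moreover have "is_module Md \<rho> M" using K.is_module_M unfolding M rho_def .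
  moreover have "d\<omega> \<in> crossed_homs Md \<rho> M" using K.crossed_hom_d\<omega> unfolding M rho_def d\<omega> .
  moreover have "d\<omega> f \<in> carrier (mixed_wedge W) \<and> mixed_wedge_iso H W q (d\<omega> f) = v (\<tau> f)"
    if "f \<in> johnson_kernel Md (mcg_act_pi1 \<Sigma>) P k" for f
    using K.d\<omega>_extends_johnson[of "\<lambda>x. lg (\<iota> x)" f, OF _ that]
    by (simp add: lp d\<omega> v_def tau_def H_def)
  moreover have "free_abelian_finite_rank M" using K.free_M unfolding M .
  ultimately show ?thesis by blast
qed

end
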